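(* Let $\Lambda=kQ/(\rho)$ be a string algebra and suppose that the $\Lambda$-module $M$ is a direct sum of copies of string modules and modules of the form $M(C,V)$, say \[ M=\Big(\bigoplus_\lambda M(C^\lambda)\Big)\oplus\Big(\bigoplus_\mu M(C^\mu,V^\mu)\Big), \] where the $C^\lambda$ are non-periodic words, the $C^\mu$ are periodic words and the $V^\mu$ are $k[T,T^{-1}]$-modules. Let $B,D$ be words with the same head and opposite signs. (i) If $B^{-1}D$ is a non-periodic word, then $\dim F_{B,D}(M)$ is equal to the number of string module summands $M(C^\lambda)$ with $C^\lambda\sim B^{-1}D$. (ii) If $B^{-1}D$ is a periodic word, then $F_{B,D}(M)$ is isomorphic, as a $k[T,T^{-1}]$-module, to the direct sum of the $V^\mu$ for those $\mu$ such that $C^\mu$ is a shift of $B^{-1}D$, and of the $\mathrm{res}_\iota V^\mu$ for those $\mu$ such that $C^\mu$ is a shift of $D^{-1}B$.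
   Context: String algebras. Let $k$ be a field, $Q$ a quiver (not necessarily finite), $kQ$ its path algebra; a product $xy$ of arrows is a path when the tail of $x$ equals the head of $y$ (first $y$, then $x$). Let $\rho$ be a set of paths of length $\ge 2$ ("zero relations"). $\Lambda=kQ/(\rho)$ is a string algebra if (a) every vertex of $Q$ is the head of at most two arrows and the tail of at most two arrows, and (b) for any arrow $y$ there is at most one path $xy$ of length 2 with $xy\notin\rho$ and at most one path $yz$ of length 2 with $yz\notin\rho$. $e_v$ is the trivial path at the vertex $v$. A $\Lambda$-module is a left module $M$ with $\Lambda M=M$ (equivalently $M=\bigoplus_v e_vM$). Words. A letter is an arrow $x$ (direct letter) or its formal inverse $x^{-1}$ (inverse letter); the head of $x^{-1}$ is the tail of $x$ and vice versa; $(x^{-1})^{-1}=x$. Let $I$ be $\{0,1,\dots,n\}$ ($n\ge0$), $\mathbb N=\{0,1,2,\dots\}$, $-\mathbb N=\{0,-1,-2,\dots\}$ or $\mathbb Z$. If $I\ne\{0\}$, an $I$-word $C$ is a sequence of letters $C_i$, one for each $i\in I$ with $i-1\in I$, such that for consecutive letters $C_i,C_{i+1}$ the tail of $C_i$ is the head of $C_{i+1}$ and $C_i^{-1}\neq C_{i+1}$, and no zero relation $x_1\dots x_m\in\rho$ nor its inverse $x_m^{-1}\dots x_1^{-1}$ occurs as a sequence of consecutive letters. For $I=\{0\}$ there are trivial words $1_{v,\epsilon}$ for each vertex $v$ and $\epsilon=\pm1$. A word with $I=\{0,\dots,n\}$ is finite of length $n$. For $i\in I$, $v_i(C)$ is the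 tail of $C_i$ or the head of $C_{i+1}$ (and $v$ for $1_{v,\epsilon}$). The inverse $C^{-1}$ is obtained by inverting the letters and reversing their order, with $(1_{v,\epsilon})^{-1}=1_{v,-\epsilon}$; a $\mathbb Z$-word is written $\dots C_0|C_1\dots$ and its inverse is indexed as $\dots C_1^{-1}|C_0^{-1}\dots$. For a $\mathbb Z$-word, the shift is $C[n]=\dots C_n|C_{n+1}\dots$; for $I\ne\mathbb Z$ put $C[n]=C$. $C$ is periodic if it is a $\mathbb Z$-word with $C=C[n]$ for some $n>0$; the minimal such $n$ is the period. $C\sim D$ means $D=C[m]$ or $D=(C^{-1})[m]$ for some $m$. Modules. For an $I$-word $C$, $M(C)$ has $k$-basis $b_i$ ($i\in I$), with $e_vb_i=b_i$ if $v_i(C)=v$ and $0$ otherwise, and for an arrow $x$: $xb_i=b_{i-1}$ if $i-1\in I$ and $C_i=x$; $xb_i=b_{i+1}$ if $i+1\in I$ and $C_{i+1}=x^{-1}$; $xb_i=0$ otherwise. If $C$ is periodic of period $n$, $M(C)$ is a $\Lambda$-$k[T,T^{-1}]$-bimodule with $T$ acting by $b_i\mapsto b_{i-n}$, and $M(C,V)=M(C)\otimes_{k[T,T^{-1}]}V$ for a $k[T,T^{-1}]$-module $V$. A string module is $M(C)$ with $C$ non-periodic. $\iota$ is the automorphism of $k[T,T^{-1}]$ exchanging $T$ and $T^{-1}$, and $\mathrm{res}_\iota$ is restriction along $\iota$. Signs and composition. Fix a sign $\pm1$ for each letter such that if distinct letters $\ell,\ell'$ have the same head and sign then $\{\ell,\ell'\}=\{x^{-1},y\}$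 for some zero relation $xy\in\rho$. The head of a finite word or $\mathbb N$-word $C$ is $v_0(C)$; its sign is that of $C_1$, or $\epsilon$ for $1_{v,\epsilon}$. The tail of a finite word of length $n$ is $v_n(C)$, and of a $(-\mathbb N)$-word is $v_0(C)$. The composition $CD$ is the concatenation, defined if the tail of $C$ equals the head of $D$, $C^{-1}$ and $D$ have opposite signs, and the result is a word ($1_{v,\epsilon}1_{v,\epsilon}=1_{v,\epsilon}$; a $(-\mathbb N)$-word times an $\mathbb N$-word is indexed as $\dots C_{-1}C_0|D_1D_2\dots$). If $E=E_1\dots E_n$ is a non-trivial finite word all of whose powers are words, ${}^\infty E^\infty=\dots E_1\dots E_n|E_1\dots E_nE_1\dots$. Functors. A linear relation from $V$ to $W$ is a subspace $C\subseteq V\oplus W$; $Cv=\{w:(v,w)\in C\}$, $CH=\bigcup_{v\in H}Cv$, with the usual composition and inverse. For a $\Lambda$-module $M$ an arrow $x$ with tail $u$ and head $v$ gives (the graph of) a relation from $e_uM$ to $e_vM$; by composing these and their inverses, a finite word $C$ with head $v$ and tail $u$ gives a linear relation from $e_uM$ to $e_vM$ (trivial words give the identity). Write $C0=C\{0\}$ and $CM=C(e_uM)$. For $C$ a finite word: $C^+(M)=Cx^{-1}0$ if there is an arrow $x$ with $Cx^{-1}$ a word, otherwise $C^+(M)=CM$; $C^-(M)=CyM$ if there is an arrow $y$ with $Cy$ a word, otherwise $C^-(M)=C0$. For $C$ an $\mathbb N$-word: $C^+(M)$ is the set of $m\in M$ for which there are $m_n$ ($n\ge0$) with $m_0=m$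 and $m_{n-1}\in C_nm_n$ for all $n\geq 1$; $C^-(M)$ is the set of such $m$ for which the sequence can be chosen eventually zero. For words $B,D$ with the same head $v$ and opposite signs, $F^+_{B,D}(M)=B^+(M)\cap D^+(M)$, $F^-_{B,D}(M)=(B^+(M)\cap D^-(M))+(B^-(M)\cap D^+(M))$ and $F_{B,D}(M)=F^+_{B,D}(M)/F^-_{B,D}(M)$. If $B^{-1}D$ is periodic of period $n$, then $B^{-1}D={}^\infty E^\infty$ with $E$ of length $n$ and head $v$, and $F_{B,D}(M)$ is a $k[T,T^{-1}]$-module with $T$ the automorphism induced by the relation $E$ on $e_vM$: $T(F^-_{B,D}(M)+m)=F^-_{B,D}(M)+m'$ if and only if $m'\in F^+_{B,D}(M)\cap(F^-_{B,D}(M)+Em)$. *)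

theory Defs
  imports
    "HOL-Library.Poly_Mapping"
    "HOL-Library.FuncSet"
    "HOL-Library.Equipollence"
    "HOL-Algebra.Module"
    "HOL-Algebra.QuotRing"
    "HOL-Algebra.Generated_Groups"
    "HOL-Algebra.Free_Abelian_Groups"
    "Graph_Theory.Digraph"
begin

section \<open>Modules: non-unital rings, direct sums, quotients, tensor products\<close>

text \<open>
  Left modules over a ring that need not have a unit, subject to \<open>RM = M\<close>.  The last axiom
  says that every element of \<open>M\<close> is a finite sum of elements \<open>r m\<close>; the locale
  \<^term>\<open>Module.module\<close> is not applicable since it demands a commutative ring with unit.
\<close>

definition full_module :: "('r, 'x) ring_scheme \<Rightarrow> ('r, 'm) module \<Rightarrow> bool" where
  "full_module R M \<longleftrightarrow>
     abelian_group M \<and>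
     (\<forall>r\<in>carrier R. \<forall>m\<in>carrier M. r \<odot>\<^bsub>M\<^esub> m \<in> carrier M) \<and>
     (\<forall>r\<in>carrier R. \<forall>s\<in>carrier R. \<forall>m\<in>carrier M.
        (r \<oplus>\<^bsub>R\<^esub> s) \<odot>\<^bsub>M\<^esub> m = r \<odot>\<^bsub>M\<^esub> m \<oplus>\<^bsub>M\<^esub> s \<odot>\<^bsub>M\<^esub> m) \<and>
     (\<forall>r\<in>carrier R. \<forall>m\<in>carrier M. \<forall>n\<in>carrier M.
        r \<odot>\<^bsub>M\<^esub> (m \<oplus>\<^bsub>M\<^esub> n) = r \<odot>\<^bsub>M\<^esub> m \<oplus>\<^bsub>M\<^esub> r \<odot>\<^bsub>M\<^esub> n) \<and>
     (\<forall>r\<in>carrier R. \<forall>s\<in>carrier R. \<forall>m\<in>carrier M.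
        (r \<otimes>\<^bsub>R\<^esub> s) \<odot>\<^bsub>M\<^esub> m = r \<odot>\<^bsub>M\<^esub> (s \<odot>\<^bsub>M\<^esub> m)) \<and>
     generate (add_monoid M) {r \<odot>\<^bsub>M\<^esub> m |r m. r \<in> carrier R \<and> m \<in> carrier M} = carrier M"

definition module_isomorphic ::
    "('r, 'x) ring_scheme \<Rightarrow> ('r, 'm) module \<Rightarrow> ('r, 'n) module \<Rightarrow> bool" where
  "module_isomorphic R M N \<longleftrightarrow>
     (\<exists>\<phi>\<in>iso (add_monoid M) (add_monoid N).
        \<forall>r\<in>carrier R. \<forall>m\<in>carrier M. \<phi> (r \<odot>\<^bsub>M\<^esub> m) = r \<odot>\<^bsub>N\<^esub> \<phi> m)"

text \<open>
  The record type of modules extends that of rings, so the irrelevant fields \<open>mult\<close> and \<open>one\<close>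
  have to be given some value; they are never used.
\<close>

definition direct_sum :: "'i set \<Rightarrow> ('i \<Rightarrow> ('r, 'm) module) \<Rightarrow> ('r, 'i \<Rightarrow> 'm) module" where
  "direct_sum I N =
     \<lparr>carrier = {f \<in> (\<Pi>\<^sub>E i\<in>I. carrier (N i)). finite {i\<in>I. f i \<noteq> \<zero>\<^bsub>N i\<^esub>}},
      monoid.mult = undefined, monoid.one = undefined,
      ring.zero = (\<lambda>i\<in>I. \<zero>\<^bsub>N i\<^esub>),
      ring.add = (\<lambda>f g. \<lambda>i\<in>I. f i \<oplus>\<^bsub>N i\<^esub> g i),
      module.smult = (\<lambda>r f. \<lambda>i\<in>I. r \<odot>\<^bsub>N i\<^esub> f i)\<rparr>"

definition direct_sum2 :: "('r, 'm) module \<Rightarrow> ('r, 'n) module \<Rightarrow> ('r, 'm \<times> 'n) module" where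
  "direct_sum2 M N =
     \<lparr>carrier = carrier M \<times> carrier N,
      monoid.mult = undefined, monoid.one = undefined,
      ring.zero = (\<zero>\<^bsub>M\<^esub>, \<zero>\<^bsub>N\<^esub>),
      ring.add = (\<lambda>(m, n) (m', n'). (m \<oplus>\<^bsub>M\<^esub> m', n \<oplus>\<^bsub>N\<^esub> n')),
      module.smult = (\<lambda>r (m, n). (r \<odot>\<^bsub>M\<^esub> m, r \<odot>\<^bsub>N\<^esub> n))\<rparr>"

text \<open>As in \<^const>\<open>rcoset_mult\<close>, the union below is a union of identical cosets.\<close>

definition quot_module :: "('r, 'm) module \<Rightarrow> 'm set \<Rightarrow> ('r, 'm set) module" where
  "quot_module M N =
     \<lparr>carrier = a_rcosets\<^bsub>M\<^esub> N,
      monoid.mult = undefined, monoid.one = undefined,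
      ring.zero = N,
      ring.add = set_add M,
      module.smult = (\<lambda>r X. \<Union>m\<in>X. N +>\<^bsub>M\<^esub> (r \<odot>\<^bsub>M\<^esub> m))\<rparr>"

text \<open>
  \<open>X\<close> is a bimodule over \<open>L\<close> (on the left) and \<open>R\<close> (on the right), the latter acting through
  \<open>ract x r = x r\<close>.  The tensor product over \<open>R\<close> is the free abelian group on pairs modulo the
  usual relations, with \<open>L\<close> acting on the first factor.
\<close>

inductive_set tensor_relations ::
    "('r, 'x) ring_scheme \<Rightarrow> ('l, 'm) module \<Rightarrow> ('m \<Rightarrow> 'r \<Rightarrow> 'm) \<Rightarrow> ('r, 'w) module
      \<Rightarrow> ('m \<times> 'w \<Rightarrow>\<^sub>0 int) set"
  for R X ract V where
  zero: "0 \<in> tensor_relations R X ract V"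
| diff: "f \<in> tensor_relations R X ract V \<Longrightarrow> g \<in> tensor_relations R X ract V \<Longrightarrow>
    f - g \<in> tensor_relations R X ract V"
| add_left: "x \<in> carrier X \<Longrightarrow> y \<in> carrier X \<Longrightarrow> v \<in> carrier V \<Longrightarrow>
    frag_of (x \<oplus>\<^bsub>X\<^esub> y, v) - frag_of (x, v) - frag_of (y, v) \<in> tensor_relations R X ract V"
| add_right: "x \<in> carrier X \<Longrightarrow> v \<in> carrier V \<Longrightarrow> w \<in> carrier V \<Longrightarrow>
    frag_of (x, v \<oplus>\<^bsub>V\<^esub> w) - frag_of (x, v) - frag_of (x, w) \<in> tensor_relations R X ract V"
| balanced: "x \<in> carrier X \<Longrightarrow> r \<in> carrier R \<Longrightarrow> v \<in> carrier V \<Longrightarrow>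
    frag_of (ract x r, v) - frag_of (x, r \<odot>\<^bsub>V\<^esub> v) \<in> tensor_relations R X ract V"

definition tensor_module ::
    "('r, 'x) ring_scheme \<Rightarrow> ('l, 'm) module \<Rightarrow> ('m \<Rightarrow> 'r \<Rightarrow> 'm) \<Rightarrow> ('r, 'w) module
      \<Rightarrow> ('l, ('m \<times> 'w \<Rightarrow>\<^sub>0 int) set) module" where
  "tensor_module R X ract V =
     quot_module
       \<lparr>carrier = {f. Poly_Mapping.keys f \<subseteq> carrier X \<times> carrier V},
        monoid.mult = undefined, monoid.one = undefined,
        ring.zero = 0, ring.add = (+),
        module.smult = (\<lambda>a. frag_extend (\<lambda>(x, v). frag_of (a \<odot>\<^bsub>X\<^esub> x, v)))\<rparr>
       (tensor_relations R X ract V)"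

definition is_basis :: "('k::field, 'm) module \<Rightarrow> 'm set \<Rightarrow> bool" where
  "is_basis F S \<longleftrightarrow> S \<subseteq> carrier F \<and>
     (\<forall>x\<in>carrier F. \<exists>!c :: 'm \<Rightarrow>\<^sub>0 'k. Poly_Mapping.keys c \<subseteq> S \<and>
        x = finsum F (\<lambda>b. Poly_Mapping.lookup c b \<odot>\<^bsub>F\<^esub> b) (Poly_Mapping.keys c))"

text \<open>The dimension of \<open>F\<close> is the cardinality of \<open>A\<close>, also for infinite \<open>A\<close>.\<close>

definition has_dim :: "('k::field, 'm) module \<Rightarrow> 'i set \<Rightarrow> bool" where
  "has_dim F A \<longleftrightarrow> (\<exists>S. is_basis F S \<and> S \<approx> A)"


section \<open>Laurent polynomials\<close>

text \<open>
  The group ring \<open>int \<Rightarrow>\<^sub>0 'k\<close> of the integers is \<open>k[T, T\<^sup>-\<^sup>1]\<close>; the exponents are the keys.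
\<close>

type_synonym 'k laurent = "int \<Rightarrow>\<^sub>0 'k"

definition laurent_ring :: "'k::field laurent ring" where
  "laurent_ring = \<lparr>carrier = UNIV, monoid.mult = (*), monoid.one = 1, ring.zero = 0, ring.add = (+)\<rparr>"

definition swap_T :: "'k::field laurent \<Rightarrow> 'k laurent" where
  "swap_T p = Poly_Mapping.map_key uminus p"

definition res_swap :: "('k::field laurent, 'w) module \<Rightarrow> ('k laurent, 'w) module" where
  "res_swap V = V\<lparr>module.smult := (\<lambda>p v. swap_T p \<odot>\<^bsub>V\<^esub> v)\<rparr>"


section \<open>Quivers, path algebras and string algebras\<close>

text \<open>
  A path is its head together with its list of arrows \<open>x\<^sub>1 \<dots> x\<^sub>m\<close>, where the tail of \<open>x\<^sub>i\<close> is the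
  head of \<open>x\<^sub>i\<^sub>+\<^sub>1\<close>; the empty list gives the trivial path at the vertex.
\<close>

type_synonym ('v, 'a) qpath = "'v \<times> 'a list"

definition arrow_path :: "('v, 'a) pre_digraph \<Rightarrow> 'a list \<Rightarrow> bool" where
  "arrow_path Q xs \<longleftrightarrow> set xs \<subseteq> arcs Q \<and> successively (\<lambda>x y. tail Q x = head Q y) xs"

definition qpaths :: "('v, 'a) pre_digraph \<Rightarrow> ('v, 'a) qpath set" where
  "qpaths Q =
     {(v, xs). v \<in> verts Q \<and> arrow_path Q xs \<and> (xs \<noteq> [] \<longrightarrow> head Q (hd xs) = v)}"

definition path_tail :: "('v, 'a) pre_digraph \<Rightarrow> ('v, 'a) qpath \<Rightarrow> 'v" where
  "path_tail Q p = (if snd p = [] then fst p else tail Q (last (snd p)))"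

definition path_mult :: "('v, 'a) pre_digraph \<Rightarrow>
    (('v, 'a) qpath \<Rightarrow>\<^sub>0 'k::field) \<Rightarrow> (('v, 'a) qpath \<Rightarrow>\<^sub>0 'k) \<Rightarrow> (('v, 'a) qpath \<Rightarrow>\<^sub>0 'k)" where
  "path_mult Q f g =
     (\<Sum>p\<in>Poly_Mapping.keys f. \<Sum>q\<in>Poly_Mapping.keys g.
        if path_tail Q p = fst q
        then Poly_Mapping.single (fst p, snd p @ snd q)
               (Poly_Mapping.lookup f p * Poly_Mapping.lookup g q)
        else 0)"

text \<open>
  The path algebra has a unit only if there are finitely many vertices; for an infinite vertex
  set the field \<open>one\<close> holds the meaningless value \<open>0\<close>, and it is not used anywhere.
\<close>

definition path_algebra :: "('v, 'a) pre_digraph \<Rightarrow> (('v, 'a) qpath \<Rightarrow>\<^sub>0 'k::field) ring" where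
  "path_algebra Q =
     \<lparr>carrier = {f. Poly_Mapping.keys f \<subseteq> qpaths Q},
      monoid.mult = path_mult Q,
      monoid.one = (\<Sum>v\<in>verts Q. Poly_Mapping.single (v, []) 1),
      ring.zero = 0, ring.add = (+)\<rparr>"

text \<open>
  The two-sided ideal generated by the zero relations.  \<^const>\<open>genideal\<close> is not usable for
  rings without unit.  Closure under scalars comes from multiplication by multiples of trivial
  paths.
\<close>

inductive_set relation_ideal ::
    "('v, 'a) pre_digraph \<Rightarrow> 'a list set \<Rightarrow> (('v, 'a) qpath \<Rightarrow>\<^sub>0 'k::field) set"
  for Q \<rho> where
  generator: "r \<in> \<rho> \<Longrightarrow> Poly_Mapping.single (head Q (hd r), r) 1 \<in> relation_ideal Q \<rho>"
| zero: "0 \<in> relation_ideal Q \<rho>"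
| diff: "f \<in> relation_ideal Q \<rho> \<Longrightarrow> g \<in> relation_ideal Q \<rho> \<Longrightarrow> f - g \<in> relation_ideal Q \<rho>"
| left: "a \<in> carrier (path_algebra Q) \<Longrightarrow> f \<in> relation_ideal Q \<rho> \<Longrightarrow>
    a \<otimes>\<^bsub>path_algebra Q\<^esub> f \<in> relation_ideal Q \<rho>"
| right: "a \<in> carrier (path_algebra Q) \<Longrightarrow> f \<in> relation_ideal Q \<rho> \<Longrightarrow>
    f \<otimes>\<^bsub>path_algebra Q\<^esub> a \<in> relation_ideal Q \<rho>"

definition quotient_algebra ::
    "('v, 'a) pre_digraph \<Rightarrow> 'a list set \<Rightarrow> (('v, 'a) qpath \<Rightarrow>\<^sub>0 'k::field) set ring" where
  "quotient_algebra Q \<rho> = path_algebra Q Quot relation_ideal Q \<rho>"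

definition string_algebra :: "('v, 'a) pre_digraph \<Rightarrow> 'a list set \<Rightarrow> bool" where
  "string_algebra Q \<rho> \<longleftrightarrow>
     wf_digraph Q \<and>
     (\<forall>r\<in>\<rho>. arrow_path Q r \<and> length r \<ge> 2) \<and>
     (\<forall>v\<in>verts Q. finite (in_arcs Q v) \<and> card (in_arcs Q v) \<le> 2 \<and>
                   finite (out_arcs Q v) \<and> card (out_arcs Q v) \<le> 2) \<and>
     (\<forall>y\<in>arcs Q.
        (\<forall>x x'. arrow_path Q [x, y] \<and> [x, y] \<notin> \<rho> \<and> arrow_path Q [x', y] \<and> [x', y] \<notin> \<rho> \<longrightarrow> x = x') \<and>
        (\<forall>z z'. arrow_path Q [y, z] \<and> [y, z] \<notin> \<rho> \<and> arrow_path Q [y, z'] \<and> [y, z'] \<notin> \<rho> \<longrightarrow> z = z'))"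

text \<open>
  The elements \<open>c e\<^sub>v\<close> and \<open>x\<close> of the quotient algebra.  The ground field acts on \<open>e\<^sub>v M\<close> through
  the elements \<open>c e\<^sub>v\<close>, so a module needs no separate vector space structure.
\<close>

definition vertex_elem ::
    "('v, 'a) pre_digraph \<Rightarrow> 'a list set \<Rightarrow> 'k::field \<Rightarrow> 'v \<Rightarrow> (('v, 'a) qpath \<Rightarrow>\<^sub>0 'k) set" where
  "vertex_elem Q \<rho> c v = relation_ideal Q \<rho> +>\<^bsub>path_algebra Q\<^esub> Poly_Mapping.single (v, []) c"

definition arrow_elem ::
    "('v, 'a) pre_digraph \<Rightarrow> 'a list set \<Rightarrow> 'a \<Rightarrow> (('v, 'a) qpath \<Rightarrow>\<^sub>0 'k::field) set" where
  "arrow_elem Q \<rho> x = relation_ideal Q \<rho> +>\<^bsub>path_algebra Q\<^esub> Poly_Mapping.single (head Q x, [x]) 1"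


section \<open>Words\<close>

datatype 'a letter = Direct 'a | Inverse 'a

primrec letter_inv :: "'a letter \<Rightarrow> 'a letter" where
  "letter_inv (Direct x) = Inverse x"
| "letter_inv (Inverse x) = Direct x"

primrec letter_arrow :: "'a letter \<Rightarrow> 'a" where
  "letter_arrow (Direct x) = x"
| "letter_arrow (Inverse x) = x"

primrec letter_head :: "('v, 'a) pre_digraph \<Rightarrow> 'a letter \<Rightarrow> 'v" where
  "letter_head Q (Direct x) = head Q x"
| "letter_head Q (Inverse x) = tail Q x"

primrec letter_tail :: "('v, 'a) pre_digraph \<Rightarrow> 'a letter \<Rightarrow> 'v" where
  "letter_tail Q (Direct x) = tail Q x"
| "letter_tail Q (Inverse x) = head Q x"

datatype shape = Fin nat | Nat | NegNat | AllInt

primrec index_set :: "shape \<Rightarrow> int set" where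
  "index_set (Fin n) = {0..int n}"
| "index_set Nat = {0..}"
| "index_set NegNat = {..0}"
| "index_set AllInt = UNIV"

definition positions :: "shape \<Rightarrow> int set" where
  "positions s = {i. i \<in> index_set s \<and> i - 1 \<in> index_set s}"

text \<open>
  The function of a word \<^term>\<open>Letters s c\<close> is \<^const>\<open>undefined\<close> outside \<^term>\<open>positions s\<close>, so
  that equality of words is equality of sequences of letters.
\<close>

datatype ('v, 'a) qword = Trivial 'v int | Letters shape "int \<Rightarrow> 'a letter"

primrec word_shape :: "('v, 'a) qword \<Rightarrow> shape" where
  "word_shape (Trivial v \<epsilon>) = Fin 0"
| "word_shape (Letters s c) = s"

primrec letter_at :: "('v, 'a) qword \<Rightarrow> int \<Rightarrow> 'a letter" where
  "letter_at (Trivial v \<epsilon>) = (\<lambda>i. undefined)"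
| "letter_at (Letters s c) = c"

definition occurs_at :: "'a letter list \<Rightarrow> shape \<Rightarrow> (int \<Rightarrow> 'a letter) \<Rightarrow> int \<Rightarrow> bool" where
  "occurs_at u s c i \<longleftrightarrow> (\<forall>j<length u. i + int j \<in> positions s \<and> c (i + int j) = u ! j)"

primrec is_word :: "('v, 'a) pre_digraph \<Rightarrow> 'a list set \<Rightarrow> ('v, 'a) qword \<Rightarrow> bool" where
  "is_word Q \<rho> (Trivial v \<epsilon>) \<longleftrightarrow> v \<in> verts Q \<and> \<epsilon> \<in> {1, -1}"
| "is_word Q \<rho> (Letters s c) \<longleftrightarrow>
     s \<noteq> Fin 0 \<and>
     c \<in> extensional (positions s) \<and>
     (\<forall>i\<in>positions s. letter_arrow (c i) \<in> arcs Q) \<and>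
     (\<forall>i. i \<in> positions s \<and> i + 1 \<in> positions s \<longrightarrow>
        letter_tail Q (c i) = letter_head Q (c (i + 1)) \<and> letter_inv (c i) \<noteq> c (i + 1)) \<and>
     (\<forall>r\<in>\<rho>. \<forall>i. \<not> occurs_at (map Direct r) s c i \<and> \<not> occurs_at (map Inverse (rev r)) s c i)"

primrec word_vertex :: "('v, 'a) pre_digraph \<Rightarrow> ('v, 'a) qword \<Rightarrow> int \<Rightarrow> 'v" where
  "word_vertex Q (Trivial v \<epsilon>) i = v"
| "word_vertex Q (Letters s c) i =
     (if i \<in> positions s then letter_tail Q (c i) else letter_head Q (c (i + 1)))"

primrec inverse_shape :: "shape \<Rightarrow> shape" where
  "inverse_shape (Fin n) = Fin n"
| "inverse_shape Nat = NegNat"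
| "inverse_shape NegNat = Nat"
| "inverse_shape AllInt = AllInt"

primrec word_inv :: "('v, 'a) qword \<Rightarrow> ('v, 'a) qword" where
  "word_inv (Trivial v \<epsilon>) = Trivial v (- \<epsilon>)"
| "word_inv (Letters s c) =
     Letters (inverse_shape s)
       (\<lambda>i\<in>positions (inverse_shape s).
          letter_inv (c (case s of Fin n \<Rightarrow> int n + 1 - i | _ \<Rightarrow> 1 - i)))"

definition shift :: "int \<Rightarrow> ('v, 'a) qword \<Rightarrow> ('v, 'a) qword" where
  "shift m C =
     (if word_shape C = AllInt then Letters AllInt (\<lambda>i. letter_at C (i + m)) else C)"

definition periodic :: "('v, 'a) qword \<Rightarrow> bool" where
  "periodic C \<longleftrightarrow> word_shape C = AllInt \<and> (\<exists>n::nat. n > 0 \<and> C = shift (int n) C)"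

definition period :: "('v, 'a) qword \<Rightarrow> nat" where
  "period C = (LEAST n::nat. n > 0 \<and> C = shift (int n) C)"

definition is_shift_of :: "('v, 'a) qword \<Rightarrow> ('v, 'a) qword \<Rightarrow> bool" where
  "is_shift_of D C \<longleftrightarrow> (\<exists>m. D = shift m C)"

definition word_equiv :: "('v, 'a) qword \<Rightarrow> ('v, 'a) qword \<Rightarrow> bool" where
  "word_equiv C D \<longleftrightarrow> is_shift_of D C \<or> is_shift_of D (word_inv C)"


subsection \<open>Signs and composition\<close>

definition sign_choice ::
    "('v, 'a) pre_digraph \<Rightarrow> 'a list set \<Rightarrow> ('a letter \<Rightarrow> int) \<Rightarrow> bool" where
  "sign_choice Q \<rho> \<sigma> \<longleftrightarrow>
     (\<forall>l. letter_arrow l \<in> arcs Q \<longrightarrow> \<sigma> l \<in> {1, -1}) \<and>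
     (\<forall>l l'. letter_arrow l \<in> arcs Q \<and> letter_arrow l' \<in> arcs Q \<and> l \<noteq> l' \<and>
        letter_head Q l = letter_head Q l' \<and> \<sigma> l = \<sigma> l' \<longrightarrow>
        (\<exists>x y. [x, y] \<in> \<rho> \<and> {l, l'} = {Inverse x, Direct y}))"

definition has_head :: "('v, 'a) qword \<Rightarrow> bool" where
  "has_head C \<longleftrightarrow> word_shape C \<noteq> NegNat \<and> word_shape C \<noteq> AllInt"

definition has_tail :: "('v, 'a) qword \<Rightarrow> bool" where
  "has_tail C \<longleftrightarrow> word_shape C \<noteq> Nat \<and> word_shape C \<noteq> AllInt"

definition word_head :: "('v, 'a) pre_digraph \<Rightarrow> ('v, 'a) qword \<Rightarrow> 'v" where
  "word_head Q C = word_vertex Q C 0"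

definition word_tail :: "('v, 'a) pre_digraph \<Rightarrow> ('v, 'a) qword \<Rightarrow> 'v" where
  "word_tail Q C = word_vertex Q C (case word_shape C of Fin n \<Rightarrow> int n | _ \<Rightarrow> 0)"

primrec word_sign :: "('a letter \<Rightarrow> int) \<Rightarrow> ('v, 'a) qword \<Rightarrow> int" where
  "word_sign \<sigma> (Trivial v \<epsilon>) = \<epsilon>"
| "word_sign \<sigma> (Letters s c) = \<sigma> (c 1)"

text \<open>
  The concatenation is meaningful only if the first word has a tail and the second one a head.
  A \<open>-\<nat>\<close>-word followed by a finite word of length \<open>n\<close> is reindexed to end at \<open>0\<close>.
\<close>

fun concatenation :: "('v, 'a) qword \<Rightarrow> ('v, 'a) qword \<Rightarrow> ('v, 'a) qword" where
  "concatenation (Trivial v \<epsilon>) D = D"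
| "concatenation C (Trivial v \<epsilon>) = C"
| "concatenation (Letters (Fin m) c) (Letters (Fin n) d) =
     Letters (Fin (m + n))
       (\<lambda>i\<in>positions (Fin (m + n)). if i \<le> int m then c i else d (i - int m))"
| "concatenation (Letters (Fin m) c) (Letters Nat d) =
     Letters Nat (\<lambda>i\<in>positions Nat. if i \<le> int m then c i else d (i - int m))"
| "concatenation (Letters NegNat c) (Letters (Fin n) d) =
     Letters NegNat (\<lambda>i\<in>positions NegNat. if i \<le> - int n then c (i + int n) else d (i + int n))"
| "concatenation (Letters NegNat c) (Letters Nat d) =
     Letters AllInt (\<lambda>i. if i \<le> 0 then c i else d i)"
| "concatenation C D = undefined"

text \<open>\<open>composable Q \<rho> \<sigma> C D\<close> says that the composition \<open>C D\<close> is defined (``is a word'').\<close>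

definition composable ::
    "('v, 'a) pre_digraph \<Rightarrow> 'a list set \<Rightarrow> ('a letter \<Rightarrow> int)
      \<Rightarrow> ('v, 'a) qword \<Rightarrow> ('v, 'a) qword \<Rightarrow> bool" where
  "composable Q \<rho> \<sigma> C D \<longleftrightarrow>
     has_tail C \<and> has_head D \<and>
     word_tail Q C = word_head Q D \<and>
     word_sign \<sigma> (word_inv C) = - word_sign \<sigma> D \<and>
     is_word Q \<rho> (concatenation C D)"

definition letter_word :: "'a letter \<Rightarrow> ('v, 'a) qword" where
  "letter_word l = Letters (Fin 1) (\<lambda>i\<in>positions (Fin 1). l)"

text \<open>
  If \<open>C = B\<^sup>-\<^sup>1 D\<close> is periodic of period \<open>n\<close>, this is the word \<open>E = C\<^sub>1 \<dots> C\<^sub>n\<close> of length \<open>n\<close> with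
  \<open>C = \<^sup>\<infinity>E\<^sup>\<infinity>\<close>.
\<close>

definition period_word :: "('v, 'a) qword \<Rightarrow> ('v, 'a) qword" where
  "period_word C =
     Letters (Fin (period C)) (\<lambda>i\<in>positions (Fin (period C)). letter_at C i)"


section \<open>The modules \<open>M(C)\<close> and \<open>M(C, V)\<close>\<close>

text \<open>
  The vector space underlying \<open>M(C)\<close> consists of the finitely supported functions on the index
  set, \<open>b\<^sub>i\<close> being \<^term>\<open>Poly_Mapping.single i 1\<close>.
\<close>

definition vertex_action ::
    "('v, 'a) pre_digraph \<Rightarrow> ('v, 'a) qword \<Rightarrow> 'v \<Rightarrow> (int \<Rightarrow>\<^sub>0 'k::field) \<Rightarrow> (int \<Rightarrow>\<^sub>0 'k)" where
  "vertex_action Q C v f =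
     (\<Sum>i\<in>Poly_Mapping.keys f.
        if word_vertex Q C i = v then Poly_Mapping.single i (Poly_Mapping.lookup f i) else 0)"

definition arrow_action ::
    "('v, 'a) qword \<Rightarrow> 'a \<Rightarrow> (int \<Rightarrow>\<^sub>0 'k::field) \<Rightarrow> (int \<Rightarrow>\<^sub>0 'k)" where
  "arrow_action C x f =
     (\<Sum>i\<in>Poly_Mapping.keys f.
        if i \<in> positions (word_shape C) \<and> letter_at C i = Direct x
        then Poly_Mapping.single (i - 1) (Poly_Mapping.lookup f i)
        else if i + 1 \<in> positions (word_shape C) \<and> letter_at C (i + 1) = Inverse x
        then Poly_Mapping.single (i + 1) (Poly_Mapping.lookup f i)
        else 0)"

definition path_action ::
    "('v, 'a) pre_digraph \<Rightarrow> ('v, 'a) qword \<Rightarrow> ('v, 'a) qpath \<Rightarrow> (int \<Rightarrow>\<^sub>0 'k::field) \<Rightarrow> (int \<Rightarrow>\<^sub>0 'k)" where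
  "path_action Q C p f =
     (if snd p = [] then vertex_action Q C (fst p) f else foldr (arrow_action C) (snd p) f)"

definition path_algebra_action ::
    "('v, 'a) pre_digraph \<Rightarrow> ('v, 'a) qword \<Rightarrow> (('v, 'a) qpath \<Rightarrow>\<^sub>0 'k::field)
      \<Rightarrow> (int \<Rightarrow>\<^sub>0 'k) \<Rightarrow> (int \<Rightarrow>\<^sub>0 'k)" where
  "path_algebra_action Q C a f =
     (\<Sum>p\<in>Poly_Mapping.keys a.
        Poly_Mapping.map (\<lambda>t. Poly_Mapping.lookup a p * t) (path_action Q C p f))"

text \<open>
  All representatives \<open>a\<close> of a class \<open>X\<close> in the quotient algebra act in the same way if \<open>C\<close> is a
  word, so that the image below is a singleton.
\<close>

definition string_module :: "('v, 'a) pre_digraph \<Rightarrow> ('v, 'a) qword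
    \<Rightarrow> ((('v, 'a) qpath \<Rightarrow>\<^sub>0 'k::field) set, int \<Rightarrow>\<^sub>0 'k) module" where
  "string_module Q C =
     \<lparr>carrier = {f. Poly_Mapping.keys f \<subseteq> index_set (word_shape C)},
      monoid.mult = undefined, monoid.one = undefined,
      ring.zero = 0, ring.add = (+),
      module.smult = (\<lambda>X f. the_elem ((\<lambda>a. path_algebra_action Q C a f) ` X))\<rparr>"

text \<open>The right action of \<open>k[T, T\<^sup>-\<^sup>1]\<close> on \<open>M(C)\<close> with \<open>b\<^sub>i T = b\<^sub>i\<^sub>-\<^sub>n\<close>, \<open>n\<close> the period.\<close>

definition laurent_action ::
    "('v, 'a) qword \<Rightarrow> (int \<Rightarrow>\<^sub>0 'k::field) \<Rightarrow> 'k laurent \<Rightarrow> (int \<Rightarrow>\<^sub>0 'k)" where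
  "laurent_action C f p =
     (\<Sum>i\<in>Poly_Mapping.keys f. \<Sum>j\<in>Poly_Mapping.keys p.
        Poly_Mapping.single (i - int (period C) * j)
          (Poly_Mapping.lookup f i * Poly_Mapping.lookup p j))"

definition periodic_module :: "('v, 'a) pre_digraph \<Rightarrow> ('v, 'a) qword
    \<Rightarrow> ('k::field laurent, 'w) module
    \<Rightarrow> ((('v, 'a) qpath \<Rightarrow>\<^sub>0 'k) set, ((int \<Rightarrow>\<^sub>0 'k) \<times> 'w \<Rightarrow>\<^sub>0 int) set) module" where
  "periodic_module Q C V = tensor_module laurent_ring (string_module Q C) (laurent_action C) V"


section \<open>The functors\<close>

definition vertex_space :: "('v, 'a) pre_digraph \<Rightarrow> 'a list set
    \<Rightarrow> ((('v, 'a) qpath \<Rightarrow>\<^sub>0 'k::field) set, 'm) module \<Rightarrow> 'v \<Rightarrow> 'm set" where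
  "vertex_space Q \<rho> M v = (\<lambda>m. vertex_elem Q \<rho> 1 v \<odot>\<^bsub>M\<^esub> m) ` carrier M"

text \<open>
  A linear relation is a set of pairs, with \<open>C H\<close> being \<^term>\<open>C `` H\<close>.  In the notation of the
  words the right factor is applied first, so a product \<open>C D\<close> of relations is \<^term>\<open>D O C\<close>.
\<close>

primrec letter_relation :: "('v, 'a) pre_digraph \<Rightarrow> 'a list set
    \<Rightarrow> ((('v, 'a) qpath \<Rightarrow>\<^sub>0 'k::field) set, 'm) module \<Rightarrow> 'a letter \<Rightarrow> ('m \<times> 'm) set" where
  "letter_relation Q \<rho> M (Direct x) =
     {(m, arrow_elem Q \<rho> x \<odot>\<^bsub>M\<^esub> m) |m. m \<in> vertex_space Q \<rho> M (tail Q x)}"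
| "letter_relation Q \<rho> M (Inverse x) =
     {(m, arrow_elem Q \<rho> x \<odot>\<^bsub>M\<^esub> m) |m. m \<in> vertex_space Q \<rho> M (tail Q x)}\<inverse>"

text \<open>To be used for finite words only, as are the two definitions following it.\<close>

primrec word_relation :: "('v, 'a) pre_digraph \<Rightarrow> 'a list set
    \<Rightarrow> ((('v, 'a) qpath \<Rightarrow>\<^sub>0 'k::field) set, 'm) module \<Rightarrow> ('v, 'a) qword \<Rightarrow> ('m \<times> 'm) set" where
  "word_relation Q \<rho> M (Trivial v \<epsilon>) = Id_on (vertex_space Q \<rho> M v)"
| "word_relation Q \<rho> M (Letters s c) =
     foldr (\<lambda>i R. R O letter_relation Q \<rho> M (c i))
       (case s of Fin n \<Rightarrow> [1..int n] | _ \<Rightarrow> undefined) Id"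

definition finite_plus :: "('v, 'a) pre_digraph \<Rightarrow> 'a list set \<Rightarrow> ('a letter \<Rightarrow> int)
    \<Rightarrow> ((('v, 'a) qpath \<Rightarrow>\<^sub>0 'k::field) set, 'm) module \<Rightarrow> ('v, 'a) qword \<Rightarrow> 'm set" where
  "finite_plus Q \<rho> \<sigma> M C =
     (let P = (\<lambda>x. x \<in> arcs Q \<and> composable Q \<rho> \<sigma> C (letter_word (Inverse x)))
      in if \<exists>x. P x
         then word_relation Q \<rho> M (concatenation C (letter_word (Inverse (THE x. P x)))) `` {\<zero>\<^bsub>M\<^esub>}
         else word_relation Q \<rho> M C `` vertex_space Q \<rho> M (word_tail Q C))"

definition finite_minus :: "('v, 'a) pre_digraph \<Rightarrow> 'a list set \<Rightarrow> ('a letter \<Rightarrow> int)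
    \<Rightarrow> ((('v, 'a) qpath \<Rightarrow>\<^sub>0 'k::field) set, 'm) module \<Rightarrow> ('v, 'a) qword \<Rightarrow> 'm set" where
  "finite_minus Q \<rho> \<sigma> M C =
     (let P = (\<lambda>y. y \<in> arcs Q \<and> composable Q \<rho> \<sigma> C (letter_word (Direct y)))
      in if \<exists>y. P y
         then word_relation Q \<rho> M (concatenation C (letter_word (Direct (THE y. P y))))
                `` vertex_space Q \<rho> M (tail Q (THE y. P y))
         else word_relation Q \<rho> M C `` {\<zero>\<^bsub>M\<^esub>})"

text \<open>\<open>C\<^sup>+(M)\<close> and \<open>C\<^sup>-(M)\<close>, for \<open>C\<close> a finite word or an \<open>\<nat>\<close>-word.\<close>

definition functor_plus :: "('v, 'a) pre_digraph \<Rightarrow> 'a list set \<Rightarrow> ('a letter \<Rightarrow> int)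
    \<Rightarrow> ((('v, 'a) qpath \<Rightarrow>\<^sub>0 'k::field) set, 'm) module \<Rightarrow> ('v, 'a) qword \<Rightarrow> 'm set" where
  "functor_plus Q \<rho> \<sigma> M C =
     (if word_shape C = Nat
      then {m \<in> carrier M. \<exists>s :: nat \<Rightarrow> 'm. s 0 = m \<and>
              (\<forall>n\<ge>1. s (n - 1) \<in> letter_relation Q \<rho> M (letter_at C (int n)) `` {s n})}
      else finite_plus Q \<rho> \<sigma> M C)"

definition functor_minus :: "('v, 'a) pre_digraph \<Rightarrow> 'a list set \<Rightarrow> ('a letter \<Rightarrow> int)
    \<Rightarrow> ((('v, 'a) qpath \<Rightarrow>\<^sub>0 'k::field) set, 'm) module \<Rightarrow> ('v, 'a) qword \<Rightarrow> 'm set" where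
  "functor_minus Q \<rho> \<sigma> M C =
     (if word_shape C = Nat
      then {m \<in> carrier M. \<exists>s :: nat \<Rightarrow> 'm. s 0 = m \<and>
              (\<forall>n\<ge>1. s (n - 1) \<in> letter_relation Q \<rho> M (letter_at C (int n)) `` {s n}) \<and>
              (\<exists>N. \<forall>n\<ge>N. s n = \<zero>\<^bsub>M\<^esub>)}
      else finite_minus Q \<rho> \<sigma> M C)"

definition F_plus :: "('v, 'a) pre_digraph \<Rightarrow> 'a list set \<Rightarrow> ('a letter \<Rightarrow> int)
    \<Rightarrow> ((('v, 'a) qpath \<Rightarrow>\<^sub>0 'k::field) set, 'm) module
    \<Rightarrow> ('v, 'a) qword \<Rightarrow> ('v, 'a) qword \<Rightarrow> 'm set" where
  "F_plus Q \<rho> \<sigma> M B D = functor_plus Q \<rho> \<sigma> M B \<inter> functor_plus Q \<rho> \<sigma> M D"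

definition F_minus :: "('v, 'a) pre_digraph \<Rightarrow> 'a list set \<Rightarrow> ('a letter \<Rightarrow> int)
    \<Rightarrow> ((('v, 'a) qpath \<Rightarrow>\<^sub>0 'k::field) set, 'm) module
    \<Rightarrow> ('v, 'a) qword \<Rightarrow> ('v, 'a) qword \<Rightarrow> 'm set" where
  "F_minus Q \<rho> \<sigma> M B D =
     (functor_plus Q \<rho> \<sigma> M B \<inter> functor_minus Q \<rho> \<sigma> M D) <+>\<^bsub>M\<^esub>
     (functor_minus Q \<rho> \<sigma> M B \<inter> functor_plus Q \<rho> \<sigma> M D)"

text \<open>The vector space \<open>F\<^sub>B\<^sub>,\<^sub>D(M)\<close>, a subquotient of \<open>e\<^sub>v M\<close> with \<open>v\<close> the common head of \<open>B\<close> and \<open>D\<close>.\<close>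

definition F_space :: "('v, 'a) pre_digraph \<Rightarrow> 'a list set \<Rightarrow> ('a letter \<Rightarrow> int)
    \<Rightarrow> ((('v, 'a) qpath \<Rightarrow>\<^sub>0 'k::field) set, 'm) module
    \<Rightarrow> ('v, 'a) qword \<Rightarrow> ('v, 'a) qword \<Rightarrow> ('k, 'm set) module" where
  "F_space Q \<rho> \<sigma> M B D =
     quot_module
       \<lparr>carrier = F_plus Q \<rho> \<sigma> M B D,
        monoid.mult = undefined, monoid.one = undefined,
        ring.zero = \<zero>\<^bsub>M\<^esub>, ring.add = (\<oplus>\<^bsub>M\<^esub>),
        module.smult = (\<lambda>c m. vertex_elem Q \<rho> c (word_head Q B) \<odot>\<^bsub>M\<^esub> m)\<rparr>
       (F_minus Q \<rho> \<sigma> M B D)"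

text \<open>
  For \<open>B\<^sup>-\<^sup>1 D\<close> periodic: \<open>T(F\<^sup>- + m)\<close> is the set of all \<open>m'\<close> in \<open>F\<^sup>+ \<inter> (F\<^sup>- + E m)\<close>.
\<close>

definition F_T :: "('v, 'a) pre_digraph \<Rightarrow> 'a list set \<Rightarrow> ('a letter \<Rightarrow> int)
    \<Rightarrow> ((('v, 'a) qpath \<Rightarrow>\<^sub>0 'k::field) set, 'm) module
    \<Rightarrow> ('v, 'a) qword \<Rightarrow> ('v, 'a) qword \<Rightarrow> 'm set \<Rightarrow> 'm set" where
  "F_T Q \<rho> \<sigma> M B D X =
     (let E = period_word (concatenation (word_inv B) D)
      in \<Union>m\<in>X. F_plus Q \<rho> \<sigma> M B D \<inter>
                 (F_minus Q \<rho> \<sigma> M B D <+>\<^bsub>M\<^esub> (word_relation Q \<rho> M E `` {m})))"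

definition int_iterate :: "'x set \<Rightarrow> ('x \<Rightarrow> 'x) \<Rightarrow> int \<Rightarrow> 'x \<Rightarrow> 'x" where
  "int_iterate A t j =
     (if j \<ge> 0 then t ^^ nat j else inv_into A t ^^ nat (- j))"

definition F_laurent_module :: "('v, 'a) pre_digraph \<Rightarrow> 'a list set \<Rightarrow> ('a letter \<Rightarrow> int)
    \<Rightarrow> ((('v, 'a) qpath \<Rightarrow>\<^sub>0 'k::field) set, 'm) module
    \<Rightarrow> ('v, 'a) qword \<Rightarrow> ('v, 'a) qword \<Rightarrow> ('k laurent, 'm set) module" where
  "F_laurent_module Q \<rho> \<sigma> M B D =
     (let F = F_space Q \<rho> \<sigma> M B D
      in \<lparr>carrier = carrier F,
          monoid.mult = undefined, monoid.one = undefined,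
          ring.zero = \<zero>\<^bsub>F\<^esub>, ring.add = (\<oplus>\<^bsub>F\<^esub>),
          module.smult = (\<lambda>p X. finsum F
            (\<lambda>j. Poly_Mapping.lookup p j \<odot>\<^bsub>F\<^esub>
                   int_iterate (carrier F) (F_T Q \<rho> \<sigma> M B D) j X)
            (Poly_Mapping.keys p))\<rparr>)"

end

theory Submission
  imports Defs
begin

text \<open>
  The module has coordinates indexed by the positions of the words \<open>C\<^sup>\<lambda>\<close> and \<open>C\<^sup>\<mu>\<close>, and a letter moves
  coordinates along a partial injection of the positions.  So the relations given by words map
  subspaces spanned by sets of positions to subspaces of the same kind, for the whole direct sum
  at once.  Following a word \<open>D\<close> from a position \<open>i\<close>, one can go on as long as the word at \<open>i\<close>
  agrees with \<open>D\<close>; if this stops at an inverse letter of \<open>D\<close>, then \<open>i\<close> belongs to \<open>D\<^sup>-(M)\<close>, if it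
  stops at a direct letter, then \<open>i\<close> does not belong to \<open>D\<^sup>+(M)\<close>, and if it never stops, then \<open>i\<close>
  belongs to \<open>D\<^sup>+(M)\<close> but not to \<open>D\<^sup>-(M)\<close>.  Hence \<open>F\<^sub>B\<^sub>,\<^sub>D(M)\<close> has the coordinates at those positions where the
  word is \<open>B\<^sup>-\<^sup>1 D\<close>, read in one of the two directions.  A word which is not periodic has at most one
  such position, and a periodic one has a single residue class of them, because no word is a
  nontrivial reflection of itself.  In the periodic case the relation \<open>E\<close> moves such a position by
  one period, to the right or to the left according to the orientation, so it acts on the
  coordinate in \<open>V\<^sup>\<mu>\<close> as \<open>T\<close> or as \<open>T\<^sup>-\<^sup>1\<close>.
\<close>

section \<open>Rays of words\<close>

text \<open>The functors are built from sums and intersections of subspaces, which in general obey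
  no distributive law. Subspaces spanned by sets of positions do, as soon as an element can be cut
  into its coordinates on a set and those off it. In \<open>M(C, V)\<close> such a cut must respect
  the period. The sets that are cut along depend only on the two words read from a position, and
  this gives the invariance. The relation of an inverse letter contains the kernel of the arrow,
  whereas that of a direct letter reaches only the image: hence the asymmetry between stopping at
  the one and at the other. For an \<nat>-word one sequence has to serve all coordinates of an
  element. For the plus functor it is built by dependent choice. For the minus functor it must
  vanish from some index on, and a common bound exists because only finitely many coordinates are
  nonzero up to the period. A trivial word shows no letter, so its direction has to be recovered
  from the signs.\<close>

definition dir :: "bool \<Rightarrow> int" where
  "dir d = (if d then 1 else - 1)"

lemma dir_simps [simp]: "dir True = 1" "dir False = - 1" "dir (\<not> d) = - dir d"
  by (auto simp: dir_def)

text \<open>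
  Seen from a position \<open>i\<close>, a word \<open>C\<close> consists of the two words \<open>C\<^sub>i\<^sub>+\<^sub>1 C\<^sub>i\<^sub>+\<^sub>2 \<dots>\<close> and \<open>C\<^sub>i\<^sup>-\<^sup>1 C\<^sub>i\<^sub>-\<^sub>1\<^sup>-\<^sup>1 \<dots>\<close>
  with head \<open>v\<^sub>i(C)\<close>; the first one is read in the direction \<^term>\<open>True\<close>.
\<close>

definition out_letter :: "('v, 'a) qword \<Rightarrow> int \<Rightarrow> bool \<Rightarrow> 'a letter option" where
  "out_letter C i d =
     (if d then if i + 1 \<in> positions (word_shape C) then Some (letter_at C (i + 1)) else None
      else if i \<in> positions (word_shape C) then Some (letter_inv (letter_at C i)) else None)"

definition ray :: "('v, 'a) qword \<Rightarrow> int \<Rightarrow> bool \<Rightarrow> nat \<Rightarrow> 'a letter option" where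
  "ray C i d k = out_letter C (i + dir d * int k) d"

text \<open>On basis vectors this is the relation of \<open>l\<close>, which relates the one at
  \<open>i'\<close> to the one at \<open>i\<close>: the arrow \<open>x\<close> takes
  \<open>b_i'\<close> to \<open>b_i\<close> for \<open>l = Direct x\<close>, and \<open>b_i\<close>
  to \<open>b_i'\<close> for \<open>l = Inverse x\<close>. Words are thus followed from their
  head.\<close>

definition step :: "('v, 'a) qword \<Rightarrow> int \<Rightarrow> 'a letter \<Rightarrow> int \<Rightarrow> bool" where
  "step C i l i' \<longleftrightarrow> (\<exists>d. out_letter C i d = Some l \<and> i' = i + dir d)"

lemma letter_inv_inv [simp]: "letter_inv (letter_inv l) = l"
  by (cases l) auto

lemma letter_inv_eq_iff [simp]: "letter_inv l = letter_inv l' \<longleftrightarrow> l = l'"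
  by (metis letter_inv_inv)

lemma letter_inv_neq [simp]: "letter_inv l \<noteq> l" "l \<noteq> letter_inv l"
  by (cases l; simp)+

lemma letter_inv_head_tail [simp]:
  "letter_head Q (letter_inv l) = letter_tail Q l" "letter_tail Q (letter_inv l) = letter_head Q l"
  "letter_arrow (letter_inv l) = letter_arrow l"
  by (cases l; simp)+

lemma index_set_convex: "i \<in> index_set s \<Longrightarrow> j \<in> index_set s \<Longrightarrow> i \<le> k \<Longrightarrow> k \<le> j \<Longrightarrow> k \<in> index_set s"
  by (cases s) auto

lemma positions_between:
  "i \<in> index_set s \<Longrightarrow> j \<in> index_set s \<Longrightarrow> i < k \<Longrightarrow> k \<le> j \<Longrightarrow> k \<in> positions s"
  using index_set_convex[of i s j k] index_set_convex[of i s j "k - 1"] by (auto simp: positions_def)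

lemma positions_simps:
  "i \<in> positions (Fin n) \<longleftrightarrow> 1 \<le> i \<and> i \<le> int n" "i \<in> positions Nat \<longleftrightarrow> 1 \<le> i"
  "i \<in> positions NegNat \<longleftrightarrow> i \<le> 0" "i \<in> positions AllInt"
  by (auto simp: positions_def)

lemma out_letter_index:
  assumes "out_letter C i d = Some l"
  shows "i \<in> index_set (word_shape C)" "i + dir d \<in> index_set (word_shape C)"
  using assms by (auto simp: out_letter_def positions_def split: if_splits)

lemma out_letter_back:
  "out_letter C i d = Some l \<Longrightarrow> out_letter C (i + dir d) (\<not> d) = Some (letter_inv l)"
  by (auto simp: out_letter_def split: if_splits)

lemma word_letter:
  assumes "is_word Q \<rho> C" "i \<in> positions (word_shape C)"
  shows "letter_arrow (letter_at C i) \<in> arcs Q"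
    "i + 1 \<in> positions (word_shape C) \<Longrightarrow> letter_tail Q (letter_at C i) = letter_head Q (letter_at C (i + 1))"
    "i + 1 \<in> positions (word_shape C) \<Longrightarrow> letter_inv (letter_at C i) \<noteq> letter_at C (i + 1)"
  using assms by (cases C; auto simp: positions_simps)+

text \<open>Equality would mean \<open>C_i^-1 = C_(i+1)\<close>. So a letter leaving a position
  determines its direction, and together with \<open>step_inv\<close> this makes \<open>step\<close>
  a partial injection.\<close>

lemma out_letter_distinct:
  assumes "is_word Q \<rho> C" "out_letter C i d = Some l" "out_letter C i (\<not> d) = Some l'"
  shows "l \<noteq> l'"
  using assms(2,3) word_letter(3)[OF assms(1), of i]
  by (cases d) (auto simp: out_letter_def split: if_splits)

lemma out_letter_dir_unique:
  assumes "is_word Q \<rho> C" "out_letter C i d = Some l" "out_letter C i d' = Some l"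
  shows "d = d'"
  using out_letter_distinct[OF assms(1), of i d l l] assms(2,3) by (cases "d' = d") auto

lemma out_letter_props:
  assumes "is_word Q \<rho> C" "out_letter C i d = Some l"
  shows "letter_arrow l \<in> arcs Q" "letter_head Q l = word_vertex Q C i"
    "letter_tail Q l = word_vertex Q C (i + dir d)"
proof -
  show "letter_arrow l \<in> arcs Q"
    using assms(2) word_letter(1)[OF assms(1)] by (auto simp: out_letter_def split: if_splits)
  obtain s c where C: "C = Letters s c"
    using assms(2) by (cases C) (auto simp: out_letter_def positions_simps split: if_splits)
  show "letter_head Q l = word_vertex Q C i"
    using assms(2) word_letter(2)[OF assms(1), of i]
    by (auto simp: out_letter_def C split: if_splits)
  show "letter_tail Q l = word_vertex Q C (i + dir d)"
    using assms(2) word_letter(2)[OF assms(1), of "i - 1"]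
    by (cases d) (auto simp: out_letter_def C split: if_splits)
qed

lemma word_vertex_in_verts:
  assumes "wf_digraph Q" "is_word Q \<rho> C" "i \<in> index_set (word_shape C)"
  shows "word_vertex Q C i \<in> verts Q"
proof (cases "\<exists>d l. out_letter C i d = Some l")
  case True
  then obtain d l where l: "out_letter C i d = Some l" by blast
  have "letter_head Q l \<in> verts Q"
    using out_letter_props(1)[OF assms(2) l] assms(1) by (cases l) (auto simp: wf_digraph_def)
  then show ?thesis using out_letter_props(2)[OF assms(2) l] by simp
next
  case False
  have "\<exists>v e. C = Trivial v e"
  proof (cases C)
    case (Letters s c)
    from False have "i \<notin> positions s" "i + 1 \<notin> positions s"
      using Letters by (auto simp: out_letter_def all_bool_eq)
    then have "s = Fin 0" using assms(3) Letters by (cases s) (auto simp: positions_simps)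
    then show ?thesis using assms(2) Letters by simp
  qed auto
  then show ?thesis using assms(2) by auto
qed

lemma step_unique: "is_word Q \<rho> C \<Longrightarrow> step C i l i1 \<Longrightarrow> step C i l i2 \<Longrightarrow> i1 = i2"
  unfolding step_def using out_letter_dir_unique by fastforce

lemma step_inv: "step C i l i' \<longleftrightarrow> step C i' (letter_inv l) i"
proof -
  have "step C i l i' \<Longrightarrow> step C i' (letter_inv l) i" for i i' l
  proof -
    assume "step C i l i'"
    then obtain d where d: "out_letter C i d = Some l" "i' = i + dir d"
      by (auto simp: step_def)
    then show "step C i' (letter_inv l) i"
      unfolding step_def by (intro exI[of _ "\<not> d"]) (use out_letter_back[OF d(1)] in auto)
  qed
  then show ?thesis by (metis letter_inv_inv)
qed

lemma step_props:
  assumes "is_word Q \<rho> C" "step C i l i'"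
  shows "i \<in> index_set (word_shape C)" "i' \<in> index_set (word_shape C)"
    "letter_arrow l \<in> arcs Q" "word_vertex Q C i = letter_head Q l" "word_vertex Q C i' = letter_tail Q l"
  proof -
  obtain d where d: "out_letter C i d = Some l" "i' = i + dir d" using assms(2) by (auto simp: step_def)
  show "i \<in> index_set (word_shape C)" "i' \<in> index_set (word_shape C)"
    "letter_arrow l \<in> arcs Q" "word_vertex Q C i = letter_head Q l" "word_vertex Q C i' = letter_tail Q l"
    using out_letter_index[OF d(1)] out_letter_props[OF assms(1) d(1)] d(2) by simp_all
qed

text \<open>By the choice of signs, two letters with equal head and sign form a pair
  \<open>x^-1\<close>, \<open>y\<close> with \<open>xy\<close> a zero relation, and then this
  relation occurs in \<open>C\<close> around \<open>i\<close>.\<close>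

lemma out_letter_opposite_sign:
  assumes "is_word Q \<rho> C" "sign_choice Q \<rho> \<sigma>"
    "out_letter C i d = Some l" "out_letter C i (\<not> d) = Some l'"
  shows "\<sigma> l' = - \<sigma> l"
proof -
  have arcs: "letter_arrow l \<in> arcs Q" "letter_arrow l' \<in> arcs Q"
    and heads: "letter_head Q l = letter_head Q l'"
    using out_letter_props[OF assms(1)] assms(3,4) by auto
  have ne: "l \<noteq> l'" using out_letter_distinct[OF assms(1,3,4)] .
  have "\<sigma> l \<noteq> \<sigma> l'"
  proof
    assume eq: "\<sigma> l = \<sigma> l'"
    obtain x y where xy: "[x, y] \<in> \<rho>" "{l, l'} = {Inverse x, Direct y}"
      using assms(2) arcs heads ne eq unfolding sign_choice_def by blast
    obtain s c where C: "C = Letters s c"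
      using assms(3) by (cases C) (auto simp: out_letter_def positions_simps split: if_splits)
    have pos: "i \<in> positions s" "i + 1 \<in> positions s"
      using assms(3,4) C by (cases d; auto simp: out_letter_def split: if_splits)+
    have "{letter_inv (c i), c (i + 1)} = {Inverse x, Direct y}"
      using assms(3,4) C pos xy(2) by (cases d) (auto simp: out_letter_def insert_commute)
    then consider "letter_inv (c i) = Inverse x" "c (i + 1) = Direct y"
      | "letter_inv (c i) = Direct y" "c (i + 1) = Inverse x"
      by (auto simp: doubleton_eq_iff)
    \<comment> \<open>Depending on which of the two letters lies to the right, the relation occurs
      as \<open>xy\<close> or inverted as \<open>y^-1 x^-1\<close>.\<close>
    then have "occurs_at (map Direct [x, y]) s c i \<or> occurs_at (map Inverse (rev [x, y])) s c i"
    proof cases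
      case 1
      then have "c i = Direct x" by (metis letter_inv.simps(2) letter_inv_inv)
      then show ?thesis using 1 pos by (auto simp: occurs_at_def less_Suc_eq)
    next
      case 2
      then have "c i = Inverse y" by (metis letter_inv.simps(1) letter_inv_inv)
      then show ?thesis using 2 pos by (auto simp: occurs_at_def less_Suc_eq)
    qed
    then show False using assms(1) C xy(1) by auto
  qed
  moreover have "\<sigma> l \<in> {1, - 1}" "\<sigma> l' \<in> {1, - 1}"
    using assms(2) arcs unfolding sign_choice_def by auto
  ultimately show ?thesis by auto
qed

section \<open>Following a sequence of letters through a word\<close>

fun follows :: "('v, 'a) qword \<Rightarrow> (nat \<Rightarrow> 'a letter) \<Rightarrow> nat \<Rightarrow> int \<Rightarrow> int \<Rightarrow> bool" where
  "follows C c 0 i j \<longleftrightarrow> i = j"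
| "follows C c (Suc n) i j \<longleftrightarrow> (\<exists>k. step C i (c 0) k \<and> follows C (\<lambda>n. c (Suc n)) n k j)"

text \<open>The defining recursion strips the first letter, as the relations of words do; arguments
  about where a reading ends strip the last one.\<close>

lemma follows_Suc_right:
  "follows C c (Suc n) i j \<longleftrightarrow> (\<exists>k. follows C c n i k \<and> step C k (c n) j)"
proof (induction n arbitrary: c i)
  case (Suc n)
  show ?case using Suc.IH[of "\<lambda>n. c (Suc n)"] by (subst follows.simps(2)) auto
qed auto

lemma follows_unique: "is_word Q \<rho> C \<Longrightarrow> follows C c n i j \<Longrightarrow> follows C c n i j' \<Longrightarrow> j = j'"
  by (induction n arbitrary: c i) (auto dest: step_unique)

lemma follows_mono: "follows C c n i j \<Longrightarrow> m \<le> n \<Longrightarrow> \<exists>k. follows C c m i k"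
  proof (induction n arbitrary: j)
  case (Suc n)
  then show ?case by (cases "m = Suc n") (auto simp: follows_Suc_right simp del: follows.simps(2))
qed auto

lemma ray_0: "ray C i d 0 = out_letter C i d"
  by (simp add: ray_def)

text \<open>Turning around would use the inverse of the letter just read, which the sequence
  \<open>c\<close> excludes. So the direction of the first step is kept throughout.\<close>

lemma follows_iff_ray:
  assumes "is_word Q \<rho> C" and "\<And>k. Suc k < n \<Longrightarrow> letter_inv (c k) \<noteq> c (Suc k)"
  shows "follows C c n i j \<longleftrightarrow>
    (\<exists>d. (\<forall>k<n. ray C i d k = Some (c k)) \<and> j = i + dir d * int n)"
  using assms(2)
proof (induction n arbitrary: j)
  case (Suc n)
  have IH: "follows C c n i j \<longleftrightarrow> (\<exists>d. (\<forall>k<n. ray C i d k = Some (c k)) \<and> j = i + dir d * int n)"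
    for j using Suc by (metis Suc_lessI less_Suc_eq)
  show ?case
  proof
    assume "follows C c (Suc n) i j"
    then obtain k where k: "follows C c n i k" "step C k (c n) j"
      by (auto simp: follows_Suc_right simp del: follows.simps)
    obtain d where d: "\<forall>k<n. ray C i d k = Some (c k)" "k = i + dir d * int n"
      using IH k(1) by auto
    obtain d' where d': "out_letter C k d' = Some (c n)" "j = k + dir d'"
      using k(2) by (auto simp: step_def)
    show "\<exists>d. (\<forall>k<Suc n. ray C i d k = Some (c k)) \<and> j = i + dir d * int (Suc n)"
    proof (cases "n = 0")
      case True
      then show ?thesis using d d' by (auto simp: ray_def)
    next
      case False
      then obtain m where m: "n = Suc m" by (cases n) auto
      have "out_letter C (i + dir d * int m) d = Some (c m)"
        using d(1) m by (auto simp: ray_def)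
      from out_letter_back[OF this] have "out_letter C k (\<not> d) = Some (letter_inv (c m))"
        using d(2) m by (simp add: algebra_simps)
      moreover have "letter_inv (c m) \<noteq> c n" using Suc.prems[of m] m by auto
      ultimately have "d' = d" using d'(1) by (cases "d' = d") auto
      then show ?thesis using d d' by (intro exI[of _ d]) (auto simp: less_Suc_eq ray_def algebra_simps)
    qed
  next
    assume "\<exists>d. (\<forall>k<Suc n. ray C i d k = Some (c k)) \<and> j = i + dir d * int (Suc n)"
    then obtain d where d: "\<forall>k<Suc n. ray C i d k = Some (c k)" "j = i + dir d * int (Suc n)" by auto
    have "follows C c n i (i + dir d * int n)" using IH d(1) by (blast intro: less_SucI)
    moreover have "step C (i + dir d * int n) (c n) j"
      using d unfolding step_def by (intro exI[of _ d]) (auto simp: ray_def algebra_simps)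
    ultimately show "follows C c (Suc n) i j" by (auto simp: follows_Suc_right simp del: follows.simps)
  qed
qed auto

section \<open>Rays determine positions up to the symmetries of a word\<close>

lemma ray_NoneD:
  assumes "i \<in> index_set (word_shape C)" "ray C i d k = None" "k \<le> m"
  shows "ray C i d m = None"
proof (rule ccontr)
  assume "ray C i d m \<noteq> None"
  then obtain l where "out_letter C (i + dir d * int m) d = Some l" by (auto simp: ray_def)
  from out_letter_index[OF this]
  have m: "i + dir d * int m + dir d \<in> index_set (word_shape C)" by auto
  show False
  proof (cases d)
    case True
    have "i + int k + 1 \<in> positions (word_shape C)"
      using positions_between[OF assms(1) m, of "i + int k + 1"] True assms(3) by auto
    then show False using assms(2) True by (auto simp: ray_def out_letter_def split: if_splits)
  next
    case False
    have "i - int k \<in> positions (word_shape C)"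
      using positions_between[OF m assms(1), of "i - int k"] False assms(3) by auto
    then show False using assms(2) False by (auto simp: ray_def out_letter_def split: if_splits)
  qed
qed

text \<open>The value \<open>None\<close> marks the absence of a letter, so that an equality of
  these functions compares the shapes as well.\<close>

definition letter_opt :: "('v, 'a) qword \<Rightarrow> int \<Rightarrow> 'a letter option" where
  "letter_opt C p = (if p \<in> positions (word_shape C) then Some (letter_at C p) else None)"

lemma ray_letter_opt:
  "ray C i True k = letter_opt C (i + 1 + int k)"
  "ray C i False k = map_option letter_inv (letter_opt C (i - int k))"
  by (auto simp: ray_def out_letter_def letter_opt_def algebra_simps)

lemma inj_map_letter_inv: "map_option letter_inv a = map_option letter_inv b \<longleftrightarrow> a = b"
  by (cases a; cases b) auto

lemma map_letter_inv_inv: "map_option letter_inv (map_option letter_inv a) = a"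
  by (cases a) auto

text \<open>The cut lies between 0 and 1 because from position \<open>i\<close> the ray to the right
  starts with the letter at \<open>i + 1\<close> and the ray to the left with the letter at
  \<open>i\<close>.\<close>

lemma int_split: obtains k where "p = 1 + int k" | k where "p = - int k"
proof (cases "p \<ge> 1")
  case True
  then have "p = 1 + int (nat (p - 1))" by simp
  then show ?thesis using that by blast
next
  case False
  then have "p = - int (nat (- p))" by simp
  then show ?thesis using that by blast
qed

lemma rays_same_iff:
  "(\<forall>d. ray C i d = ray C' j d) \<longleftrightarrow> (\<forall>p. letter_opt C (i + p) = letter_opt C' (j + p))"
proof
  assume L: "\<forall>d. ray C i d = ray C' j d"
  show "\<forall>p. letter_opt C (i + p) = letter_opt C' (j + p)"
  proof
    fix p
    show "letter_opt C (i + p) = letter_opt C' (j + p)"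
    proof (rule int_split[of p])
      fix k assume "p = 1 + int k"
      then show ?thesis using fun_cong[OF spec[OF L, of True], of k] by (simp add: ray_letter_opt add.assoc)
    next
      fix k assume "p = - int k"
      then show ?thesis using fun_cong[OF spec[OF L, of False], of k]
        by (simp add: ray_letter_opt inj_map_letter_inv)
    qed
  qed
next
  assume R: "\<forall>p. letter_opt C (i + p) = letter_opt C' (j + p)"
  show "\<forall>d. ray C i d = ray C' j d"
  proof (intro allI ext)
    fix d k
    show "ray C i d k = ray C' j d k"
      using spec[OF R, of "1 + int k"] spec[OF R, of "- int k"]
      by (cases d) (simp_all add: ray_letter_opt add.assoc)
  qed
qed

lemma rays_opposite_iff:
  "(\<forall>d. ray C i d = ray C' j (\<not> d)) \<longleftrightarrow>
   (\<forall>p. letter_opt C (i + p) = map_option letter_inv (letter_opt C' (j + 1 - p)))"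
proof
  assume L: "\<forall>d. ray C i d = ray C' j (\<not> d)"
  show "\<forall>p. letter_opt C (i + p) = map_option letter_inv (letter_opt C' (j + 1 - p))"
  proof
    fix p
    show "letter_opt C (i + p) = map_option letter_inv (letter_opt C' (j + 1 - p))"
    proof (rule int_split[of p])
      fix k assume "p = 1 + int k"
      then show ?thesis using fun_cong[OF spec[OF L, of True], of k] by (simp add: ray_letter_opt add.assoc)
    next
      fix k assume p: "p = - int k"
      have "map_option letter_inv (letter_opt C (i + p)) = letter_opt C' (j + 1 - p)"
        using fun_cong[OF spec[OF L, of False], of k] p by (simp add: ray_letter_opt)
      then show ?thesis by (metis map_letter_inv_inv)
    qed
  qed
next
  assume R: "\<forall>p. letter_opt C (i + p) = map_option letter_inv (letter_opt C' (j + 1 - p))"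
  show "\<forall>d. ray C i d = ray C' j (\<not> d)"
  proof (intro allI ext)
    fix d k
    show "ray C i d k = ray C' j (\<not> d) k"
      using spec[OF R, of "1 + int k"] spec[OF R, of "- int k"]
      by (cases d) (simp_all add: ray_letter_opt add.assoc map_letter_inv_inv)
  qed
qed

lemma index_set_shift:
  assumes "\<And>x. x \<in> index_set s \<longleftrightarrow> x - t \<in> index_set s'"
  shows "s = s' \<and> (t = 0 \<or> s = AllInt)"
proof -
  \<comment> \<open>\<open>N\<close> exceeds the shift and both lengths, so the tests at
    \<open>N\<close> and \<open>- N\<close> detect which index sets are unbounded above or
    below.\<close>
  define N where "N = \<bar>t\<bar> + 1 + (case s of Fin n \<Rightarrow> int n | _ \<Rightarrow> 0) + (case s' of Fin n \<Rightarrow> int n | _ \<Rightarrow> 0)"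
  show ?thesis
  using assms[of 0] assms[of t] assms[of N] assms[of "- N"]
    assms[of "case s of Fin n \<Rightarrow> int n | _ \<Rightarrow> 0"] assms[of "t + (case s' of Fin n \<Rightarrow> int n | _ \<Rightarrow> 0)"]
    by (cases s; cases s'; simp add: N_def; arith)
qed

text \<open>The normal form conditions of \<open>is_word\<close>. They suffice to recover a word
  from its letters and are immediate for inverses and compositions.\<close>

definition proper_word :: "('v, 'a) qword \<Rightarrow> bool" where
  "proper_word C \<longleftrightarrow> (\<forall>s c. C = Letters s c \<longrightarrow> s \<noteq> Fin 0 \<and> c \<in> extensional (positions s))"

lemma is_word_proper: "is_word Q \<rho> C \<Longrightarrow> proper_word C"
  by (auto simp: proper_word_def)

lemma letter_opt_eq_None: "letter_opt C p = None \<longleftrightarrow> p \<notin> positions (word_shape C)"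
  by (simp add: letter_opt_def)

lemma index_set_positions:
  "i \<in> index_set s \<Longrightarrow> x \<in> index_set s \<longleftrightarrow> x = i \<or> x \<in> positions s \<or> x + 1 \<in> positions s"
  by (cases s) (auto simp: positions_def)

lemma same_rays_shape:
  assumes "i \<in> index_set (word_shape C)" "j \<in> index_set (word_shape C')"
    and "\<And>d. ray C i d = ray C' j d"
  shows "word_shape C = word_shape C' \<and> (i = j \<or> word_shape C = AllInt)"
proof -
  have opt: "letter_opt C (i + p) = letter_opt C' (j + p)" for p
    using assms(3) rays_same_iff[of C i C' j] by blast
  have pos: "p \<in> positions (word_shape C) \<longleftrightarrow> p - (i - j) \<in> positions (word_shape C')" for p
    using opt[of "p - i"] letter_opt_eq_None[of C p] letter_opt_eq_None[of C' "p - (i - j)"]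
    by (simp add: algebra_simps)
  have "x \<in> index_set (word_shape C) \<longleftrightarrow> x - (i - j) \<in> index_set (word_shape C')" for x
    using pos[of x] pos[of "x + 1"] unfolding index_set_positions[OF assms(1)] index_set_positions[OF assms(2)]
    by (auto simp: algebra_simps)
  from index_set_shift[OF this] show ?thesis by auto
qed

lemma same_rays_letters:
  assumes "\<And>d. ray C i d = ray C' j d" "word_shape C = AllInt" "word_shape C' = AllInt"
  shows "letter_at C p = letter_at C' (p + (j - i))"
proof -
  have "letter_opt C (i + (p - i)) = letter_opt C' (j + (p - i))"
    using assms(1) rays_same_iff[of C i C' j] by blast
  then show ?thesis using assms(2,3) by (simp add: letter_opt_def positions_simps algebra_simps)
qed

text \<open>A reflection of a word onto itself would fix a letter or exchange two consecutive letters.\<close>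

lemma opposite_rays_unique:
  assumes "is_word Q \<rho> C" "i \<in> index_set (word_shape C)" "j \<in> index_set (word_shape C)"
    and "\<And>d. ray C i d = ray C j (\<not> d)"
  shows "i = j \<and> (\<forall>d. ray C i d = ray C j d)"
proof -
  let ?P = "positions (word_shape C)"
  have opt: "letter_opt C (i + p) = map_option letter_inv (letter_opt C (j + 1 - p))" for p
    using assms(4) rays_opposite_iff[of C i C j] by blast
  then have opt: "letter_opt C q = map_option letter_inv (letter_opt C (i + j + 1 - q))" for q
  proof -
    have eq: "i + (q - i) = q" "j + 1 - (q - i) = i + j + 1 - q" by simp_all
    show ?thesis using opt[of "q - i"] unfolding eq .
  qed
  have no_fix: "q \<notin> ?P" if "2 * q = i + j + 1" for q
  proof -
    have eq: "i + j + 1 - q = q" using that by simp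
    show ?thesis using opt[of q] unfolding eq by (auto simp: letter_opt_def split: if_splits)
  qed
  have no_pair: "\<not> (q \<in> ?P \<and> q + 1 \<in> ?P)" if "2 * q = i + j" for q
  proof -
    have "i + j + 1 - q = q + 1" using that by simp
    then show ?thesis using opt[of q] word_letter(3)[OF assms(1), of q]
      by (auto simp: letter_opt_def split: if_splits)
  qed
  have "i = j"
  proof (rule ccontr)
    assume "i \<noteq> j"
    \<comment> \<open>The centre of the reflection lies between \<open>i\<close> and
      \<open>j\<close>, where all letters exist by convexity of the index set.\<close>
    define a b where "a = min i j" and "b = max i j"
    have ab: "a < b" "a \<in> index_set (word_shape C)" "b \<in> index_set (word_shape C)" "i + j = a + b"
      using \<open>i \<noteq> j\<close> assms(2,3) by (auto simp: a_def b_def min_def max_def)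
    show False
    proof (cases "even (i + j)")
      case True
      then obtain q where q: "i + j = 2 * q" by blast
      then have "a < q" "q < b" using ab by auto
      then show False using no_pair[of q] q positions_between[OF ab(2,3), of q]
          positions_between[OF ab(2,3), of "q + 1"] by auto
    next
      case False
      then obtain q where q: "i + j + 1 = 2 * q" by (metis even_plus_one_iff evenE)
      then have "a < q" "q \<le> b" using ab by auto
      then show False using no_fix[of q] q positions_between[OF ab(2,3), of q] by auto
    qed
  qed
  \<comment> \<open>The reflection exchanges the two places next to \<open>i\<close>. Letters there
    would be inverse to each other, so there are none and both rays are empty.\<close>
  have "\<not> (i \<in> ?P \<and> i + 1 \<in> ?P)" using no_pair[of i] \<open>i = j\<close> by simp
  moreover have "i \<in> ?P \<longleftrightarrow> i + 1 \<in> ?P"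
    using opt[of i] letter_opt_eq_None[of C i] letter_opt_eq_None[of C "i + 1"] \<open>i = j\<close> by simp
  ultimately have "i \<notin> ?P" "i + 1 \<notin> ?P" by auto
  then show ?thesis using \<open>i = j\<close> by simp
qed

lemma same_rays_periodic:
  assumes "i \<in> index_set (word_shape C)" "j \<in> index_set (word_shape C)"
    and "\<And>d. ray C i d = ray C j d"
  shows "i = j \<or> word_shape C = AllInt \<and> (\<forall>p. letter_at C (p + (j - i)) = letter_at C p)"
  using same_rays_shape[OF assms] same_rays_letters[OF assms(3)] by metis

section \<open>Periods of a word\<close>

lemma shift_letters:
  "word_shape C = AllInt \<Longrightarrow> C = shift t C \<longleftrightarrow> (\<forall>p. letter_at C (p + t) = letter_at C p)"
  by (cases C) (auto simp: shift_def fun_eq_iff)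

lemma periodic_letters:
  assumes "word_shape C = AllInt" "\<And>p. letter_at C (p + t) = letter_at C p" "t \<noteq> 0"
  shows "periodic C"
proof -
  have "letter_at C (p + \<bar>t\<bar>) = letter_at C p" for p
    using assms(2)[of p] assms(2)[of "p - t"] by (auto simp: abs_if)
  then have "C = shift (int (nat \<bar>t\<bar>)) C" using shift_letters[OF assms(1), of "int (nat \<bar>t\<bar>)"] by simp
  then show ?thesis unfolding periodic_def using assms(1,3)
    by (intro conjI exI[of _ "nat \<bar>t\<bar>"]) auto
qed

lemma period_props:
  assumes "periodic C"
  shows "period C > 0" "letter_at C (p + int (period C)) = letter_at C p" "word_shape C = AllInt"
proof -
  show A: "word_shape C = AllInt" using assms by (simp add: periodic_def)
  have "period C > 0 \<and> C = shift (int (period C)) C"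
    unfolding period_def by (rule LeastI_ex) (use assms in \<open>auto simp: periodic_def\<close>)
  then show "period C > 0" "letter_at C (p + int (period C)) = letter_at C p"
    using shift_letters[OF A] by auto
qed

lemma letter_at_period_mult:
  assumes "periodic C"
  shows "letter_at C (p + int (period C) * q) = letter_at C p"
proof (induction q rule: int_induct[of _ 0])
  case (step1 i)
  then show ?case using period_props(2)[OF assms, of "p + int (period C) * i"] by (simp add: algebra_simps)
next
  case (step2 i)
  then show ?case using period_props(2)[OF assms, of "p + int (period C) * (i - 1)"] by (simp add: algebra_simps)
qed auto

lemma letter_at_period_cong:
  assumes "periodic C" "int (period C) dvd p - q"
  shows "letter_at C p = letter_at C q"
proof -
  obtain k where "p - q = int (period C) * k" using assms(2) by blast
  then have "p = q + int (period C) * k" by simp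
  then show ?thesis using letter_at_period_mult[OF assms(1)] by simp
qed

text \<open>The remainder of a translation \<open>t\<close> modulo the least period preserves the
  letters too, and by minimality it is 0.\<close>

lemma letter_at_shift_iff:
  assumes "periodic C"
  shows "(\<forall>p. letter_at C (p + t) = letter_at C p) \<longleftrightarrow> int (period C) dvd t"
proof
  assume L: "\<forall>p. letter_at C (p + t) = letter_at C p"
  define r where "r = t mod int (period C)"
  have n: "period C > 0" by (rule period_props(1)[OF assms])
  have r: "0 \<le> r" "r < int (period C)" using n by (auto simp: r_def)
  have "letter_at C (p + r) = letter_at C p" for p
  proof -
    have "p + r = p + t + int (period C) * (- (t div int (period C)))"
      unfolding r_def by (simp add: minus_mult_div_eq_mod[symmetric])
    then show ?thesis using letter_at_period_mult[OF assms, of "p + t"] L by metis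
  qed
  then have "C = shift (int (nat r)) C" using shift_letters[OF period_props(3)[OF assms]] r(1) by simp
  then have "\<not> nat r > 0" using not_less_Least[of "nat r" "\<lambda>n. n > 0 \<and> C = shift (int n) C"] r
    by (auto simp: period_def)
  then show "int (period C) dvd t" using r by (auto simp: r_def)
next
  assume "int (period C) dvd t"
  then show "\<forall>p. letter_at C (p + t) = letter_at C p" using letter_at_period_cong[OF assms] by simp
qed

lemma same_rays_dvd:
  assumes "periodic C"
  shows "(\<forall>d. ray C i d = ray C j d) \<longleftrightarrow> int (period C) dvd j - i"
proof -
  have A: "word_shape C = AllInt" using assms by (simp add: periodic_def)
  have "(\<forall>d. ray C i d = ray C j d) \<longleftrightarrow> (\<forall>p. letter_at C (i + p) = letter_at C (j + p))"
    unfolding rays_same_iff by (simp add: letter_opt_def A positions_simps)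
  also have "\<dots> \<longleftrightarrow> (\<forall>p. letter_at C (p + (j - i)) = letter_at C p)"
  proof
    assume L: "\<forall>p. letter_at C (i + p) = letter_at C (j + p)"
    show "\<forall>p. letter_at C (p + (j - i)) = letter_at C p"
    proof
      fix p show "letter_at C (p + (j - i)) = letter_at C p"
        using spec[OF L, of "p - i"] by (simp add: algebra_simps)
    qed
  next
    assume R: "\<forall>p. letter_at C (p + (j - i)) = letter_at C p"
    show "\<forall>p. letter_at C (i + p) = letter_at C (j + p)"
    proof
      fix p show "letter_at C (i + p) = letter_at C (j + p)"
        using spec[OF R, of "i + p"] by (simp add: algebra_simps)
    qed
  qed
  finally show ?thesis using letter_at_shift_iff[OF assms] by simp
qed

text \<open>A bounded end of the index set is visible in the rays, so only \<int>-words leave room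
  for a translation. Trivial words form an exception, since their empty rays show neither vertex nor
  sign.\<close>

lemma same_rays_is_shift:
  assumes "proper_word C" "proper_word C'"
    and "i \<in> index_set (word_shape C)" "j \<in> index_set (word_shape C')"
    and "\<And>d. ray C i d = ray C' j d"
  shows "is_shift_of C C' \<or> (\<exists>v v' e e'. C = Trivial v e \<and> C' = Trivial v' e')"
proof -
  have sh: "word_shape C = word_shape C'" "i = j \<or> word_shape C = AllInt"
    using same_rays_shape[OF assms(3-5)] by auto
  have opt: "letter_opt C (i + p) = letter_opt C' (j + p)" for p
    using assms(5) rays_same_iff[of C i C' j] by blast
  show ?thesis
  proof (cases "word_shape C = AllInt")
    case True
    then have "C = shift (j - i) C'"
      using sh same_rays_letters[OF assms(5)] by (cases C) (auto simp: shift_def fun_eq_iff)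
    then show ?thesis by (auto simp: is_shift_of_def)
  next
    case False
    then have "i = j" using sh by simp
    then have opt': "letter_opt C q = letter_opt C' q" for q using opt[of "q - i"] by simp
    show ?thesis
    proof (cases "C")
      case (Trivial v e)
      then show ?thesis using sh(1) assms(2) by (cases C') (auto simp: proper_word_def)
    next
      case (Letters s c)
      then obtain c' where C': "C' = Letters s c'"
        using sh(1) assms(1) by (cases C') (auto simp: proper_word_def)
      have "c p = c' p" for p
        using opt'[of p] assms(1,2) Letters C'
        by (cases "p \<in> positions s") (auto simp: letter_opt_def proper_word_def extensional_def)
      then have "C = C'" using Letters C' by auto
      then have "C = shift 0 C'" using C' by (simp add: shift_def)
      then show ?thesis unfolding is_shift_of_def by blast
    qed
  qed
qed

lemma is_shift_of_rays:
  assumes "is_shift_of C C'" "j \<in> index_set (word_shape C')"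
  shows "\<exists>i\<in>index_set (word_shape C). word_vertex Q C i = word_vertex Q C' j \<and> (\<forall>d. ray C i d = ray C' j d)"
proof -
  obtain m where m: "C = shift m C'" using assms(1) by (auto simp: is_shift_of_def)
  show ?thesis
  proof (cases "word_shape C' = AllInt")
    case True
    then obtain c where C': "C' = Letters AllInt c" by (cases C') auto
    show ?thesis
      unfolding rays_same_iff m
      by (intro bexI[of _ "j - m"]) (auto simp: C' shift_def letter_opt_def positions_simps algebra_simps)
  next
    case False
    then have "C = C'" using m by (simp add: shift_def)
    then show ?thesis using assms(2) by auto
  qed
qed

section \<open>Inverse words and the composition of \<open>word_inv B\<close> with
  \<open>D\<close>\<close>

lemma proper_word_inv: "proper_word C \<Longrightarrow> proper_word (word_inv C)"
  proof (cases C)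
  case (Letters s c)
  then show "proper_word C \<Longrightarrow> ?thesis" by (cases s) (auto simp: proper_word_def)
qed (auto simp: proper_word_def)

lemma rays_word_inv:
  assumes "is_word Q \<rho> C"
  obtains t where "\<And>j. j \<in> index_set (word_shape (word_inv C)) \<longleftrightarrow> t - j \<in> index_set (word_shape C)"
    and "\<And>i. i \<in> index_set (word_shape C) \<Longrightarrow> word_vertex Q (word_inv C) (t - i) = word_vertex Q C i"
    and "\<And>i d. ray (word_inv C) (t - i) d = ray C i (\<not> d)"
proof (cases C)
  case (Trivial v e)
  show ?thesis
    by (rule that[of 0]) (use Trivial in \<open>auto simp: ray_def out_letter_def positions_simps fun_eq_iff\<close>)
next
  case (Letters s c)
  \<comment> \<open>The letter with index \<open>q\<close> lies between the positions
    \<open>q - 1\<close> and \<open>q\<close>; hence letters are reflected by \<open>t - q\<close>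
    and positions by \<open>t - 1 - i\<close>.\<close>
  define t where "t = (case s of Fin n \<Rightarrow> int n + 1 | _ \<Rightarrow> 1)"
  have flip: "word_inv C = Letters (inverse_shape s) (\<lambda>q\<in>positions (inverse_shape s). letter_inv (c (t - q)))"
    using Letters by (cases s) (auto simp: t_def)
  have I: "j \<in> index_set (inverse_shape s) \<longleftrightarrow> t - 1 - j \<in> index_set s" for j
    by (cases s) (auto simp: t_def)
  have pos: "q \<in> positions (inverse_shape s) \<longleftrightarrow> t - q \<in> positions s" for q
    by (cases s) (auto simp: t_def positions_simps)
  have opt: "letter_opt (word_inv C) (t - 1 - i + p) = map_option letter_inv (letter_opt C (i + 1 - p))" for i p
  proof -
    have eq: "t - (t - 1 - i + p) = i + 1 - p" by simp
    show ?thesis using pos[of "t - 1 - i + p"] unfolding eq letter_opt_def flip by (simp add: eq Letters)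
  qed
  have "(\<forall>d. ray (word_inv C) (t - 1 - i) d = ray C i (\<not> d))" for i
    unfolding rays_opposite_iff using opt[of i] by blast
  moreover have "word_vertex Q (word_inv C) (t - 1 - i) = word_vertex Q C i" if i: "i \<in> index_set s" for i
  proof -
    have ne: "i \<in> positions s \<or> i + 1 \<in> positions s"
      using assms i Letters by (cases s) (auto simp: positions_simps)
    have "t - (t - 1 - i) = i + 1" "t - 1 - i + 1 = t - i" "t - (t - i) = i" by auto
    then show ?thesis unfolding flip using pos[of "t - 1 - i"] pos[of "t - i"] ne word_letter(2)[OF assms, of i]
      by (auto simp: Letters add.commute[of 1])
  qed
  ultimately show ?thesis using that[of "t - 1"] I by (simp add: flip Letters[symmetric]) (simp add: Letters)
qed

lemma is_shift_of_sym: "is_shift_of C D \<Longrightarrow> is_shift_of D C"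
proof -
  assume "is_shift_of C D"
  then obtain m where m: "C = shift m D" by (auto simp: is_shift_of_def)
  have "D = shift (- m) C" by (cases D) (auto simp: m shift_def)
  then show ?thesis by (auto simp: is_shift_of_def)
qed

text \<open>Both words are read from their common head: \<open>D\<close> is what lies to the right
  of the meeting point, and inverting \<open>B\<close> twice gives \<open>B\<close> again on the
  left.\<close>

lemma concatenation_rays:
  assumes "is_word Q \<rho> B" "is_word Q \<rho> D" "has_head B" "has_head D" "word_head Q B = word_head Q D"
    and "W = concatenation (word_inv B) D"
  shows "\<exists>i\<in>index_set (word_shape W). (\<forall>d. ray W i d = ray (if d then D else B) 0 True)
    \<and> proper_word W \<and> (is_word Q \<rho> W \<longrightarrow> word_vertex Q W i = word_head Q D)"
proof -
  have vertex: "word_vertex Q W i = word_head Q D"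
    if "is_word Q \<rho> W" "ray W i d 0 \<noteq> None" "\<forall>d. ray W i d = ray (if d then D else B) 0 True" for i d
  proof -
    from that(2) obtain l where l: "ray W i d 0 = Some l" by blast
    have "letter_head Q l = word_vertex Q W i" using out_letter_props(2)[OF that(1)] l by (simp add: ray_0)
    moreover have "ray (if d then D else B) 0 True 0 = Some l" using l that(3) by simp
    ultimately show ?thesis using out_letter_props(2)[OF assms(2), of 0 True l]
        out_letter_props(2)[OF assms(1), of 0 True l] assms(5)
      by (cases d) (simp_all add: ray_0 word_head_def)
  qed
  have split_rays: "\<forall>d. ray W i d = ray (if d then D else B) 0 True"
    if "\<And>k. letter_opt W (i + 1 + int k) = letter_opt D (1 + int k)"
      "\<And>k. letter_opt W (i - int k) = map_option letter_inv (letter_opt B (1 + int k))" for i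
    using that by (auto simp: fun_eq_iff ray_letter_opt map_letter_inv_inv)
  have "\<exists>i\<in>index_set (word_shape W). (\<forall>d. ray W i d = ray (if d then D else B) 0 True) \<and> proper_word W
     \<and> ((\<forall>d. ray W i d 0 = None) \<longrightarrow> word_vertex Q W i = word_head Q D)"
  proof (cases B)
    case B: (Trivial v e)
    have W: "W = D" using B assms by simp
    have 0: "0 \<in> index_set (word_shape D)" using assms(2,4) by (cases "word_shape D") (auto simp: has_head_def)
    have "\<forall>d. ray W 0 d = ray (if d then D else B) 0 True"
      by (rule split_rays) (use assms(4) in \<open>cases "word_shape D"; auto simp: W B letter_opt_def has_head_def positions_simps\<close>)+
    moreover have "proper_word W" "word_vertex Q W 0 = word_head Q D" "0 \<in> index_set (word_shape W)"
      using 0 is_word_proper[OF assms(2)] by (simp_all add: W word_head_def)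
    ultimately show ?thesis by blast
  next
    case B: (Letters sb b)
    show ?thesis
    proof (cases D)
      case D: (Trivial v e)
      have W: "W = word_inv B" using B D assms by simp
      define i where "i = (case sb of Fin n \<Rightarrow> int n | _ \<Rightarrow> 0)"
      have i: "i \<in> index_set (word_shape W)" using B assms(3) by (cases sb) (auto simp: W i_def has_head_def)
      have "\<forall>d. ray W i d = ray (if d then D else B) 0 True"
        by (rule split_rays) (use assms(3) in \<open>cases sb; auto simp: W B D i_def letter_opt_def has_head_def positions_simps\<close>)+
      moreover have "ray B 0 True 0 \<noteq> None"
        using assms(1,3) B by (cases sb) (auto simp: ray_def out_letter_def has_head_def positions_simps)
      ultimately show ?thesis using i proper_word_inv[OF is_word_proper[OF assms(1)]] W
        by (metis (full_types))
    next
      case D: (Letters sd d)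
      \<comment> \<open>A finite first factor ends at its length. A composition of a (-\<nat>)-word
        with a finite word is reindexed to end at 0, so the factors meet at minus the length of the
        second; in the remaining case they meet at 0.\<close>
      define i where "i = (case sb of Fin m \<Rightarrow> int m | _ \<Rightarrow> (case sd of Fin n \<Rightarrow> - int n | _ \<Rightarrow> 0))"
      consider m n where "sb = Fin m" "sd = Fin n" | m where "sb = Fin m" "sd = Nat"
        | n where "sb = Nat" "sd = Fin n" | "sb = Nat" "sd = Nat"
        using B D assms(3,4) by (cases sb; cases sd) (auto simp: has_head_def)
      note cases = this
      have ne: "sb \<noteq> Fin 0" "sd \<noteq> Fin 0" using B D assms(1,2) by auto
      have i: "i \<in> index_set (word_shape W)"
        using cases by cases (simp_all add: assms(6) B D i_def)
      have proper: "proper_word W"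
        using cases ne by cases (simp_all add: assms(6) B D proper_word_def extensional_def positions_simps)
      have "letter_opt W (i + 1 + int k) = letter_opt D (1 + int k)" for k
        using cases by cases (simp_all add: assms(6) B D i_def letter_opt_def positions_simps)
      moreover have "letter_opt W (i - int k) = map_option letter_inv (letter_opt B (1 + int k))" for k
        using cases by cases (simp_all add: assms(6) B D i_def letter_opt_def positions_simps)
      ultimately have "\<forall>d. ray W i d = ray (if d then D else B) 0 True"
        using split_rays by blast
      moreover have "ray B 0 True 0 \<noteq> None"
        using assms(1,3) B by (cases sb) (auto simp: ray_def out_letter_def has_head_def positions_simps)
      ultimately show ?thesis using i proper by (metis (full_types))
    qed
  qed
  then show ?thesis using vertex by metis
qed

text \<open>
  In other words, \<open>C\<close> is a shift of \<open>B\<^sup>-\<^sup>1 D\<close> if \<open>d\<close> holds and of \<open>D\<^sup>-\<^sup>1 B\<close> otherwise, and \<open>i\<close> is the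
  position where the two factors meet.
\<close>

definition splits_at ::
    "('v, 'a) pre_digraph \<Rightarrow> ('v, 'a) qword \<Rightarrow> ('v, 'a) qword \<Rightarrow> ('v, 'a) qword \<Rightarrow> int \<Rightarrow> bool \<Rightarrow> bool" where
  "splits_at Q B D C i d \<longleftrightarrow> i \<in> index_set (word_shape C) \<and> word_vertex Q C i = word_head Q D \<and>
     ray C i d = ray D 0 True \<and> ray C i (\<not> d) = ray B 0 True"

text \<open>If the directions differ, \<open>C\<close> agrees with a reflection of itself, and
  \<open>opposite_rays_unique\<close> leaves one position with two equal rays. This happens for a
  trivial word, which splits in both directions; hence the conditions attached to
  \<open>d = e\<close>.\<close>

lemma splits_at_unique:
  assumes "is_word Q \<rho> C" "splits_at Q B D C i d" "splits_at Q B D C j e"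
  shows "(\<forall>d'. ray C i d' = ray C j d') \<and> (i \<noteq> j \<longrightarrow> d = e) \<and> (periodic C \<longrightarrow> d = e)"
proof (cases "d = e")
  case True
  have "ray C i d' = ray C j d'" for d'
    using assms(2,3) True unfolding splits_at_def by (cases "d' = d") auto
  with True show ?thesis by simp
next
  case False
  have "ray C i d' = ray C j (\<not> d')" for d'
    using assms(2,3) False unfolding splits_at_def by (cases "d' = d") auto
  from opposite_rays_unique[OF assms(1) _ _ this] assms(2,3)
  have eq: "i = j" "\<forall>d. ray C i d = ray C j d" unfolding splits_at_def by blast+
  have "ray C i True = ray C i False" using \<open>\<And>d'. ray C i d' = ray C j (\<not> d')\<close>[of True] eq by simp
  then have "out_letter C i True = out_letter C i False" by (metis ray_0)
  then have "\<not> periodic C" using out_letter_dir_unique[OF assms(1), of i True _ False]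
    by (auto simp: periodic_def out_letter_def positions_simps split: if_splits)
  with eq show ?thesis by simp
qed

lemma word_equiv_iff_splits:
  assumes "is_word Q \<rho> B" "is_word Q \<rho> D" "has_head B" "has_head D" "word_head Q B = word_head Q D"
    and "W = concatenation (word_inv B) D" "is_word Q \<rho> W" "is_word Q \<rho> C"
  shows "word_equiv C W \<longleftrightarrow> (\<exists>i d. splits_at Q B D C i d)"
proof -
  obtain j where j: "j \<in> index_set (word_shape W)" "\<And>d. ray W j d = ray (if d then D else B) 0 True"
    "proper_word W" "word_vertex Q W j = word_head Q D"
    using concatenation_rays[OF assms(1-6)] assms(7) by blast
  obtain t where t: "\<And>j. j \<in> index_set (word_shape (word_inv C)) \<longleftrightarrow> t - j \<in> index_set (word_shape C)"
    "\<And>i. i \<in> index_set (word_shape C) \<Longrightarrow> word_vertex Q (word_inv C) (t - i) = word_vertex Q C i"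
    "\<And>i d. ray (word_inv C) (t - i) d = ray C i (\<not> d)"
    using rays_word_inv[OF assms(8)] by blast
  have proper: "proper_word C" "proper_word (word_inv C)"
    using is_word_proper[OF assms(8)] proper_word_inv by auto
  \<comment> \<open>Trivial words at one vertex are equal or inverse to each other, so the sign
    hidden by the rays does not affect equivalence.\<close>
  have triv: "word_equiv C W" if "C = Trivial v e" "W = Trivial v e'" for v e e'
    using that assms(7,8) by (auto simp: word_equiv_def is_shift_of_def shift_def)
  show ?thesis
  proof
    assume "word_equiv C W"
    then consider "is_shift_of W C" | "is_shift_of W (word_inv C)" by (auto simp: word_equiv_def)
    then show "\<exists>i d. splits_at Q B D C i d"
    proof cases
      case 1
      then have "is_shift_of C W" by (rule is_shift_of_sym)
      from is_shift_of_rays[OF this j(1), of Q] obtain i where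
        "i \<in> index_set (word_shape C)" "word_vertex Q C i = word_vertex Q W j" "\<forall>d. ray C i d = ray W j d"
        by blast
      then have "splits_at Q B D C i True" using j unfolding splits_at_def by simp
      then show ?thesis by blast
    next
      case 2
      then have "is_shift_of (word_inv C) W" by (rule is_shift_of_sym)
      from is_shift_of_rays[OF this j(1), of Q] obtain i where
        i: "i \<in> index_set (word_shape (word_inv C))" "word_vertex Q (word_inv C) i = word_vertex Q W j"
          "\<forall>d. ray (word_inv C) i d = ray W j d" by blast
      have ti: "t - i \<in> index_set (word_shape C)" using t(1) i(1) by blast
      have "word_vertex Q C (t - i) = word_vertex Q W j" using t(2)[OF ti] i(2) by simp
      moreover have "ray C (t - i) d = ray W j (\<not> d)" for d
        using t(3)[of "t - i" "\<not> d"] i(3) by simp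
      ultimately have "splits_at Q B D C (t - i) False" using j ti unfolding splits_at_def by simp
      then show ?thesis by blast
    qed
  next
    assume "\<exists>i d. splits_at Q B D C i d"
    then obtain i d where id: "splits_at Q B D C i d" by blast
    show "word_equiv C W"
    proof (cases d)
      case True
      then have i: "i \<in> index_set (word_shape C)" "word_vertex Q C i = word_vertex Q W j"
        "ray C i e = ray W j e" for e
        using id j(2,4) unfolding splits_at_def by (cases e; simp)+
      from same_rays_is_shift[OF proper(1) j(3) i(1) j(1) i(3)] show ?thesis
      proof
        assume "is_shift_of C W"
        then show ?thesis by (simp add: word_equiv_def is_shift_of_sym)
      next
        assume "\<exists>v v' e e'. C = Trivial v e \<and> W = Trivial v' e'"
        then show ?thesis using triv i(2) by auto
      qed
    next
      case False
      then have i: "i \<in> index_set (word_shape C)" "word_vertex Q C i = word_vertex Q W j"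
        "ray C i (\<not> e) = ray W j e" for e
        using id j(2,4) unfolding splits_at_def by (cases e; simp)+
      have ti: "t - i \<in> index_set (word_shape (word_inv C))" using t(1) i(1) by simp
      have rays: "ray (word_inv C) (t - i) e = ray W j e" for e using t(3) i(3) by simp
      have "word_vertex Q (word_inv C) (t - i) = word_vertex Q W j" using t(2)[OF i(1)] i(2) by simp
      note vertex = this
      from same_rays_is_shift[OF proper(2) j(3) ti j(1) rays] show ?thesis
      proof
        assume "is_shift_of (word_inv C) W"
        then show ?thesis by (simp add: word_equiv_def is_shift_of_sym)
      next
        assume *: "\<exists>v v' e e'. word_inv C = Trivial v e \<and> W = Trivial v' e'"
        then show ?thesis using triv vertex by (cases C) auto
      qed
    qed
  qed
qed

text \<open>The oriented counterpart of \<open>word_equiv_iff_splits\<close>. Used once for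
  \<open>B\<close>, \<open>D\<close> and once with the two exchanged, it separates the summands
  \<open>V\<close> from the summands restricted along the swap of \<open>T\<close> and its
  inverse.\<close>

lemma is_shift_of_iff_splits:
  assumes "is_word Q \<rho> B" "is_word Q \<rho> D" "has_head B" "has_head D" "word_head Q B = word_head Q D"
    and "word_shape (concatenation (word_inv B) D) = AllInt" "is_word Q \<rho> C"
  shows "is_shift_of C (concatenation (word_inv B) D) \<longleftrightarrow> (\<exists>i. splits_at Q B D C i True)"
proof -
  let ?W = "concatenation (word_inv B) D"
  obtain j where j: "j \<in> index_set (word_shape ?W)" "\<And>d. ray ?W j d = ray (if d then D else B) 0 True"
    "proper_word ?W"
    using concatenation_rays[OF assms(1-5) refl] by blast
  have D: "ray D 0 True 0 \<noteq> None"
    unfolding j(2)[of True, simplified, symmetric] using assms(6)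
    by (simp add: ray_def out_letter_def positions_simps)
  show ?thesis
  proof
    assume "is_shift_of C ?W"
    from is_shift_of_rays[OF this j(1), of Q] obtain i where
      i: "i \<in> index_set (word_shape C)" "\<forall>d. ray C i d = ray ?W j d" by blast
    obtain l where l: "ray D 0 True 0 = Some l" using D by blast
    have "ray C i True 0 = Some l" using i(2) j(2) l by simp
    then have "word_vertex Q C i = word_head Q D"
      using out_letter_props(2)[OF assms(7), of i True l] out_letter_props(2)[OF assms(2), of 0 True l] l
      by (simp add: ray_0 word_head_def)
    then show "\<exists>i. splits_at Q B D C i True" using i j(2) unfolding splits_at_def by auto
  next
    assume "\<exists>i. splits_at Q B D C i True"
    then obtain i where i: "splits_at Q B D C i True" by blast
    have "ray C i d = ray ?W j d" for d
      using i j(2) unfolding splits_at_def by (cases d) auto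
    from same_rays_is_shift[OF is_word_proper[OF assms(7)] j(3) _ j(1) this] i assms(6)
    show "is_shift_of C ?W" unfolding splits_at_def by auto
  qed
qed

lemma splits_at_swap:
  "word_head Q B = word_head Q D \<Longrightarrow> splits_at Q D B C i d \<longleftrightarrow> splits_at Q B D C i (\<not> d)"
  by (auto simp: splits_at_def)

section \<open>Finite words along a ray and their continuations\<close>

lemma occurs_on_ray:
  assumes "\<And>p. 1 \<le> p \<Longrightarrow> p \<le> int N \<Longrightarrow> ray C i d (nat (p - 1)) = Some (e p)"
    and "C = Letters s c" and "occurs_at u (Fin N) e q"
  shows "\<exists>q'. occurs_at (if d then u else map letter_inv (rev u)) s c q'"
proof -
  have u: "ray C i d (nat (q + int j - 1)) = Some (u ! j) \<and> 1 \<le> q + int j" if "j < length u" for j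
    using assms(1)[of "q + int j"] assms(3) that by (auto simp: occurs_at_def positions_simps)
  show ?thesis
  proof (cases d)
    case True
    have "occurs_at u s c (i + q)"
      unfolding occurs_at_def
    proof (intro allI impI)
      fix j assume j: "j < length u"
      have "i + 1 + int (nat (q + int j - 1)) = i + q + int j" using u[OF j] by simp
      then show "i + q + int j \<in> positions s \<and> c (i + q + int j) = u ! j"
        using u[OF j] True by (auto simp: ray_letter_opt letter_opt_def assms(2) add.assoc split: if_splits)
    qed
    then show ?thesis using True by auto
  next
    case False
    \<comment> \<open>On the ray to the left, \<open>u ! j\<close> is the inverse of the letter of
      \<open>C\<close> at \<open>i + 1 - q - j\<close>. The leftmost of these places belongs to the
      last index of \<open>u\<close>.\<close>
    have "occurs_at (map letter_inv (rev u)) s c (i + 1 - q - (int (length u) - 1))"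
      unfolding occurs_at_def
    proof (intro allI impI)
      fix j assume "j < length (map letter_inv (rev u))"
      then have j: "j < length u" by simp
      define j' where "j' = length u - 1 - j"
      have j': "j' < length u" "i + 1 - q - (int (length u) - 1) + int j = i - int (nat (q + int j' - 1))"
        using u[of j'] j by (auto simp: j'_def)
      show "i + 1 - q - (int (length u) - 1) + int j \<in> positions s \<and>
         c (i + 1 - q - (int (length u) - 1) + int j) = map letter_inv (rev u) ! j"
        unfolding j'(2) using u[OF j'(1)] False j
        by (auto simp: ray_letter_opt letter_opt_def assms(2) rev_nth j'_def split: if_splits)
          (metis letter_inv_inv)
    qed
    then show ?thesis using False by auto
  qed
qed

text \<open>Every clause is inherited from \<open>C\<close>. For a ray to the left this uses that a
  word avoids the inverses of the zero relations as well.\<close>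

lemma is_word_on_ray:
  assumes C: "is_word Q \<rho> C" and N: "N > 0" and e: "e \<in> extensional (positions (Fin N))"
    and ray: "\<And>p. 1 \<le> p \<Longrightarrow> p \<le> int N \<Longrightarrow> ray C i d (nat (p - 1)) = Some (e p)"
  shows "is_word Q \<rho> (Letters (Fin N) e)"
proof -
  obtain s c where Cs: "C = Letters s c"
    using ray[of 1] N by (cases C) (auto simp: ray_def out_letter_def positions_simps split: if_splits)
  have out: "out_letter C (i + dir d * (p - 1)) d = Some (e p)" if "1 \<le> p" "p \<le> int N" for p
    using ray[OF that] that by (simp add: ray_def)
  have arcs: "letter_arrow (e p) \<in> arcs Q" if "1 \<le> p" "p \<le> int N" for p
    using out_letter_props(1)[OF C out[OF that]] .
  have consec: "letter_tail Q (e p) = letter_head Q (e (p + 1)) \<and> letter_inv (e p) \<noteq> e (p + 1)"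
    if "1 \<le> p" "p + 1 \<le> int N" for p
  proof -
    have 1: "out_letter C (i + dir d * (p - 1)) d = Some (e p)" using out[of p] that by simp
    have eq: "i + dir d * (p - 1) + dir d = i + dir d * p" by (simp add: algebra_simps)
    have 2: "out_letter C (i + dir d * p) d = Some (e (p + 1))" using out[of "p + 1"] that by simp
    show ?thesis using out_letter_props[OF C 1] out_letter_props[OF C 2] eq
        out_letter_back[OF 1, unfolded eq] out_letter_distinct[OF C 2] by auto
  qed
  have zero: "\<not> occurs_at (map Direct r) (Fin N) e q \<and> \<not> occurs_at (map Inverse (rev r)) (Fin N) e q"
    if "r \<in> \<rho>" for r q
  proof -
    have "map letter_inv (rev (map Direct r)) = map Inverse (rev r)"
      "map letter_inv (rev (map Inverse (rev r))) = map Direct r"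
      by (simp_all add: rev_map o_def)
    then show ?thesis
      using occurs_on_ray[OF ray Cs, where u = "map Direct r" and q = q and N = N]
        occurs_on_ray[OF ray Cs, where u = "map Inverse (rev r)" and q = q and N = N]
        C that unfolding Cs by (auto split: if_splits)
  qed
  show ?thesis using N e arcs consec zero by (auto simp: positions_simps)
qed

text \<open>At the end of the prefix the way back and the letter \<open>l\<close> have opposite
  signs, which is the sign condition for composing. A trivial \<open>D\<close> has no last letter,
  so in that case \<open>triv\<close> supplies vertex and sign.\<close>

lemma composable_on_ray:
  assumes sig: "sign_choice Q \<rho> \<sigma>" and C: "is_word Q \<rho> C" and D: "is_word Q \<rho> D" "word_shape D = Fin n"
    and prefix: "\<And>k. k < n \<Longrightarrow> ray C i d k = Some (letter_at D (int k + 1))"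
    and l: "ray C i d n = Some l"
    and triv: "n = 0 \<Longrightarrow> word_vertex Q C i = word_head Q D \<and> \<sigma> l = word_sign \<sigma> D"
  shows "composable Q \<rho> \<sigma> D (letter_word l)"
proof -
  have outl: "out_letter C (i + dir d * int n) d = Some l" using l by (simp add: ray_def)
  have hl: "word_head Q (letter_word l) = letter_head Q l" for Q
    by (simp add: word_head_def letter_word_def positions_simps)
  show ?thesis
  proof (cases D)
    case (Trivial v e)
    then have n: "n = 0" using D by simp
    have "is_word Q \<rho> (letter_word l)"
      unfolding letter_word_def
      by (rule is_word_on_ray[OF C, of _ _ i d]) (use l n in \<open>auto simp: positions_simps\<close>)
    then show ?thesis
      using triv[OF n] n Trivial out_letter_props(2)[OF C outl] hl[of Q]
      by (auto simp: composable_def has_tail_def has_head_def letter_word_def word_tail_def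
          word_head_def positions_simps)
  next
    case (Letters s c)
    then have s: "s = Fin n" and n: "n > 0" using D by auto
    have outc: "out_letter C (i + dir d * (int n - 1)) d = Some (c (int n))"
      using prefix[of "n - 1"] n Letters by (simp add: ray_def of_nat_diff)
    have eq: "i + dir d * (int n - 1) + dir d = i + dir d * int n" by (simp add: algebra_simps)
    have "is_word Q \<rho> (concatenation D (letter_word l))"
      unfolding Letters s letter_word_def concatenation.simps
    proof (rule is_word_on_ray[OF C])
      fix p assume p: "1 \<le> p" "p \<le> int (n + 1)"
      show "ray C i d (nat (p - 1)) = Some ((\<lambda>i\<in>positions (Fin (n + 1)).
          if i \<le> int n then c i else (\<lambda>i\<in>positions (Fin 1). l) (i - int n)) p)"
      proof (cases "p \<le> int n")
        case True
        then have "nat (p - 1) < n" using p by simp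
        from prefix[OF this] show ?thesis using p True Letters by (simp add: positions_simps)
      next
        case False
        then have "p = int n + 1" using p by simp
        then show ?thesis using l by (simp add: positions_simps)
      qed
    qed auto
    moreover have "\<sigma> (letter_inv (c (int n))) = - \<sigma> l"
      using out_letter_opposite_sign[OF C sig outl, of "letter_inv (c (int n))"] out_letter_back[OF outc] eq
      by simp
    moreover have "letter_tail Q (c (int n)) = letter_head Q l"
      using out_letter_props(3)[OF C outc] out_letter_props(2)[OF C outl] eq by simp
    ultimately show ?thesis using Letters s n hl[of Q]
      by (auto simp: composable_def has_tail_def has_head_def letter_word_def word_tail_def positions_simps)
  qed
qed

text \<open>All continuations of \<open>D\<close> share head and sign, so there is at most one
  direct and at most one inverse letter among them. This gives meaning to the descriptions by
  \<open>THE\<close> in \<open>finite_plus\<close> and \<open>finite_minus\<close>.\<close>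

lemma composable_letter_unique:
  assumes "sign_choice Q \<rho> \<sigma>" "letter_arrow l \<in> arcs Q" "letter_arrow l' \<in> arcs Q"
    and "composable Q \<rho> \<sigma> D (letter_word l)" "composable Q \<rho> \<sigma> D (letter_word l')"
  shows "letter_head Q l = letter_head Q l' \<and> \<sigma> l = \<sigma> l' \<and>
    (l \<noteq> l' \<longrightarrow> (\<exists>x y. {l, l'} = {Inverse x, Direct y}))"
proof -
  have "letter_head Q l = letter_head Q l' \<and> \<sigma> l = \<sigma> l'"
    using assms(4,5) by (auto simp: composable_def word_head_def letter_word_def positions_simps)
  then show ?thesis using assms(1-3) unfolding sign_choice_def by metis
qed

section \<open>Modules with coordinates indexed by positions of words\<close>

text \<open>If the reading stops at \<open>j\<close> before an inverse letter
  \<open>Inverse x\<close>, then \<open>x\<close> kills the basis vector at \<open>j\<close>. So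
  this vector lies in the image of 0 under that letter, and the vector at \<open>i\<close> in the
  image of 0 under the whole sequence.\<close>

definition stuck :: "('v, 'a) qword \<Rightarrow> (nat \<Rightarrow> 'a letter) \<Rightarrow> nat \<Rightarrow> int \<Rightarrow> bool" where
  "stuck C c n i \<longleftrightarrow> (\<exists>k<n. \<exists>j x. follows C c k i j \<and> c k = Inverse x \<and> (\<nexists>j'. step C j (c k) j'))"

lemma stuck_0 [simp]: "\<not> stuck C c 0 i"
  by (simp add: stuck_def)

lemma stuck_Suc:
  "stuck C c (Suc n) i \<longleftrightarrow> (\<exists>x. c 0 = Inverse x) \<and> (\<nexists>j. step C i (c 0) j) \<or>
     (\<exists>j. step C i (c 0) j \<and> stuck C (\<lambda>n. c (Suc n)) n j)"
  unfolding stuck_def Ex_less_Suc2 follows.simps by blast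

lemma stuck_Suc_right:
  "stuck C c (Suc n) i \<longleftrightarrow> stuck C c n i \<or>
     (\<exists>j x. follows C c n i j \<and> c n = Inverse x \<and> (\<nexists>j'. step C j (c n) j'))"
  unfolding stuck_def Ex_less_Suc by auto

lemma stuck_mono: "stuck C c m i \<Longrightarrow> m \<le> n \<Longrightarrow> stuck C c n i"
  unfolding stuck_def by (meson less_le_trans)

lemma stuck_not_follows:
  assumes "is_word Q \<rho> C" "stuck C c n i"
  shows "\<not> follows C c n i j"
proof
  assume f: "follows C c n i j"
  obtain k i' x where k: "k < n" "follows C c k i i'" "c k = Inverse x" "\<nexists>j'. step C i' (c k) j'"
    using assms(2) by (auto simp: stuck_def)
  obtain j' where "follows C c (Suc k) i j'" using follows_mono[OF f, of "Suc k"] k(1) by auto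
  then obtain i'' where "follows C c k i i''" "step C i'' (c k) j'"
    by (auto simp: follows_Suc_right simp del: follows.simps(2))
  then show False using k follows_unique[OF assms(1) k(2)] by auto
qed

lemma follows_cong: "(\<And>k. k < n \<Longrightarrow> c k = c' k) \<Longrightarrow> follows C c n i j \<longleftrightarrow> follows C c' n i j"
proof (induction n arbitrary: j)
  case (Suc n)
  then show ?case by (simp add: follows_Suc_right del: follows.simps(2))
qed auto

lemma stuck_cong: "(\<And>k. k < n \<Longrightarrow> c k = c' k) \<Longrightarrow> stuck C c n i \<longleftrightarrow> stuck C c' n i"
proof -
  assume c: "\<And>k. k < n \<Longrightarrow> c k = c' k"
  have "follows C c k i j \<longleftrightarrow> follows C c' k i j" if "k < n" for k j
    by (rule follows_cong) (use c that in auto)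
  then show ?thesis using c unfolding stuck_def by (metis (no_types, lifting))
qed

section \<open>The order of words\<close>

definition word_letters :: "('v, 'a) qword \<Rightarrow> nat \<Rightarrow> 'a letter" where
  "word_letters D k = letter_at D (int k + 1)"

definition word_length :: "('v, 'a) qword \<Rightarrow> nat" where
  "word_length D = (case word_shape D of Fin n \<Rightarrow> n | _ \<Rightarrow> 0)"

text \<open>
  \<open>below_word D C i\<close> and \<open>upto_word D C i\<close> hold if the word that starts at position \<open>i\<close> of \<open>C\<close> in the
  direction given by the sign of \<open>D\<close> is smaller than \<open>D\<close>, respectively at most \<open>D\<close>, in the usual
  total order, in which direct letters come before the end of a word and inverse letters after it.
\<close>

definition below_word :: "('v, 'a) pre_digraph \<Rightarrow> 'a list set \<Rightarrow> ('a letter \<Rightarrow> int)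
    \<Rightarrow> ('v, 'a) qword \<Rightarrow> ('v, 'a) qword \<Rightarrow> int \<Rightarrow> bool" where
  "below_word Q \<rho> \<sigma> D C i \<longleftrightarrow>
     (if word_shape D = Nat then \<exists>n. stuck C (word_letters D) n i
      else stuck C (word_letters D) (word_length D) i \<or>
        (\<exists>j y j'. follows C (word_letters D) (word_length D) i j \<and> y \<in> arcs Q \<and>
           composable Q \<rho> \<sigma> D (letter_word (Direct y)) \<and> step C j (Direct y) j'))"

definition upto_word :: "('v, 'a) pre_digraph \<Rightarrow> 'a list set \<Rightarrow> ('a letter \<Rightarrow> int)
    \<Rightarrow> ('v, 'a) qword \<Rightarrow> ('v, 'a) qword \<Rightarrow> int \<Rightarrow> bool" where
  "upto_word Q \<rho> \<sigma> D C i \<longleftrightarrow>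
     (if word_shape D = Nat then (\<exists>n. stuck C (word_letters D) n i) \<or> (\<forall>n. \<exists>j. follows C (word_letters D) n i j)
      else stuck C (word_letters D) (word_length D) i \<or>
        (\<exists>j. follows C (word_letters D) (word_length D) i j \<and>
           (\<forall>x\<in>arcs Q. composable Q \<rho> \<sigma> D (letter_word (Inverse x)) \<longrightarrow> (\<nexists>j'. step C j (Inverse x) j'))))"

lemma word_letters_reduced:
  assumes "is_word Q \<rho> D" "int k + 2 \<in> positions (word_shape D)"
  shows "letter_inv (word_letters D k) \<noteq> word_letters D (Suc k)"
    "letter_tail Q (word_letters D k) = letter_head Q (word_letters D (Suc k))"
proof -
  have "int k + 1 \<in> positions (word_shape D)"
    using assms(2) by (cases "word_shape D") (auto simp: positions_simps)
  moreover have "int k + 1 + 1 = int k + 2" "int (Suc k) + 1 = int k + 2" by simp_all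
  ultimately show "letter_inv (word_letters D k) \<noteq> word_letters D (Suc k)"
    "letter_tail Q (word_letters D k) = letter_head Q (word_letters D (Suc k))"
    using word_letter[OF assms(1), of "int k + 1"] assms(2) unfolding word_letters_def by metis+
qed

lemma ray_word:
  "ray D 0 True k = (if int k + 1 \<in> positions (word_shape D) then Some (word_letters D k) else None)"
  by (simp add: ray_letter_opt letter_opt_def word_letters_def add.commute)

text \<open>Of a step with a direct letter and one with an inverse letter, two letters that continue \<open>D\<close>, at
  most one is possible since the letters have the same sign.\<close>

lemma below_upto:
  assumes sig: "sign_choice Q \<rho> \<sigma>" and C: "is_word Q \<rho> C"
    and "below_word Q \<rho> \<sigma> D C i"
  shows "upto_word Q \<rho> \<sigma> D C i"
proof (cases "word_shape D = Nat \<or> stuck C (word_letters D) (word_length D) i")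
  case True
  then show ?thesis using assms(3) by (auto simp: below_word_def upto_word_def)
next
  case False
  then obtain j y j' where j: "follows C (word_letters D) (word_length D) i j" "y \<in> arcs Q"
    "composable Q \<rho> \<sigma> D (letter_word (Direct y))" "step C j (Direct y) j'"
    using assms(3) by (auto simp: below_word_def)
  have "\<nexists>j'. step C j (Inverse x) j'" if x: "x \<in> arcs Q" "composable Q \<rho> \<sigma> D (letter_word (Inverse x))" for x
  proof
    assume "\<exists>j'. step C j (Inverse x) j'"
    then obtain d where d: "out_letter C j d = Some (Inverse x)" by (auto simp: step_def)
    obtain e where e: "out_letter C j e = Some (Direct y)" using j(4) by (auto simp: step_def)
    have "e = (\<not> d)" using d e by (cases "e = d") auto
    then have "\<sigma> (Direct y) = - \<sigma> (Inverse x)"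
      using out_letter_opposite_sign[OF C sig d] e by simp
    moreover have "\<sigma> (Direct y) = \<sigma> (Inverse x)"
      using composable_letter_unique[OF sig _ _ j(3) x(2)] j(2) x(1) by simp
    moreover have "\<sigma> (Direct y) \<in> {1, -1}" using sig j(2) by (auto simp: sign_choice_def)
    ultimately show False by auto
  qed
  then show ?thesis using False j(1) by (auto simp: upto_word_def)
qed

text \<open>At most \<open>D\<close> but not below it: \<open>D\<close> is read to its end and
  \<open>C\<close> offers no continuation there. The clause on the opposite side speaks for trivial
  \<open>D\<close>, whose empty ray does not show its sign.\<close>

lemma upto_not_below_iff:
  assumes sig: "sign_choice Q \<rho> \<sigma>" and C: "is_word Q \<rho> C" and D: "is_word Q \<rho> D" "has_head D"
    and i: "i \<in> index_set (word_shape C)" "word_vertex Q C i = word_head Q D"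
  shows "upto_word Q \<rho> \<sigma> D C i \<and> \<not> below_word Q \<rho> \<sigma> D C i \<longleftrightarrow>
    (\<exists>d. ray C i d = ray D 0 True \<and> (\<forall>l. out_letter C i (\<not> d) = Some l \<longrightarrow> \<sigma> l = - word_sign \<sigma> D))"
    (is "?L \<longleftrightarrow> ?R")
proof -
  let ?c = "word_letters D"
  have sgn: "\<forall>l. out_letter C i (\<not> d) = Some l \<longrightarrow> \<sigma> l = - word_sign \<sigma> D"
    if "out_letter C i d = Some (?c 0)" "D = Letters s c" for d s c
    using out_letter_opposite_sign[OF C sig that(1)] that(2) by (auto simp: word_letters_def)
  show ?thesis
  proof (cases "word_shape D = Nat")
    case True
    then obtain c where Dc: "D = Letters Nat c" by (cases D) auto
    have red: "letter_inv (?c k) \<noteq> ?c (Suc k)" for k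
      using word_letters_reduced(1)[OF D(1), of k] True by (simp add: positions_simps)
    have rayD: "ray D 0 True k = Some (?c k)" for k using ray_word[of D k] True by (simp add: positions_simps)
    have fol: "follows C ?c n i j \<longleftrightarrow> (\<exists>d. (\<forall>k<n. ray C i d k = Some (?c k)) \<and> j = i + dir d * int n)" for n j
      using follows_iff_ray[OF C, of n ?c i j] red by blast
    have "?L \<longleftrightarrow> (\<forall>n. \<exists>j. follows C ?c n i j)"
      using stuck_not_follows[OF C, of ?c] unfolding upto_word_def below_word_def if_P[OF True] by blast
    also have "\<dots> \<longleftrightarrow> (\<exists>d. \<forall>k. ray C i d k = Some (?c k))"
    proof
      assume A: "\<forall>n. \<exists>j. follows C ?c n i j"
      have A': "\<exists>d. \<forall>k<n. ray C i d k = Some (?c k)" for n using A fol by blast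
      \<comment> \<open>The first letter already fixes the direction, so the prefixes of all lengths
        lie on one ray.\<close>
      obtain d where d: "ray C i d 0 = Some (?c 0)" using A'[of 1] by auto
      have "ray C i d k = Some (?c k)" for k
      proof -
        obtain e where e: "\<forall>k'<Suc k. ray C i e k' = Some (?c k')" using A' by blast
        then have "ray C i e 0 = Some (?c 0)" by blast
        then have "e = d" using out_letter_dir_unique[OF C, of i e "?c 0" d] d by (simp add: ray_0)
        then show ?thesis using e by simp
      qed
      then show "\<exists>d. \<forall>k. ray C i d k = Some (?c k)" by blast
    qed (use fol in blast)
    also have "\<dots> \<longleftrightarrow> ?R"
    proof -
      have eq: "ray C i d = ray D 0 True \<longleftrightarrow> (\<forall>k. ray C i d k = Some (?c k))" for d
        using rayD by (simp add: fun_eq_iff)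
      have "out_letter C i d = Some (?c 0)" if "\<forall>k. ray C i d k = Some (?c k)" for d
        using spec[OF that, of 0] by (simp add: ray_0)
      then show ?thesis unfolding eq using sgn[OF _ Dc] by blast
    qed
    finally show ?thesis .
  next
    case False
    then obtain n where n: "word_shape D = Fin n" using D(2) by (cases "word_shape D") (auto simp: has_head_def)
    then have len: "word_length D = n" by (simp add: word_length_def)
    have red: "letter_inv (?c k) \<noteq> ?c (Suc k)" if "Suc k < n" for k
      using word_letters_reduced(1)[OF D(1), of k] that n by (simp add: positions_simps)
    have rayD: "ray D 0 True k = (if k < n then Some (?c k) else None)" for k
      using ray_word[of D k] n by (auto simp: positions_simps)
    have fol: "follows C ?c n i j \<longleftrightarrow> (\<exists>d. (\<forall>k<n. ray C i d k = Some (?c k)) \<and> j = i + dir d * int n)" for j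
      using follows_iff_ray[OF C, of n ?c i j] red by blast
    have comp: "composable Q \<rho> \<sigma> D (letter_word l)"
      if "\<forall>k<n. ray C i d k = Some (?c k)" "ray C i d n = Some l" "n = 0 \<Longrightarrow> \<sigma> l = word_sign \<sigma> D" for d l
      by (rule composable_on_ray[OF sig C D(1) n, of i d])
        (use that i in \<open>auto simp: word_letters_def\<close>)
    have arc: "letter_arrow l \<in> arcs Q" if "out_letter C j d = Some l" for j d l
      using out_letter_props(1)[OF C that] .
    show ?thesis
    proof
      assume L: ?L
      then have ns: "\<not> stuck C ?c n i" using False len by (auto simp: below_word_def)
      then obtain j where j: "follows C ?c n i j"
         and jx: "\<And>x. x \<in> arcs Q \<Longrightarrow> composable Q \<rho> \<sigma> D (letter_word (Inverse x)) \<Longrightarrow> \<nexists>j'. step C j (Inverse x) j'"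
        using L False len by (auto simp: upto_word_def)
      have jy: "\<nexists>j'. step C j (Direct y) j'" if "y \<in> arcs Q" "composable Q \<rho> \<sigma> D (letter_word (Direct y))" for y
        using L False len j that by (auto simp: below_word_def)
      have no_ext: False if "letter_arrow l \<in> arcs Q" "composable Q \<rho> \<sigma> D (letter_word l)" "step C j l j'" for l j'
        using jx jy that by (cases l) auto
      obtain d0 where d0: "\<forall>k<n. ray C i d0 k = Some (?c k)" "j = i + dir d0 * int n" using fol j by blast
      have sg: "word_sign \<sigma> D \<in> {1, - 1}" if "n = 0"
        using that D(1) n by (cases D) auto
      \<comment> \<open>For \<open>n = 0\<close>, a letter at \<open>i\<close> with the sign of
        \<open>D\<close> would continue \<open>D\<close>, so every letter there has the opposite
        sign. As two letters at one position differ in sign, one side is empty.\<close>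
      have wlog: "\<exists>d. (\<forall>k<n. ray C i d k = Some (?c k)) \<and> j = i + dir d * int n \<and> ray C i d n = None
          \<and> (\<forall>l. out_letter C i (\<not> d) = Some l \<longrightarrow> \<sigma> l = - word_sign \<sigma> D)"
      proof (cases "n = 0")
        case n0: True
        then have ji: "j = i" using d0 by simp
        have ne: "\<sigma> l \<noteq> word_sign \<sigma> D" if "out_letter C i d = Some l" for d l
        proof
          assume "\<sigma> l = word_sign \<sigma> D"
          then have "composable Q \<rho> \<sigma> D (letter_word l)" using comp[of d l] n0 that by (simp add: ray_0)
          then show False using no_ext[OF arc[OF that], of "i + dir d"] that ji by (auto simp: step_def)
        qed
        have eqm: "\<sigma> l = - word_sign \<sigma> D" if "out_letter C i d = Some l" for d l
          using ne[OF that] sg[OF n0] arc[OF that] sig by (auto simp: sign_choice_def)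
        have "\<exists>d. out_letter C i d = None"
        proof (rule ccontr)
          assume "\<nexists>d. out_letter C i d = None"
          then have "\<forall>d. out_letter C i d \<noteq> None" by simp
          from spec[OF this, of True] spec[OF this, of False]
          obtain l l' where l: "out_letter C i True = Some l" "out_letter C i False = Some l'" by blast
          then have "\<sigma> l' = - \<sigma> l" using out_letter_opposite_sign[OF C sig l(1)] by simp
          then show False using eqm[OF l(1)] eqm[OF l(2)] sg[OF n0] by auto
        qed
        then show ?thesis using eqm ji n0 by (auto simp: ray_0)
      next
        case n0: False
        have "ray C i d0 n = None"
        proof (rule ccontr)
          assume "ray C i d0 n \<noteq> None"
          then obtain l where l: "ray C i d0 n = Some l" by blast
          have "composable Q \<rho> \<sigma> D (letter_word l)" using comp[OF d0(1) l] n0 by simp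
          moreover have "out_letter C j d0 = Some l" using l d0(2) by (simp add: ray_def)
          ultimately show False using no_ext[OF arc, of j d0 l "j + dir d0"] by (auto simp: step_def)
        qed
        moreover obtain s c where "D = Letters s c" using n0 n by (cases D) auto
        ultimately show ?thesis using d0 n0 sgn[of d0] by (auto simp: ray_0[symmetric])
      qed
      then obtain d where d: "\<forall>k<n. ray C i d k = Some (?c k)" "ray C i d n = None"
        "\<forall>l. out_letter C i (\<not> d) = Some l \<longrightarrow> \<sigma> l = - word_sign \<sigma> D" by blast
      have "ray C i d k = ray D 0 True k" for k
        using d(1) ray_NoneD[OF i(1) d(2), of k] rayD[of k] by auto
      then show ?R using d(3) by blast
    next
      assume ?R
      then obtain d where R: "ray C i d = ray D 0 True \<and>
        (\<forall>l. out_letter C i (\<not> d) = Some l \<longrightarrow> \<sigma> l = - word_sign \<sigma> D)" ..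
      then have d: "\<And>k. ray C i d k = ray D 0 True k"
        "\<forall>l. out_letter C i (\<not> d) = Some l \<longrightarrow> \<sigma> l = - word_sign \<sigma> D" by simp_all
      define j where "j = i + dir d * int n"
      have pre: "\<forall>k<n. ray C i d k = Some (?c k)" using d(1) rayD by simp
      then have f: "follows C ?c n i j" using fol j_def by blast
      have ns: "\<not> stuck C ?c n i" using stuck_not_follows[OF C] f by blast
      \<comment> \<open>Only the side opposite to \<open>d\<close> can have a letter at
        \<open>j\<close>. Its sign is that of \<open>word_inv D\<close>: for nontrivial
        \<open>D\<close> it is the inverse of the last letter, and for trivial \<open>D\<close> this
        is the sign clause. A continuation needs the other sign.\<close>
      have no: "\<not> step C j l j'" if l: "letter_arrow l \<in> arcs Q" "composable Q \<rho> \<sigma> D (letter_word l)" for l j'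
      proof
        assume "step C j l j'"
        then obtain e where e: "out_letter C j e = Some l" by (auto simp: step_def)
        have none: "out_letter C j d = None" using d(1)[of n] rayD[of n] by (simp add: ray_def j_def)
        then have e': "e = (\<not> d)" using e by (cases "e = d") auto
        have sgl: "word_sign \<sigma> (word_inv D) = - \<sigma> l"
          using l(2) by (auto simp: composable_def letter_word_def positions_simps)
        show False
        proof (cases D)
          case (Trivial v \<epsilon>)
          then have "n = 0" using n by simp
          then have "\<sigma> l = - \<epsilon>" using d(2) e e' j_def Trivial by simp
          then have "\<epsilon> = 0" using sgl Trivial by simp
          then show False using D(1) Trivial by simp
        next
          case (Letters s c)
          then have n0: "n \<noteq> 0" using D(1) n by auto
          have c: "out_letter C (j - dir d) d = Some (?c (n - 1))"
          proof -
            have eq: "j - dir d = i + dir d * int (n - 1)" using n0 by (simp add: j_def of_nat_diff algebra_simps)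
            have "n - 1 < n" using n0 by simp
            then have "ray C i d (n - 1) = Some (?c (n - 1))" using pre by blast
            then show ?thesis unfolding eq ray_def .
          qed
          have "out_letter C j (\<not> d) = Some (letter_inv (?c (n - 1)))" using out_letter_back[OF c] by simp
          then have "l = letter_inv (?c (n - 1))" using e e' by simp
          moreover have "word_sign \<sigma> (word_inv D) = \<sigma> (letter_inv (?c (n - 1)))"
            using Letters n n0 by (auto simp: word_letters_def positions_simps)
          moreover have "\<sigma> l \<in> {1, - 1}" using sig l(1) by (auto simp: sign_choice_def)
          ultimately show False using sgl by auto
        qed
      qed
      have "\<not> below_word Q \<rho> \<sigma> D C i"
        using ns no[of "Direct _"] follows_unique[OF C f] False len by (auto simp: below_word_def)
      moreover have "upto_word Q \<rho> \<sigma> D C i"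
        using ns no[of "Inverse _"] f False len by (auto simp: upto_word_def)
      ultimately show ?L by simp
    qed
  qed
qed

text \<open>The opposite signs of \<open>B\<close> and \<open>D\<close> make the two rays go in opposite directions.\<close>

lemma upto_not_below_both_iff:
  assumes sig: "sign_choice Q \<rho> \<sigma>" and C: "is_word Q \<rho> C"
    and B: "is_word Q \<rho> B" "has_head B" and D: "is_word Q \<rho> D" "has_head D"
    and head: "word_head Q B = word_head Q D" and sign: "word_sign \<sigma> B = - word_sign \<sigma> D"
    and i: "i \<in> index_set (word_shape C)" "word_vertex Q C i = word_head Q D"
  shows "(upto_word Q \<rho> \<sigma> B C i \<and> \<not> below_word Q \<rho> \<sigma> B C i) \<and>
      (upto_word Q \<rho> \<sigma> D C i \<and> \<not> below_word Q \<rho> \<sigma> D C i) \<longleftrightarrow> (\<exists>d. splits_at Q B D C i d)"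
proof -
  have first: "\<sigma> l = word_sign \<sigma> X" if "ray X 0 True 0 = Some l" "is_word Q \<rho> X" for X l
    using that by (cases X) (auto simp: ray_word positions_simps word_letters_def split: if_splits)
  have arc: "\<sigma> l \<in> {1, - 1}" if "out_letter C j d = Some l" for j d l
    using out_letter_props(1)[OF C that] sig by (auto simp: sign_choice_def)
  show ?thesis
    unfolding upto_not_below_iff[OF sig C B i(1) i(2)[folded head]] upto_not_below_iff[OF sig C D i]
  proof (intro iffI; elim conjE exE)
    fix d e
    assume B': "ray C i e = ray B 0 True" "\<forall>l. out_letter C i (\<not> e) = Some l \<longrightarrow> \<sigma> l = - word_sign \<sigma> B"
      and D': "ray C i d = ray D 0 True" "\<forall>l. out_letter C i (\<not> d) = Some l \<longrightarrow> \<sigma> l = - word_sign \<sigma> D"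
    show "\<exists>d. splits_at Q B D C i d"
    proof (cases "e = d")
      case False
      then have "e = (\<not> d)" by auto
      then show ?thesis using B' D' i by (auto simp: splits_at_def)
    next
      \<comment> \<open>If both words are found in the same direction, then first letters of
        opposite sign would coincide. So both words are trivial, \<open>i\<close> has no letter at
        all, and either direction is a splitting.\<close>
      case True
      have "ray D 0 True 0 = None"
      proof (rule ccontr)
        assume "ray D 0 True 0 \<noteq> None"
        then obtain l where l: "ray D 0 True 0 = Some l" by blast
        then have "out_letter C i d = Some l" "ray B 0 True 0 = Some l"
          using B'(1) D'(1) True ray_0[of C i d] by simp_all
        then show False using first[OF l D(1)] first[of B l] B(1) sign arc[of i d l] by auto
      qed
      moreover from this have "ray B 0 True 0 = None" using B'(1) D'(1) True by simp
      moreover have "out_letter C i (\<not> d) = None"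
      proof (rule ccontr)
        assume "out_letter C i (\<not> d) \<noteq> None"
        then obtain l where "out_letter C i (\<not> d) = Some l" by blast
        then show False using B'(2) D'(2) True sign arc[of i "\<not> d" l] by auto
      qed
      ultimately have "ray C i (\<not> d) = ray B 0 True"
        using ray_NoneD[OF i(1), of "\<not> d" 0] ray_NoneD[of 0 B True 0] B(2)
        by (cases "word_shape B") (auto simp: fun_eq_iff ray_0 has_head_def)
      then show ?thesis using D'(1) i by (auto simp: splits_at_def)
    qed
  next
    fix d assume "splits_at Q B D C i d"
    then have d: "ray C i d = ray D 0 True" "ray C i (\<not> d) = ray B 0 True" by (auto simp: splits_at_def)
    have D': "\<forall>l. out_letter C i d = Some l \<longrightarrow> \<sigma> l = - word_sign \<sigma> B"
      using first[of D] D(1) d(1) sign ray_0[of C i d] by simp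
    have B': "\<forall>l. out_letter C i (\<not> d) = Some l \<longrightarrow> \<sigma> l = - word_sign \<sigma> D"
      using first[of B] B(1) d(2) sign ray_0[of C i "\<not> d"] by simp
    show "(\<exists>d. ray C i d = ray B 0 True \<and> (\<forall>l. out_letter C i (\<not> d) = Some l \<longrightarrow> \<sigma> l = - word_sign \<sigma> B)) \<and>
      (\<exists>d. ray C i d = ray D 0 True \<and> (\<forall>l. out_letter C i (\<not> d) = Some l \<longrightarrow> \<sigma> l = - word_sign \<sigma> D))"
      by (intro conjI exI[of _ "\<not> d"] exI[of _ d]) (use d D' B' in simp_all)
  qed
qed

text \<open>
  \<open>co m s i\<close> is the coordinate of \<open>m\<close> at the position \<open>i\<close> of the word \<open>wd s\<close>, and \<open>z s\<close> is the zero
  coordinate.  For a periodic word there is a coordinate at every position and not just at one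
  position in every residue class modulo the period \<open>n\<close>: the coordinates of an element of
  \<open>M(C, V)\<close> will be families \<open>u\<close> in \<open>V\<close> with \<open>u\<^sub>i\<^sub>+\<^sub>n = T u\<^sub>i\<close>.  So the arrows act in the same way on string
  modules and on modules \<open>M(C, V)\<close>.  Only finitely many coordinates are nonzero up to
  periodicity, which is what \<open>finite_rays\<close> says.
\<close>

locale word_coordinates =
  fixes Q :: "('v, 'a) pre_digraph" and \<rho> :: "'a list set" and \<sigma> :: "'a letter \<Rightarrow> int"
    and M :: "((('v, 'a) qpath \<Rightarrow>\<^sub>0 'k::field) set, 'm) module"
    and J :: "'s set" and wd :: "'s \<Rightarrow> ('v, 'a) qword"
    and co :: "'m \<Rightarrow> 's \<Rightarrow> int \<Rightarrow> 'c" and z :: "'s \<Rightarrow> 'c"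
  assumes string_algebra: "string_algebra Q \<rho>" and signs: "sign_choice Q \<rho> \<sigma>"
    and group: "abelian_group M"
    and word: "s \<in> J \<Longrightarrow> is_word Q \<rho> (wd s)"
    and vertex_closed: "v \<in> verts Q \<Longrightarrow> m \<in> carrier M \<Longrightarrow> vertex_elem Q \<rho> 1 v \<odot>\<^bsub>M\<^esub> m \<in> carrier M"
    and arrow_closed: "x \<in> arcs Q \<Longrightarrow> m \<in> carrier M \<Longrightarrow> arrow_elem Q \<rho> x \<odot>\<^bsub>M\<^esub> m \<in> carrier M"
    and co_eqI: "m \<in> carrier M \<Longrightarrow> m' \<in> carrier M \<Longrightarrow>
      (\<And>s i. s \<in> J \<Longrightarrow> i \<in> index_set (word_shape (wd s)) \<Longrightarrow> co m s i = co m' s i) \<Longrightarrow> m = m'"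
    and co_zero: "s \<in> J \<Longrightarrow> i \<in> index_set (word_shape (wd s)) \<Longrightarrow> co \<zero>\<^bsub>M\<^esub> s i = z s"
    and co_add_zero: "m \<in> carrier M \<Longrightarrow> m' \<in> carrier M \<Longrightarrow> s \<in> J \<Longrightarrow> i \<in> index_set (word_shape (wd s)) \<Longrightarrow>
      co m s i = z s \<Longrightarrow> co (m \<oplus>\<^bsub>M\<^esub> m') s i = co m' s i"
    and co_vertex: "v \<in> verts Q \<Longrightarrow> m \<in> carrier M \<Longrightarrow> s \<in> J \<Longrightarrow> i \<in> index_set (word_shape (wd s)) \<Longrightarrow>
      co (vertex_elem Q \<rho> 1 v \<odot>\<^bsub>M\<^esub> m) s i = (if word_vertex Q (wd s) i = v then co m s i else z s)"
    and co_arrow: "x \<in> arcs Q \<Longrightarrow> m \<in> carrier M \<Longrightarrow> s \<in> J \<Longrightarrow> step (wd s) i (Direct x) i' \<Longrightarrow>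
      co (arrow_elem Q \<rho> x \<odot>\<^bsub>M\<^esub> m) s i = co m s i'"
    and co_arrow_zero: "x \<in> arcs Q \<Longrightarrow> m \<in> carrier M \<Longrightarrow> s \<in> J \<Longrightarrow> i \<in> index_set (word_shape (wd s)) \<Longrightarrow>
      \<nexists>i'. step (wd s) i (Direct x) i' \<Longrightarrow> co (arrow_elem Q \<rho> x \<odot>\<^bsub>M\<^esub> m) s i = z s"
    \<comment> \<open>The bound keeps supports finite, since a coordinate is copied to at most three
      positions. Commuting with the period keeps the families of a periodic word compatible with
      \<open>T\<close>.\<close>
    and relocate: "m \<in> carrier M \<Longrightarrow>
      (\<And>s i i'. s \<in> J \<Longrightarrow> i \<in> index_set (word_shape (wd s)) \<Longrightarrow> h s i = Some i' \<Longrightarrow>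
         i' \<in> index_set (word_shape (wd s)) \<and> \<bar>i' - i\<bar> \<le> 1) \<Longrightarrow>
      (\<And>s i. s \<in> J \<Longrightarrow> periodic (wd s) \<Longrightarrow>
         h s (i + int (period (wd s))) = map_option (\<lambda>j. j + int (period (wd s))) (h s i)) \<Longrightarrow>
      \<exists>m'\<in>carrier M. \<forall>s\<in>J. \<forall>i\<in>index_set (word_shape (wd s)).
         co m' s i = (case h s i of None \<Rightarrow> z s | Some i' \<Rightarrow> co m s i')"
    and finite_rays: "m \<in> carrier M \<Longrightarrow> \<exists>K. finite K \<and>
      (\<forall>s\<in>J. \<forall>i\<in>index_set (word_shape (wd s)). co m s i \<noteq> z s \<longrightarrow>
         (\<exists>i'\<in>index_set (word_shape (wd s)). (s, i') \<in> K \<and> (\<forall>d. ray (wd s) i d = ray (wd s) i' d)))"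
begin

section \<open>Subspaces spanned by sets of positions\<close>

abbreviation I where "I s \<equiv> index_set (word_shape (wd s))"

definition supported :: "('s \<Rightarrow> int \<Rightarrow> bool) \<Rightarrow> 'm set" where
  "supported P = {m \<in> carrier M. \<forall>s\<in>J. \<forall>i\<in>I s. co m s i \<noteq> z s \<longrightarrow> P s i}"

lemma supportedD:
  "m \<in> supported P \<Longrightarrow> s \<in> J \<Longrightarrow> i \<in> I s \<Longrightarrow> co m s i \<noteq> z s \<Longrightarrow> P s i"
  "m \<in> supported P \<Longrightarrow> m \<in> carrier M"
  by (auto simp: supported_def)

lemma supported_cong:
  "(\<And>s i. s \<in> J \<Longrightarrow> i \<in> I s \<Longrightarrow> P s i \<longleftrightarrow> P' s i) \<Longrightarrow> supported P = supported P'"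
  by (auto simp: supported_def)

lemma supported_Int: "supported P \<inter> supported P' = supported (\<lambda>s i. P s i \<and> P' s i)"
  by (auto simp: supported_def)

lemma supported_False: "supported (\<lambda>s i. False) = {\<zero>\<^bsub>M\<^esub>}"
proof -
  interpret abelian_group M by (rule group)
  show ?thesis using co_eqI[of _ "\<zero>\<^bsub>M\<^esub>"] co_zero by (auto simp: supported_def)
qed

lemma co_add_zero': "m \<in> carrier M \<Longrightarrow> m' \<in> carrier M \<Longrightarrow> s \<in> J \<Longrightarrow> i \<in> I s \<Longrightarrow>
    co m' s i = z s \<Longrightarrow> co (m \<oplus>\<^bsub>M\<^esub> m') s i = co m s i"
  using co_add_zero[of m' m s i] abelian_monoid.a_comm[OF abelian_group.axioms(1)[OF group], of m m']
  by simp

lemma co_minus_zero: "m \<in> carrier M \<Longrightarrow> s \<in> J \<Longrightarrow> i \<in> I s \<Longrightarrow> co m s i = z s \<Longrightarrow> co (\<ominus>\<^bsub>M\<^esub> m) s i = z s"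
proof -
  interpret abelian_group M by (rule group)
  assume m: "m \<in> carrier M" "s \<in> J" "i \<in> I s" "co m s i = z s"
  have "co (m \<oplus>\<^bsub>M\<^esub> \<ominus>\<^bsub>M\<^esub> m) s i = co (\<ominus>\<^bsub>M\<^esub> m) s i" using m by (intro co_add_zero) auto
  then show ?thesis using m co_zero by (simp add: r_neg)
qed

lemma supported_subgroup: "additive_subgroup (supported P) M"
proof -
  interpret abelian_group M by (rule group)
  show ?thesis
  proof (rule additive_subgroup.intro, rule subgroup.intro)
    show "supported P \<subseteq> carrier (add_monoid M)" by (auto simp: supported_def)
    show "\<one>\<^bsub>add_monoid M\<^esub> \<in> supported P" using co_zero by (simp add: supported_def)
    fix a assume a: "a \<in> supported P"
    show "inv\<^bsub>add_monoid M\<^esub> a \<in> supported P"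
      unfolding a_inv_def[symmetric] using a co_minus_zero by (force simp: supported_def)
    fix b assume b: "b \<in> supported P"
    have "P s i" if "s \<in> J" "i \<in> I s" "co (a \<oplus>\<^bsub>M\<^esub> b) s i \<noteq> z s" for s i
      using that co_add_zero[of a b s i] supportedD[OF a] supportedD[OF b] by metis
    then show "a \<otimes>\<^bsub>add_monoid M\<^esub> b \<in> supported P"
      using supportedD(2)[OF a] supportedD(2)[OF b] by (simp add: supported_def)
  qed
qed

text \<open>For a periodic word this is invariance under the period. In a non-periodic word distinct
  positions have distinct rays, and nothing is demanded.\<close>

definition ray_invariant :: "('s \<Rightarrow> int \<Rightarrow> bool) \<Rightarrow> bool" where
  "ray_invariant P \<longleftrightarrow> (\<forall>s\<in>J. \<forall>i\<in>I s. \<forall>j\<in>I s. (\<forall>d. ray (wd s) i d = ray (wd s) j d) \<longrightarrow> P s i = P s j)"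

lemma split_support:
  assumes "m \<in> carrier M" "ray_invariant P"
  obtains m1 m2 where "m1 \<in> carrier M" "m2 \<in> carrier M" "m = m1 \<oplus>\<^bsub>M\<^esub> m2"
    "\<And>s i. s \<in> J \<Longrightarrow> i \<in> I s \<Longrightarrow> co m1 s i = (if P s i then co m s i else z s)"
    "\<And>s i. s \<in> J \<Longrightarrow> i \<in> I s \<Longrightarrow> co m2 s i = (if P s i then z s else co m s i)"
proof -
  interpret abelian_group M by (rule group)
  have part: "\<exists>m'\<in>carrier M. \<forall>s\<in>J. \<forall>i\<in>I s. co m' s i = (if P' s i then co m s i else z s)"
    if "ray_invariant P'" for P'
  proof -
    have "P' s (i + int (period (wd s))) = P' s i" if "s \<in> J" "periodic (wd s)" for s i
      using \<open>ray_invariant P'\<close> that same_rays_dvd[OF that(2), of "i + int (period (wd s))" i] period_props(3)[OF that(2)]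
      unfolding ray_invariant_def by auto
    then have "\<exists>m'\<in>carrier M. \<forall>s\<in>J. \<forall>i\<in>I s.
        co m' s i = (case if P' s i then Some i else None of None \<Rightarrow> z s | Some i' \<Rightarrow> co m s i')"
      by (intro relocate[OF assms(1)]) (auto split: if_splits)
    then obtain m' where m': "m' \<in> carrier M" "\<And>s i. s \<in> J \<Longrightarrow> i \<in> I s \<Longrightarrow>
        co m' s i = (case if P' s i then Some i else None of None \<Rightarrow> z s | Some i' \<Rightarrow> co m s i')" by blast
    show ?thesis
    proof (intro bexI[OF _ m'(1)] ballI)
      fix s i assume s: "s \<in> J" "i \<in> I s"
      show "co m' s i = (if P' s i then co m s i else z s)"
        unfolding m'(2)[OF s] by (cases "P' s i") simp_all
    qed
  qed
  obtain m1 where m1: "m1 \<in> carrier M" "\<forall>s\<in>J. \<forall>i\<in>I s. co m1 s i = (if P s i then co m s i else z s)"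
    using part[OF assms(2)] by blast
  have "ray_invariant (\<lambda>s i. \<not> P s i)" using assms(2) unfolding ray_invariant_def by blast
  from part[OF this] obtain m2 where m2: "m2 \<in> carrier M"
    "\<forall>s\<in>J. \<forall>i\<in>I s. co m2 s i = (if \<not> P s i then co m s i else z s)"
    by blast
  have "m = m1 \<oplus>\<^bsub>M\<^esub> m2"
  proof (rule co_eqI[OF assms(1)])
    fix s i assume s: "s \<in> J" "i \<in> I s"
    show "co m s i = co (m1 \<oplus>\<^bsub>M\<^esub> m2) s i"
    proof (cases "P s i")
      case True
      then have "co m1 s i = co m s i" "co m2 s i = z s" using m1(2) m2(2) s by auto
      then show ?thesis using co_add_zero'[OF m1(1) m2(1) s] by simp
    next
      case False
      then have "co m1 s i = z s" "co m2 s i = co m s i" using m1(2) m2(2) s by auto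
      then show ?thesis using co_add_zero[OF m1(1) m2(1) s] by simp
    qed
  qed (use m1 m2 in auto)
  moreover have "co m2 s i = (if P s i then z s else co m s i)" if "s \<in> J" "i \<in> I s" for s i
    using m2(2) that by auto
  ultimately show ?thesis using that[OF m1(1) m2(1)] m1(2) by blast
qed

text \<open>Cutting an element along \<open>P\<close> leaves a remainder supported on
  \<open>P'\<close>. Together with \<open>supported_Int\<close> this reduces sums and intersections
  of subspaces to sets of positions.\<close>

lemma supported_sum:
  assumes "ray_invariant P"
  shows "supported P <+>\<^bsub>M\<^esub> supported P' = supported (\<lambda>s i. P s i \<or> P' s i)"
proof
  interpret abelian_group M by (rule group)
  have "m1 \<oplus>\<^bsub>M\<^esub> m2 \<in> supported (\<lambda>s i. P s i \<or> P' s i)" if "m1 \<in> supported P" "m2 \<in> supported P'" for m1 m2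
  proof -
    have "m1 \<in> supported (\<lambda>s i. P s i \<or> P' s i)" "m2 \<in> supported (\<lambda>s i. P s i \<or> P' s i)"
      using that unfolding supported_def by blast+
    then show ?thesis using additive_subgroup.a_closed[OF supported_subgroup] by blast
  qed
  then show "supported P <+>\<^bsub>M\<^esub> supported P' \<subseteq> supported (\<lambda>s i. P s i \<or> P' s i)"
    unfolding set_add_def' by blast
  show "supported (\<lambda>s i. P s i \<or> P' s i) \<subseteq> supported P <+>\<^bsub>M\<^esub> supported P'"
  proof
    fix m assume m: "m \<in> supported (\<lambda>s i. P s i \<or> P' s i)"
    obtain m1 m2 where m12: "m1 \<in> carrier M" "m2 \<in> carrier M" "m = m1 \<oplus>\<^bsub>M\<^esub> m2"
      "\<And>s i. s \<in> J \<Longrightarrow> i \<in> I s \<Longrightarrow> co m1 s i = (if P s i then co m s i else z s)"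
      "\<And>s i. s \<in> J \<Longrightarrow> i \<in> I s \<Longrightarrow> co m2 s i = (if P s i then z s else co m s i)"
      using split_support[OF supportedD(2)[OF m] assms] by blast
    have "m1 \<in> supported P" "m2 \<in> supported P'"
      using m m12 by (auto simp: supported_def)
    then show "m \<in> supported P <+>\<^bsub>M\<^esub> supported P'"
      using m12(3) unfolding set_add_def' by blast
  qed
qed

lemma ends_in_verts: "x \<in> arcs Q \<Longrightarrow> head Q x \<in> verts Q \<and> tail Q x \<in> verts Q"
  using string_algebra by (auto simp: string_algebra_def wf_digraph_def)

lemma vertex_space_supported:
  assumes "v \<in> verts Q"
  shows "vertex_space Q \<rho> M v = supported (\<lambda>s i. word_vertex Q (wd s) i = v)"
proof
  show "vertex_space Q \<rho> M v \<subseteq> supported (\<lambda>s i. word_vertex Q (wd s) i = v)"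
    using co_vertex[OF assms] vertex_closed[OF assms]
    by (auto simp: vertex_space_def supported_def split: if_splits)
  show "supported (\<lambda>s i. word_vertex Q (wd s) i = v) \<subseteq> vertex_space Q \<rho> M v"
  proof
    fix m assume m: "m \<in> supported (\<lambda>s i. word_vertex Q (wd s) i = v)"
    then have "m = vertex_elem Q \<rho> 1 v \<odot>\<^bsub>M\<^esub> m"
      using vertex_closed[OF assms, of m] co_vertex[OF assms, of m]
      by (intro co_eqI) (auto simp: supported_def)
    then show "m \<in> vertex_space Q \<rho> M v" using supportedD(2)[OF m] unfolding vertex_space_def by blast
  qed
qed

section \<open>The relation of a single letter\<close>

lemma letter_relation_inv: "letter_relation Q \<rho> M (letter_inv l) = (letter_relation Q \<rho> M l)\<inverse>"
  by (cases l) auto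

lemma letter_relation_direct:
  assumes "x \<in> arcs Q" "(m, m') \<in> letter_relation Q \<rho> M (Direct x)"
  shows "m \<in> supported (\<lambda>s i. word_vertex Q (wd s) i = tail Q x)"
    "m' \<in> supported (\<lambda>s i. \<exists>i'. step (wd s) i (Direct x) i')"
    "\<And>s i i'. s \<in> J \<Longrightarrow> step (wd s) i (Direct x) i' \<Longrightarrow> co m' s i = co m s i'"
proof -
  have m: "m \<in> vertex_space Q \<rho> M (tail Q x)" "m' = arrow_elem Q \<rho> x \<odot>\<^bsub>M\<^esub> m" using assms(2) by auto
  show "m \<in> supported (\<lambda>s i. word_vertex Q (wd s) i = tail Q x)"
    using m(1) vertex_space_supported[of "tail Q x"] ends_in_verts[OF assms(1)] by simp
  then have mc: "m \<in> carrier M" by (rule supportedD)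
  show "m' \<in> supported (\<lambda>s i. \<exists>i'. step (wd s) i (Direct x) i')"
    using arrow_closed[OF assms(1) mc] co_arrow_zero[OF assms(1) mc] m(2) by (auto simp: supported_def)
  show "\<And>s i i'. s \<in> J \<Longrightarrow> step (wd s) i (Direct x) i' \<Longrightarrow> co m' s i = co m s i'"
    using co_arrow[OF assms(1) mc] m(2) by simp
qed

lemma letter_relation_coord:
  assumes l: "letter_arrow l \<in> arcs Q" and r: "(m, m') \<in> letter_relation Q \<rho> M l"
  shows "m \<in> carrier M" "m' \<in> supported (\<lambda>s i. word_vertex Q (wd s) i = letter_head Q l)"
    "m \<in> supported (\<lambda>s i. word_vertex Q (wd s) i = letter_tail Q l)"
    "\<And>s i i'. s \<in> J \<Longrightarrow> step (wd s) i l i' \<Longrightarrow> co m' s i = co m s i'"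
    "l = Direct x \<Longrightarrow> m' \<in> supported (\<lambda>s i. \<exists>i'. step (wd s) i l i')"
    "l = Inverse x \<Longrightarrow> m \<in> supported (\<lambda>s i'. \<exists>i. step (wd s) i l i')"
proof -
  have sub: "supported (\<lambda>s i. \<exists>i'. step (wd s) i l i') \<subseteq> supported (\<lambda>s i. word_vertex Q (wd s) i = letter_head Q l)" for l
    using step_props(4)[OF word] unfolding supported_def by blast
  have all: "m \<in> carrier M \<and> m' \<in> supported (\<lambda>s i. word_vertex Q (wd s) i = letter_head Q l) \<and>
    m \<in> supported (\<lambda>s i. word_vertex Q (wd s) i = letter_tail Q l) \<and>
    (\<forall>s i i'. s \<in> J \<longrightarrow> step (wd s) i l i' \<longrightarrow> co m' s i = co m s i') \<and>
    (l = Direct x \<longrightarrow> m' \<in> supported (\<lambda>s i. \<exists>i'. step (wd s) i l i')) \<and>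
    (l = Inverse x \<longrightarrow> m \<in> supported (\<lambda>s i'. \<exists>i. step (wd s) i l i'))"
  proof (cases l)
    case (Direct y)
    then show ?thesis
      using letter_relation_direct[of y m m'] l r sub[of "Direct y"] supportedD(2) by auto
  next
    case (Inverse y)
    then have "(m', m) \<in> letter_relation Q \<rho> M (Direct y)" using r by auto
    note d = letter_relation_direct[OF _ this]
    have y: "y \<in> arcs Q" using Inverse l by simp
    have st: "step C i l i' \<longleftrightarrow> step C i' (Direct y) i" for C :: "('v, 'a) qword" and i i'
      using step_inv[of C i l i'] Inverse by simp
    have "co m' s i = co m s i'" if "s \<in> J" "step (wd s) i l i'" for s i i'
      using d(3)[OF y that(1)] that(2) st by simp
    then show ?thesis
      using d(1,2)[OF y] sub[of "Direct y"] supportedD(2)[of m] st Inverse by auto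
  qed
  show "m \<in> carrier M" "m' \<in> supported (\<lambda>s i. word_vertex Q (wd s) i = letter_head Q l)"
    "m \<in> supported (\<lambda>s i. word_vertex Q (wd s) i = letter_tail Q l)"
    "\<And>s i i'. s \<in> J \<Longrightarrow> step (wd s) i l i' \<Longrightarrow> co m' s i = co m s i'"
    "l = Direct x \<Longrightarrow> m' \<in> supported (\<lambda>s i. \<exists>i'. step (wd s) i l i')"
    "l = Inverse x \<Longrightarrow> m \<in> supported (\<lambda>s i'. \<exists>i. step (wd s) i l i')"
    using all by auto
qed

lemma step_shift_period:
  assumes "s \<in> J" "periodic (wd s)"
  shows "step (wd s) (i + int (period (wd s))) l (j + int (period (wd s))) \<longleftrightarrow> step (wd s) i l j"
proof -
  have "ray (wd s) (i + int (period (wd s))) d = ray (wd s) i d" for d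
    using same_rays_dvd[OF assms(2), of "i + int (period (wd s))" i] by simp
  then have "out_letter (wd s) (i + int (period (wd s))) d = out_letter (wd s) i d" for d by (metis ray_0)
  then show ?thesis by (auto simp: step_def)
qed

text \<open>For an inverse letter the partner of \<open>m\<close> is its image under the arrow. For
  a direct letter it is a preimage, namely the one that carries the coordinates of \<open>m\<close>
  along \<open>step\<close> and is zero elsewhere.\<close>

lemma letter_relation_follow:
  assumes l: "letter_arrow l \<in> arcs Q"
    and m: "m \<in> supported (\<lambda>s i. word_vertex Q (wd s) i = letter_head Q l)"
    and dir: "\<And>x. l = Direct x \<Longrightarrow> m \<in> supported (\<lambda>s i. \<exists>i'. step (wd s) i l i')"
  shows "\<exists>m'. (m', m) \<in> letter_relation Q \<rho> M l \<and> m' \<in> carrier M \<and>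
    (\<forall>s\<in>J. \<forall>i'\<in>I s. co m' s i' \<noteq> z s \<longrightarrow> (\<exists>i. step (wd s) i l i' \<and> co m s i \<noteq> z s))"
proof (cases l)
  case (Inverse x)
  then have x: "x \<in> arcs Q" using l by simp
  have mc: "m \<in> carrier M" using m by (rule supportedD)
  have v: "m \<in> vertex_space Q \<rho> M (tail Q x)"
    using m Inverse vertex_space_supported[of "tail Q x"] ends_in_verts[OF x] by simp
  define m' where "m' = arrow_elem Q \<rho> x \<odot>\<^bsub>M\<^esub> m"
  have "(m', m) \<in> letter_relation Q \<rho> M l" using v Inverse m'_def by auto
  moreover have "\<exists>i. step (wd s) i l i' \<and> co m s i \<noteq> z s" if "s \<in> J" "i' \<in> I s" "co m' s i' \<noteq> z s" for s i'
    using that co_arrow[OF x mc, of s i'] co_arrow_zero[OF x mc, of s i'] step_inv[of "wd s" _ l i'] Inverse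
    unfolding m'_def by force
  ultimately show ?thesis using arrow_closed[OF x mc] m'_def by blast
next
  case (Direct x)
  then have x: "x \<in> arcs Q" using l by simp
  have mc: "m \<in> carrier M" using m by (rule supportedD)
  have ms: "m \<in> supported (\<lambda>s i. \<exists>i'. step (wd s) i l i')" using dir Direct by simp
  \<comment> \<open>\<open>relocate\<close> asks where the coordinate at \<open>i'\<close> is taken
    from, so \<open>h\<close> is the inverse of \<open>step\<close>.\<close>
  define h where "h s i' = (if \<exists>i. step (wd s) i l i' then Some (THE i. step (wd s) i l i') else None)" for s i'
  have h: "h s i' = Some i \<longleftrightarrow> step (wd s) i l i'" if "s \<in> J" for s i i'
  proof -
    have uniq: "i1 = i2" if "step (wd s) i1 l i'" "step (wd s) i2 l i'" for i1 i2
      using step_unique[OF word[OF \<open>s \<in> J\<close>], of i' "letter_inv l"] that step_inv[of "wd s" _ l] by blast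
    then have "(THE i. step (wd s) i l i') = i" if "step (wd s) i l i'" for i
      using that by (intro the_equality) auto
    then show ?thesis unfolding h_def by auto
  qed
  have "\<exists>m'\<in>carrier M. \<forall>s\<in>J. \<forall>i\<in>I s. co m' s i = (case h s i of None \<Rightarrow> z s | Some i' \<Rightarrow> co m s i')"
  proof (rule relocate[OF mc])
    fix s i i' assume s: "s \<in> J" "i \<in> I s" "h s i = Some i'"
    then have st: "step (wd s) i' l i" using h by simp
    then have "\<bar>i' - i\<bar> \<le> 1" by (auto simp: step_def dir_def)
    then show "i' \<in> I s \<and> \<bar>i' - i\<bar> \<le> 1" using step_props(1)[OF word[OF s(1)] st] by simp
  next
    fix s i assume s: "s \<in> J" "periodic (wd s)"
    let ?p = "int (period (wd s))"
    have "h s (i + ?p) = Some j \<longleftrightarrow> map_option (\<lambda>j. j + ?p) (h s i) = Some j" for j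
      using h[OF s(1), of "i + ?p" j] h[OF s(1), of i "j - ?p"] step_shift_period[OF s, of "j - ?p" l i]
      by (cases "h s i") auto
    then show "h s (i + ?p) = map_option (\<lambda>j. j + ?p) (h s i)" by (metis option.exhaust)
  qed
  then obtain m' where m': "m' \<in> carrier M"
    "\<And>s i. s \<in> J \<Longrightarrow> i \<in> I s \<Longrightarrow> co m' s i = (case h s i of None \<Rightarrow> z s | Some i' \<Rightarrow> co m s i')" by blast
  have supp: "\<exists>i. step (wd s) i l i' \<and> co m s i \<noteq> z s" if "s \<in> J" "i' \<in> I s" "co m' s i' \<noteq> z s" for s i'
    using that m'(2)[OF that(1,2)] h[OF that(1), of i'] by (cases "h s i'") auto
  have "m' \<in> supported (\<lambda>s i. word_vertex Q (wd s) i = tail Q x)"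
    using supp m'(1) step_props(5)[OF word] Direct by (fastforce simp: supported_def)
  then have v: "m' \<in> vertex_space Q \<rho> M (tail Q x)"
    using vertex_space_supported[of "tail Q x"] ends_in_verts[OF x] by simp
  have "arrow_elem Q \<rho> x \<odot>\<^bsub>M\<^esub> m' = m"
  proof (rule co_eqI[OF arrow_closed[OF x m'(1)] mc])
    fix s i assume s: "s \<in> J" "i \<in> I s"
    show "co (arrow_elem Q \<rho> x \<odot>\<^bsub>M\<^esub> m') s i = co m s i"
    proof (cases "\<exists>i'. step (wd s) i l i'")
      case True
      then obtain i' where i': "step (wd s) i l i'" by blast
      then have "i' \<in> I s" using step_props(2)[OF word[OF s(1)]] by blast
      moreover have "h s i' = Some i" using h[OF s(1)] i' by simp
      ultimately have "co m' s i' = co m s i" using m'(2)[OF s(1)] by simp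
      then show ?thesis using co_arrow[OF x m'(1) s(1)] i' Direct by simp
    next
      case False
      then have "co m s i = z s" using supportedD(1)[OF ms s] by blast
      then show ?thesis using co_arrow_zero[OF x m'(1) s] False Direct by simp
    qed
  qed
  then have "(m', m) \<in> letter_relation Q \<rho> M l" using v Direct by auto
  then show ?thesis using m'(1) supp by blast
qed

end

section \<open>Invariance under the period\<close>

lemma same_rays_translate:
  assumes "is_word Q \<rho> C" "i \<in> index_set (word_shape C)" "j \<in> index_set (word_shape C)"
    and "\<And>d. ray C i d = ray C j d"
  shows "out_letter C (p + (j - i)) d = out_letter C p d"
    "word_vertex Q C i = word_vertex Q C j"
proof -
  from same_rays_periodic[OF assms(2-4)]
  show out: "out_letter C (p + (j - i)) d = out_letter C p d" for p d
  proof
    assume "word_shape C = AllInt \<and> (\<forall>p. letter_at C (p + (j - i)) = letter_at C p)"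
    then have A: "word_shape C = AllInt" "\<And>p. letter_at C (p + (j - i)) = letter_at C p" by auto
    have eq: "p + (j - i) + 1 = (p + 1) + (j - i)" by simp
    show ?thesis unfolding out_letter_def A(1) eq A(2) by (simp add: positions_simps)
  qed auto
  show "word_vertex Q C i = word_vertex Q C j"
  proof (cases "i = j")
    case False
    then have "word_shape C = AllInt" using same_rays_periodic[OF assms(2-4)] by simp
    then obtain l where "out_letter C i True = Some l" by (simp add: out_letter_def positions_simps)
    moreover have "out_letter C j True = out_letter C i True" using out[of i True] by simp
    ultimately show ?thesis using out_letter_props(2)[OF assms(1)] by metis
  qed simp
qed

lemma same_rays_follows:
  assumes "is_word Q \<rho> C" "i \<in> index_set (word_shape C)" "j \<in> index_set (word_shape C)"
    and "\<And>d. ray C i d = ray C j d"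
  shows "step C (p + (j - i)) l (q + (j - i)) \<longleftrightarrow> step C p l q"
    "follows C c n (p + (j - i)) (q + (j - i)) \<longleftrightarrow> follows C c n p q"
proof -
  show step: "step C (p + (j - i)) l (q + (j - i)) \<longleftrightarrow> step C p l q" for p q l
    unfolding step_def same_rays_translate(1)[OF assms] by auto
  show "follows C c n (p + (j - i)) (q + (j - i)) \<longleftrightarrow> follows C c n p q"
  proof (induction n arbitrary: q)
    case (Suc n)
    have "follows C c (Suc n) (p + (j - i)) (q + (j - i)) \<longleftrightarrow>
       (\<exists>k. follows C c n (p + (j - i)) (k + (j - i)) \<and> step C (k + (j - i)) (c n) (q + (j - i)))"
      unfolding follows_Suc_right by (metis diff_add_cancel)
    then show ?case unfolding Suc step follows_Suc_right .
  qed simp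
qed

text \<open>Positions with equal rays differ by a translation that preserves the steps, and all
  three notions are built from steps. This makes the relevant sets of positions
  \<open>ray_invariant\<close>.\<close>

lemma same_rays_invariant:
  assumes "is_word Q \<rho> C" "i \<in> index_set (word_shape C)" "j \<in> index_set (word_shape C)"
    and "\<And>d. ray C i d = ray C j d"
  shows "stuck C c n j \<longleftrightarrow> stuck C c n i"
    "upto_word Q \<rho> \<sigma> D C j \<longleftrightarrow> upto_word Q \<rho> \<sigma> D C i"
    "below_word Q \<rho> \<sigma> D C j \<longleftrightarrow> below_word Q \<rho> \<sigma> D C i"
proof -
  define t where "t = j - i"
  have ex: "(\<exists>q. R q) \<longleftrightarrow> (\<exists>q. R (q + t))" for R :: "int \<Rightarrow> bool" by (metis diff_add_cancel)
  have j: "j = i + t" by (simp add: t_def)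
  have st: "step C (p + t) l (q + t) \<longleftrightarrow> step C p l q" for p l q
    using same_rays_follows(1)[OF assms] by (simp add: t_def)
  have ex_step: "(\<exists>q. step C (p + t) l q) \<longleftrightarrow> (\<exists>q. step C p l q)" for p l
    using ex[of "\<lambda>q. step C (p + t) l q"] st by simp
  have fol: "follows C c n (p + t) (q + t) \<longleftrightarrow> follows C c n p q" for c n p q
    using same_rays_follows(2)[OF assms] by (simp add: t_def)
  show stuck: "stuck C c n j \<longleftrightarrow> stuck C c n i" for c n
  proof -
    have "stuck C c n j \<longleftrightarrow> (\<exists>k<n. \<exists>q x. follows C c k (i + t) (q + t) \<and> c k = Inverse x \<and> (\<nexists>j'. step C (q + t) (c k) j'))"
      unfolding stuck_def j using ex[of "\<lambda>q. \<exists>x. follows C c _ (i + t) q \<and> c _ = Inverse x \<and> (\<nexists>j'. step C q (c _) j')"]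
      by simp
    then show ?thesis unfolding stuck_def fol ex_step .
  qed
  have ex_fol: "(\<exists>q. follows C c n j q) \<longleftrightarrow> (\<exists>q. follows C c n i q)" for c n
    using ex[of "\<lambda>q. follows C c n j q"] fol unfolding j by simp
  have "(\<exists>q. follows C c n j q \<and> (\<forall>x\<in>arcs Q. Z x \<longrightarrow> (\<nexists>j'. step C q (Inverse x) j'))) \<longleftrightarrow>
     (\<exists>q. follows C c n i q \<and> (\<forall>x\<in>arcs Q. Z x \<longrightarrow> (\<nexists>j'. step C q (Inverse x) j')))" for c n Z
    using ex[of "\<lambda>q. follows C c n j q \<and> (\<forall>x\<in>arcs Q. Z x \<longrightarrow> (\<nexists>j'. step C q (Inverse x) j'))"]
    unfolding j fol ex_step .
  then show "upto_word Q \<rho> \<sigma> D C j \<longleftrightarrow> upto_word Q \<rho> \<sigma> D C i"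
    unfolding upto_word_def stuck ex_fol by simp
  have "(\<exists>q y j'. follows C c n j q \<and> y \<in> arcs Q \<and> Z y \<and> step C q (Direct y) j') \<longleftrightarrow>
     (\<exists>q y j'. follows C c n i q \<and> y \<in> arcs Q \<and> Z y \<and> step C q (Direct y) j')" for c n Z
  proof -
    have "(\<exists>q y j'. follows C c n j q \<and> y \<in> arcs Q \<and> Z y \<and> step C q (Direct y) j') \<longleftrightarrow>
      (\<exists>q. follows C c n j q \<and> (\<exists>y\<in>arcs Q. Z y \<and> (\<exists>j'. step C q (Direct y) j')))" for j by blast
    then show ?thesis
      using ex[of "\<lambda>q. follows C c n j q \<and> (\<exists>y\<in>arcs Q. Z y \<and> (\<exists>j'. step C q (Direct y) j'))"]
      unfolding j fol ex_step by simp
  qed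
  then show "below_word Q \<rho> \<sigma> D C j \<longleftrightarrow> below_word Q \<rho> \<sigma> D C i"
    unfolding below_word_def stuck by simp
qed

lemma follows_back_unique:
  "is_word Q \<rho> C \<Longrightarrow> follows C c n i j \<Longrightarrow> follows C c n i' j \<Longrightarrow> i = i'"
proof (induction n arbitrary: j)
  case (Suc n)
  then obtain k k' where "follows C c n i k" "step C k (c n) j" "follows C c n i' k'" "step C k' (c n) j"
    by (auto simp: follows_Suc_right simp del: follows.simps(2))
  moreover from this have "k = k'"
    using step_unique[OF Suc.prems(1), of j "letter_inv (c n)"] step_inv[of C] by blast
  ultimately show ?case using Suc.IH Suc.prems(1) by blast
qed simp

lemma follows_end:
  assumes "is_word Q \<rho> C" "follows C c n i j" "i \<in> index_set (word_shape C)"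
  shows "j \<in> index_set (word_shape C)" "n > 0 \<Longrightarrow> word_vertex Q C j = letter_tail Q (c (n - 1))"
  using assms step_props[OF assms(1)]
  by (cases n; auto simp: follows_Suc_right simp del: follows.simps(2))+

section \<open>Images under the relations of finite words\<close>

context word_coordinates
begin

text \<open>In a pair the first component belongs to the tail and the second to the head, so the
  letters are read from the second component towards the first.\<close>

fun chain_relation :: "(nat \<Rightarrow> 'a letter) \<Rightarrow> nat \<Rightarrow> ('m \<times> 'm) set" where
  "chain_relation c 0 = Id"
| "chain_relation c (Suc n) = chain_relation (\<lambda>k. c (Suc k)) n O letter_relation Q \<rho> M (c 0)"

lemma word_relation_Letters: "word_relation Q \<rho> M (Letters (Fin n) c) = chain_relation (\<lambda>k. c (int k + 1)) n"
proof -
  have "foldr (\<lambda>i R. R O letter_relation Q \<rho> M (c i)) [a + 1..a + int n] Id = chain_relation (\<lambda>k. c (a + int k + 1)) n" for a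
  proof (induction n arbitrary: a)
    case (Suc n)
    have "[a + 1..a + int (Suc n)] = (a + 1) # [(a + 1) + 1..(a + 1) + int n]"
      by (subst upto_rec1) (auto simp: algebra_simps)
    then show ?case using Suc[of "a + 1"] by (simp add: algebra_simps)
  qed simp
  from this[of 0] show ?thesis by simp
qed

definition reaches :: "(nat \<Rightarrow> 'a letter) \<Rightarrow> nat \<Rightarrow> ('s \<Rightarrow> int \<Rightarrow> bool) \<Rightarrow> 's \<Rightarrow> int \<Rightarrow> bool" where
  "reaches c n P s i \<longleftrightarrow> stuck (wd s) c n i \<or> (\<exists>j. follows (wd s) c n i j \<and> P s j)"

text \<open>The image under an inverse letter is a full preimage of an arrow and so contains its
  kernel, spanned at that vertex by the positions without a step. The image under a direct letter
  consists of images of the arrow, so each position needs a step.\<close>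

lemma letter_relation_image:
  assumes l: "letter_arrow l \<in> arcs Q"
  shows "letter_relation Q \<rho> M l `` supported P = supported (\<lambda>s i. word_vertex Q (wd s) i = letter_head Q l \<and>
    ((\<exists>x. l = Inverse x) \<and> (\<nexists>j. step (wd s) i l j) \<or> (\<exists>j. step (wd s) i l j \<and> P s j)))" (is "?L = supported ?R")
proof
  show "?L \<subseteq> supported ?R"
  proof
    fix m assume "m \<in> ?L"
    then obtain m' where m': "m' \<in> supported P" "(m', m) \<in> letter_relation Q \<rho> M l" by blast
    note r = letter_relation_coord[OF l m'(2)]
    have "?R s i" if s: "s \<in> J" "i \<in> I s" "co m s i \<noteq> z s" for s i
    proof -
      have v: "word_vertex Q (wd s) i = letter_head Q l" using supportedD(1)[OF r(2) s] .
      have P: "P s j" if "step (wd s) i l j" for j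
        using supportedD(1)[OF m'(1) s(1), of j] r(4)[OF s(1) that] s(3) step_props(2)[OF word[OF s(1)] that] by simp
      have "\<exists>j. step (wd s) i l j" if "l = Direct x" for x
        using supportedD(1)[OF r(5)[OF that] s] .
      then show ?thesis using v P by (cases l) auto
    qed
    then show "m \<in> supported ?R" using supportedD(2)[OF r(2)] by (auto simp: supported_def)
  qed
  show "supported ?R \<subseteq> ?L"
  proof
    fix m assume m: "m \<in> supported ?R"
    have "m \<in> supported (\<lambda>s i. word_vertex Q (wd s) i = letter_head Q l)"
      using m by (auto simp: supported_def)
    moreover have "l = Direct x \<Longrightarrow> m \<in> supported (\<lambda>s i. \<exists>i'. step (wd s) i l i')" for x
      using m by (auto simp: supported_def)
    ultimately obtain m' where m': "(m', m) \<in> letter_relation Q \<rho> M l" "m' \<in> carrier M"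
      "\<forall>s\<in>J. \<forall>i'\<in>I s. co m' s i' \<noteq> z s \<longrightarrow> (\<exists>i. step (wd s) i l i' \<and> co m s i \<noteq> z s)"
      using letter_relation_follow[OF l, of m] by blast
    have "P s i'" if s: "s \<in> J" "i' \<in> I s" "co m' s i' \<noteq> z s" for s i'
    proof -
      obtain i where i: "step (wd s) i l i'" "co m s i \<noteq> z s" using m'(3) s by blast
      then show ?thesis
        using supportedD(1)[OF m s(1) step_props(1)[OF word[OF s(1)] i(1)] i(2)] step_unique[OF word[OF s(1)] i(1)] by blast
    qed
    then have "m' \<in> supported P" using m'(2) by (auto simp: supported_def)
    then show "m \<in> ?L" using m'(1) by blast
  qed
qed

text \<open>The first letter is applied last, so in the induction it acts on the image under the
  remaining ones. With \<open>n > 0\<close> the letters determine the vertex of the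
  positions.\<close>

lemma chain_relation_image:
  assumes "n > 0" "\<And>k. k < n \<Longrightarrow> letter_arrow (c k) \<in> arcs Q"
    and "\<And>k. Suc k < n \<Longrightarrow> letter_tail Q (c k) = letter_head Q (c (Suc k))"
  shows "chain_relation c n `` supported P =
    supported (\<lambda>s i. word_vertex Q (wd s) i = letter_head Q (c 0) \<and> reaches c n P s i)"
  using assms
proof (induction n arbitrary: c)
  case (Suc n)
  let ?c = "\<lambda>k. c (Suc k)"
  have reach: "reaches c (Suc n) P s i \<longleftrightarrow> (\<exists>x. c 0 = Inverse x) \<and> (\<nexists>j. step (wd s) i (c 0) j) \<or>
       (\<exists>j. step (wd s) i (c 0) j \<and> reaches ?c n P s j)" for s i
    unfolding reaches_def stuck_Suc follows.simps by blast
  have l: "letter_arrow (c 0) \<in> arcs Q" using Suc.prems by simp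
  show ?case
  proof (cases "n = 0")
    case True
    then have "chain_relation c (Suc n) `` supported P = letter_relation Q \<rho> M (c 0) `` supported P" by simp
    moreover have "reaches ?c n P = P" using True by (intro ext) (simp add: reaches_def)
    ultimately show ?thesis unfolding reach letter_relation_image[OF l] by simp
  next
    case False
    have IH: "chain_relation ?c n `` supported P =
      supported (\<lambda>s i. word_vertex Q (wd s) i = letter_head Q (?c 0) \<and> reaches ?c n P s i)"
      by (rule Suc.IH) (use Suc.prems False in auto)
    have t: "letter_tail Q (c 0) = letter_head Q (?c 0)" using Suc.prems(3)[of 0] False by simp
    have "chain_relation c (Suc n) `` supported P =
       letter_relation Q \<rho> M (c 0) `` (chain_relation ?c n `` supported P)" by (simp add: relcomp_Image)
    also have "\<dots> = supported (\<lambda>s i. word_vertex Q (wd s) i = letter_head Q (c 0) \<and> reaches c (Suc n) P s i)"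
      unfolding IH letter_relation_image[OF l] reach
    proof (rule supported_cong)
      fix s i assume s: "s \<in> J" "i \<in> I s"
      have "word_vertex Q (wd s) j = letter_head Q (?c 0)" if "step (wd s) i (c 0) j" for j
        using step_props(5)[OF word[OF s(1)] that] t by simp
      then show "(word_vertex Q (wd s) i = letter_head Q (c 0) \<and>
          ((\<exists>x. c 0 = Inverse x) \<and> (\<nexists>j. step (wd s) i (c 0) j) \<or>
           (\<exists>j. step (wd s) i (c 0) j \<and> word_vertex Q (wd s) j = letter_head Q (c (Suc 0)) \<and> reaches ?c n P s j))) =
        (word_vertex Q (wd s) i = letter_head Q (c 0) \<and>
          ((\<exists>x. c 0 = Inverse x) \<and> (\<nexists>j. step (wd s) i (c 0) j) \<or>
           (\<exists>j. step (wd s) i (c 0) j \<and> reaches ?c n P s j)))" by blast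
    qed
    finally show ?thesis .
  qed
qed simp

lemma word_relation_image:
  assumes D: "is_word Q \<rho> D" "word_shape D = Fin n"
  shows "word_relation Q \<rho> M D `` supported (\<lambda>s i. word_vertex Q (wd s) i = word_tail Q D \<and> P s i) =
    supported (\<lambda>s i. word_vertex Q (wd s) i = word_head Q D \<and> reaches (word_letters D) n P s i)"
proof (cases D)
  case (Trivial v e)
  have "Id_on (supported (\<lambda>s i. word_vertex Q (wd s) i = v)) `` supported (\<lambda>s i. word_vertex Q (wd s) i = v \<and> P s i) =
    supported (\<lambda>s i. word_vertex Q (wd s) i = v \<and> P s i)" by (auto simp: supported_def)
  then show ?thesis using Trivial D vertex_space_supported[of v]
    by (simp add: word_tail_def word_head_def reaches_def)
next
  case (Letters s c)
  then have D': "D = Letters (Fin n) c" and n: "n > 0" using D by auto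
  have pos: "int k + 1 \<in> positions (word_shape D)" if "k < n" for k using that D(2) by (simp add: positions_simps)
  have arcs: "letter_arrow (word_letters D k) \<in> arcs Q" if "k < n" for k
    using word_letter(1)[OF D(1) pos[OF that]] by (simp add: word_letters_def)
  have heads: "letter_tail Q (word_letters D k) = letter_head Q (word_letters D (Suc k))" if "Suc k < n" for k
    using word_letters_reduced(2)[OF D(1), of k] that D(2) by (simp add: positions_simps)
  have tl: "word_tail Q D = letter_tail Q (word_letters D (n - 1))"
    using D' n by (simp add: word_tail_def word_letters_def positions_simps of_nat_diff)
  have hd: "word_head Q D = letter_head Q (word_letters D 0)"
    using D' n by (simp add: word_head_def word_letters_def positions_simps)
  have rel: "word_relation Q \<rho> M D = chain_relation (word_letters D) n"
    unfolding D' word_relation_Letters by (simp add: word_letters_def[abs_def])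
  have img: "chain_relation (word_letters D) n `` supported P' =
    supported (\<lambda>s i. word_vertex Q (wd s) i = letter_head Q (word_letters D 0) \<and> reaches (word_letters D) n P' s i)"
    for P' by (rule chain_relation_image[OF n]) (use arcs heads in auto)
  show ?thesis
    unfolding rel img hd
  proof (rule supported_cong)
    fix s i assume s: "s \<in> J" "i \<in> I s"
    have "word_vertex Q (wd s) j = word_tail Q D" if "follows (wd s) (word_letters D) n i j" for j
      using follows_end(2)[OF word[OF s(1)] that s(2) n] tl by simp
    then show "(word_vertex Q (wd s) i = letter_head Q (word_letters D 0) \<and>
       reaches (word_letters D) n (\<lambda>s i. word_vertex Q (wd s) i = word_tail Q D \<and> P s i) s i) =
      (word_vertex Q (wd s) i = letter_head Q (word_letters D 0) \<and> reaches (word_letters D) n P s i)"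
      unfolding reaches_def by blast
  qed
qed

lemma concatenation_letter:
  assumes D: "is_word Q \<rho> D" "word_shape D = Fin n" and c: "composable Q \<rho> \<sigma> D (letter_word l)"
  defines "D' \<equiv> concatenation D (letter_word l)"
  shows "is_word Q \<rho> D'" "word_shape D' = Fin (Suc n)" "word_head Q D' = word_head Q D"
    "word_tail Q D' = letter_tail Q l" "k < n \<Longrightarrow> word_letters D' k = word_letters D k"
    "word_letters D' n = l"
proof -
  show "is_word Q \<rho> D'" using c by (simp add: composable_def D'_def)
  have "word_shape D' = Fin (Suc n) \<and> word_head Q D' = word_head Q D \<and> word_tail Q D' = letter_tail Q l \<and>
    (k < n \<longrightarrow> word_letters D' k = word_letters D k) \<and> word_letters D' n = l"
  proof (cases D)
    case (Trivial v e)
    then show ?thesis using c D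
      by (simp add: D'_def letter_word_def composable_def word_tail_def word_head_def positions_simps word_letters_def)
  next
    case (Letters s d)
    then have "s = Fin n" "n > 0" using D by auto
    then show ?thesis using Letters
      by (simp add: D'_def letter_word_def word_tail_def word_head_def positions_simps word_letters_def)
  qed
  then show "word_shape D' = Fin (Suc n)" "word_head Q D' = word_head Q D"
    "word_tail Q D' = letter_tail Q l" "k < n \<Longrightarrow> word_letters D' k = word_letters D k"
    "word_letters D' n = l" by auto
qed

lemma word_relation_extension_image:
  assumes D: "is_word Q \<rho> D" "word_shape D = Fin n" and c: "composable Q \<rho> \<sigma> D (letter_word l)"
  shows "word_relation Q \<rho> M (concatenation D (letter_word l)) ``
      supported (\<lambda>s i. word_vertex Q (wd s) i = letter_tail Q l \<and> P s i) =
    supported (\<lambda>s i. word_vertex Q (wd s) i = word_head Q D \<and>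
      (stuck (wd s) (word_letters D) n i \<or> (\<exists>j. follows (wd s) (word_letters D) n i j \<and>
         ((\<exists>x. l = Inverse x) \<and> (\<nexists>j'. step (wd s) j l j') \<or> (\<exists>j'. step (wd s) j l j' \<and> P s j')))))"
proof -
  note ext = concatenation_letter[OF D c]
  have st: "stuck C (word_letters (concatenation D (letter_word l))) n i \<longleftrightarrow> stuck C (word_letters D) n i"
    for C :: "('v, 'a) qword" and i by (rule stuck_cong) (rule ext(5))
  have fol: "follows C (word_letters (concatenation D (letter_word l))) n i j \<longleftrightarrow> follows C (word_letters D) n i j"
    for C :: "('v, 'a) qword" and i j by (rule follows_cong) (rule ext(5))
  have "reaches (word_letters (concatenation D (letter_word l))) (Suc n) P s i \<longleftrightarrow>
     stuck (wd s) (word_letters D) n i \<or> (\<exists>j. follows (wd s) (word_letters D) n i j \<and>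
         ((\<exists>x. l = Inverse x) \<and> (\<nexists>j'. step (wd s) j l j') \<or> (\<exists>j'. step (wd s) j l j' \<and> P s j')))" for s i
    unfolding reaches_def stuck_Suc_right follows_Suc_right ext(6) st fol
    by blast
  then show ?thesis
    using word_relation_image[OF ext(1,2), of P] unfolding ext(3,4) by simp
qed

text \<open>The two cases of the definition start from the empty set of positions, with the
  continuation appended to \<open>D\<close>, and from all positions at the tail of
  \<open>D\<close>.\<close>

lemma finite_plus_supported:
  assumes D: "is_word Q \<rho> D" "word_shape D = Fin n"
  shows "finite_plus Q \<rho> \<sigma> M D =
    supported (\<lambda>s i. word_vertex Q (wd s) i = word_head Q D \<and> upto_word Q \<rho> \<sigma> D (wd s) i)"
proof -
  let ?P = "\<lambda>x. x \<in> arcs Q \<and> composable Q \<rho> \<sigma> D (letter_word (Inverse x))"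
  have len: "word_length D = n" using D by (simp add: word_length_def)
  show ?thesis
  proof (cases "\<exists>x. ?P x")
    case True
    then obtain x where x: "?P x" by blast
    have uniq: "y = x" if "?P y" for y
      using composable_letter_unique[OF signs, of "Inverse x" "Inverse y" D] that x by (auto simp: doubleton_eq_iff)
    then have the: "(THE x. ?P x) = x" using x by blast
    have "finite_plus Q \<rho> \<sigma> M D = word_relation Q \<rho> M (concatenation D (letter_word (Inverse x))) `` supported (\<lambda>s i. False)"
      unfolding finite_plus_def Let_def the supported_False using True by simp
    then have "finite_plus Q \<rho> \<sigma> M D = supported (\<lambda>s i. word_vertex Q (wd s) i = word_head Q D \<and>
      (stuck (wd s) (word_letters D) n i \<or> (\<exists>j. follows (wd s) (word_letters D) n i j \<and>
         (\<nexists>j'. step (wd s) j (Inverse x) j'))))"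
      using word_relation_extension_image[OF D conjunct2[OF x], of "\<lambda>s i. False"] by simp
    moreover have "(\<forall>x\<in>arcs Q. composable Q \<rho> \<sigma> D (letter_word (Inverse x)) \<longrightarrow> (\<nexists>j'. step C j (Inverse x) j')) \<longleftrightarrow>
      (\<nexists>j'. step C j (Inverse x) j')" for C :: "('v, 'a) qword" and j using uniq x by blast
    ultimately show ?thesis using D(2) len unfolding upto_word_def by simp
  next
    case False
    have v: "word_tail Q D \<in> verts Q"
      unfolding word_tail_def using word_vertex_in_verts[OF _ D(1), of "int n"] D(2) string_algebra
      by (simp add: string_algebra_def)
    have "finite_plus Q \<rho> \<sigma> M D = word_relation Q \<rho> M D `` supported (\<lambda>s i. word_vertex Q (wd s) i = word_tail Q D \<and> True)"
      unfolding finite_plus_def Let_def by (simp only: False if_False vertex_space_supported[OF v] simp_thms)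
    also have "\<dots> = supported (\<lambda>s i. word_vertex Q (wd s) i = word_head Q D \<and> upto_word Q \<rho> \<sigma> D (wd s) i)"
      unfolding word_relation_image[OF D] reaches_def upto_word_def len using False D(2) by simp
    finally show ?thesis .
  qed
qed

lemma finite_minus_supported:
  assumes D: "is_word Q \<rho> D" "word_shape D = Fin n"
  shows "finite_minus Q \<rho> \<sigma> M D =
    supported (\<lambda>s i. word_vertex Q (wd s) i = word_head Q D \<and> below_word Q \<rho> \<sigma> D (wd s) i)"
proof -
  let ?P = "\<lambda>x. x \<in> arcs Q \<and> composable Q \<rho> \<sigma> D (letter_word (Direct x))"
  have len: "word_length D = n" using D by (simp add: word_length_def)
  show ?thesis
  proof (cases "\<exists>x. ?P x")
    case True
    then obtain x where x: "?P x" by blast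
    have uniq: "y = x" if "?P y" for y
      using composable_letter_unique[OF signs, of "Direct x" "Direct y" D] that x by (auto simp: doubleton_eq_iff)
    then have the: "(THE x. ?P x) = x" using x by blast
    have "finite_minus Q \<rho> \<sigma> M D = word_relation Q \<rho> M (concatenation D (letter_word (Direct x))) ``
        supported (\<lambda>s i. word_vertex Q (wd s) i = letter_tail Q (Direct x) \<and> True)"
      unfolding finite_minus_def Let_def the using True vertex_space_supported[of "tail Q x"] ends_in_verts[of x] x by simp
    then have "finite_minus Q \<rho> \<sigma> M D = supported (\<lambda>s i. word_vertex Q (wd s) i = word_head Q D \<and>
      (stuck (wd s) (word_letters D) n i \<or> (\<exists>j. follows (wd s) (word_letters D) n i j \<and>
         (\<exists>j'. step (wd s) j (Direct x) j'))))"
      unfolding word_relation_extension_image[OF D conjunct2[OF x]] by simp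
    moreover have "(\<exists>j y j'. follows C (word_letters D) n i j \<and> y \<in> arcs Q \<and>
           composable Q \<rho> \<sigma> D (letter_word (Direct y)) \<and> step C j (Direct y) j') \<longleftrightarrow>
      (\<exists>j. follows C (word_letters D) n i j \<and> (\<exists>j'. step C j (Direct x) j'))"
      for C :: "('v, 'a) qword" and i using uniq x by blast
    ultimately show ?thesis using D(2) len unfolding below_word_def by simp
  next
    case False
    have "finite_minus Q \<rho> \<sigma> M D = word_relation Q \<rho> M D `` supported (\<lambda>s i. word_vertex Q (wd s) i = word_tail Q D \<and> False)"
      unfolding finite_minus_def Let_def by (simp only: False if_False supported_False simp_thms)
    also have "\<dots> = supported (\<lambda>s i. word_vertex Q (wd s) i = word_head Q D \<and> below_word Q \<rho> \<sigma> D (wd s) i)"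
      unfolding word_relation_image[OF D] reaches_def below_word_def len
      by (rule supported_cong) (use False D(2) in auto)
    finally show ?thesis .
  qed
qed

end

section \<open>The functors of infinite words\<close>

context word_coordinates
begin

text \<open>A nonzero coordinate is carried along without end: before a direct letter a step exists
  since the element lies in the image of the arrow, before an inverse letter since the reading is
  not stuck.\<close>

lemma chain_coordinates:
  assumes f: "\<And>n. letter_arrow (c n) \<in> arcs Q \<and> (f (Suc n), f n) \<in> letter_relation Q \<rho> M (c n)"
    and s: "s \<in> J" "i \<in> I s" and supp: "co (f 0) s i \<noteq> z s" and ns: "\<And>n. \<not> stuck (wd s) c n i"
  shows "\<exists>j\<in>I s. follows (wd s) c n i j \<and> co (f n) s j = co (f 0) s i"
proof (induction n)
  case (Suc n)
  then obtain j where j: "j \<in> I s" "follows (wd s) c n i j" "co (f n) s j = co (f 0) s i" by blast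
  have rel: "letter_arrow (c n) \<in> arcs Q" "(f (Suc n), f n) \<in> letter_relation Q \<rho> M (c n)" using f by auto
  note r = letter_relation_coord[OF rel]
  have "\<exists>j'. step (wd s) j (c n) j'"
  proof (cases "c n")
    case (Direct x)
    then show ?thesis using supportedD(1)[OF r(5)[OF Direct] s(1) j(1)] j(3) supp by simp
  next
    case (Inverse x)
    then show ?thesis using ns[of "Suc n"] j(2) unfolding stuck_Suc_right by blast
  qed
  then obtain j' where j': "step (wd s) j (c n) j'" by blast
  show ?case
    using j(2,3) j' r(4)[OF s(1) j'] step_props(2)[OF word[OF s(1)] j']
    by (intro bexI[of _ j']) (auto simp: follows_Suc_right simp del: follows.simps)
qed (use s in auto)

text \<open>The sequence comes from dependent choice. \<open>R n\<close> is the property of the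
  positions in the \<open>n\<close>-th element that provides a step at direct letters and is passed
  on along steps.\<close>

lemma chain_exists:
  assumes arcs: "\<And>n. letter_arrow (c n) \<in> arcs Q" and heads: "\<And>n. letter_tail Q (c n) = letter_head Q (c (Suc n))"
    and direct: "\<And>n s i x. s \<in> J \<Longrightarrow> i \<in> I s \<Longrightarrow> R n s i \<Longrightarrow> c n = Direct x \<Longrightarrow> \<exists>j. step (wd s) i (c n) j"
    and next_R: "\<And>n s i j. s \<in> J \<Longrightarrow> i \<in> I s \<Longrightarrow> R n s i \<Longrightarrow> step (wd s) i (c n) j \<Longrightarrow> R (Suc n) s j"
    and m: "m \<in> supported (\<lambda>s i. word_vertex Q (wd s) i = letter_head Q (c 0) \<and> R 0 s i)"
  shows "\<exists>f. f 0 = m \<and> (\<forall>n. (f (Suc n), f n) \<in> letter_relation Q \<rho> M (c n) \<and> f n \<in> supported (R n))"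
proof -
  let ?A = "\<lambda>n. supported (\<lambda>s i. word_vertex Q (wd s) i = letter_head Q (c n) \<and> R n s i)"
  have "\<exists>f. \<forall>n. (f n \<in> ?A n \<and> (n = 0 \<longrightarrow> f n = m)) \<and> (f (Suc n), f n) \<in> letter_relation Q \<rho> M (c n)"
  proof (rule dependent_nat_choice)
    show "\<exists>x. x \<in> ?A 0 \<and> (0 = 0 \<longrightarrow> x = m)" using m by blast
    fix x n assume x: "x \<in> ?A n \<and> (n = 0 \<longrightarrow> x = m)"
    have 1: "x \<in> supported (\<lambda>s i. word_vertex Q (wd s) i = letter_head Q (c n))"
      using x unfolding supported_def by blast
    have 2: "\<And>y. c n = Direct y \<Longrightarrow> x \<in> supported (\<lambda>s i. \<exists>j. step (wd s) i (c n) j)"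
      using x direct[of _ _ n] unfolding supported_def by blast
    obtain x' where x': "(x', x) \<in> letter_relation Q \<rho> M (c n)" "x' \<in> carrier M"
      "\<forall>s\<in>J. \<forall>i'\<in>I s. co x' s i' \<noteq> z s \<longrightarrow> (\<exists>i. step (wd s) i (c n) i' \<and> co x s i \<noteq> z s)"
      using letter_relation_follow[OF arcs[of n] 1] 2 by blast
    have "word_vertex Q (wd s) i' = letter_head Q (c (Suc n)) \<and> R (Suc n) s i'"
      if s: "s \<in> J" "i' \<in> I s" "co x' s i' \<noteq> z s" for s i'
    proof -
      obtain i where i: "step (wd s) i (c n) i'" "co x s i \<noteq> z s" using x'(3) s by blast
      have iI: "i \<in> I s" using step_props(1)[OF word[OF s(1)] i(1)] .
      have "R n s i" using supportedD(1)[OF conjunct1[OF x] s(1) iI i(2)] by blast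
      then show ?thesis
        using next_R[OF s(1) iI _ i(1)] step_props(5)[OF word[OF s(1)] i(1)] heads by simp
    qed
    then have "x' \<in> ?A (Suc n)" using x'(2) by (simp add: supported_def)
    then show "\<exists>y. (y \<in> ?A (Suc n) \<and> (Suc n = 0 \<longrightarrow> y = m)) \<and> (y, x) \<in> letter_relation Q \<rho> M (c n)"
      using x'(1) by blast
  qed
  then obtain f where f: "\<And>n. f n \<in> ?A n" "f 0 = m" "\<And>n. (f (Suc n), f n) \<in> letter_relation Q \<rho> M (c n)"
    by blast
  have "f n \<in> supported (R n)" for n using f(1)[of n] unfolding supported_def by blast
  then show ?thesis using f(2,3) by blast
qed

lemma stuck_step:
  assumes "is_word Q \<rho> C" "step C i (c 0) j"
  shows "stuck C c (Suc n) i \<longleftrightarrow> stuck C (\<lambda>k. c (Suc k)) n j"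
  using assms(2) step_unique[OF assms] unfolding stuck_Suc by blast

lemma infinite_chain_iff:
  assumes "word_shape D = Nat"
  shows "(\<forall>n\<ge>1. f (n - 1) \<in> letter_relation Q \<rho> M (letter_at D (int n)) `` {f n}) \<longleftrightarrow>
    (\<forall>n. (f (Suc n), f n) \<in> letter_relation Q \<rho> M (word_letters D n))"
proof
  assume L: "\<forall>n\<ge>1. f (n - 1) \<in> letter_relation Q \<rho> M (letter_at D (int n)) `` {f n}"
  show "\<forall>n. (f (Suc n), f n) \<in> letter_relation Q \<rho> M (word_letters D n)"
    using spec[OF L, of "Suc _"] by (simp add: word_letters_def add.commute)
next
  assume R: "\<forall>n. (f (Suc n), f n) \<in> letter_relation Q \<rho> M (word_letters D n)"
  show "\<forall>n\<ge>1. f (n - 1) \<in> letter_relation Q \<rho> M (letter_at D (int n)) `` {f n}"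
  proof (intro allI impI)
    fix n :: nat assume "n \<ge> 1"
    then obtain k where "n = Suc k" by (cases n) auto
    then show "f (n - 1) \<in> letter_relation Q \<rho> M (letter_at D (int n)) `` {f n}"
      using spec[OF R, of k] by (simp add: word_letters_def add.commute)
  qed
qed

lemma Nat_word_letters:
  assumes "is_word Q \<rho> D" "word_shape D = Nat"
  shows "letter_arrow (word_letters D n) \<in> arcs Q"
    "letter_tail Q (word_letters D n) = letter_head Q (word_letters D (Suc n))"
    "word_head Q D = letter_head Q (word_letters D 0)"
proof -
  show "letter_arrow (word_letters D n) \<in> arcs Q"
    unfolding word_letters_def by (rule word_letter(1)[OF assms(1)]) (simp add: assms(2) positions_simps)
  show "letter_tail Q (word_letters D n) = letter_head Q (word_letters D (Suc n))"
    by (rule word_letters_reduced(2)[OF assms(1)]) (simp add: assms(2) positions_simps)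
  show "word_head Q D = letter_head Q (word_letters D 0)"
    using assms by (cases D) (auto simp: word_head_def word_letters_def positions_simps)
qed

lemma infinite_plus_supported:
  assumes D: "is_word Q \<rho> D" "word_shape D = Nat"
  shows "functor_plus Q \<rho> \<sigma> M D =
    supported (\<lambda>s i. word_vertex Q (wd s) i = word_head Q D \<and> upto_word Q \<rho> \<sigma> D (wd s) i)" (is "_ = ?R")
proof -
  let ?c = "word_letters D"
  note c = Nat_word_letters[OF D]
  have L: "functor_plus Q \<rho> \<sigma> M D =
    {m \<in> carrier M. \<exists>f. f 0 = m \<and> (\<forall>n. (f (Suc n), f n) \<in> letter_relation Q \<rho> M (?c n))}"
    unfolding functor_plus_def infinite_chain_iff[OF D(2)] using D(2) by simp
  have up: "upto_word Q \<rho> \<sigma> D C i \<longleftrightarrow> (\<exists>n. stuck C ?c n i) \<or> (\<forall>n. \<exists>j. follows C ?c n i j)" for C :: "('v, 'a) qword" and i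
    unfolding upto_word_def using D(2) by simp
  show ?thesis
  proof
    show "functor_plus Q \<rho> \<sigma> M D \<subseteq> ?R"
    proof
      fix m assume "m \<in> functor_plus Q \<rho> \<sigma> M D"
      then obtain f where f: "f 0 = m" "\<And>n. (f (Suc n), f n) \<in> letter_relation Q \<rho> M (?c n)" "m \<in> carrier M"
        unfolding L by blast
      have "word_vertex Q (wd s) i = word_head Q D \<and> upto_word Q \<rho> \<sigma> D (wd s) i"
        if s: "s \<in> J" "i \<in> I s" "co m s i \<noteq> z s" for s i
      proof
        have "m \<in> supported (\<lambda>s i. word_vertex Q (wd s) i = letter_head Q (?c 0))"
          using letter_relation_coord(2)[OF c(1) f(2), of 0] f(1) by simp
        then show "word_vertex Q (wd s) i = word_head Q D" using supportedD(1) s c(3) by simp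
        show "upto_word Q \<rho> \<sigma> D (wd s) i"
          using chain_coordinates[of ?c f s i] c(1) f s unfolding up by blast
      qed
      then show "m \<in> ?R" using f(3) by (simp add: supported_def)
    qed
    show "?R \<subseteq> functor_plus Q \<rho> \<sigma> M D"
    proof
      fix m assume m: "m \<in> ?R"
      \<comment> \<open>This is the condition of \<open>upto_word\<close> for what remains of
        \<open>D\<close> after \<open>n\<close> letters.\<close>
      define R where "R n s i \<longleftrightarrow> (\<exists>q. stuck (wd s) (\<lambda>k. ?c (n + k)) q i) \<or>
        (\<forall>q. \<exists>j. follows (wd s) (\<lambda>k. ?c (n + k)) q i j)" for n s i
      have "\<exists>f. f 0 = m \<and> (\<forall>n. (f (Suc n), f n) \<in> letter_relation Q \<rho> M (?c n) \<and> f n \<in> supported (R n))"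
      proof (rule chain_exists[where c = ?c, OF c(1) c(2)])
        fix n s i x assume s: "s \<in> J" "i \<in> I s" "R n s i" "?c n = Direct x"
        then consider q where "stuck (wd s) (\<lambda>k. ?c (n + k)) q i"
          | j where "follows (wd s) (\<lambda>k. ?c (n + k)) 1 i j" unfolding R_def by blast
        then show "\<exists>j. step (wd s) i (?c n) j"
        proof cases
          case 1
          then show ?thesis using s(4) by (cases q) (auto simp: stuck_Suc)
        qed auto
      next
        fix n s i j assume s: "s \<in> J" "i \<in> I s" "R n s i" and st: "step (wd s) i (?c n) j"
        have st': "step (wd s) i (?c (n + 0)) j" using st by simp
        show "R (Suc n) s j"
        proof (cases "\<exists>q. stuck (wd s) (\<lambda>k. ?c (n + k)) q i")
          case True
          then obtain q where q: "stuck (wd s) (\<lambda>k. ?c (n + k)) q i" by blast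
          then obtain q' where "q = Suc q'" by (cases q) auto
          then have "stuck (wd s) (\<lambda>k. ?c (Suc n + k)) q' j"
            using q stuck_step[where c = "\<lambda>k. ?c (n + k)", OF word[OF s(1)] st'] by simp
          then show ?thesis unfolding R_def by blast
        next
          case False
          then have F: "\<exists>j'. follows (wd s) (\<lambda>k. ?c (n + k)) (Suc q) i j'" for q using s(3) unfolding R_def by blast
          have "\<exists>j'. follows (wd s) (\<lambda>k. ?c (Suc n + k)) q j j'" for q
            using F[of q] step_unique[OF word[OF s(1)] st] by auto
          then show ?thesis unfolding R_def by blast
        qed
      next
        show "m \<in> supported (\<lambda>s i. word_vertex Q (wd s) i = letter_head Q (?c 0) \<and> R 0 s i)"
          using m unfolding R_def up c(3) by simp
      qed
      then show "m \<in> functor_plus Q \<rho> \<sigma> M D" unfolding L using supportedD(2)[OF m] by blast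
    qed
  qed
qed

text \<open>An element can have infinitely many nonzero coordinates in a periodic summand. Being
  stuck depends only on the rays, so finitely many representatives decide, and one bound serves the
  whole element, as an eventually zero sequence requires.\<close>

lemma stuck_bound:
  assumes "m \<in> carrier M" "\<And>s i. s \<in> J \<Longrightarrow> i \<in> I s \<Longrightarrow> co m s i \<noteq> z s \<Longrightarrow> \<exists>n. stuck (wd s) c n i"
  shows "\<exists>N. \<forall>s\<in>J. \<forall>i\<in>I s. co m s i \<noteq> z s \<longrightarrow> stuck (wd s) c N i"
proof -
  obtain K where K: "finite K" "\<And>s i. s \<in> J \<Longrightarrow> i \<in> I s \<Longrightarrow> co m s i \<noteq> z s \<Longrightarrow>
      \<exists>i'\<in>I s. (s, i') \<in> K \<and> (\<forall>d. ray (wd s) i d = ray (wd s) i' d)"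
    using finite_rays[OF assms(1)] by blast
  define N where "N p = (SOME n. stuck (wd (fst p)) c n (snd p))" for p
  define B where "B = Max (insert 0 (N ` K))"
  have "stuck (wd s) c B i" if s: "s \<in> J" "i \<in> I s" "co m s i \<noteq> z s" for s i
  proof -
    obtain i' where i': "i' \<in> I s" "(s, i') \<in> K" "\<And>d. ray (wd s) i d = ray (wd s) i' d" using K(2)[OF s] by blast
    obtain n where "stuck (wd s) c n i" using assms(2)[OF s] by blast
    then have "stuck (wd s) c n i'" using same_rays_invariant(1)[OF word[OF s(1)] s(2) i'(1,3)] by simp
    then have "stuck (wd s) c (N (s, i')) i'" unfolding N_def by (metis fst_conv snd_conv someI)
    moreover have "N (s, i') \<le> B" unfolding B_def using K(1) i'(2) by (intro Max_ge) auto
    ultimately have "stuck (wd s) c B i'" by (rule stuck_mono)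
    then show ?thesis using same_rays_invariant(1)[OF word[OF s(1)] s(2) i'(1,3)] by simp
  qed
  then show ?thesis by blast
qed

lemma infinite_minus_supported:
  assumes D: "is_word Q \<rho> D" "word_shape D = Nat"
  shows "functor_minus Q \<rho> \<sigma> M D =
    supported (\<lambda>s i. word_vertex Q (wd s) i = word_head Q D \<and> below_word Q \<rho> \<sigma> D (wd s) i)" (is "_ = ?R")
proof -
  let ?c = "word_letters D"
  note c = Nat_word_letters[OF D]
  have L: "functor_minus Q \<rho> \<sigma> M D = {m \<in> carrier M. \<exists>f. f 0 = m \<and>
      (\<forall>n. (f (Suc n), f n) \<in> letter_relation Q \<rho> M (?c n)) \<and> (\<exists>N. \<forall>n\<ge>N. f n = \<zero>\<^bsub>M\<^esub>)}"
    unfolding functor_minus_def conj_assoc[symmetric]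
    using D(2) infinite_chain_iff[OF D(2)] by (simp add: conj_assoc)
  have below: "below_word Q \<rho> \<sigma> D C i \<longleftrightarrow> (\<exists>n. stuck C ?c n i)" for C :: "('v, 'a) qword" and i
    unfolding below_word_def using D(2) by simp
  show ?thesis
  proof
    show "functor_minus Q \<rho> \<sigma> M D \<subseteq> ?R"
    proof
      fix m assume "m \<in> functor_minus Q \<rho> \<sigma> M D"
      then obtain f N where f: "f 0 = m" "\<And>n. (f (Suc n), f n) \<in> letter_relation Q \<rho> M (?c n)" "m \<in> carrier M"
        "\<forall>n\<ge>N. f n = \<zero>\<^bsub>M\<^esub>" unfolding L by blast
      have "word_vertex Q (wd s) i = word_head Q D \<and> below_word Q \<rho> \<sigma> D (wd s) i"
        if s: "s \<in> J" "i \<in> I s" "co m s i \<noteq> z s" for s i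
      proof
        have "m \<in> supported (\<lambda>s i. word_vertex Q (wd s) i = letter_head Q (?c 0))"
          using letter_relation_coord(2)[OF c(1) f(2), of 0] f(1) by simp
        then show "word_vertex Q (wd s) i = word_head Q D" using supportedD(1) s c(3) by simp
        show "below_word Q \<rho> \<sigma> D (wd s) i"
        proof (rule ccontr)
          assume "\<not> below_word Q \<rho> \<sigma> D (wd s) i"
          then obtain j where "j \<in> I s" "co (f N) s j = co (f 0) s i"
            using chain_coordinates[of ?c f s i N] c(1) f s unfolding below by blast
          then show False using f(1,4) s co_zero[OF s(1)] by simp
        qed
      qed
      then show "m \<in> ?R" using f(3) by (simp add: supported_def)
    qed
    show "?R \<subseteq> functor_minus Q \<rho> \<sigma> M D"
    proof
      fix m assume m: "m \<in> ?R"
      obtain N where N: "\<forall>s\<in>J. \<forall>i\<in>I s. co m s i \<noteq> z s \<longrightarrow> stuck (wd s) ?c N i"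
        using stuck_bound[OF supportedD(2)[OF m], of ?c] supportedD(1)[OF m] unfolding below by blast
      \<comment> \<open>The reading of the remaining letters breaks off within \<open>N - n\<close>
        of them. At \<open>n = N\<close> no position is left and the sequence becomes zero.\<close>
      define R where "R n s i \<longleftrightarrow> stuck (wd s) (\<lambda>k. ?c (n + k)) (N - n) i" for n s i
      have "\<exists>f. f 0 = m \<and> (\<forall>n. (f (Suc n), f n) \<in> letter_relation Q \<rho> M (?c n) \<and> f n \<in> supported (R n))"
      proof (rule chain_exists[where c = ?c, OF c(1) c(2)])
        fix n s i x assume s: "s \<in> J" "i \<in> I s" "R n s i" "?c n = Direct x"
        then show "\<exists>j. step (wd s) i (?c n) j"
          unfolding R_def by (cases "N - n") (auto simp: stuck_Suc)
      next
        fix n s i j assume s: "s \<in> J" "i \<in> I s" "R n s i" and st: "step (wd s) i (?c n) j"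
        have st': "step (wd s) i (?c (n + 0)) j" using st by simp
        obtain q where q: "N - n = Suc q" using s(3) unfolding R_def by (cases "N - n") auto
        then have "N - Suc n = q" by simp
        then show "R (Suc n) s j" using s(3) q
          stuck_step[where c = "\<lambda>k. ?c (n + k)", OF word[OF s(1)] st'] unfolding R_def by simp
      next
        show "m \<in> supported (\<lambda>s i. word_vertex Q (wd s) i = letter_head Q (?c 0) \<and> R 0 s i)"
          using m N unfolding R_def c(3) by (simp add: supported_def)
      qed
      then obtain f where f: "f 0 = m" "\<And>n. (f (Suc n), f n) \<in> letter_relation Q \<rho> M (?c n)"
        "\<And>n. f n \<in> supported (R n)" by blast
      have "f n = \<zero>\<^bsub>M\<^esub>" if "n \<ge> N" for n
      proof -
        have "R n = (\<lambda>s i. False)" using that by (simp add: R_def fun_eq_iff)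
        then show ?thesis using f(3)[of n] supported_False by simp
      qed
      then show "m \<in> functor_minus Q \<rho> \<sigma> M D" unfolding L using supportedD(2)[OF m] f(1,2) by blast
    qed
  qed
qed

section \<open>\<open>F_plus\<close> and \<open>F_minus\<close> in terms of positions\<close>

lemma functor_supported:
  assumes D: "is_word Q \<rho> D" "has_head D"
  shows "functor_plus Q \<rho> \<sigma> M D =
      supported (\<lambda>s i. word_vertex Q (wd s) i = word_head Q D \<and> upto_word Q \<rho> \<sigma> D (wd s) i)"
    "functor_minus Q \<rho> \<sigma> M D =
      supported (\<lambda>s i. word_vertex Q (wd s) i = word_head Q D \<and> below_word Q \<rho> \<sigma> D (wd s) i)"
proof -
  consider "word_shape D = Nat" | n where "word_shape D = Fin n"
    using D(2) by (cases "word_shape D") (auto simp: has_head_def)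
  then show "functor_plus Q \<rho> \<sigma> M D =
      supported (\<lambda>s i. word_vertex Q (wd s) i = word_head Q D \<and> upto_word Q \<rho> \<sigma> D (wd s) i)"
    "functor_minus Q \<rho> \<sigma> M D =
      supported (\<lambda>s i. word_vertex Q (wd s) i = word_head Q D \<and> below_word Q \<rho> \<sigma> D (wd s) i)"
  proof (atomize (full), cases)
    case 1
    then show "functor_plus Q \<rho> \<sigma> M D =
      supported (\<lambda>s i. word_vertex Q (wd s) i = word_head Q D \<and> upto_word Q \<rho> \<sigma> D (wd s) i) \<and>
      functor_minus Q \<rho> \<sigma> M D =
      supported (\<lambda>s i. word_vertex Q (wd s) i = word_head Q D \<and> below_word Q \<rho> \<sigma> D (wd s) i)"
      using infinite_plus_supported[OF D(1)] infinite_minus_supported[OF D(1)] by blast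
  next
    case 2
    then show "functor_plus Q \<rho> \<sigma> M D =
      supported (\<lambda>s i. word_vertex Q (wd s) i = word_head Q D \<and> upto_word Q \<rho> \<sigma> D (wd s) i) \<and>
      functor_minus Q \<rho> \<sigma> M D =
      supported (\<lambda>s i. word_vertex Q (wd s) i = word_head Q D \<and> below_word Q \<rho> \<sigma> D (wd s) i)"
      using finite_plus_supported[OF D(1)] finite_minus_supported[OF D(1)]
      by (simp add: functor_plus_def functor_minus_def)
  qed
qed

definition split_cell :: "('v, 'a) qword \<Rightarrow> ('v, 'a) qword \<Rightarrow> 's \<Rightarrow> int \<Rightarrow> bool" where
  "split_cell B D s i \<longleftrightarrow> (\<exists>d. splits_at Q B D (wd s) i d)"

text \<open>The positions in the support of \<open>F\<^sup>+\<close> but not of \<open>F\<^sup>-\<close> are those where the word is \<open>B\<^sup>-\<^sup>1 D\<close>.\<close>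

lemma F_supported:
  assumes B: "is_word Q \<rho> B" "has_head B" and D: "is_word Q \<rho> D" "has_head D"
    and head: "word_head Q B = word_head Q D" and sign: "word_sign \<sigma> B = - word_sign \<sigma> D"
  obtains P where "F_plus Q \<rho> \<sigma> M B D = supported P"
    "F_minus Q \<rho> \<sigma> M B D = supported (\<lambda>s i. P s i \<and> \<not> split_cell B D s i)"
    "\<And>s i. split_cell B D s i \<Longrightarrow> s \<in> J \<Longrightarrow> P s i" "ray_invariant P"
    "\<And>s i. s \<in> J \<Longrightarrow> i \<in> I s \<Longrightarrow> P s i \<Longrightarrow> word_vertex Q (wd s) i = word_head Q D"
proof -
  let ?v = "\<lambda>s i. word_vertex Q (wd s) i = word_head Q D"
  let ?u = "\<lambda>X s i. upto_word Q \<rho> \<sigma> X (wd s) i" and ?b = "\<lambda>X s i. below_word Q \<rho> \<sigma> X (wd s) i"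
  define P where "P s i \<longleftrightarrow> ?v s i \<and> ?u B s i \<and> ?u D s i" for s i
  note FB = functor_supported[OF B, unfolded head] and FD = functor_supported[OF D]
  have plus: "F_plus Q \<rho> \<sigma> M B D = supported P"
    unfolding F_plus_def FB FD supported_Int P_def by (rule supported_cong) auto
  have inv: "ray_invariant (\<lambda>s i. (?v s i \<and> ?u B s i) \<and> ?v s i \<and> ?b D s i)" and invP: "ray_invariant P"
    unfolding ray_invariant_def P_def using same_rays_invariant[OF word] same_rays_translate(2)[OF word] by metis+
  have sp: "?u B s i \<and> \<not> ?b B s i \<and> ?u D s i \<and> \<not> ?b D s i \<longleftrightarrow> split_cell B D s i"
    if "s \<in> J" "i \<in> I s" "?v s i" for s i
    using upto_not_below_both_iff[OF signs word[OF that(1)] B D head sign that(2,3)] unfolding split_cell_def by blast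
  have minus: "F_minus Q \<rho> \<sigma> M B D = supported (\<lambda>s i. P s i \<and> \<not> split_cell B D s i)"
    unfolding F_minus_def FB FD supported_Int supported_sum[OF inv]
  proof (rule supported_cong)
    fix s i assume s: "s \<in> J" "i \<in> I s"
    \<comment> \<open>Since being below implies being at most, the two summands cover exactly those
      positions of \<open>P\<close> that are below \<open>B\<close> or below
      \<open>D\<close>.\<close>
    show "((?v s i \<and> ?u B s i) \<and> ?v s i \<and> ?b D s i \<or> (?v s i \<and> ?b B s i) \<and> ?v s i \<and> ?u D s i) =
      (P s i \<and> \<not> split_cell B D s i)"
      using sp[OF s] below_upto[OF signs word[OF s(1)]] unfolding P_def by blast
  qed
  have cell: "P s i" if "split_cell B D s i" "s \<in> J" for s i
  proof -
    have "i \<in> I s" "?v s i" using that(1) by (auto simp: split_cell_def splits_at_def)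
    then show ?thesis using sp[OF that(2)] that(1) unfolding P_def by blast
  qed
  show ?thesis
    by (rule that[OF plus minus cell invP]) (auto simp: P_def)
qed

lemma chain_relation_coord:
  assumes "(m', m) \<in> chain_relation c n" "\<And>k. k < n \<Longrightarrow> letter_arrow (c k) \<in> arcs Q"
    "s \<in> J" "follows (wd s) c n i j"
  shows "co m s i = co m' s j"
  using assms
proof (induction n arbitrary: c m i)
  case (Suc n)
  then obtain m1 where m1: "(m', m1) \<in> chain_relation (\<lambda>k. c (Suc k)) n" "(m1, m) \<in> letter_relation Q \<rho> M (c 0)"
    by auto
  obtain k where k: "step (wd s) i (c 0) k" "follows (wd s) (\<lambda>n. c (Suc n)) n k j" using Suc.prems(4) by auto
  have "co m s i = co m1 s k" using letter_relation_coord(4)[OF Suc.prems(2)[of 0] m1(2) Suc.prems(3) k(1)] by simp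
  also have "\<dots> = co m' s j" using Suc.IH[OF m1(1) _ Suc.prems(3) k(2)] Suc.prems(2) by simp
  finally show ?case .
qed auto

text \<open>Here the element at the tail is given, so the letters are used inverted, from the last
  to the first. Every coordinate of \<open>m'\<close> sits at the end of a reading of
  \<open>c\<close>, so none of these backward steps can fail.\<close>

lemma chain_relation_backward:
  assumes "\<And>k. k < n \<Longrightarrow> letter_arrow (c k) \<in> arcs Q"
    and "m' \<in> supported (\<lambda>s j. \<exists>i. follows (wd s) c n i j)"
  shows "\<exists>m\<in>carrier M. (m', m) \<in> chain_relation c n \<and>
    (\<forall>s\<in>J. \<forall>i\<in>I s. co m s i \<noteq> z s \<longrightarrow> (\<exists>j. follows (wd s) c n i j \<and> co m' s j \<noteq> z s))"
  using assms
proof (induction n arbitrary: c)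
  case (Suc n)
  let ?c = "\<lambda>k. c (Suc k)"
  have l: "letter_arrow (letter_inv (c 0)) \<in> arcs Q" using Suc.prems(1)[of 0] by simp
  have "m' \<in> supported (\<lambda>s j. \<exists>i. follows (wd s) ?c n i j)"
    using Suc.prems(2) unfolding supported_def by auto
  then obtain m1 where m1: "m1 \<in> carrier M" "(m', m1) \<in> chain_relation ?c n"
    "\<And>s k. s \<in> J \<Longrightarrow> k \<in> I s \<Longrightarrow> co m1 s k \<noteq> z s \<Longrightarrow> \<exists>j. follows (wd s) ?c n k j \<and> co m' s j \<noteq> z s"
    using Suc.IH[of ?c] Suc.prems(1) by (metis Suc_mono)
  have prev: "\<exists>i. step (wd s) i (c 0) k" if s: "s \<in> J" "k \<in> I s" "co m1 s k \<noteq> z s" for s k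
  proof -
    obtain j where j: "follows (wd s) ?c n k j" "co m' s j \<noteq> z s" using m1(3)[OF s] by blast
    have "j \<in> I s" using follows_end(1)[OF word[OF s(1)] j(1) s(2)] .
    then obtain i where "follows (wd s) c (Suc n) i j" using supportedD(1)[OF Suc.prems(2) s(1) _ j(2)] by blast
    then obtain k' where k': "step (wd s) i (c 0) k'" "follows (wd s) ?c n k' j" by auto
    have "k' = k" using follows_back_unique[OF word[OF s(1)] k'(2) j(1)] .
    then show ?thesis using k'(1) by blast
  qed
  have inv: "step (wd s) k (letter_inv (c 0)) i \<longleftrightarrow> step (wd s) i (c 0) k" for s i k
    using step_inv[of "wd s" i "c 0" k] by simp
  have "m1 \<in> supported (\<lambda>s k. word_vertex Q (wd s) k = letter_head Q (letter_inv (c 0)))"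
    using m1(1) prev step_props(5)[OF word] by (fastforce simp: supported_def)
  moreover have "m1 \<in> supported (\<lambda>s k. \<exists>i. step (wd s) k (letter_inv (c 0)) i)"
    using m1(1) prev unfolding supported_def inv by blast
  ultimately obtain m where m: "(m, m1) \<in> letter_relation Q \<rho> M (letter_inv (c 0))" "m \<in> carrier M"
    "\<forall>s\<in>J. \<forall>i\<in>I s. co m s i \<noteq> z s \<longrightarrow> (\<exists>k. step (wd s) k (letter_inv (c 0)) i \<and> co m1 s k \<noteq> z s)"
    using letter_relation_follow[OF l, of m1] by blast
  have "(m', m) \<in> chain_relation c (Suc n)"
    using m1(2) m(1) unfolding letter_relation_inv by auto
  moreover have "\<exists>j. follows (wd s) c (Suc n) i j \<and> co m' s j \<noteq> z s" if s: "s \<in> J" "i \<in> I s" "co m s i \<noteq> z s" for s i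
  proof -
    obtain k where k: "step (wd s) i (c 0) k" "co m1 s k \<noteq> z s" using m(3) s unfolding inv by blast
    obtain j where "follows (wd s) ?c n k j \<and> co m' s j \<noteq> z s"
      using m1(3)[OF s(1) step_props(2)[OF word[OF s(1)] k(1)] k(2)] by blast
    then show ?thesis using k(1) by auto
  qed
  ultimately show ?case using m(2) by blast
qed (auto simp: supported_def)

end

section \<open>The action of the quotient algebra on a string module\<close>

lemma sum_keys_superset:
  assumes "finite A" "Poly_Mapping.keys f \<subseteq> A" "\<And>k. F k 0 = 0"
  shows "(\<Sum>k\<in>Poly_Mapping.keys f. F k (Poly_Mapping.lookup f k)) = (\<Sum>k\<in>A. F k (Poly_Mapping.lookup f k))"
  by (rule sum.mono_neutral_left) (use assms in \<open>auto simp: in_keys_iff\<close>)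

text \<open>The actions are sums over the support of their argument, and supports are not additive
  because of cancellation. A common finite superset repairs this.\<close>

lemma sum_keys_add:
  assumes "\<And>k. F k 0 = 0" "\<And>k a b. F k (a + b) = F k a + F k b"
  shows "(\<Sum>k\<in>Poly_Mapping.keys (f + g). F k (Poly_Mapping.lookup (f + g) k)) =
    (\<Sum>k\<in>Poly_Mapping.keys f. F k (Poly_Mapping.lookup f k)) +
    (\<Sum>k\<in>Poly_Mapping.keys g. F k (Poly_Mapping.lookup g k))"
proof -
  let ?A = "Poly_Mapping.keys f \<union> Poly_Mapping.keys g"
  have A: "finite ?A" "Poly_Mapping.keys (f + g) \<subseteq> ?A" using keys_add[of f g] by auto
  show ?thesis
    using sum_keys_superset[OF A, of F] sum_keys_superset[OF A(1), of f F] sum_keys_superset[OF A(1), of g F] assms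
    by (simp add: lookup_add sum.distrib)
qed

lemma poly_mapping_sum_singles:
  fixes f :: "'i \<Rightarrow>\<^sub>0 'k::comm_monoid_add"
  shows "(\<Sum>k\<in>Poly_Mapping.keys f. Poly_Mapping.single k (Poly_Mapping.lookup f k)) = f"
  by (rule poly_mapping_eqI) (simp add: lookup_sum lookup_single when_def in_keys_iff)

lemma poly_mapping_single_induct [case_names zero single add]:
  fixes f :: "'i \<Rightarrow>\<^sub>0 'k::comm_monoid_add"
  assumes "P 0" "\<And>k c. k \<in> Poly_Mapping.keys f \<Longrightarrow> P (Poly_Mapping.single k c)" "\<And>f g. P f \<Longrightarrow> P g \<Longrightarrow> P (f + g)"
  shows "P f"
proof -
  have "P (\<Sum>k\<in>A. Poly_Mapping.single k (Poly_Mapping.lookup f k))" if "finite A" "A \<subseteq> Poly_Mapping.keys f" for A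
    using that by (induction A) (auto intro: assms)
  from this[of "Poly_Mapping.keys f"] show ?thesis by (simp add: poly_mapping_sum_singles)
qed

section \<open>Linear maps that move basis vectors\<close>

definition scale :: "'k::field \<Rightarrow> ('i \<Rightarrow>\<^sub>0 'k) \<Rightarrow> ('i \<Rightarrow>\<^sub>0 'k)" where
  "scale c = Poly_Mapping.map (\<lambda>t. c * t)"

lemma lookup_scale [simp]: "Poly_Mapping.lookup (scale c f) i = c * Poly_Mapping.lookup f i"
  by (simp add: scale_def map.rep_eq when_def)

lemma scale_add: "scale c (f + g) = scale c f + scale c g" "scale (a + b) f = scale a f + scale b f"
  "scale c 0 = 0" "scale 0 f = 0" "scale a (scale b f) = scale (a * b) f"
  by (rule poly_mapping_eqI; simp add: lookup_add algebra_simps)+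

lemma scale_sum: "scale c (sum F A) = (\<Sum>x\<in>A. scale c (F x))"
  by (rule poly_mapping_eqI) (simp add: lookup_sum sum_distrib_left)

lemma scale_single [simp]: "scale c (Poly_Mapping.single i d) = Poly_Mapping.single i (c * d)"
  by (rule poly_mapping_eqI) (simp add: lookup_single when_def)

text \<open>The linear map taking the basis vector at \<open>i\<close> to the one at
  \<open>h i\<close>, or to zero. Every path acts on \<open>M(C)\<close> in this way, which reduces
  the module laws to partial maps of positions.\<close>

definition move :: "('i \<Rightarrow> 'j option) \<Rightarrow> ('i \<Rightarrow>\<^sub>0 'k::comm_monoid_add) \<Rightarrow> ('j \<Rightarrow>\<^sub>0 'k)" where
  "move h f = (\<Sum>i\<in>Poly_Mapping.keys f.
     case h i of None \<Rightarrow> 0 | Some j \<Rightarrow> Poly_Mapping.single j (Poly_Mapping.lookup f i))"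

lemma move_add: "move h (f + g) = move h f + move h g"
  unfolding move_def
  by (rule sum_keys_add[where F = "\<lambda>i t. case h i of None \<Rightarrow> 0 | Some j \<Rightarrow> Poly_Mapping.single j t"])
    (auto simp: single_add split: option.split)

lemma move_0 [simp]: "move h 0 = 0"
  by (simp add: move_def)

lemma move_single: "move h (Poly_Mapping.single i c) = (case h i of None \<Rightarrow> 0 | Some j \<Rightarrow> Poly_Mapping.single j c)"
  by (cases "c = 0") (auto simp: move_def split: option.split)

lemma move_move: "move g (move h f) = move (\<lambda>i. Option.bind (h i) g) f"
  by (induction f rule: poly_mapping_single_induct)
    (auto simp: move_add move_single split: option.split)

lemma move_cong: "(\<And>i. i \<in> Poly_Mapping.keys f \<Longrightarrow> h i = h' i) \<Longrightarrow> move h f = move h' f"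
  by (simp add: move_def)

lemma move_none: "(\<And>i. i \<in> Poly_Mapping.keys f \<Longrightarrow> h i = None) \<Longrightarrow> move h f = 0"
  by (simp add: move_def)

lemma keys_move: "Poly_Mapping.keys (move h f) \<subseteq> {j. \<exists>i\<in>Poly_Mapping.keys f. h i = Some j}"
proof
  fix j assume "j \<in> Poly_Mapping.keys (move h f)"
  then have "(\<Sum>i\<in>Poly_Mapping.keys f. Poly_Mapping.lookup (case h i of None \<Rightarrow> 0 | Some j \<Rightarrow>
       Poly_Mapping.single j (Poly_Mapping.lookup f i)) j) \<noteq> 0"
    by (simp add: move_def in_keys_iff lookup_sum)
  then obtain i where "i \<in> Poly_Mapping.keys f" "Poly_Mapping.lookup (case h i of None \<Rightarrow> 0 | Some j \<Rightarrow>
       Poly_Mapping.single j (Poly_Mapping.lookup f i)) j \<noteq> 0"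
    by (meson sum.not_neutral_contains_not_neutral)
  then show "j \<in> {j. \<exists>i\<in>Poly_Mapping.keys f. h i = Some j}"
    by (auto simp: lookup_single when_def split: option.splits if_splits)
qed

lemma move_scale: "move h (scale c f) = scale c (move h f)"
proof (induction f rule: poly_mapping_single_induct)
  case (single k d)
  show ?case by (auto simp: move_single scale_add split: option.split)
qed (auto simp: move_add scale_add)

lemma lookup_move:
  assumes "\<And>i i'. h i = Some j \<Longrightarrow> h i' = Some j \<Longrightarrow> i = i'" "h i = Some j"
  shows "Poly_Mapping.lookup (move h f) j = Poly_Mapping.lookup f i"
proof (induction f rule: poly_mapping_single_induct)
  case (single k c)
  show ?case
  proof (cases "k = i")
    case True
    then show ?thesis using assms(2) by (simp add: move_single)
  next
    case False
    then have "h k \<noteq> Some j" using assms by blast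
    then show ?thesis using False by (simp add: move_single lookup_single when_def split: option.split)
  qed
qed (auto simp: move_add lookup_add)

lemma lookup_move_zero: "(\<And>i. h i \<noteq> Some j) \<Longrightarrow> Poly_Mapping.lookup (move h f) j = 0"
  using keys_move[of h f] by (auto simp: in_keys_iff)

definition arrow_move :: "('v, 'a) qword \<Rightarrow> 'a \<Rightarrow> int \<Rightarrow> int option" where
  "arrow_move C x i =
     (if i \<in> positions (word_shape C) \<and> letter_at C i = Direct x then Some (i - 1)
      else if i + 1 \<in> positions (word_shape C) \<and> letter_at C (i + 1) = Inverse x then Some (i + 1)
      else None)"

definition vertex_move :: "('v, 'a) pre_digraph \<Rightarrow> ('v, 'a) qword \<Rightarrow> 'v \<Rightarrow> int \<Rightarrow> int option" where
  "vertex_move Q C v i = (if word_vertex Q C i = v then Some i else None)"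

fun arrows_move :: "('v, 'a) qword \<Rightarrow> 'a list \<Rightarrow> int \<Rightarrow> int option" where
  "arrows_move C [] i = Some i"
| "arrows_move C (x # xs) i = Option.bind (arrows_move C xs i) (arrow_move C x)"

definition path_move :: "('v, 'a) pre_digraph \<Rightarrow> ('v, 'a) qword \<Rightarrow> ('v, 'a) qpath \<Rightarrow> int \<Rightarrow> int option" where
  "path_move Q C p = (if snd p = [] then vertex_move Q C (fst p) else arrows_move C (snd p))"

lemma arrow_action_move: "arrow_action C x f = move (arrow_move C x) f"
  unfolding arrow_action_def move_def by (rule sum.cong) (auto simp: arrow_move_def)

lemma path_action_move: "path_action Q C p f = move (path_move Q C p) f"
proof -
  have "foldr (arrow_action C) xs f = move (arrows_move C xs) f" for xs
  proof (induction xs)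
    case Nil
    have "arrows_move C [] = Some" by (rule ext) simp
    then show ?case by (simp add: move_def poly_mapping_sum_singles)
  next
    case (Cons x xs)
    then show ?case by (simp add: arrow_action_move move_move)
  qed
  moreover have "vertex_action Q C v f = move (vertex_move Q C v) f" for v
    unfolding vertex_action_def move_def by (rule sum.cong) (auto simp: vertex_move_def)
  ultimately show ?thesis by (simp add: path_action_def path_move_def)
qed

text \<open>In the definition the first case takes precedence. The two cases exclude each other in a
  reduced word, so the result is symmetric in the two directions, as \<open>step\<close> is.\<close>

lemma arrow_move_step:
  assumes "is_word Q \<rho> C"
  shows "arrow_move C x i = Some j \<longleftrightarrow> step C j (Direct x) i"
proof
  assume "arrow_move C x i = Some j"
  then consider "i \<in> positions (word_shape C)" "letter_at C i = Direct x" "j = i - 1"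
    | "i + 1 \<in> positions (word_shape C)" "letter_at C (i + 1) = Inverse x" "j = i + 1"
    by (auto simp: arrow_move_def split: if_splits)
  then show "step C j (Direct x) i"
  proof cases
    case 1
    then show ?thesis unfolding step_def by (intro exI[of _ True]) (simp add: out_letter_def)
  next
    case 2
    then show ?thesis unfolding step_def by (intro exI[of _ False]) (simp add: out_letter_def)
  qed
next
  assume st: "step C j (Direct x) i"
  then obtain d where d: "out_letter C j d = Some (Direct x)" "i = j + dir d" by (auto simp: step_def)
  have "\<exists>j'. arrow_move C x i = Some j' \<and> step C j' (Direct x) i"
  proof (cases d)
    case True
    then have "arrow_move C x i = Some j" using d by (auto simp: arrow_move_def out_letter_def split: if_splits)
    then show ?thesis using st by blast
  next
    case False
    then have l: "j \<in> positions (word_shape C)" "letter_at C j = Inverse x" "i = j - 1"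
      using d by (auto simp: out_letter_def split: if_splits) (metis letter_inv.simps(1) letter_inv_inv)
    have "\<not> (i \<in> positions (word_shape C) \<and> letter_at C i = Direct x)"
      using word_letter(3)[OF assms, of i] l by auto
    then have "arrow_move C x i = Some j" using l by (auto simp: arrow_move_def)
    then show ?thesis using st by blast
  qed
  then obtain j' where j': "arrow_move C x i = Some j'" "step C j' (Direct x) i" by blast
  moreover have "j' = j"
    using step_unique[OF assms, of i "letter_inv (Direct x)"] j'(2) st step_inv[of C _ "Direct x" i] by blast
  ultimately show "arrow_move C x i = Some j" by simp
qed

lemma arrows_move_append:
  "arrows_move C (xs @ ys) i = Option.bind (arrows_move C ys i) (arrows_move C xs)"
proof (induction xs)
  case Nil
  have "Option.bind a Some = a" for a :: "int option" by (cases a) auto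
  moreover have "arrows_move C [] = Some" by (rule ext) simp
  ultimately show ?case by simp
next
  case (Cons x xs)
  then show ?case by (cases "arrows_move C ys i") auto
qed

lemma arrows_move_follows:
  assumes "is_word Q \<rho> C"
  shows "arrows_move C xs i = Some j \<Longrightarrow> follows C (\<lambda>k. Direct (xs ! k)) (length xs) j i"
proof (induction xs arbitrary: j)
  case (Cons x xs)
  then obtain k where k: "arrows_move C xs i = Some k" "arrow_move C x k = Some j"
    by (auto simp: bind_eq_Some_conv)
  then show ?case using Cons.IH[OF k(1)] arrow_move_step[OF assms] by auto
qed simp

lemma arrows_move_ends:
  assumes "is_word Q \<rho> C" "arrow_path Q xs" "xs \<noteq> []" "arrows_move C xs i = Some j"
  shows "i \<in> index_set (word_shape C)" "j \<in> index_set (word_shape C)"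
    "word_vertex Q C i = tail Q (last xs)" "word_vertex Q C j = head Q (hd xs)"
proof -
  have f: "follows C (\<lambda>k. Direct (xs ! k)) (length xs) j i" by (rule arrows_move_follows[OF assms(1,4)])
  obtain x ys where xs: "xs = x # ys" using assms(3) by (cases xs) auto
  obtain k where k: "step C j (Direct x) k" using f xs by auto
  show j: "j \<in> index_set (word_shape C)" and "word_vertex Q C j = head Q (hd xs)"
    using step_props[OF assms(1) k] xs by auto
  show "i \<in> index_set (word_shape C)" "word_vertex Q C i = tail Q (last xs)"
    using follows_end[OF assms(1) f j] assms(3) by (auto simp: last_conv_nth)
qed

text \<open>A path that does not kill a basis vector is read along a ray, its letters being all
  direct. So it occurs in \<open>C\<close>, directly or inverted.\<close>

lemma zero_relation_move:
  assumes C: "is_word Q \<rho> C" and "r \<in> \<rho>" "r \<noteq> []"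
  shows "arrows_move C r i = None"
proof (rule ccontr)
  assume "arrows_move C r i \<noteq> None"
  then obtain j where j: "arrows_move C r i = Some j" by blast
  let ?c = "\<lambda>k. Direct (r ! k)"
  have f: "follows C ?c (length r) j i" by (rule arrows_move_follows[OF C j])
  obtain d where "\<forall>k<length r. ray C j d k = Some (?c k)"
    using f unfolding follows_iff_ray[OF C, of "length r" ?c, simplified] by blast
  then have ray: "ray C j d (nat (p - 1)) = Some (Direct (r ! nat (p - 1)))" if "1 \<le> p" "p \<le> int (length r)" for p
    using that by auto
  obtain s c where Cs: "C = Letters s c"
    using ray[of 1] assms(3) by (cases C) (auto simp: ray_def out_letter_def positions_simps Suc_le_eq split: if_splits)
  have "occurs_at (map Direct r) (Fin (length r)) (\<lambda>p. Direct (r ! nat (p - 1))) 1"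
    by (auto simp: occurs_at_def positions_simps)
  from occurs_on_ray[where e = "\<lambda>p. Direct (r ! nat (p - 1))", OF ray Cs this]
  obtain q where "occurs_at (if d then map Direct r else map letter_inv (rev (map Direct r))) s c q" by blast
  moreover have "map letter_inv (rev (map Direct r)) = map Inverse (rev r)" by (simp add: rev_map o_def)
  ultimately show False using C assms(2) Cs by (auto split: if_splits)
qed

section \<open>The action of the path algebra and its quotient\<close>

lemma path_algebra_action_move:
  "path_algebra_action Q C a f =
    (\<Sum>p\<in>Poly_Mapping.keys a. scale (Poly_Mapping.lookup a p) (move (path_move Q C p) f))"
  by (simp add: path_algebra_action_def path_action_move scale_def)

lemma path_algebra_action_add:
  "path_algebra_action Q C (a + b) f = path_algebra_action Q C a f + path_algebra_action Q C b f"
  unfolding path_algebra_action_move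
  by (rule sum_keys_add[where F = "\<lambda>p t. scale t (move (path_move Q C p) f)"]) (auto simp: scale_add)

lemma path_algebra_action_0 [simp]: "path_algebra_action Q C 0 f = 0"
  by (simp add: path_algebra_action_move)

lemma path_algebra_action_single:
  "path_algebra_action Q C (Poly_Mapping.single p c) f = scale c (move (path_move Q C p) f)"
  by (cases "c = 0") (auto simp: path_algebra_action_move scale_add)

lemma path_algebra_action_sum:
  "path_algebra_action Q C (sum F A) f = (\<Sum>x\<in>A. path_algebra_action Q C (F x) f)"
  by (induction A rule: infinite_finite_induct) (auto simp: path_algebra_action_add)

lemma path_algebra_action_zero [simp]: "path_algebra_action Q C a 0 = 0"
  by (simp add: path_algebra_action_move scale_add)

lemma path_algebra_action_diff:
  "path_algebra_action Q C (a - b) f = path_algebra_action Q C a f - path_algebra_action Q C b f"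
  using path_algebra_action_add[of Q C "a - b" b f] by (simp add: algebra_simps)

lemma path_move_index:
  assumes "is_word Q \<rho> C" "p \<in> qpaths Q" "i \<in> index_set (word_shape C)" "path_move Q C p i = Some j"
  shows "j \<in> index_set (word_shape C)" "word_vertex Q C i = path_tail Q p" "word_vertex Q C j = fst p"
proof -
  have "j \<in> index_set (word_shape C) \<and> word_vertex Q C i = path_tail Q p \<and> word_vertex Q C j = fst p"
  proof (cases "snd p = []")
    case True
    then show ?thesis using assms by (auto simp: path_move_def vertex_move_def path_tail_def split: if_splits)
  next
    case False
    then show ?thesis using assms arrows_move_ends[OF assms(1), of "snd p" i j]
      by (auto simp: path_move_def path_tail_def qpaths_def)
  qed
  then show "j \<in> index_set (word_shape C)" "word_vertex Q C i = path_tail Q p" "word_vertex Q C j = fst p" by auto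
qed

text \<open>A path moves only vectors at its tail and puts them at its head. So the composite
  vanishes for paths that do not compose, as their product does.\<close>

lemma path_move_mult:
  assumes C: "is_word Q \<rho> C" and p: "p \<in> qpaths Q" and q: "q \<in> qpaths Q" and i: "i \<in> index_set (word_shape C)"
  shows "Option.bind (path_move Q C q i) (path_move Q C p) =
    (if path_tail Q p = fst q then path_move Q C (fst p, snd p @ snd q) i else None)"
proof (cases "path_tail Q p = fst q")
  case False
  have "Option.bind (path_move Q C q i) (path_move Q C p) \<noteq> Some k" for k
    using path_move_index[OF C q i] path_move_index[OF C p] False by (auto simp: bind_eq_Some_conv)
  then show ?thesis using False by (metis option.exhaust)
next
  case True
  show ?thesis
  proof (cases "snd q = []")
    case q': True
    have eq: "fst q = path_tail Q p" using True by simp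
    show ?thesis
    proof (cases "word_vertex Q C i = fst q")
      case True
      then show ?thesis using q' eq by (simp add: path_move_def vertex_move_def)
    next
      case False
      then have "path_move Q C p i = None" using path_move_index(2)[OF C p i] eq by (metis option.exhaust)
      then show ?thesis using q' eq False by (cases p) (simp add: path_move_def vertex_move_def)
    qed
  next
    case q': False
    show ?thesis
    proof (cases "snd p = []")
      case p': True
      have "Option.bind (path_move Q C q i) (path_move Q C p) = path_move Q C q i"
        using path_move_index(3)[OF C q i] True p'
        by (cases "path_move Q C q i") (auto simp: path_move_def[of Q C p] vertex_move_def path_tail_def)
      then show ?thesis using True p' q' by (simp add: path_move_def)
    next
      case False
      then show ?thesis using True q' by (simp add: path_move_def arrows_move_append)
    qed
  qed
qed

lemma keys_path_algebra_action:
  assumes "is_word Q \<rho> C" "a \<in> carrier (path_algebra Q)" "Poly_Mapping.keys f \<subseteq> index_set (word_shape C)"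
  shows "Poly_Mapping.keys (path_algebra_action Q C a f) \<subseteq> index_set (word_shape C)"
proof -
  have "Poly_Mapping.keys (scale c (move (path_move Q C p) f)) \<subseteq> index_set (word_shape C)"
    if "p \<in> Poly_Mapping.keys a" for p c
  proof -
    have "Poly_Mapping.keys (scale c (move (path_move Q C p) f)) \<subseteq> Poly_Mapping.keys (move (path_move Q C p) f)"
      by (auto simp: in_keys_iff)
    moreover have "Poly_Mapping.keys (move (path_move Q C p) f) \<subseteq> index_set (word_shape C)"
    proof
      fix j assume "j \<in> Poly_Mapping.keys (move (path_move Q C p) f)"
      then obtain i where i: "i \<in> Poly_Mapping.keys f" "path_move Q C p i = Some j"
        using keys_move[of "path_move Q C p" f] by blast
      have "p \<in> qpaths Q" using assms(2) that by (auto simp: path_algebra_def)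
      then show "j \<in> index_set (word_shape C)"
        using path_move_index(1)[OF assms(1) _ _ i(2)] i(1) assms(3) by blast
    qed
    ultimately show ?thesis by (rule order_trans)
  qed
  then show ?thesis unfolding path_algebra_action_move
    by (intro order_trans[OF keys_sum] UN_least) simp
qed

lemma path_algebra_action_mult:
  assumes C: "is_word Q \<rho> C" and a: "a \<in> carrier (path_algebra Q)" and b: "b \<in> carrier (path_algebra Q)"
    and f: "Poly_Mapping.keys f \<subseteq> index_set (word_shape C)"
  shows "path_algebra_action Q C (path_mult Q a b) f = path_algebra_action Q C a (path_algebra_action Q C b f)"
proof -
  let ?ka = "Poly_Mapping.keys a" and ?kb = "Poly_Mapping.keys b"
  let ?m = "\<lambda>p. move (path_move Q C p)" and ?la = "Poly_Mapping.lookup a" and ?lb = "Poly_Mapping.lookup b"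
  have mm: "?m p (?m q f) = (if path_tail Q p = fst q then ?m (fst p, snd p @ snd q) f else 0)"
    if "p \<in> ?ka" "q \<in> ?kb" for p q
  proof -
    have pq: "p \<in> qpaths Q" "q \<in> qpaths Q" using a b that by (auto simp: path_algebra_def)
    have "?m p (?m q f) = move (\<lambda>i. if path_tail Q p = fst q then path_move Q C (fst p, snd p @ snd q) i else None) f"
      unfolding move_move by (rule move_cong) (use path_move_mult[OF C pq] f in auto)
    then show ?thesis by (auto intro: move_none)
  qed
  have move_sum: "move h (sum F A) = (\<Sum>x\<in>A. move h (F x))" for h :: "int \<Rightarrow> int option" and F :: "_ \<Rightarrow> int \<Rightarrow>\<^sub>0 'c" and A
    by (induction A rule: infinite_finite_induct) (auto simp: move_add)
  have "path_algebra_action Q C (path_mult Q a b) f =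
    (\<Sum>p\<in>?ka. \<Sum>q\<in>?kb. if path_tail Q p = fst q then scale (?la p * ?lb q) (?m (fst p, snd p @ snd q) f) else 0)"
    unfolding path_mult_def path_algebra_action_sum
    by (intro sum.cong refl) (auto simp: path_algebra_action_single)
  also have "\<dots> = (\<Sum>p\<in>?ka. \<Sum>q\<in>?kb. scale (?la p * ?lb q) (?m p (?m q f)))"
    by (intro sum.cong refl) (auto simp: mm scale_add)
  also have "\<dots> = (\<Sum>p\<in>?ka. scale (?la p) (?m p (\<Sum>q\<in>?kb. scale (?lb q) (?m q f))))"
    by (simp add: move_sum scale_sum move_scale scale_add)
  finally show ?thesis unfolding path_algebra_action_move .
qed

lemma path_mult_closed:
  assumes "a \<in> carrier (path_algebra Q)" "b \<in> carrier (path_algebra Q)"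
  shows "path_mult Q a b \<in> carrier (path_algebra Q)"
proof -
  have "(fst p, snd p @ snd q) \<in> qpaths Q" if "p \<in> Poly_Mapping.keys a" "q \<in> Poly_Mapping.keys b" "path_tail Q p = fst q" for p q
  proof -
    have "p \<in> qpaths Q" "q \<in> qpaths Q" using assms that by (auto simp: path_algebra_def)
    then show ?thesis using that(3)
      by (auto simp: qpaths_def arrow_path_def path_tail_def successively_append_iff split: if_splits)
  qed
  then have "Poly_Mapping.keys (if path_tail Q p = fst q
        then Poly_Mapping.single (fst p, snd p @ snd q) (Poly_Mapping.lookup a p * Poly_Mapping.lookup b q) else 0) \<subseteq> qpaths Q"
    if "p \<in> Poly_Mapping.keys a" "q \<in> Poly_Mapping.keys b" for p q using that by auto
  then have "Poly_Mapping.keys (path_mult Q a b) \<subseteq> qpaths Q"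
    unfolding path_mult_def
    by (intro order_trans[OF keys_sum] UN_least) blast
  then show ?thesis by (simp add: path_algebra_def)
qed

text \<open>This makes the action of a coset independent of the representative, so that
  \<open>the_elem\<close> in \<open>string_module\<close> applies to a singleton. Membership in the
  path algebra is carried through the induction because multiplicativity of the action depends on
  it.\<close>

lemma relation_ideal_annihilates:
  assumes "string_algebra Q \<rho>" and C: "is_word Q \<rho> C"
    and "a \<in> relation_ideal Q \<rho>"
  shows "a \<in> carrier (path_algebra Q) \<and>
    (\<forall>f. Poly_Mapping.keys f \<subseteq> index_set (word_shape C) \<longrightarrow> path_algebra_action Q C a f = 0)"
  using assms(3)
proof induction
  case (generator r)
  have r: "arrow_path Q r" "length r \<ge> 2" using assms(1) generator by (auto simp: string_algebra_def)
  then have ne: "r \<noteq> []" by auto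
  have "hd r \<in> arcs Q" using r ne by (cases r) (auto simp: arrow_path_def)
  then have "head Q (hd r) \<in> verts Q" using assms(1) by (auto simp: string_algebra_def wf_digraph_def)
  then have "(head Q (hd r), r) \<in> qpaths Q" using r ne by (auto simp: qpaths_def)
  moreover have "move (path_move Q C (head Q (hd r), r)) f = 0" for f :: "int \<Rightarrow>\<^sub>0 'c"
    by (rule move_none) (use zero_relation_move[OF C generator ne] ne in \<open>simp add: path_move_def\<close>)
  ultimately show ?case by (auto simp: path_algebra_def path_algebra_action_single scale_add)
next
  case zero
  then show ?case by (auto simp: path_algebra_def)
next
  case (diff f g)
  then show ?case using keys_diff[of f g] by (auto simp: path_algebra_def path_algebra_action_diff)
next
  case (left a f)
  have m: "a \<otimes>\<^bsub>path_algebra Q\<^esub> f = path_mult Q a f" by (simp add: path_algebra_def)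
  show ?case unfolding m
    using left path_mult_closed[of a Q f] path_algebra_action_mult[OF C, of a f] by auto
next
  case (right a f)
  have m: "f \<otimes>\<^bsub>path_algebra Q\<^esub> a = path_mult Q f a" by (simp add: path_algebra_def)
  show ?case unfolding m
    using right path_mult_closed[of f Q a] path_algebra_action_mult[OF C, of f a] keys_path_algebra_action[OF C, of a] by auto
qed

lemma string_module_smult:
  assumes "string_algebra Q \<rho>" "is_word Q \<rho> C" "f \<in> carrier (string_module Q C)"
  shows "(relation_ideal Q \<rho> +>\<^bsub>path_algebra Q\<^esub> a) \<odot>\<^bsub>string_module Q C\<^esub> f = path_algebra_action Q C a f"
proof -
  have "path_algebra_action Q C (r + a) f = path_algebra_action Q C a f" if "r \<in> relation_ideal Q \<rho>" for r
    using relation_ideal_annihilates[OF assms(1,2) that] assms(3)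
    by (auto simp: path_algebra_action_add string_module_def)
  then have "(\<lambda>b. path_algebra_action Q C b f) ` (relation_ideal Q \<rho> +>\<^bsub>path_algebra Q\<^esub> a) = {path_algebra_action Q C a f}"
    using relation_ideal.zero[of Q \<rho>] by (auto simp: a_r_coset_def' path_algebra_def)
  then show ?thesis by (simp add: string_module_def)
qed

lemma coset_in_quotient_algebra:
  assumes "p \<in> qpaths Q"
  shows "relation_ideal Q \<rho> +>\<^bsub>path_algebra Q\<^esub> Poly_Mapping.single p c \<in> carrier (quotient_algebra Q \<rho>)"
proof -
  have "Poly_Mapping.single p c \<in> carrier (path_algebra Q)" using assms by (auto simp: path_algebra_def)
  then show ?thesis unfolding quotient_algebra_def FactRing_def A_RCOSETS_def' by auto
qed

lemma vertex_elem_in_quotient_algebra: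
  "v \<in> verts Q \<Longrightarrow> vertex_elem Q \<rho> c v \<in> carrier (quotient_algebra Q \<rho>)"
  unfolding vertex_elem_def by (rule coset_in_quotient_algebra) (auto simp: qpaths_def arrow_path_def)

lemma arrow_elem_in_quotient_algebra:
  "wf_digraph Q \<Longrightarrow> x \<in> arcs Q \<Longrightarrow> arrow_elem Q \<rho> x \<in> carrier (quotient_algebra Q \<rho>)"
  unfolding arrow_elem_def
  by (rule coset_in_quotient_algebra) (auto simp: qpaths_def arrow_path_def wf_digraph_def)

lemma lookup_vertex_elem:
  assumes "string_algebra Q \<rho>" "is_word Q \<rho> C" "f \<in> carrier (string_module Q C)"
  shows "Poly_Mapping.lookup (vertex_elem Q \<rho> c v \<odot>\<^bsub>string_module Q C\<^esub> f) i =
    (if word_vertex Q C i = v then c * Poly_Mapping.lookup f i else 0)"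
proof -
  have "Poly_Mapping.lookup (move (vertex_move Q C v) f) i =
      (if word_vertex Q C i = v then Poly_Mapping.lookup f i else 0)"
  proof (cases "word_vertex Q C i = v")
    case True
    then show ?thesis by (simp, intro lookup_move) (auto simp: vertex_move_def split: if_splits)
  next
    case False
    then show ?thesis by (simp, intro lookup_move_zero) (auto simp: vertex_move_def split: if_splits)
  qed
  then show ?thesis
    unfolding vertex_elem_def string_module_smult[OF assms] path_algebra_action_single by (simp add: path_move_def)
qed

lemma lookup_arrow_elem:
  assumes "string_algebra Q \<rho>" "is_word Q \<rho> C" "f \<in> carrier (string_module Q C)"
  shows "step C i (Direct x) i' \<Longrightarrow>
      Poly_Mapping.lookup (arrow_elem Q \<rho> x \<odot>\<^bsub>string_module Q C\<^esub> f) i = Poly_Mapping.lookup f i'"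
    and "\<nexists>i'. step C i (Direct x) i' \<Longrightarrow>
      Poly_Mapping.lookup (arrow_elem Q \<rho> x \<odot>\<^bsub>string_module Q C\<^esub> f) i = 0"
proof -
  have mv: "path_move Q C (head Q x, [x]) = arrow_move C x" by (auto simp: path_move_def fun_eq_iff)
  have eq: "arrow_elem Q \<rho> x \<odot>\<^bsub>string_module Q C\<^esub> f = scale 1 (move (arrow_move C x) f)"
    unfolding arrow_elem_def string_module_smult[OF assms] path_algebra_action_single mv ..
  show "step C i (Direct x) i' \<Longrightarrow>
      Poly_Mapping.lookup (arrow_elem Q \<rho> x \<odot>\<^bsub>string_module Q C\<^esub> f) i = Poly_Mapping.lookup f i'"
    unfolding eq using lookup_move[of "arrow_move C x" i i' f] step_unique[OF assms(2)]
    by (simp add: arrow_move_step[OF assms(2)])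
  show "\<nexists>i'. step C i (Direct x) i' \<Longrightarrow>
      Poly_Mapping.lookup (arrow_elem Q \<rho> x \<odot>\<^bsub>string_module Q C\<^esub> f) i = 0"
    unfolding eq using lookup_move_zero[of "arrow_move C x" i f] by (simp add: arrow_move_step[OF assms(2)])
qed

section \<open>Coordinates of the modules \<open>M(C, V)\<close>\<close>

lemma laurent_ring_simps [simp]:
  "carrier laurent_ring = UNIV" "x \<otimes>\<^bsub>laurent_ring\<^esub> y = x * y" "\<one>\<^bsub>laurent_ring\<^esub> = 1"
  "\<zero>\<^bsub>laurent_ring\<^esub> = 0" "x \<oplus>\<^bsub>laurent_ring\<^esub> y = x + y"
  by (simp_all add: laurent_ring_def)

locale laurent_module = V: Module.module "laurent_ring :: 'k::field laurent ring" V
  for V :: "('k::field laurent, 'w) module" (structure)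
begin

lemma smult_closed [simp, intro]: "v \<in> carrier V \<Longrightarrow> p \<odot>\<^bsub>V\<^esub> v \<in> carrier V"
  using V.smult_closed[of p v] by simp

lemma smult_add_left: "v \<in> carrier V \<Longrightarrow> (p + q) \<odot>\<^bsub>V\<^esub> v = p \<odot>\<^bsub>V\<^esub> v \<oplus>\<^bsub>V\<^esub> q \<odot>\<^bsub>V\<^esub> v"
  using V.smult_l_distr[of p q v] by simp

lemma smult_add_right: "v \<in> carrier V \<Longrightarrow> w \<in> carrier V \<Longrightarrow> p \<odot>\<^bsub>V\<^esub> (v \<oplus>\<^bsub>V\<^esub> w) = p \<odot>\<^bsub>V\<^esub> v \<oplus>\<^bsub>V\<^esub> p \<odot>\<^bsub>V\<^esub> w"
  using V.smult_r_distr[of p v w] by simp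

lemma smult_mult: "v \<in> carrier V \<Longrightarrow> (p * q) \<odot>\<^bsub>V\<^esub> v = p \<odot>\<^bsub>V\<^esub> (q \<odot>\<^bsub>V\<^esub> v)"
  using V.smult_assoc1[of p q v] by simp

lemma smult_1 [simp]: "v \<in> carrier V \<Longrightarrow> 1 \<odot>\<^bsub>V\<^esub> v = v"
  using V.smult_one[of v] by simp

lemma smult_0_left [simp]: "v \<in> carrier V \<Longrightarrow> 0 \<odot>\<^bsub>V\<^esub> v = \<zero>\<^bsub>V\<^esub>"
  using V.smult_l_null[of v] by simp

lemma smult_0_right [simp]: "p \<odot>\<^bsub>V\<^esub> \<zero>\<^bsub>V\<^esub> = \<zero>\<^bsub>V\<^esub>"
  using V.smult_r_null[of p] by simp

end

section \<open>The right action of Laurent polynomials on a string module\<close>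

lemma laurent_action_add:
  "laurent_action C (f + g) p = laurent_action C f p + laurent_action C g p"
  unfolding laurent_action_def
  by (rule sum_keys_add[where F = "\<lambda>i t. \<Sum>j\<in>Poly_Mapping.keys p.
        Poly_Mapping.single (i - int (period C) * j) (t * Poly_Mapping.lookup p j)"])
    (simp_all add: algebra_simps single_add sum.distrib)

lemma laurent_action_add_right:
  "laurent_action C f (p + q) = laurent_action C f p + laurent_action C f q"
  unfolding laurent_action_def sum.distrib[symmetric]
  by (rule sum.cong[OF refl])
    (rule sum_keys_add[where F = "\<lambda>j t. Poly_Mapping.single (_ - int (period C) * j) (Poly_Mapping.lookup f _ * t)"],
      simp_all add: algebra_simps single_add)

lemma laurent_action_single:
  "laurent_action C (Poly_Mapping.single i a) (Poly_Mapping.single j b) =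
    Poly_Mapping.single (i - int (period C) * j) (a * b)"
  by (cases "a = 0"; cases "b = 0") (auto simp: laurent_action_def)

lemma laurent_action_0 [simp]: "laurent_action C 0 p = 0" "laurent_action C f 0 = 0"
  by (simp_all add: laurent_action_def)

locale periodic_tensor = laurent_module V
  for V :: "('k::field laurent, 'w) module" (structure) +
  fixes Q :: "('v, 'a) pre_digraph" and \<rho> :: "'a list set" and C :: "('v, 'a) qword"
  assumes string_algebra: "string_algebra Q \<rho>" and C: "is_word Q \<rho> C" and periodic: "periodic C"
begin

abbreviation n where "n \<equiv> int (period C)"

abbreviation T :: "int \<Rightarrow> 'k laurent" where "T j \<equiv> Poly_Mapping.single j 1"

lemma n_pos: "n > 0"
  using period_props(1)[OF periodic] by simp

lemma shape: "word_shape C = AllInt"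
  by (rule period_props(3)[OF periodic])

lemma string_carrier: "carrier (string_module Q C) = UNIV"
  by (simp add: string_module_def shape)

text \<open>The coefficient of \<open>b\<^sub>i\<close>, with the basis vectors \<open>b\<^sub>j\<close> for \<open>j\<close> congruent to \<open>i\<close> expressed as
  \<open>b\<^sub>i T\<^sup>q\<close>.\<close>

definition comp :: "int \<Rightarrow> (int \<Rightarrow>\<^sub>0 'k) \<Rightarrow> 'k laurent" where
  "comp i = Poly_Mapping.map_key (\<lambda>q. i - n * q)"

lemma inj_comp: "inj (\<lambda>q. i - n * q)"
  using n_pos by (auto simp: inj_def)

lemma lookup_comp: "Poly_Mapping.lookup (comp i x) q = Poly_Mapping.lookup x (i - n * q)"
  by (simp add: comp_def map_key.rep_eq[OF inj_comp])

lemma comp_add: "comp i (x + y) = comp i x + comp i y"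
  by (rule poly_mapping_eqI) (simp add: lookup_comp lookup_add)

lemma comp_0 [simp]: "comp i 0 = 0"
  by (rule poly_mapping_eqI) (simp add: lookup_comp)

lemma lookup_T_mult: "Poly_Mapping.lookup (Poly_Mapping.single j c * p) q = c * Poly_Mapping.lookup p (q - j)"
  for c :: 'k and p :: "'k laurent"
proof (induction p rule: poly_mapping_single_induct)
  case (single k d)
  then show ?case by (auto simp: mult_single lookup_single when_def)
qed (auto simp: lookup_add distrib_left)

lemma comp_shift: "comp (i + n) x = T 1 * comp i x"
  by (rule poly_mapping_eqI) (simp add: lookup_comp lookup_T_mult algebra_simps)

lemma comp_single: "comp i (Poly_Mapping.single (i - n * q) c) = Poly_Mapping.single q c"
  using n_pos by (intro poly_mapping_eqI) (auto simp: lookup_comp lookup_single when_def)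

lemma comp_single_zero: "\<not> n dvd i - j \<Longrightarrow> comp i (Poly_Mapping.single j c) = 0"
  by (intro poly_mapping_eqI) (auto simp: lookup_comp lookup_single when_def)

text \<open>Linearity of \<open>comp i\<close> over Laurent polynomials makes the map from
  \<open>(x, v)\<close> to \<open>comp i x\<close> applied to \<open>v\<close> balanced, so it
  descends to the tensor product.\<close>

lemma comp_laurent_action: "comp i (laurent_action C x p) = comp i x * p"
proof (induction x rule: poly_mapping_single_induct)
  case (single k c)
  show ?case
  proof (induction p rule: poly_mapping_single_induct)
    case single': (single j d)
    show ?case
    proof (cases "n dvd i - k")
      case True
      then obtain q where q: "k = i - n * q" by (metis diff_diff_eq2 add_diff_cancel_left' dvdE)
      have eq: "k - n * j = i - n * (q + j)" using q by (simp add: algebra_simps)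
      show ?thesis unfolding laurent_action_single eq comp_single unfolding q comp_single by (simp add: mult_single)
    next
      case False
      have "\<not> n dvd i - (k - n * j)"
      proof
        assume "n dvd i - (k - n * j)"
        then have "n dvd (i - (k - n * j)) - n * j" by (rule dvd_diff) simp
        moreover have "(i - (k - n * j)) - n * j = i - k" by simp
        ultimately show False using False by simp
      qed
      then show ?thesis using False by (simp add: laurent_action_single comp_single_zero)
    qed
  qed (simp_all add: laurent_action_add_right comp_add distrib_left)
qed (simp_all add: laurent_action_add comp_add distrib_right)

text \<open>Over \<open>k[T, T^-1]\<close> the module \<open>M(C)\<close> is free on the basis
  vectors of one period.\<close>

lemma sum_comp: "(\<Sum>j\<in>{0..<n}. laurent_action C (Poly_Mapping.single j 1) (comp j x)) = x"
proof (induction x rule: poly_mapping_single_induct)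
  case (single k c)
  \<comment> \<open>The minus sign is there because \<open>T\<close> lowers the index by one
    period.\<close>
  define q where "q = - (k div n)"
  have k: "k = k mod n - n * q" by (simp add: q_def)
  have r: "k mod n \<in> {0..<n}" using n_pos by simp
  have other: "comp j (Poly_Mapping.single k c) = 0" if "j \<in> {0..<n}" "j \<noteq> k mod n" for j
  proof (rule comp_single_zero)
    show "\<not> n dvd j - k"
    proof
      assume "n dvd j - k"
      then have "j mod n = k mod n" by (simp add: mod_eq_dvd_iff)
      then show False using that by simp
    qed
  qed
  have "(\<Sum>j\<in>{0..<n}. laurent_action C (Poly_Mapping.single j 1) (comp j (Poly_Mapping.single k c))) =
    laurent_action C (Poly_Mapping.single (k mod n) 1) (comp (k mod n) (Poly_Mapping.single k c))"
    by (rule sum.mono_neutral_right[of "{0..<n}" "{k mod n}", simplified]) (use r other in auto)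
  also have "comp (k mod n) (Poly_Mapping.single k c) = Poly_Mapping.single q c"
    using comp_single[of "k mod n" q c] k by simp
  finally show ?case using k by (simp add: laurent_action_single)
qed (simp_all add: comp_add laurent_action_add_right sum.distrib)

section \<open>Formal sums of pairs and their coordinates\<close>

definition frags :: "((int \<Rightarrow>\<^sub>0 'k) \<times> 'w \<Rightarrow>\<^sub>0 int) set" where
  "frags = {f. Poly_Mapping.keys f \<subseteq> UNIV \<times> carrier V}"

abbreviation R where "R \<equiv> tensor_relations laurent_ring (string_module Q C) (laurent_action C) V"

text \<open>The additive map from the tensor product to \<open>V\<close> that sends \<open>x\<close>
  tensor \<open>v\<close> to \<open>comp i x\<close> applied to \<open>v\<close>, written on formal
  sums before cosets are formed.\<close>

definition tc :: "((int \<Rightarrow>\<^sub>0 'k) \<times> 'w \<Rightarrow>\<^sub>0 int) \<Rightarrow> int \<Rightarrow> 'w" where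
  "tc f i = finsum V (\<lambda>xv. (of_int (Poly_Mapping.lookup f xv) * comp i (fst xv)) \<odot>\<^bsub>V\<^esub> snd xv) (Poly_Mapping.keys f)"

lemma frags_closed:
  "f \<in> frags \<Longrightarrow> g \<in> frags \<Longrightarrow> f + g \<in> frags" "f \<in> frags \<Longrightarrow> g \<in> frags \<Longrightarrow> f - g \<in> frags" "0 \<in> frags"
  "v \<in> carrier V \<Longrightarrow> frag_of (x, v) \<in> frags"
  using keys_add[of f g] keys_diff[of f g] by (auto simp: frags_def)

lemma tc_superset:
  assumes "finite A" "A \<subseteq> UNIV \<times> carrier V" "Poly_Mapping.keys f \<subseteq> A"
  shows "tc f i = finsum V (\<lambda>xv. (of_int (Poly_Mapping.lookup f xv) * comp i (fst xv)) \<odot>\<^bsub>V\<^esub> snd xv) A"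
  unfolding tc_def
  by (rule V.add.finprod_mono_neutral_cong_left[OF assms(1,3)])
    (use assms in \<open>auto simp: in_keys_iff\<close>)

lemma tc_closed [simp]: "f \<in> frags \<Longrightarrow> tc f i \<in> carrier V"
  unfolding tc_def by (rule V.finsum_closed) (auto simp: frags_def)

lemma tc_add:
  assumes "f \<in> frags" "g \<in> frags"
  shows "tc (f + g) i = tc f i \<oplus>\<^bsub>V\<^esub> tc g i"
proof -
  let ?A = "Poly_Mapping.keys f \<union> Poly_Mapping.keys g"
  have A: "finite ?A" "?A \<subseteq> UNIV \<times> carrier V" "Poly_Mapping.keys (f + g) \<subseteq> ?A"
    using assms keys_add[of f g] by (auto simp: frags_def)
  let ?F = "\<lambda>f xv. (of_int (Poly_Mapping.lookup f xv) * comp i (fst xv)) \<odot>\<^bsub>V\<^esub> snd xv"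
  have "tc (f + g) i = finsum V (\<lambda>xv. ?F f xv \<oplus>\<^bsub>V\<^esub> ?F g xv) ?A"
    unfolding tc_superset[OF A]
    by (rule V.finsum_cong') (use A(2) in \<open>auto simp: lookup_add distrib_right smult_add_left\<close>)
  also have "\<dots> = finsum V (?F f) ?A \<oplus>\<^bsub>V\<^esub> finsum V (?F g) ?A"
    by (rule V.finsum_addf) (use A(2) in auto)
  finally show ?thesis using tc_superset[OF A(1,2), of f i] tc_superset[OF A(1,2), of g i] by simp
qed

lemma tc_0 [simp]: "tc 0 i = \<zero>\<^bsub>V\<^esub>"
  by (simp add: tc_def)

lemma tc_diff:
  assumes "f \<in> frags" "g \<in> frags"
  shows "tc (f - g) i = tc f i \<ominus>\<^bsub>V\<^esub> tc g i"
proof -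
  have "tc f i = tc (f - g) i \<oplus>\<^bsub>V\<^esub> tc g i"
    using tc_add[OF frags_closed(2)[OF assms] assms(2), of i] by simp
  then show ?thesis
    using assms frags_closed(2)[OF assms] by (simp add: V.minus_eq V.a_assoc V.r_neg)
qed

lemma tc_frag_of: "v \<in> carrier V \<Longrightarrow> tc (frag_of (x, v)) i = comp i x \<odot>\<^bsub>V\<^esub> v"
  by (simp add: tc_def)

lemma relations_frags: "f \<in> R \<Longrightarrow> f \<in> frags"
  by (induction rule: tensor_relations.induct) (auto intro!: frags_closed)

lemma cancel: "v \<in> carrier V \<Longrightarrow> w \<in> carrier V \<Longrightarrow> v \<oplus>\<^bsub>V\<^esub> w \<ominus>\<^bsub>V\<^esub> v \<ominus>\<^bsub>V\<^esub> w = \<zero>\<^bsub>V\<^esub>"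
  unfolding V.a_comm[of v w] by (simp add: V.minus_eq V.a_assoc V.r_neg)

lemma tc_relations: "f \<in> R \<Longrightarrow> tc f i = \<zero>\<^bsub>V\<^esub>"
proof (induction rule: tensor_relations.induct)
  case (diff f g)
  then show ?case using relations_frags by (simp add: tc_diff V.minus_eq)
next
  case (add_left x y v)
  then show ?case
    by (simp add: tc_diff frags_closed tc_frag_of string_module_def comp_add smult_add_left cancel)
next
  case (add_right x v w)
  then show ?case
    by (simp add: tc_diff frags_closed tc_frag_of smult_add_right cancel)
next
  case (balanced x r v)
  then show ?case
    by (simp add: tc_diff frags_closed tc_frag_of comp_laurent_action smult_mult V.minus_eq V.r_neg)
qed auto

lemma relations_add: "f \<in> R \<Longrightarrow> g \<in> R \<Longrightarrow> f + g \<in> R"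
  using tensor_relations.diff[of f _ _ _ _ "0 - g"] tensor_relations.diff[of 0 _ _ _ _ g] tensor_relations.zero
  by (metis diff_minus_eq_add diff_0)

lemma relations_sum: "(\<And>x. x \<in> A \<Longrightarrow> F x \<in> R) \<Longrightarrow> sum F A \<in> R"
  by (induction A rule: infinite_finite_induct) (auto intro: relations_add tensor_relations.zero)

text \<open>A normal form: the family \<open>u\<close> is reassembled over one period from the free
  basis of \<open>M(C)\<close>.\<close>

definition standard :: "(int \<Rightarrow> 'w) \<Rightarrow> ((int \<Rightarrow>\<^sub>0 'k) \<times> 'w \<Rightarrow>\<^sub>0 int)" where
  "standard u = (\<Sum>j\<in>{0..<n}. frag_of (Poly_Mapping.single j 1, u j))"

lemma standard_frags: "(\<And>j. u j \<in> carrier V) \<Longrightarrow> standard u \<in> frags"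
proof -
  assume u: "\<And>j. u j \<in> carrier V"
  have "(\<Sum>j\<in>A. frag_of (Poly_Mapping.single j 1, u j)) \<in> frags" for A
    using u by (induction A rule: infinite_finite_induct) (auto intro: frags_closed)
  then show ?thesis by (simp add: standard_def)
qed

lemma relations_left_sum:
  assumes "v \<in> carrier V" "finite A"
  shows "frag_of (sum F A, v) - (\<Sum>x\<in>A. frag_of (F x, v)) \<in> R"
  using assms(2)
proof (induction A)
  case empty
  have "frag_of (0 + 0, v) - frag_of (0, v) - frag_of (0, v) \<in> R"
    using tensor_relations.add_left[of 0 "string_module Q C" 0 v V laurent_ring "laurent_action C"] assms(1)
    by (simp add: string_module_def shape)
  then have "0 - (0 - frag_of (0, v)) \<in> R" using tensor_relations.diff tensor_relations.zero by fastforce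
  then show ?case by simp
next
  case (insert a A)
  have "frag_of (F a + sum F A, v) - frag_of (F a, v) - frag_of (sum F A, v) \<in> R"
    using tensor_relations.add_left[of "F a" "string_module Q C" "sum F A" v V laurent_ring "laurent_action C"] assms(1)
    by (simp add: string_module_def shape)
  from relations_add[OF this insert.IH] insert.hyps show ?case by (simp add: algebra_simps)
qed

text \<open>Expand \<open>x\<close> by \<open>sum_comp\<close> and move the Laurent polynomials
  across to \<open>V\<close>. As the induction on formal sums proceeds by differences, biadditivity
  enters in the last case.\<close>

lemma standard_form:
  assumes "f \<in> frags"
  shows "f - standard (tc f) \<in> R"
proof -
  have zero: "frag_of (x, \<zero>\<^bsub>V\<^esub>) \<in> R" for x
  proof -
    have "frag_of (x, \<zero>\<^bsub>V\<^esub> \<oplus>\<^bsub>V\<^esub> \<zero>\<^bsub>V\<^esub>) - frag_of (x, \<zero>\<^bsub>V\<^esub>) - frag_of (x, \<zero>\<^bsub>V\<^esub>) \<in> R"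
      by (rule tensor_relations.add_right) (auto simp: string_carrier)
    then have "0 - (0 - frag_of (x, \<zero>\<^bsub>V\<^esub>)) \<in> R" using tensor_relations.diff tensor_relations.zero by fastforce
    then show ?thesis by simp
  qed
  have "Poly_Mapping.keys f \<subseteq> UNIV \<times> carrier V" using assms by (simp add: frags_def)
  then have "f \<in> frags \<and> f - standard (tc f) \<in> R"
  proof (induction f rule: frag_induction)
    case zero
    have "standard (tc 0) \<in> R" unfolding standard_def by (rule relations_sum) (simp add: \<open>\<And>x. frag_of (x, \<zero>\<^bsub>V\<^esub>) \<in> R\<close>)
    then have "0 - standard (tc 0) \<in> R" using tensor_relations.diff tensor_relations.zero by blast
    moreover have "tc 0 = (\<lambda>i. \<zero>\<^bsub>V\<^esub>)" by (rule ext) simp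
    ultimately show ?case by (simp add: frags_closed)
  next
    case (one xv)
    obtain x v where xv: "xv = (x, v)" "v \<in> carrier V" using one by auto
    let ?b = "\<lambda>j. Poly_Mapping.single j 1 :: int \<Rightarrow>\<^sub>0 'k"
    have "frag_of (x, v) - (\<Sum>j\<in>{0..<n}. frag_of (laurent_action C (?b j) (comp j x), v)) \<in> R"
      using relations_left_sum[OF xv(2), of "{0..<n}" "\<lambda>j. laurent_action C (?b j) (comp j x)"] sum_comp[of x] by simp
    moreover have "(\<Sum>j\<in>{0..<n}. frag_of (laurent_action C (?b j) (comp j x), v) - frag_of (?b j, comp j x \<odot>\<^bsub>V\<^esub> v)) \<in> R"
      by (rule relations_sum, rule tensor_relations.balanced) (use xv in \<open>auto simp: string_carrier\<close>)
    ultimately have "frag_of (x, v) - standard (\<lambda>j. comp j x \<odot>\<^bsub>V\<^esub> v) \<in> R"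
      using relations_add by (fastforce simp: standard_def sum_subtractf)
    moreover have "tc (frag_of (x, v)) = (\<lambda>j. comp j x \<odot>\<^bsub>V\<^esub> v)" using tc_frag_of[OF xv(2)] by (intro ext) simp
    ultimately show ?case using xv frags_closed(4) by simp
  next
    case (diff a b)
    then have ab: "a \<in> frags" "b \<in> frags" by auto
    have "frag_of (x, v \<ominus>\<^bsub>V\<^esub> w) - (frag_of (x, v) - frag_of (x, w)) \<in> R" if "v \<in> carrier V" "w \<in> carrier V" for x v w
    proof -
      have "frag_of (x, (v \<ominus>\<^bsub>V\<^esub> w) \<oplus>\<^bsub>V\<^esub> w) - frag_of (x, v \<ominus>\<^bsub>V\<^esub> w) - frag_of (x, w) \<in> R"
        by (rule tensor_relations.add_right) (use that in \<open>auto simp: string_carrier\<close>)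
      then have "frag_of (x, v) - frag_of (x, v \<ominus>\<^bsub>V\<^esub> w) - frag_of (x, w) \<in> R"
        using that by (simp add: V.minus_eq V.a_assoc V.l_neg)
      then have "0 - (frag_of (x, v) - frag_of (x, v \<ominus>\<^bsub>V\<^esub> w) - frag_of (x, w)) \<in> R"
        using tensor_relations.diff tensor_relations.zero by blast
      then show ?thesis by (simp add: algebra_simps)
    qed
    then have "(\<Sum>j\<in>{0..<n}. frag_of (Poly_Mapping.single j 1, tc (a - b) j) -
       (frag_of (Poly_Mapping.single j 1, tc a j) - frag_of (Poly_Mapping.single j 1, tc b j))) \<in> R"
      by (intro relations_sum) (use ab in \<open>simp add: tc_diff\<close>)
    then have "standard (tc (a - b)) - (standard (tc a) - standard (tc b)) \<in> R"
      by (simp add: standard_def sum_subtractf)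
    moreover have "(a - standard (tc a)) - (b - standard (tc b)) \<in> R"
      using diff tensor_relations.diff by blast
    ultimately have "(a - standard (tc a)) - (b - standard (tc b)) - (standard (tc (a - b)) - (standard (tc a) - standard (tc b))) \<in> R"
      using tensor_relations.diff by blast
    then show ?case using ab frags_closed(2) by (simp add: algebra_simps)
  qed
  then show ?thesis by blast
qed

text \<open>Congruent formal sums have equal coordinates by \<open>tc_relations\<close>. Conversely,
  equal coordinates give one and the same standard form.\<close>

lemma relations_iff: "f \<in> frags \<Longrightarrow> g \<in> frags \<Longrightarrow> f - g \<in> R \<longleftrightarrow> (\<forall>i. tc f i = tc g i)"
proof
  assume fg: "f \<in> frags" "g \<in> frags" and "f - g \<in> R"
  show "\<forall>i. tc f i = tc g i"
  proof
    fix i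
    have "tc f i = tc ((f - g) + g) i" by simp
    also have "\<dots> = tc (f - g) i \<oplus>\<^bsub>V\<^esub> tc g i" using fg by (intro tc_add frags_closed)
    finally show "tc f i = tc g i" using tc_relations[OF \<open>f - g \<in> R\<close>] fg by simp
  qed
next
  assume fg: "f \<in> frags" "g \<in> frags" and "\<forall>i. tc f i = tc g i"
  then have "tc f = tc g" by auto
  then have "(f - standard (tc f)) - (g - standard (tc f)) \<in> R"
    using standard_form[OF fg(1)] standard_form[OF fg(2)] tensor_relations.diff by metis
  then show "f - g \<in> R" by simp
qed

lemma tc_shift:
  assumes "f \<in> frags"
  shows "tc f (i + n) = T 1 \<odot>\<^bsub>V\<^esub> tc f i"
proof -
  have "Poly_Mapping.keys f \<subseteq> UNIV \<times> carrier V" using assms by (simp add: frags_def)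
  then have "f \<in> frags \<and> tc f (i + n) = T 1 \<odot>\<^bsub>V\<^esub> tc f i"
  proof (induction f rule: frag_induction)
    case (one xv)
    then show ?case by (cases xv) (auto simp: tc_frag_of comp_shift smult_mult frags_closed)
  next
    case (diff a b)
    have "T 1 \<odot>\<^bsub>V\<^esub> (v \<ominus>\<^bsub>V\<^esub> w) = T 1 \<odot>\<^bsub>V\<^esub> v \<ominus>\<^bsub>V\<^esub> T 1 \<odot>\<^bsub>V\<^esub> w" if "v \<in> carrier V" "w \<in> carrier V" for v w
      using that V.smult_r_minus[of "T 1" w] by (simp add: V.minus_eq smult_add_right)
    then show ?case using diff by (simp add: tc_diff frags_closed)
  qed (auto simp: frags_closed)
  then show ?thesis by blast
qed

lemma T_mult: "T i * T j = T (i + j)"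
  by (simp add: mult_single)

lemma shift_mult:
  assumes "\<And>i. u (i + n) = T 1 \<odot>\<^bsub>V\<^esub> u i" "\<And>i. u i \<in> carrier V"
  shows "u (i + n * q) = T q \<odot>\<^bsub>V\<^esub> u i"
proof (induction q rule: int_induct[of _ 0])
  case base
  show ?case using assms(2) by simp
next
  case (step1 q)
  have "u (i + n * (q + 1)) = T 1 \<odot>\<^bsub>V\<^esub> u (i + n * q)"
    using assms(1)[of "i + n * q"] by (simp add: algebra_simps)
  then show ?case using step1 assms(2) by (simp add: smult_mult[symmetric] T_mult add.commute)
next
  case (step2 q)
  have "T 1 \<odot>\<^bsub>V\<^esub> u (i + n * (q - 1)) = T q \<odot>\<^bsub>V\<^esub> u i"
    using assms(1)[of "i + n * (q - 1)"] step2 by (simp add: algebra_simps)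
  then have "T (-1) \<odot>\<^bsub>V\<^esub> (T 1 \<odot>\<^bsub>V\<^esub> u (i + n * (q - 1))) = T (-1) \<odot>\<^bsub>V\<^esub> (T q \<odot>\<^bsub>V\<^esub> u i)" by simp
  then show ?case using assms(2) by (simp add: smult_mult[symmetric] T_mult)
qed

lemma tc_standard:
  assumes "\<And>i. u (i + n) = T 1 \<odot>\<^bsub>V\<^esub> u i" "\<And>i. u i \<in> carrier V"
  shows "tc (standard u) i = u i"
proof -
  let ?b = "\<lambda>j. Poly_Mapping.single j 1 :: int \<Rightarrow>\<^sub>0 'k"
  have sum: "(\<Sum>j\<in>A. frag_of (?b j, u j)) \<in> frags \<and>
      tc (\<Sum>j\<in>A. frag_of (?b j, u j)) i = finsum V (\<lambda>j. comp i (?b j) \<odot>\<^bsub>V\<^esub> u j) A" if "finite A" for A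
    using that
  proof (induction A)
    case (insert a A)
    then show ?case using assms(2) by (auto simp: tc_add frags_closed tc_frag_of)
  qed (auto simp: frags_closed)
  define r where "r = i mod n"
  have r: "r \<in> {0..<n}" "i = r + n * (i div n)" using n_pos by (auto simp: r_def)
  have other: "comp i (?b j) = 0" if "j \<in> {0..<n}" "j \<noteq> r" for j
  proof (rule comp_single_zero)
    show "\<not> n dvd i - j"
    proof
      assume "n dvd i - j"
      then have "i mod n = j mod n" by (simp add: mod_eq_dvd_iff)
      then show False using that by (simp add: r_def)
    qed
  qed
  have "tc (standard u) i = finsum V (\<lambda>j. comp i (?b j) \<odot>\<^bsub>V\<^esub> u j) {0..<n}"
    using sum[of "{0..<n}"] by (simp add: standard_def)
  also have "\<dots> = finsum V (\<lambda>j. if r = j then comp i (?b j) \<odot>\<^bsub>V\<^esub> u j else \<zero>\<^bsub>V\<^esub>) {0..<n}"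
    by (rule V.finsum_cong') (use assms(2) other in auto)
  also have "\<dots> = comp i (?b r) \<odot>\<^bsub>V\<^esub> u r"
    using V.add.finprod_singleton[of r "{0..<n}" "\<lambda>j. comp i (?b j) \<odot>\<^bsub>V\<^esub> u j"] r(1) assms(2) by simp
  also have "comp i (?b r) = T (i div n)"
    using comp_single[of i "i div n" 1] r(2) by (metis add_diff_cancel_right')
  also have "T (i div n) \<odot>\<^bsub>V\<^esub> u r = u i" using shift_mult[where u = u, OF assms(1) assms(2), of r "i div n"] r(2) by simp
  finally show ?thesis .
qed

end

section \<open>Cosets as elements of the tensor product\<close>

context periodic_tensor
begin

abbreviation P where "P \<equiv> periodic_module Q C V"

text \<open>By \<open>relations_iff\<close> a coset of the relations is cut out by coordinates; with
  this description sums of cosets can be computed in \<open>V\<close>.\<close>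

definition coset :: "((int \<Rightarrow>\<^sub>0 'k) \<times> 'w \<Rightarrow>\<^sub>0 int) \<Rightarrow> ((int \<Rightarrow>\<^sub>0 'k) \<times> 'w \<Rightarrow>\<^sub>0 int) set" where
  "coset f = {g \<in> frags. \<forall>i. tc g i = tc f i}"

lemma coset_eq: "f \<in> frags \<Longrightarrow> (\<Union>r\<in>R. {r + f}) = coset f"
proof
  assume f: "f \<in> frags"
  show "(\<Union>r\<in>R. {r + f}) \<subseteq> coset f"
    using f relations_frags frags_closed(1)[OF _ f] by (auto simp: coset_def tc_add tc_relations)
  show "coset f \<subseteq> (\<Union>r\<in>R. {r + f})"
  proof
    fix g assume "g \<in> coset f"
    then have "g - f \<in> R" using relations_iff[OF _ f] by (auto simp: coset_def)
    then show "g \<in> (\<Union>r\<in>R. {r + f})" by (intro UN_I[of "g - f"]) auto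
  qed
qed

lemma carrier_P: "carrier P = coset ` frags"
  using coset_eq
  by (auto simp: periodic_module_def tensor_module_def quot_module_def A_RCOSETS_def' a_r_coset_def'
      frags_def string_carrier)

lemma zero_P: "\<zero>\<^bsub>P\<^esub> = coset 0"
  using coset_eq[OF frags_closed(3)] by (simp add: periodic_module_def tensor_module_def quot_module_def)

lemma add_P: "X \<oplus>\<^bsub>P\<^esub> Y = (\<Union>f\<in>X. \<Union>g\<in>Y. {f + g})"
  by (simp add: periodic_module_def tensor_module_def quot_module_def set_add_def')

text \<open>A product with a scalar is a union of cosets. One member suffices to read off its
  coordinates once the union is known to be a single coset.\<close>

lemma smult_P: "m \<in> X \<Longrightarrow> frag_extend (\<lambda>(x, v). frag_of (a \<odot>\<^bsub>string_module Q C\<^esub> x, v)) m \<in> a \<odot>\<^bsub>P\<^esub> X"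
  using tensor_relations.zero
  by (force simp: periodic_module_def tensor_module_def quot_module_def a_r_coset_def')

lemma coset_self: "f \<in> frags \<Longrightarrow> f \<in> coset f"
  by (simp add: coset_def)

lemma coset_add:
  assumes "f \<in> frags" "g \<in> frags"
  shows "coset f \<oplus>\<^bsub>P\<^esub> coset g = coset (f + g)"
proof
  show "coset f \<oplus>\<^bsub>P\<^esub> coset g \<subseteq> coset (f + g)"
    unfolding add_P using assms by (auto simp: coset_def tc_add frags_closed)
  show "coset (f + g) \<subseteq> coset f \<oplus>\<^bsub>P\<^esub> coset g"
  proof
    fix h assume "h \<in> coset (f + g)"
    then have h: "h \<in> frags" "\<And>i. tc h i = tc f i \<oplus>\<^bsub>V\<^esub> tc g i" using assms by (auto simp: coset_def tc_add)
    have "tc f i \<oplus>\<^bsub>V\<^esub> tc g i \<ominus>\<^bsub>V\<^esub> tc f i = tc g i" for i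
      unfolding V.a_comm[OF tc_closed[OF assms(1)] tc_closed[OF assms(2)]]
      using assms by (simp add: V.minus_eq V.a_assoc V.r_neg)
    then have "h - f \<in> coset g" using h assms by (simp add: coset_def frags_closed tc_diff)
    then show "h \<in> coset f \<oplus>\<^bsub>P\<^esub> coset g" unfolding add_P
      by (intro UN_I[OF coset_self[OF assms(1)]] UN_I[of "h - f"]) auto
  qed
qed

definition tcoord :: "((int \<Rightarrow>\<^sub>0 'k) \<times> 'w \<Rightarrow>\<^sub>0 int) set \<Rightarrow> int \<Rightarrow> 'w" where
  "tcoord X = tc (SOME f. f \<in> X)"

lemma coset_mem: "g \<in> coset f \<Longrightarrow> tc g i = tc f i"
  by (simp add: coset_def)

lemma tcoord_coset: "f \<in> frags \<Longrightarrow> tcoord (coset f) i = tc f i"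
  unfolding tcoord_def by (rule coset_mem, rule someI[of _ f], rule coset_self)

lemma tcoord_mem: "X \<in> carrier P \<Longrightarrow> f \<in> X \<Longrightarrow> f \<in> frags \<and> tcoord X i = tc f i"
proof -
  assume "X \<in> carrier P" "f \<in> X"
  then obtain g where g: "g \<in> frags" "X = coset g" by (auto simp: carrier_P)
  then have "f \<in> coset g" using \<open>f \<in> X\<close> by simp
  then have "f \<in> frags" "tc f i = tc g i" by (auto simp: coset_def)
  then show ?thesis using tcoord_coset[OF g(1)] g(2) by simp
qed

lemma tcoord_closed: "X \<in> carrier P \<Longrightarrow> tcoord X i \<in> carrier V"
  by (auto simp: carrier_P tcoord_coset)

lemma tcoord_shift: "X \<in> carrier P \<Longrightarrow> tcoord X (i + n) = T 1 \<odot>\<^bsub>V\<^esub> tcoord X i"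
  by (auto simp: carrier_P tcoord_coset tc_shift)

lemma tcoord_inj: "X \<in> carrier P \<Longrightarrow> Y \<in> carrier P \<Longrightarrow> (\<And>i. tcoord X i = tcoord Y i) \<Longrightarrow> X = Y"
proof -
  assume XY: "X \<in> carrier P" "Y \<in> carrier P" and eq: "\<And>i. tcoord X i = tcoord Y i"
  obtain f g where fg: "f \<in> frags" "X = coset f" "g \<in> frags" "Y = coset g" using XY by (auto simp: carrier_P)
  then have "tc f i = tc g i" for i using eq[of i] tcoord_coset by simp
  then show "X = Y" using fg by (simp add: coset_def)
qed

lemma tcoord_surj:
  assumes "\<And>i. u (i + n) = T 1 \<odot>\<^bsub>V\<^esub> u i" "\<And>i. u i \<in> carrier V"
  shows "\<exists>X\<in>carrier P. \<forall>i. tcoord X i = u i"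
  using tc_standard[where u = u, OF assms(1) assms(2)] standard_frags[of u] assms(2)
  by (intro bexI[of _ "coset (standard u)"]) (auto simp: carrier_P tcoord_coset)

lemma tcoord_add: "X \<in> carrier P \<Longrightarrow> Y \<in> carrier P \<Longrightarrow> tcoord (X \<oplus>\<^bsub>P\<^esub> Y) i = tcoord X i \<oplus>\<^bsub>V\<^esub> tcoord Y i"
  by (auto simp: carrier_P tcoord_coset coset_add frags_closed tc_add)

lemma tcoord_zero: "tcoord \<zero>\<^bsub>P\<^esub> i = \<zero>\<^bsub>V\<^esub>" "\<zero>\<^bsub>P\<^esub> \<in> carrier P"
  by (auto simp: zero_P carrier_P tcoord_coset frags_closed)

lemma smult_diff: "v \<in> carrier V \<Longrightarrow> w \<in> carrier V \<Longrightarrow> p \<odot>\<^bsub>V\<^esub> (v \<ominus>\<^bsub>V\<^esub> w) = p \<odot>\<^bsub>V\<^esub> v \<ominus>\<^bsub>V\<^esub> p \<odot>\<^bsub>V\<^esub> w"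
  using V.smult_r_minus[of p w] by (simp add: V.minus_eq smult_add_right)

text \<open>The coordinates see the action on the first factor only through \<open>comp\<close>. It
  will be applied with \<open>p\<close> a constant or 0 for the elements of vertices, and with
  \<open>p\<close> equal to 1 or 0 for arrows.\<close>

lemma tc_frag_extend:
  assumes "\<And>x. comp i (a \<odot>\<^bsub>string_module Q C\<^esub> x) = p * comp i' x" "m \<in> frags"
  shows "tc (frag_extend (\<lambda>(x, v). frag_of (a \<odot>\<^bsub>string_module Q C\<^esub> x, v)) m) i = p \<odot>\<^bsub>V\<^esub> tc m i'"
proof -
  let ?e = "frag_extend (\<lambda>(x, v). frag_of (a \<odot>\<^bsub>string_module Q C\<^esub> x, v))"
  have "Poly_Mapping.keys m \<subseteq> UNIV \<times> carrier V" using assms(2) by (simp add: frags_def)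
  then have "m \<in> frags \<and> ?e m \<in> frags \<and> tc (?e m) i = p \<odot>\<^bsub>V\<^esub> tc m i'"
  proof (induction m rule: frag_induction)
    case (one xv)
    then show ?case by (cases xv) (auto simp: tc_frag_of frags_closed assms(1) smult_mult)
  next
    case (diff a b)
    then show ?case by (simp add: frag_extend_diff frags_closed tc_diff smult_diff)
  qed (auto simp: frags_closed)
  then show ?thesis by blast
qed

text \<open>
  That the product is a coset again is an assumption here; it will hold because the product comes
  from a product in the module \<open>M\<close> of the theorem.  So there is no need to prove that \<open>a\<close> preserves
  the relations of the tensor product.
\<close>

lemma tcoord_smult:
  assumes "\<And>x. comp i (a \<odot>\<^bsub>string_module Q C\<^esub> x) = p * comp i' x" "X \<in> carrier P" "a \<odot>\<^bsub>P\<^esub> X \<in> carrier P"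
  shows "tcoord (a \<odot>\<^bsub>P\<^esub> X) i = p \<odot>\<^bsub>V\<^esub> tcoord X i'"
proof -
  obtain m where m: "m \<in> X" "m \<in> frags" using assms(2) coset_self by (auto simp: carrier_P)
  show ?thesis
    using tcoord_mem[OF assms(3) smult_P[OF m(1)], of i] tcoord_mem[OF assms(2) m(1), of i']
      tc_frag_extend[where i = i and a = a and p = p and i' = i' and m = m] assms(1) m(2) by simp
qed

lemma period_invariant:
  "step C (i - n * q) l (j - n * q) \<longleftrightarrow> step C i l j" "word_vertex Q C (i - n * q) = word_vertex Q C i"
proof -
  have "\<And>d. ray C 0 d = ray C (- (n * q)) d" and "\<And>d. ray C i d = ray C (i - n * q) d"
    using same_rays_dvd[OF periodic, of 0 "- (n * q)"] same_rays_dvd[OF periodic, of i "i - n * q"] by auto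
  then show "step C (i - n * q) l (j - n * q) \<longleftrightarrow> step C i l j" "word_vertex Q C (i - n * q) = word_vertex Q C i"
    using same_rays_follows(1)[OF C, of 0 "- (n * q)" i l j] same_rays_translate(2)[OF C, of i "i - n * q"]
    by (auto simp: shape)
qed

lemma tcoord_vertex:
  assumes "X \<in> carrier P" "vertex_elem Q \<rho> c v \<odot>\<^bsub>P\<^esub> X \<in> carrier P"
  shows "tcoord (vertex_elem Q \<rho> c v \<odot>\<^bsub>P\<^esub> X) i =
    (if word_vertex Q C i = v then Poly_Mapping.single 0 c \<odot>\<^bsub>V\<^esub> tcoord X i else \<zero>\<^bsub>V\<^esub>)"
proof -
  have "comp i (vertex_elem Q \<rho> c v \<odot>\<^bsub>string_module Q C\<^esub> x) =
     (if word_vertex Q C i = v then Poly_Mapping.single 0 c else 0) * comp i x" for x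
    by (rule poly_mapping_eqI)
      (auto simp: lookup_comp lookup_vertex_elem[OF string_algebra C] string_carrier period_invariant lookup_T_mult)
  from tcoord_smult[OF this assms] show ?thesis using tcoord_closed[OF assms(1)] by auto
qed

lemma tcoord_arrow:
  assumes "X \<in> carrier P" "arrow_elem Q \<rho> x \<odot>\<^bsub>P\<^esub> X \<in> carrier P"
  shows "step C i (Direct x) i' \<Longrightarrow> tcoord (arrow_elem Q \<rho> x \<odot>\<^bsub>P\<^esub> X) i = tcoord X i'"
    and "\<nexists>i'. step C i (Direct x) i' \<Longrightarrow> tcoord (arrow_elem Q \<rho> x \<odot>\<^bsub>P\<^esub> X) i = \<zero>\<^bsub>V\<^esub>"
proof -
  assume st: "step C i (Direct x) i'"
  have "comp i (arrow_elem Q \<rho> x \<odot>\<^bsub>string_module Q C\<^esub> f) = 1 * comp i' f" for f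
  proof (rule poly_mapping_eqI)
    fix q
    have "step C (i - n * q) (Direct x) (i' - n * q)" using st by (simp add: period_invariant)
    then show "Poly_Mapping.lookup (comp i (arrow_elem Q \<rho> x \<odot>\<^bsub>string_module Q C\<^esub> f)) q =
        Poly_Mapping.lookup (1 * comp i' f) q"
      by (simp add: lookup_comp lookup_arrow_elem(1)[OF string_algebra C] string_carrier)
  qed
  from tcoord_smult[OF this assms] show "tcoord (arrow_elem Q \<rho> x \<odot>\<^bsub>P\<^esub> X) i = tcoord X i'"
    using tcoord_closed[OF assms(1)] by simp
next
  assume none: "\<nexists>i'. step C i (Direct x) i'"
  have "comp i (arrow_elem Q \<rho> x \<odot>\<^bsub>string_module Q C\<^esub> f) = 0 * comp i f" for f
  proof (rule poly_mapping_eqI)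
    fix q
    have "\<nexists>i'. step C (i - n * q) (Direct x) i'"
    proof
      assume "\<exists>i'. step C (i - n * q) (Direct x) i'"
      then obtain i' where "step C (i - n * q) (Direct x) ((i' + n * q) - n * q)" by auto
      then show False using none unfolding period_invariant by blast
    qed
    then show "Poly_Mapping.lookup (comp i (arrow_elem Q \<rho> x \<odot>\<^bsub>string_module Q C\<^esub> f)) q =
        Poly_Mapping.lookup (0 * comp i f) q"
      by (simp add: lookup_comp lookup_arrow_elem(2)[OF string_algebra C] string_carrier)
  qed
  from tcoord_smult[OF this assms] show "tcoord (arrow_elem Q \<rho> x \<odot>\<^bsub>P\<^esub> X) i = \<zero>\<^bsub>V\<^esub>"
    using tcoord_closed[OF assms(1)] by simp
qed

end

section \<open>Direct sums of string modules and of modules \<open>M(C, V)\<close>\<close>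

locale string_sum =
  fixes Q :: "('v, 'a) pre_digraph" and \<rho> :: "'a list set" and \<sigma> :: "'a letter \<Rightarrow> int"
    and M :: "((('v, 'a) qpath \<Rightarrow>\<^sub>0 'k::field) set, 'm) module"
    and S :: "'l set" and Cs :: "'l \<Rightarrow> ('v, 'a) qword"
    and P :: "'u set" and Cp :: "'u \<Rightarrow> ('v, 'a) qword"
    and V :: "'u \<Rightarrow> ('k laurent, 'w) module"
    and \<phi> :: "'m \<Rightarrow> ('l \<Rightarrow> (int \<Rightarrow>\<^sub>0 'k)) \<times> ('u \<Rightarrow> ((int \<Rightarrow>\<^sub>0 'k) \<times> 'w \<Rightarrow>\<^sub>0 int) set)"
  assumes string_algebra: "string_algebra Q \<rho>" and signs: "sign_choice Q \<rho> \<sigma>"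
    and string_word: "\<And>l. l \<in> S \<Longrightarrow> is_word Q \<rho> (Cs l) \<and> \<not> periodic (Cs l)"
    and periodic_word: "\<And>u. u \<in> P \<Longrightarrow> is_word Q \<rho> (Cp u) \<and> periodic (Cp u)"
    and laurent: "\<And>u. u \<in> P \<Longrightarrow> Module.module laurent_ring (V u)"
    and full: "full_module (quotient_algebra Q \<rho>) M"
    and \<phi>_iso: "\<phi> \<in> iso (add_monoid M) (add_monoid (direct_sum2
              (direct_sum S (\<lambda>l. string_module Q (Cs l)))
              (direct_sum P (\<lambda>u. periodic_module Q (Cp u) (V u)))))"
    and \<phi>_smult: "\<And>r m. r \<in> carrier (quotient_algebra Q \<rho>) \<Longrightarrow> m \<in> carrier M \<Longrightarrow>
      \<phi> (r \<odot>\<^bsub>M\<^esub> m) = r \<odot>\<^bsub>direct_sum2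
              (direct_sum S (\<lambda>l. string_module Q (Cs l)))
              (direct_sum P (\<lambda>u. periodic_module Q (Cp u) (V u)))\<^esub> \<phi> m"
begin

abbreviation SM where "SM l \<equiv> string_module Q (Cs l)"
abbreviation PM where "PM u \<equiv> periodic_module Q (Cp u) (V u)"
abbreviation N where "N \<equiv> direct_sum2 (direct_sum S SM) (direct_sum P PM)"

lemma group: "abelian_group M"
  using full by (simp add: full_module_def)

lemma smult_closed: "r \<in> carrier (quotient_algebra Q \<rho>) \<Longrightarrow> m \<in> carrier M \<Longrightarrow> r \<odot>\<^bsub>M\<^esub> m \<in> carrier M"
  using full by (simp add: full_module_def)

lemma tensor: "u \<in> P \<Longrightarrow> periodic_tensor (V u) Q \<rho> (Cp u)"
  using laurent periodic_word string_algebra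
  by (simp add: periodic_tensor_def periodic_tensor_axioms_def laurent_module_def)

lemma laurent_module: "u \<in> P \<Longrightarrow> laurent_module (V u)"
  using laurent by (simp add: laurent_module_def)

lemma quiver: "wf_digraph Q"
  using string_algebra by (simp add: string_algebra_def)

definition c1 :: "'m \<Rightarrow> 'l \<Rightarrow> int \<Rightarrow> 'k" where
  "c1 m l = Poly_Mapping.lookup (fst (\<phi> m) l)"

definition c2 :: "'m \<Rightarrow> 'u \<Rightarrow> int \<Rightarrow> 'w" where
  "c2 m u = periodic_tensor.tcoord (V u) (Cp u) (snd (\<phi> m) u)"

lemma \<phi>_closed:
  assumes "m \<in> carrier M"
  shows "l \<in> S \<Longrightarrow> fst (\<phi> m) l \<in> carrier (SM l)" "u \<in> P \<Longrightarrow> snd (\<phi> m) u \<in> carrier (PM u)"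
    "finite {l \<in> S. fst (\<phi> m) l \<noteq> 0}" "finite {u \<in> P. snd (\<phi> m) u \<noteq> \<zero>\<^bsub>PM u\<^esub>}"
    "fst (\<phi> m) \<in> extensional S" "snd (\<phi> m) \<in> extensional P"
proof -
  have "\<phi> m \<in> carrier N" using \<phi>_iso assms by (auto simp: iso_def hom_def)
  then show "l \<in> S \<Longrightarrow> fst (\<phi> m) l \<in> carrier (SM l)" "u \<in> P \<Longrightarrow> snd (\<phi> m) u \<in> carrier (PM u)"
    "finite {l \<in> S. fst (\<phi> m) l \<noteq> 0}" "finite {u \<in> P. snd (\<phi> m) u \<noteq> \<zero>\<^bsub>PM u\<^esub>}"
    "fst (\<phi> m) \<in> extensional S" "snd (\<phi> m) \<in> extensional P"
    by (auto simp: direct_sum2_def direct_sum_def string_module_def PiE_def mem_Times_iff)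
qed

lemma \<phi>_eqI:
  assumes "m \<in> carrier M" "m' \<in> carrier M"
    "\<And>l. l \<in> S \<Longrightarrow> fst (\<phi> m) l = fst (\<phi> m') l" "\<And>u. u \<in> P \<Longrightarrow> snd (\<phi> m) u = snd (\<phi> m') u"
  shows "m = m'"
proof -
  have "fst (\<phi> m) = fst (\<phi> m')" by (rule extensionalityI[OF \<phi>_closed(5) \<phi>_closed(5)]) (use assms in auto)
  moreover have "snd (\<phi> m) = snd (\<phi> m')" by (rule extensionalityI[OF \<phi>_closed(6) \<phi>_closed(6)]) (use assms in auto)
  ultimately have "\<phi> m = \<phi> m'" by (simp add: prod_eq_iff)
  then show ?thesis using \<phi>_iso assms(1,2) by (auto simp: iso_def bij_betw_def inj_on_def)
qed

lemma \<phi>_add: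
  assumes "m \<in> carrier M" "m' \<in> carrier M"
  shows "l \<in> S \<Longrightarrow> fst (\<phi> (m \<oplus>\<^bsub>M\<^esub> m')) l = fst (\<phi> m) l + fst (\<phi> m') l"
    "u \<in> P \<Longrightarrow> snd (\<phi> (m \<oplus>\<^bsub>M\<^esub> m')) u = snd (\<phi> m) u \<oplus>\<^bsub>PM u\<^esub> snd (\<phi> m') u"
proof -
  have "\<phi> (m \<oplus>\<^bsub>M\<^esub> m') = \<phi> m \<oplus>\<^bsub>N\<^esub> \<phi> m'" using \<phi>_iso assms by (auto simp: iso_def hom_def)
  then show "l \<in> S \<Longrightarrow> fst (\<phi> (m \<oplus>\<^bsub>M\<^esub> m')) l = fst (\<phi> m) l + fst (\<phi> m') l"
    "u \<in> P \<Longrightarrow> snd (\<phi> (m \<oplus>\<^bsub>M\<^esub> m')) u = snd (\<phi> m) u \<oplus>\<^bsub>PM u\<^esub> snd (\<phi> m') u"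
    by (auto simp: direct_sum2_def direct_sum_def string_module_def split: prod.splits)
qed

lemma \<phi>_smult_components:
  assumes "r \<in> carrier (quotient_algebra Q \<rho>)" "m \<in> carrier M"
  shows "l \<in> S \<Longrightarrow> fst (\<phi> (r \<odot>\<^bsub>M\<^esub> m)) l = r \<odot>\<^bsub>SM l\<^esub> fst (\<phi> m) l"
    "u \<in> P \<Longrightarrow> snd (\<phi> (r \<odot>\<^bsub>M\<^esub> m)) u = r \<odot>\<^bsub>PM u\<^esub> snd (\<phi> m) u"
  using \<phi>_smult[OF assms] by (auto simp: direct_sum2_def direct_sum_def split: prod.splits)

lemma c1_index: "m \<in> carrier M \<Longrightarrow> l \<in> S \<Longrightarrow> c1 m l i \<noteq> 0 \<Longrightarrow> i \<in> index_set (word_shape (Cs l))"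
  using \<phi>_closed(1)[of m l] by (auto simp: c1_def string_module_def in_keys_iff)

lemma c1_finite: "m \<in> carrier M \<Longrightarrow> finite {(l, i). l \<in> S \<and> c1 m l i \<noteq> 0}"
proof -
  assume m: "m \<in> carrier M"
  have "{(l, i). l \<in> S \<and> c1 m l i \<noteq> 0} \<subseteq> Sigma {l \<in> S. fst (\<phi> m) l \<noteq> 0} (\<lambda>l. Poly_Mapping.keys (fst (\<phi> m) l))"
    by (auto simp: c1_def in_keys_iff)
  then show ?thesis by (rule finite_subset) (use \<phi>_closed(3)[OF m] in auto)
qed

lemma c2_closed [simp, intro]: "m \<in> carrier M \<Longrightarrow> u \<in> P \<Longrightarrow> c2 m u i \<in> carrier (V u)"
  using periodic_tensor.tcoord_closed[OF tensor \<phi>_closed(2)] by (simp add: c2_def)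

lemma c2_shift:
  "m \<in> carrier M \<Longrightarrow> u \<in> P \<Longrightarrow> c2 m u (i + int (period (Cp u))) = Poly_Mapping.single 1 1 \<odot>\<^bsub>V u\<^esub> c2 m u i"
  using periodic_tensor.tcoord_shift[OF tensor \<phi>_closed(2)] by (simp add: c2_def)

lemma c2_finite: "m \<in> carrier M \<Longrightarrow> finite {u \<in> P. \<exists>i. c2 m u i \<noteq> \<zero>\<^bsub>V u\<^esub>}"
  by (rule finite_subset[OF _ \<phi>_closed(4)]) (auto simp: c2_def periodic_tensor.tcoord_zero[OF tensor])

lemma coordinates_inj:
  assumes "m \<in> carrier M" "m' \<in> carrier M"
    "\<And>l i. l \<in> S \<Longrightarrow> i \<in> index_set (word_shape (Cs l)) \<Longrightarrow> c1 m l i = c1 m' l i"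
    "\<And>u i. u \<in> P \<Longrightarrow> c2 m u i = c2 m' u i"
  shows "m = m'"
proof (rule \<phi>_eqI[OF assms(1,2)])
  fix l assume l: "l \<in> S"
  have "c1 m l i = c1 m' l i" for i
    using assms(3)[OF l, of i] c1_index[OF assms(1) l, of i] c1_index[OF assms(2) l, of i] by metis
  then show "fst (\<phi> m) l = fst (\<phi> m') l" by (intro poly_mapping_eqI) (simp add: c1_def)
next
  fix u assume u: "u \<in> P"
  show "snd (\<phi> m) u = snd (\<phi> m') u"
    by (rule periodic_tensor.tcoord_inj[OF tensor[OF u]]) (use \<phi>_closed(2)[OF _ u] assms u in \<open>auto simp: c2_def\<close>)
qed

lemma c1_add: "m \<in> carrier M \<Longrightarrow> m' \<in> carrier M \<Longrightarrow> l \<in> S \<Longrightarrow> c1 (m \<oplus>\<^bsub>M\<^esub> m') l i = c1 m l i + c1 m' l i"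
  by (simp add: c1_def \<phi>_add lookup_add)

lemma c2_add: "m \<in> carrier M \<Longrightarrow> m' \<in> carrier M \<Longrightarrow> u \<in> P \<Longrightarrow> c2 (m \<oplus>\<^bsub>M\<^esub> m') u i = c2 m u i \<oplus>\<^bsub>V u\<^esub> c2 m' u i"
  by (simp add: c2_def \<phi>_add periodic_tensor.tcoord_add[OF tensor] \<phi>_closed)

lemma c_zero: "l \<in> S \<Longrightarrow> c1 \<zero>\<^bsub>M\<^esub> l i = 0" "u \<in> P \<Longrightarrow> c2 \<zero>\<^bsub>M\<^esub> u i = \<zero>\<^bsub>V u\<^esub>"
proof -
  interpret M: abelian_group M by (rule group)
  show "l \<in> S \<Longrightarrow> c1 \<zero>\<^bsub>M\<^esub> l i = 0" proof -
    assume "l \<in> S"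
    then have "c1 \<zero>\<^bsub>M\<^esub> l i = c1 \<zero>\<^bsub>M\<^esub> l i + c1 \<zero>\<^bsub>M\<^esub> l i"
      using c1_add[OF M.zero_closed M.zero_closed, of l i] by (simp only: M.r_zero[OF M.zero_closed])
    then show "c1 \<zero>\<^bsub>M\<^esub> l i = 0" by (simp only: add_cancel_right_right)
  qed
  assume u: "u \<in> P"
  interpret V: laurent_module "V u" by (rule laurent_module[OF u])
  have "c2 \<zero>\<^bsub>M\<^esub> u i \<oplus>\<^bsub>V u\<^esub> c2 \<zero>\<^bsub>M\<^esub> u i = c2 \<zero>\<^bsub>M\<^esub> u i \<oplus>\<^bsub>V u\<^esub> \<zero>\<^bsub>V u\<^esub>"
    using c2_add[OF M.zero_closed M.zero_closed u, of i] u by simp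
  then show "c2 \<zero>\<^bsub>M\<^esub> u i = \<zero>\<^bsub>V u\<^esub>" using u V.V.add.l_cancel_one[of "c2 \<zero>\<^bsub>M\<^esub> u i" "c2 \<zero>\<^bsub>M\<^esub> u i"] by simp
qed

lemma c1_vertex:
  assumes "v \<in> verts Q" "m \<in> carrier M" "l \<in> S"
  shows "c1 (vertex_elem Q \<rho> c v \<odot>\<^bsub>M\<^esub> m) l i = (if word_vertex Q (Cs l) i = v then c * c1 m l i else 0)"
  using assms string_word[OF assms(3)]
  by (simp add: c1_def \<phi>_smult_components vertex_elem_in_quotient_algebra
      lookup_vertex_elem[OF string_algebra _ \<phi>_closed(1)])

lemma c1_arrow:
  assumes "x \<in> arcs Q" "m \<in> carrier M" "l \<in> S"
  shows "step (Cs l) i (Direct x) i' \<Longrightarrow> c1 (arrow_elem Q \<rho> x \<odot>\<^bsub>M\<^esub> m) l i = c1 m l i'"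
    "\<nexists>i'. step (Cs l) i (Direct x) i' \<Longrightarrow> c1 (arrow_elem Q \<rho> x \<odot>\<^bsub>M\<^esub> m) l i = 0"
  using assms string_word[OF assms(3)]
  by (simp_all add: c1_def \<phi>_smult_components arrow_elem_in_quotient_algebra quiver
      lookup_arrow_elem[OF string_algebra _ \<phi>_closed(1)])

lemma c2_vertex:
  assumes "v \<in> verts Q" "m \<in> carrier M" "u \<in> P"
  shows "c2 (vertex_elem Q \<rho> c v \<odot>\<^bsub>M\<^esub> m) u i =
    (if word_vertex Q (Cp u) i = v then Poly_Mapping.single 0 c \<odot>\<^bsub>V u\<^esub> c2 m u i else \<zero>\<^bsub>V u\<^esub>)"
proof -
  have "vertex_elem Q \<rho> c v \<odot>\<^bsub>PM u\<^esub> snd (\<phi> m) u \<in> carrier (PM u)"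
    using \<phi>_closed(2)[OF smult_closed, of "vertex_elem Q \<rho> c v" m u] assms
    by (simp add: \<phi>_smult_components vertex_elem_in_quotient_algebra)
  then show ?thesis
    using assms periodic_tensor.tcoord_vertex[OF tensor \<phi>_closed(2), of u m c v i]
    by (simp add: c2_def \<phi>_smult_components vertex_elem_in_quotient_algebra)
qed

lemma c2_arrow:
  assumes "x \<in> arcs Q" "m \<in> carrier M" "u \<in> P"
  shows "step (Cp u) i (Direct x) i' \<Longrightarrow> c2 (arrow_elem Q \<rho> x \<odot>\<^bsub>M\<^esub> m) u i = c2 m u i'"
    "\<nexists>i'. step (Cp u) i (Direct x) i' \<Longrightarrow> c2 (arrow_elem Q \<rho> x \<odot>\<^bsub>M\<^esub> m) u i = \<zero>\<^bsub>V u\<^esub>"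
proof -
  have cl: "arrow_elem Q \<rho> x \<odot>\<^bsub>PM u\<^esub> snd (\<phi> m) u \<in> carrier (PM u)"
    using \<phi>_closed(2)[OF smult_closed, of "arrow_elem Q \<rho> x" m u] assms
    by (simp add: \<phi>_smult_components arrow_elem_in_quotient_algebra quiver)
  have eq: "c2 (arrow_elem Q \<rho> x \<odot>\<^bsub>M\<^esub> m) u i =
      periodic_tensor.tcoord (V u) (Cp u) (arrow_elem Q \<rho> x \<odot>\<^bsub>PM u\<^esub> snd (\<phi> m) u) i"
    using assms by (simp add: c2_def \<phi>_smult_components arrow_elem_in_quotient_algebra quiver)
  show "step (Cp u) i (Direct x) i' \<Longrightarrow> c2 (arrow_elem Q \<rho> x \<odot>\<^bsub>M\<^esub> m) u i = c2 m u i'"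
    unfolding eq using periodic_tensor.tcoord_arrow(1)[OF tensor[OF assms(3)] \<phi>_closed(2)[OF assms(2,3)] cl]
    by (simp add: c2_def)
  show "\<nexists>i'. step (Cp u) i (Direct x) i' \<Longrightarrow> c2 (arrow_elem Q \<rho> x \<odot>\<^bsub>M\<^esub> m) u i = \<zero>\<^bsub>V u\<^esub>"
    unfolding eq using periodic_tensor.tcoord_arrow(2)[OF tensor[OF assms(3)] \<phi>_closed(2)[OF assms(2,3)] cl]
    by simp
qed

text \<open>The source of elements with prescribed coordinates: on the periodic side
  \<open>tcoord_surj\<close> realises each family compatible with \<open>T\<close>, and surjectivity
  of \<phi> brings the result back to \<open>M\<close>.\<close>

lemma coordinates_surj:
  assumes f: "finite {(l, i). l \<in> S \<and> f l i \<noteq> 0}" "\<And>l i. l \<in> S \<Longrightarrow> f l i \<noteq> 0 \<Longrightarrow> i \<in> index_set (word_shape (Cs l))"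
    and g: "\<And>u i. u \<in> P \<Longrightarrow> g u i \<in> carrier (V u)"
      "\<And>u i. u \<in> P \<Longrightarrow> g u (i + int (period (Cp u))) = Poly_Mapping.single 1 1 \<odot>\<^bsub>V u\<^esub> g u i"
      "finite {u \<in> P. \<exists>i. g u i \<noteq> \<zero>\<^bsub>V u\<^esub>}"
  shows "\<exists>m\<in>carrier M. (\<forall>l\<in>S. \<forall>i. c1 m l i = f l i) \<and> (\<forall>u\<in>P. \<forall>i. c2 m u i = g u i)"
proof -
  have fin: "finite {i. f l i \<noteq> 0}" if "l \<in> S" for l
    by (rule finite_subset[OF _ finite_imageI[OF f(1), of snd]]) (use that in force)
  define F where "F = (\<lambda>l\<in>S. Abs_poly_mapping (f l))"
  have F: "Poly_Mapping.lookup (F l) = f l" if "l \<in> S" for l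
    using fin[OF that] that by (simp add: F_def)
  have "\<exists>X\<in>carrier (PM u). \<forall>i. periodic_tensor.tcoord (V u) (Cp u) X i = g u i" if "u \<in> P" for u
    by (rule periodic_tensor.tcoord_surj[OF tensor[OF that]]) (use g that in auto)
  then obtain G' where G': "\<And>u. u \<in> P \<Longrightarrow> G' u \<in> carrier (PM u)"
    "\<And>u i. u \<in> P \<Longrightarrow> periodic_tensor.tcoord (V u) (Cp u) (G' u) i = g u i" by metis
  define G where "G = (\<lambda>u\<in>P. G' u)"
  have G: "\<And>u. u \<in> P \<Longrightarrow> G u \<in> carrier (PM u)"
    "\<And>u i. u \<in> P \<Longrightarrow> periodic_tensor.tcoord (V u) (Cp u) (G u) i = g u i" using G' by (auto simp: G_def)
  have "finite {l \<in> S. F l \<noteq> 0}"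
  proof (rule finite_subset[OF _ finite_imageI[OF f(1), of fst]], rule)
    fix l assume l: "l \<in> {l \<in> S. F l \<noteq> 0}"
    then obtain i where "Poly_Mapping.lookup (F l) i \<noteq> 0" using poly_mapping_eqI[of "F l" 0] by auto
    then show "l \<in> fst ` {(l, i). l \<in> S \<and> f l i \<noteq> 0}" using F l by force
  qed
  moreover have "{u \<in> P. G u \<noteq> \<zero>\<^bsub>PM u\<^esub>} \<subseteq> {u \<in> P. \<exists>i. g u i \<noteq> \<zero>\<^bsub>V u\<^esub>}"
  proof
    fix u assume u: "u \<in> {u \<in> P. G u \<noteq> \<zero>\<^bsub>PM u\<^esub>}"
    interpret T: periodic_tensor "V u" Q \<rho> "Cp u" by (rule tensor) (use u in simp)
    have "\<exists>i. g u i \<noteq> \<zero>\<^bsub>V u\<^esub>"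
    proof (rule ccontr)
      assume "\<nexists>i. g u i \<noteq> \<zero>\<^bsub>V u\<^esub>"
      then have "G u = \<zero>\<^bsub>PM u\<^esub>"
        by (intro T.tcoord_inj) (use u G in \<open>auto simp: T.tcoord_zero\<close>)
      then show False using u by simp
    qed
    then show "u \<in> {u \<in> P. \<exists>i. g u i \<noteq> \<zero>\<^bsub>V u\<^esub>}" using u by simp
  qed
  then have "finite {u \<in> P. G u \<noteq> \<zero>\<^bsub>PM u\<^esub>}" by (rule finite_subset) (rule g(3))
  moreover have "F l \<in> carrier (SM l)" if "l \<in> S" for l
    using f(2)[OF that] F[OF that] by (auto simp: string_module_def in_keys_iff)
  moreover have "F \<in> extensional S" "G \<in> extensional P" by (auto simp: F_def G_def)
  ultimately have "(F, G) \<in> carrier N"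
    using G(1) by (auto simp: direct_sum2_def direct_sum_def PiE_def string_module_def)
  moreover have "\<phi> ` carrier M = carrier N" using \<phi>_iso by (simp add: iso_def bij_betw_def)
  ultimately have "(F, G) \<in> \<phi> ` carrier M" by simp
  then obtain m where "m \<in> carrier M" "\<phi> m = (F, G)" by (metis imageE)
  then show ?thesis using F G(2) by (intro bexI[of _ m]) (auto simp: c1_def c2_def)
qed

section \<open>The two kinds of coordinates combined\<close>

definition co :: "'m \<Rightarrow> 'l + 'u \<Rightarrow> int \<Rightarrow> 'k + 'w" where
  "co m s i = (case s of Inl l \<Rightarrow> Inl (c1 m l i) | Inr u \<Rightarrow> Inr (c2 m u i))"

definition co0 :: "'l + 'u \<Rightarrow> 'k + 'w" where
  "co0 s = (case s of Inl l \<Rightarrow> Inl 0 | Inr u \<Rightarrow> Inr \<zero>\<^bsub>V u\<^esub>)"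

lemma co_simps [simp]:
  "co m (Inl l) i = Inl (c1 m l i)" "co m (Inr u) i = Inr (c2 m u i)"
  "co0 (Inl l) = Inl 0" "co0 (Inr u) = Inr \<zero>\<^bsub>V u\<^esub>"
  by (simp_all add: co_def co0_def)

abbreviation J where "J \<equiv> Inl ` S \<union> Inr ` P"
abbreviation wd where "wd \<equiv> case_sum Cs Cp"

lemma co_relocate:
  fixes h :: "'l + 'u \<Rightarrow> int \<Rightarrow> int option"
  assumes m: "m \<in> carrier M"
    and h: "\<And>s i i'. s \<in> J \<Longrightarrow> i \<in> index_set (word_shape (wd s)) \<Longrightarrow> h s i = Some i' \<Longrightarrow>
         i' \<in> index_set (word_shape (wd s)) \<and> \<bar>i' - i\<bar> \<le> 1"
    and per: "\<And>s i. s \<in> J \<Longrightarrow> periodic (wd s) \<Longrightarrow>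
         h s (i + int (period (wd s))) = map_option (\<lambda>j. j + int (period (wd s))) (h s i)"
  shows "\<exists>m'\<in>carrier M. \<forall>s\<in>J. \<forall>i\<in>index_set (word_shape (wd s)).
         co m' s i = (case h s i of None \<Rightarrow> co0 s | Some i' \<Rightarrow> co m s i')"
proof -
  define f where "f l i = (if i \<in> index_set (word_shape (Cs l)) then
    case h (Inl l) i of None \<Rightarrow> 0 | Some i' \<Rightarrow> c1 m l i' else 0)" for l i
  define g where "g u i = (case h (Inr u) i of None \<Rightarrow> \<zero>\<^bsub>V u\<^esub> | Some i' \<Rightarrow> c2 m u i')" for u i
  let ?A = "{(l, i). l \<in> S \<and> c1 m l i \<noteq> 0}"
  have "\<exists>m'\<in>carrier M. (\<forall>l\<in>S. \<forall>i. c1 m' l i = f l i) \<and> (\<forall>u\<in>P. \<forall>i. c2 m' u i = g u i)"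
  proof (rule coordinates_surj)
    have "{(l, i). l \<in> S \<and> f l i \<noteq> 0} \<subseteq>
      ?A \<union> (\<lambda>(l, i). (l, i + 1)) ` ?A \<union> (\<lambda>(l, i). (l, i - 1)) ` ?A"
    proof
      fix p assume "p \<in> {(l, i). l \<in> S \<and> f l i \<noteq> 0}"
      then obtain l i where p: "p = (l, i)" "l \<in> S" "f l i \<noteq> 0" by auto
      then obtain i' where i': "h (Inl l) i = Some i'" "c1 m l i' \<noteq> 0" "i \<in> index_set (word_shape (Cs l))"
        by (auto simp: f_def split: if_splits option.splits)
      then have "\<bar>i' - i\<bar> \<le> 1" using h[of "Inl l" i i'] p by auto
      then consider "i' = i" | "i = i' + 1" | "i = i' - 1" by linarith
      then show "p \<in> ?A \<union> (\<lambda>(l, i). (l, i + 1)) ` ?A \<union> (\<lambda>(l, i). (l, i - 1)) ` ?A"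
        using p i'(2) by cases force+
    qed
    then show "finite {(l, i). l \<in> S \<and> f l i \<noteq> 0}" by (rule finite_subset) (use c1_finite[OF m] in auto)
    show "i \<in> index_set (word_shape (Cs l))" if "f l i \<noteq> 0" for l i using that by (simp add: f_def split: if_splits)
    show "g u i \<in> carrier (V u)" if "u \<in> P" for u i
      using m that laurent_module[OF that] module.axioms(2)[OF laurent[OF that]]
      by (auto simp: g_def abelian_group.axioms abelian_monoid.zero_closed split: option.split)
    show "g u (i + int (period (Cp u))) = Poly_Mapping.single 1 1 \<odot>\<^bsub>V u\<^esub> g u i" if "u \<in> P" for u i
    proof -
      interpret V: laurent_module "V u" by (rule laurent_module[OF that])
      show ?thesis using per[of "Inr u" i] periodic_word[OF that] that c2_shift[OF m that]
        by (cases "h (Inr u) i") (auto simp: g_def)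
    qed
    show "finite {u \<in> P. \<exists>i. g u i \<noteq> \<zero>\<^bsub>V u\<^esub>}"
      by (rule finite_subset[OF _ c2_finite[OF m]]) (auto simp: g_def split: option.splits)
  qed
  then obtain m' where m': "m' \<in> carrier M" "\<forall>l\<in>S. \<forall>i. c1 m' l i = f l i" "\<forall>u\<in>P. \<forall>i. c2 m' u i = g u i" by blast
  show ?thesis
    by (rule bexI[OF _ m'(1)]) (use m'(2,3) in \<open>auto simp: f_def g_def split: option.split\<close>)
qed

text \<open>In a periodic word \<open>i\<close> and its residue modulo the period have the same
  rays, so the positions of one period represent all.\<close>

lemma co_finite_rays:
  assumes m: "m \<in> carrier M"
  shows "\<exists>K. finite K \<and> (\<forall>s\<in>J. \<forall>i\<in>index_set (word_shape (wd s)). co m s i \<noteq> co0 s \<longrightarrow>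
         (\<exists>i'\<in>index_set (word_shape (wd s)). (s, i') \<in> K \<and> (\<forall>d. ray (wd s) i d = ray (wd s) i' d)))"
proof -
  define K where "K = (\<lambda>(l, i). (Inl l, i)) ` {(l, i). l \<in> S \<and> c1 m l i \<noteq> 0} \<union>
    Sigma (Inr ` {u \<in> P. \<exists>i. c2 m u i \<noteq> \<zero>\<^bsub>V u\<^esub>}) (\<lambda>s. {0..<int (period (wd s))})"
  have "finite K" unfolding K_def using c1_finite[OF m] c2_finite[OF m] by (intro finite_UnI finite_imageI finite_SigmaI) auto
  moreover have "\<exists>i'\<in>index_set (word_shape (wd s)). (s, i') \<in> K \<and> (\<forall>d. ray (wd s) i d = ray (wd s) i' d)"
    if s: "s \<in> J" "i \<in> index_set (word_shape (wd s))" "co m s i \<noteq> co0 s" for s i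
  proof (cases s)
    case (Inl l)
    then show ?thesis using s by (intro bexI[of _ i]) (auto simp: K_def)
  next
    case (Inr u)
    then have u: "u \<in> P" using s by auto
    have per: "periodic (Cp u)" using periodic_word[OF u] by simp
    let ?n = "int (period (Cp u))"
    have "?n > 0" using period_props(1)[OF per] by simp
    then have "(s, i mod ?n) \<in> K" using Inr u s(3) unfolding K_def by auto
    moreover have "?n dvd i mod ?n - i" by (simp add: mod_eq_dvd_iff[symmetric])
    then have "\<forall>d. ray (Cp u) i d = ray (Cp u) (i mod ?n) d" using same_rays_dvd[OF per] by blast
    ultimately show ?thesis using Inr period_props(3)[OF per] by (intro bexI[of _ "i mod ?n"]) auto
  qed
  ultimately show ?thesis by (intro exI[of _ K] conjI ballI impI)
qed

lemma cell_word: "s \<in> J \<Longrightarrow> is_word Q \<rho> (wd s)"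
  using string_word periodic_word by auto

lemma vertex_elem_closed: "v \<in> verts Q \<Longrightarrow> m \<in> carrier M \<Longrightarrow> vertex_elem Q \<rho> c v \<odot>\<^bsub>M\<^esub> m \<in> carrier M"
  by (intro smult_closed vertex_elem_in_quotient_algebra)

lemma arrow_elem_closed: "x \<in> arcs Q \<Longrightarrow> m \<in> carrier M \<Longrightarrow> arrow_elem Q \<rho> x \<odot>\<^bsub>M\<^esub> m \<in> carrier M"
  by (intro smult_closed arrow_elem_in_quotient_algebra quiver)

lemma co_inj:
  assumes "m \<in> carrier M" "m' \<in> carrier M"
    and eq: "\<And>s i. s \<in> J \<Longrightarrow> i \<in> index_set (word_shape (wd s)) \<Longrightarrow> co m s i = co m' s i"
  shows "m = m'"
proof (rule coordinates_inj[OF assms(1,2)])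
  show "c1 m l i = c1 m' l i" if "l \<in> S" "i \<in> index_set (word_shape (Cs l))" for l i
    using eq[of "Inl l" i] that by simp
  show "c2 m u i = c2 m' u i" if "u \<in> P" for u i
    using eq[of "Inr u" i] that period_props(3)[of "Cp u"] periodic_word[OF that] by simp
qed

lemma co_zero_elem: "s \<in> J \<Longrightarrow> co \<zero>\<^bsub>M\<^esub> s i = co0 s"
  by (auto simp: c_zero)

lemma co_add_cancel:
  assumes "m \<in> carrier M" "m' \<in> carrier M" "s \<in> J" "co m s i = co0 s"
  shows "co (m \<oplus>\<^bsub>M\<^esub> m') s i = co m' s i"
proof (cases s)
  case (Inl l)
  then show ?thesis using assms by (auto simp: c1_add)
next
  case (Inr u)
  then have u: "u \<in> P" using assms by auto
  interpret V: laurent_module "V u" by (rule laurent_module[OF u])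
  show ?thesis using assms Inr u by (auto simp: c2_add)
qed

lemma co_vertex_elem:
  assumes "v \<in> verts Q" "m \<in> carrier M" "s \<in> J"
  shows "co (vertex_elem Q \<rho> 1 v \<odot>\<^bsub>M\<^esub> m) s i = (if word_vertex Q (wd s) i = v then co m s i else co0 s)"
proof (cases s)
  case (Inl l)
  then show ?thesis using assms by (auto simp: c1_vertex)
next
  case (Inr u)
  then have u: "u \<in> P" using assms by auto
  interpret V: laurent_module "V u" by (rule laurent_module[OF u])
  show ?thesis using assms Inr u by (auto simp: c2_vertex)
qed

lemma co_arrow_elem:
  assumes "x \<in> arcs Q" "m \<in> carrier M" "s \<in> J"
  shows "step (wd s) i (Direct x) i' \<Longrightarrow> co (arrow_elem Q \<rho> x \<odot>\<^bsub>M\<^esub> m) s i = co m s i'"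
    "\<nexists>i'. step (wd s) i (Direct x) i' \<Longrightarrow> co (arrow_elem Q \<rho> x \<odot>\<^bsub>M\<^esub> m) s i = co0 s"
  using assms c1_arrow c2_arrow by auto

sublocale word_coordinates Q \<rho> \<sigma> M J wd co co0
  by (rule word_coordinates.intro)
    (rule string_algebra signs group cell_word vertex_elem_closed arrow_elem_closed co_inj co_zero_elem
      co_add_cancel co_vertex_elem co_arrow_elem co_relocate co_finite_rays; assumption)+

end

section \<open>The quotient \<open>F\<^sub>B\<^sub>,\<^sub>D(M)\<close>\<close>

text \<open>The functions \<open>K\<close> are coordinates and the vectors dual to them form the
  basis: additivity turns a linear combination into its list of coefficients, and injectivity then
  gives both spanning and uniqueness.\<close>

lemma has_dimI:
  fixes F :: "('k::field, 'x) module" and K :: "'x \<Rightarrow> 'i \<Rightarrow> 'k"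
  assumes F: "abelian_group F"
    and closed: "\<And>c x. x \<in> carrier F \<Longrightarrow> c \<odot>\<^bsub>F\<^esub> x \<in> carrier F"
    and add: "\<And>x y a. x \<in> carrier F \<Longrightarrow> y \<in> carrier F \<Longrightarrow> a \<in> A \<Longrightarrow> K (x \<oplus>\<^bsub>F\<^esub> y) a = K x a + K y a"
    and smult: "\<And>c x a. x \<in> carrier F \<Longrightarrow> a \<in> A \<Longrightarrow> K (c \<odot>\<^bsub>F\<^esub> x) a = c * K x a"
    and inj: "\<And>x y. x \<in> carrier F \<Longrightarrow> y \<in> carrier F \<Longrightarrow> (\<And>a. a \<in> A \<Longrightarrow> K x a = K y a) \<Longrightarrow> x = y"
    and fin: "\<And>x. x \<in> carrier F \<Longrightarrow> finite {a \<in> A. K x a \<noteq> 0}"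
    and dual: "\<And>a. a \<in> A \<Longrightarrow> \<exists>x\<in>carrier F. \<forall>b\<in>A. K x b = (if b = a then 1 else 0)"
  shows "has_dim F A"
proof -
  interpret abelian_group F by (rule F)
  obtain \<beta> where \<beta>: "\<And>a. a \<in> A \<Longrightarrow> \<beta> a \<in> carrier F"
    "\<And>a b. a \<in> A \<Longrightarrow> b \<in> A \<Longrightarrow> K (\<beta> a) b = (if b = a then 1 else 0)"
    using dual by metis
  have \<beta>_inj: "inj_on \<beta> A" using \<beta>(2) by (intro inj_onI) (metis one_neq_zero)
  let ?S = "\<beta> ` A"
  have K_zero: "K \<zero>\<^bsub>F\<^esub> a = 0" if "a \<in> A" for a
    using add[OF zero_closed zero_closed that] by (simp only: l_zero[OF zero_closed] add_cancel_right_right)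
  have K_sum: "K (finsum F g X) a = (\<Sum>x\<in>X. K (g x) a)" if "finite X" "g \<in> X \<rightarrow> carrier F" "a \<in> A" for g X a
    using that
  proof (induction X)
    case (insert x X)
    then have "g x \<in> carrier F" "g \<in> X \<rightarrow> carrier F" by auto
    then show ?case using insert add[of "g x" "finsum F g X" a] by simp
  qed (simp add: K_zero)
  define comb where "comb c = finsum F (\<lambda>b. Poly_Mapping.lookup c b \<odot>\<^bsub>F\<^esub> b) (Poly_Mapping.keys c)" for c
  have comb: "comb c \<in> carrier F" "\<And>a. a \<in> A \<Longrightarrow> K (comb c) a = Poly_Mapping.lookup c (\<beta> a)"
    if c: "Poly_Mapping.keys c \<subseteq> ?S" for c
  proof -
    have S: "?S \<subseteq> carrier F" using \<beta>(1) by auto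
    have m: "(\<lambda>b. Poly_Mapping.lookup c b \<odot>\<^bsub>F\<^esub> b) \<in> Poly_Mapping.keys c \<rightarrow> carrier F" using c S closed by blast
    then show "comb c \<in> carrier F" unfolding comb_def by (rule finsum_closed)
    fix a assume a: "a \<in> A"
    have "K (comb c) a = (\<Sum>b\<in>Poly_Mapping.keys c. K (Poly_Mapping.lookup c b \<odot>\<^bsub>F\<^esub> b) a)"
      unfolding comb_def by (rule K_sum[OF _ m a]) simp
    also have "\<dots> = (\<Sum>b\<in>Poly_Mapping.keys c. if b = \<beta> a then Poly_Mapping.lookup c b else 0)"
    proof (rule sum.cong[OF refl])
      fix b assume "b \<in> Poly_Mapping.keys c"
      then obtain a' where a': "a' \<in> A" "b = \<beta> a'" using c by auto
      then have "b = \<beta> a \<longleftrightarrow> a = a'" using \<beta>_inj a by (auto simp: inj_on_def)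
      then show "K (Poly_Mapping.lookup c b \<odot>\<^bsub>F\<^esub> b) a = (if b = \<beta> a then Poly_Mapping.lookup c b else 0)"
        using smult[OF \<beta>(1)[OF a'(1)] a] \<beta>(2)[OF a'(1) a] a'(2) by simp
    qed
    also have "\<dots> = Poly_Mapping.lookup c (\<beta> a)" by (simp add: in_keys_iff)
    finally show "K (comb c) a = Poly_Mapping.lookup c (\<beta> a)" .
  qed
  have "\<exists>!c. Poly_Mapping.keys c \<subseteq> ?S \<and> x = comb c" if x: "x \<in> carrier F" for x
  proof
    let ?N = "{a \<in> A. K x a \<noteq> 0}"
    define c where "c = (\<Sum>a\<in>?N. Poly_Mapping.single (\<beta> a) (K x a))"
    have look: "Poly_Mapping.lookup c (\<beta> a) = K x a" if "a \<in> A" for a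
    proof -
      have "Poly_Mapping.lookup c (\<beta> a) = (\<Sum>b\<in>?N. if b = a then K x a else 0)"
        unfolding c_def lookup_sum
        by (rule sum.cong) (use \<beta>_inj that in \<open>auto simp: lookup_single when_def inj_on_def\<close>)
      then show ?thesis using fin[OF x] that by simp
    qed
    have keys: "Poly_Mapping.keys c \<subseteq> ?S"
    proof -
      have "Poly_Mapping.keys c \<subseteq> (\<Union>a\<in>?N. Poly_Mapping.keys (Poly_Mapping.single (\<beta> a) (K x a)))"
        unfolding c_def by (rule keys_sum)
      then show ?thesis by auto
    qed
    have "x = comb c" by (rule inj[OF x comb(1)[OF keys]]) (simp add: comb(2)[OF keys] look)
    then show "Poly_Mapping.keys c \<subseteq> ?S \<and> x = comb c" using keys by simp
    fix c' assume c': "Poly_Mapping.keys c' \<subseteq> ?S \<and> x = comb c'"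
    show "c' = c"
    proof (rule poly_mapping_eqI)
      fix b
      show "Poly_Mapping.lookup c' b = Poly_Mapping.lookup c b"
      proof (cases "b \<in> ?S")
        case True
        then show ?thesis using comb(2)[OF conjunct1[OF c']] c' look by auto
      next
        case False
        then show ?thesis using keys c' by (metis in_keys_iff subsetD)
      qed
    qed
  qed
  then have "is_basis F ?S"
    using \<beta>(1) unfolding is_basis_def comb_def by auto
  moreover have "?S \<approx> A" using \<beta>_inj by (simp add: inj_on_image_eqpoll_self)
  ultimately show ?thesis unfolding has_dim_def by blast
qed

lemma word_equiv_periodic:
  assumes "periodic C" "word_equiv C W"
  shows "periodic W"
proof -
  have A: "word_shape C = AllInt" by (rule period_props(3)[OF assms(1)])
  let ?n = "int (period C)"
  have n: "?n \<noteq> 0" using period_props(1)[OF assms(1)] by simp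
  have p: "letter_at C (p + ?n * q) = letter_at C p" for p q by (rule letter_at_period_mult[OF assms(1)])
  obtain c where C: "C = Letters AllInt c" using A by (cases C) auto
  obtain m where m: "W = shift m C \<or> W = shift m (word_inv C)"
    using assms(2) by (auto simp: word_equiv_def is_shift_of_def)
  then have "word_shape W = AllInt" by (auto simp: C shift_def)
  moreover have "letter_at W (q + ?n) = letter_at W q" for q
    using m p[of "q + m" 1] p[of "1 - (q + m)" "- 1"]
    by (auto simp: C shift_def positions_simps algebra_simps)
  ultimately show ?thesis using periodic_letters n by blast
qed

section \<open>Classes modulo \<open>F_minus\<close> and their coordinates\<close>

locale string_sum_functor = string_sum Q \<rho> \<sigma> M S Cs P Cp V \<phi>
  for Q :: "('v, 'a) pre_digraph" and \<rho> \<sigma>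
    and M :: "((('v, 'a) qpath \<Rightarrow>\<^sub>0 'k::field) set, 'm) module"
    and S :: "'l set" and Cs and P :: "'u set" and Cp
    and V :: "'u \<Rightarrow> ('k laurent, 'w) module" and \<phi> +
  fixes B D :: "('v, 'a) qword"
  assumes B: "is_word Q \<rho> B" "has_head B" and D: "is_word Q \<rho> D" "has_head D"
    and head: "word_head Q B = word_head Q D" and sign: "word_sign \<sigma> B = - word_sign \<sigma> D"
    and composable: "composable Q \<rho> \<sigma> (word_inv B) D"
begin

abbreviation A where "A \<equiv> F_plus Q \<rho> \<sigma> M B D"
abbreviation A' where "A' \<equiv> F_minus Q \<rho> \<sigma> M B D"
abbreviation F where "F \<equiv> F_space Q \<rho> \<sigma> M B D"
abbreviation split where "split \<equiv> split_cell B D"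
abbreviation W where "W \<equiv> concatenation (word_inv B) D"

text \<open>The set of positions provided by \<open>F_supported\<close>, fixed by choice so that all
  later statements refer to the same set.\<close>

definition region :: "'l + 'u \<Rightarrow> int \<Rightarrow> bool" where
  "region = (SOME R. A = supported R \<and> A' = supported (\<lambda>s i. R s i \<and> \<not> split s i) \<and>
     (\<forall>s i. split s i \<longrightarrow> s \<in> J \<longrightarrow> R s i) \<and> ray_invariant R \<and>
     (\<forall>s i. s \<in> J \<longrightarrow> i \<in> I s \<longrightarrow> R s i \<longrightarrow> word_vertex Q (wd s) i = word_head Q D))"

lemma region:
  "A = supported region" "A' = supported (\<lambda>s i. region s i \<and> \<not> split s i)"
  "split s i \<Longrightarrow> s \<in> J \<Longrightarrow> region s i"
  "s \<in> J \<Longrightarrow> i \<in> I s \<Longrightarrow> region s i \<Longrightarrow> word_vertex Q (wd s) i = word_head Q D"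
proof -
  let ?P = "\<lambda>R. A = supported R \<and> A' = supported (\<lambda>s i. R s i \<and> \<not> split s i) \<and>
     (\<forall>s i. split s i \<longrightarrow> s \<in> J \<longrightarrow> R s i) \<and> ray_invariant R \<and>
     (\<forall>s i. s \<in> J \<longrightarrow> i \<in> I s \<longrightarrow> R s i \<longrightarrow> word_vertex Q (wd s) i = word_head Q D)"
  have "\<exists>R. ?P R"
  proof (rule F_supported[OF B D head sign])
    fix R assume "A = supported R" "A' = supported (\<lambda>s i. R s i \<and> \<not> split s i)"
      "\<And>s i. split s i \<Longrightarrow> s \<in> J \<Longrightarrow> R s i" "ray_invariant R"
      "\<And>s i. s \<in> J \<Longrightarrow> i \<in> I s \<Longrightarrow> R s i \<Longrightarrow> word_vertex Q (wd s) i = word_head Q D"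
    then show ?thesis by (intro exI[of _ R] conjI allI impI)
  qed
  then have P: "?P region" unfolding region_def by (rule someI_ex)
  show "A = supported region" by (rule conjunct1[OF P])
  show "A' = supported (\<lambda>s i. region s i \<and> \<not> split s i)" by (rule conjunct1[OF conjunct2[OF P]])
  note rest = conjunct2[OF conjunct2[OF P]]
  show "split s i \<Longrightarrow> s \<in> J \<Longrightarrow> region s i"
    "s \<in> J \<Longrightarrow> i \<in> I s \<Longrightarrow> region s i \<Longrightarrow> word_vertex Q (wd s) i = word_head Q D"
    using rest by blast+
qed

lemma A_carrier: "a \<in> A \<Longrightarrow> a \<in> carrier M"
  unfolding region(1) by (rule supportedD)

lemma subgroups: "additive_subgroup A M" "additive_subgroup A' M"
  unfolding region by (rule supported_subgroup)+

lemma A'_subset: "A' \<subseteq> A"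
  unfolding region supported_def by blast

definition agree :: "'m \<Rightarrow> 'm \<Rightarrow> bool" where
  "agree a a' \<longleftrightarrow> (\<forall>s\<in>J. \<forall>i. split s i \<longrightarrow> co a s i = co a' s i)"

lemma c1_minus: "m \<in> carrier M \<Longrightarrow> m' \<in> carrier M \<Longrightarrow> l \<in> S \<Longrightarrow> c1 (m \<ominus>\<^bsub>M\<^esub> m') l i = c1 m l i - c1 m' l i"
proof -
  interpret M: abelian_group M by (rule group)
  assume a: "m \<in> carrier M" "m' \<in> carrier M" "l \<in> S"
  have "c1 ((m \<ominus>\<^bsub>M\<^esub> m') \<oplus>\<^bsub>M\<^esub> m') l i = c1 (m \<ominus>\<^bsub>M\<^esub> m') l i + c1 m' l i" using a by (intro c1_add) auto
  moreover have "(m \<ominus>\<^bsub>M\<^esub> m') \<oplus>\<^bsub>M\<^esub> m' = m" using a by (simp add: M.minus_eq M.a_assoc M.l_neg)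
  ultimately show ?thesis by simp
qed

lemma co_minus_iff:
  assumes "m \<in> carrier M" "m' \<in> carrier M" "s \<in> J"
  shows "co (m \<ominus>\<^bsub>M\<^esub> m') s i = co0 s \<longleftrightarrow> co m s i = co m' s i"
proof (cases s)
  case (Inl l)
  then show ?thesis using assms by (auto simp: c1_minus)
next
  case (Inr u)
  interpret M: abelian_group M by (rule group)
  have u: "u \<in> P" using assms Inr by auto
  interpret V: laurent_module "V u" by (rule laurent_module[OF u])
  have "c2 ((m \<ominus>\<^bsub>M\<^esub> m') \<oplus>\<^bsub>M\<^esub> m') u i = c2 (m \<ominus>\<^bsub>M\<^esub> m') u i \<oplus>\<^bsub>V u\<^esub> c2 m' u i" using assms u by (intro c2_add) auto
  moreover have "(m \<ominus>\<^bsub>M\<^esub> m') \<oplus>\<^bsub>M\<^esub> m' = m" using assms by (simp add: M.minus_eq M.a_assoc M.l_neg)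
  ultimately have eq: "c2 m u i = c2 (m \<ominus>\<^bsub>M\<^esub> m') u i \<oplus>\<^bsub>V u\<^esub> c2 m' u i" by simp
  show ?thesis unfolding Inr using assms u V.V.add.r_cancel_one[of "c2 m' u i" "c2 (m \<ominus>\<^bsub>M\<^esub> m') u i"]
    by (simp add: eq)
qed

text \<open>The supports of \<open>F_plus\<close> and \<open>F_minus\<close> differ by the split
  positions alone, so a class modulo \<open>F_minus\<close> is known from its coordinates
  there.\<close>

lemma agree_iff:
  assumes "a \<in> A" "a' \<in> A"
  shows "agree a a' \<longleftrightarrow> a \<ominus>\<^bsub>M\<^esub> a' \<in> A'"
proof -
  interpret M: abelian_group M by (rule group)
  interpret S: additive_subgroup A M by (rule subgroups)
  have d: "a \<ominus>\<^bsub>M\<^esub> a' \<in> A" using assms unfolding M.minus_eq by (intro S.a_closed S.a_inv_closed)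
  have ac: "a \<in> carrier M" "a' \<in> carrier M" using assms A_carrier by auto
  have split_I: "i \<in> I s" if "split s i" for s i using that by (auto simp: split_cell_def splits_at_def)
  have "a \<ominus>\<^bsub>M\<^esub> a' \<in> A' \<longleftrightarrow> (\<forall>s\<in>J. \<forall>i\<in>I s. co (a \<ominus>\<^bsub>M\<^esub> a') s i \<noteq> co0 s \<longrightarrow> \<not> split s i)"
    using d unfolding region supported_def by blast
  also have "\<dots> \<longleftrightarrow> agree a a'"
    using co_minus_iff[OF ac] split_I unfolding agree_def by blast
  finally show ?thesis by simp
qed

definition cls :: "'m \<Rightarrow> 'm set" where
  "cls a = {a' \<in> A. agree a' a}"

lemma agree_refl [simp]: "agree a a"
  by (simp add: agree_def)

lemma cls_self: "a \<in> A \<Longrightarrow> a \<in> cls a"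
  by (simp add: cls_def)

lemma agree_sym: "agree a b \<Longrightarrow> agree b a"
  by (simp add: agree_def)

lemma agree_trans: "agree a b \<Longrightarrow> agree b c \<Longrightarrow> agree a c"
  by (simp add: agree_def)

lemma cls_eq_iff: "a \<in> A \<Longrightarrow> a' \<in> A \<Longrightarrow> cls a = cls a' \<longleftrightarrow> agree a a'"
proof
  assume "a \<in> A" "cls a = cls a'"
  then have "a \<in> cls a'" using cls_self by blast
  then show "agree a a'" by (simp add: cls_def)
next
  assume "agree a a'"
  then have "agree x a \<longleftrightarrow> agree x a'" for x using agree_sym agree_trans by blast
  then show "cls a = cls a'" by (simp add: cls_def)
qed

lemma coset_eq_cls:
  assumes "a \<in> A"
  shows "(\<Union>b\<in>A'. {b \<oplus>\<^bsub>M\<^esub> a}) = cls a"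
proof -
  interpret M: abelian_group M by (rule group)
  interpret S: additive_subgroup A M by (rule subgroups)
  have ac: "a \<in> carrier M" using assms A_carrier by auto
  show ?thesis
  proof
    show "(\<Union>b\<in>A'. {b \<oplus>\<^bsub>M\<^esub> a}) \<subseteq> cls a"
    proof
      fix x assume "x \<in> (\<Union>b\<in>A'. {b \<oplus>\<^bsub>M\<^esub> a})"
      then obtain b where b: "b \<in> A'" "x = b \<oplus>\<^bsub>M\<^esub> a" by auto
      have bA: "b \<in> A" using b A'_subset by auto
      have "x \<ominus>\<^bsub>M\<^esub> a = b" using b(2) ac A_carrier[OF bA] by (simp add: M.minus_eq M.a_assoc M.r_neg)
      moreover have "x \<in> A" using bA assms b(2) S.a_closed by simp
      ultimately show "x \<in> cls a" using agree_iff assms b(1) by (simp add: cls_def)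
    qed
    show "cls a \<subseteq> (\<Union>b\<in>A'. {b \<oplus>\<^bsub>M\<^esub> a})"
    proof
      fix x assume x: "x \<in> cls a"
      then have "x \<ominus>\<^bsub>M\<^esub> a \<in> A'" "x \<in> carrier M" using agree_iff assms A_carrier by (auto simp: cls_def)
      then show "x \<in> (\<Union>b\<in>A'. {b \<oplus>\<^bsub>M\<^esub> a})"
        using ac by (intro UN_I[of "x \<ominus>\<^bsub>M\<^esub> a"]) (auto simp: M.minus_eq M.a_assoc M.l_neg)
    qed
  qed
qed

lemma carrier_F: "carrier F = cls ` A"
  using coset_eq_cls by (auto simp: F_space_def quot_module_def A_RCOSETS_def' a_r_coset_def')

lemma add_F_def: "X \<oplus>\<^bsub>F\<^esub> Y = (\<Union>a\<in>X. \<Union>b\<in>Y. {a \<oplus>\<^bsub>M\<^esub> b})"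
  by (simp add: F_space_def quot_module_def set_add_def')

lemma co_add_cong:
  assumes "a \<in> carrier M" "b \<in> carrier M" "a' \<in> carrier M" "b' \<in> carrier M" "s \<in> J"
    "co a s i = co a' s i" "co b s i = co b' s i"
  shows "co (a \<oplus>\<^bsub>M\<^esub> b) s i = co (a' \<oplus>\<^bsub>M\<^esub> b') s i"
  using assms by (cases s) (auto simp: c1_add c2_add)

lemma add_F:
  assumes "a \<in> A" "b \<in> A"
  shows "cls a \<oplus>\<^bsub>F\<^esub> cls b = cls (a \<oplus>\<^bsub>M\<^esub> b)" "a \<oplus>\<^bsub>M\<^esub> b \<in> A"
proof -
  interpret M: abelian_group M by (rule group)
  interpret S: additive_subgroup A M by (rule subgroups)
  show ab: "a \<oplus>\<^bsub>M\<^esub> b \<in> A" using assms by (rule S.a_closed)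
  have agree_add: "agree (x \<oplus>\<^bsub>M\<^esub> y) (x' \<oplus>\<^bsub>M\<^esub> y')"
    if "x \<in> A" "y \<in> A" "x' \<in> A" "y' \<in> A" "agree x x'" "agree y y'" for x y x' y'
    unfolding agree_def
  proof (intro ballI allI impI)
    fix s i assume s: "s \<in> J" "split s i"
    then have "co x s i = co x' s i" "co y s i = co y' s i" using that(5,6) unfolding agree_def by blast+
    then show "co (x \<oplus>\<^bsub>M\<^esub> y) s i = co (x' \<oplus>\<^bsub>M\<^esub> y') s i"
      using that(1-4) s(1) by (intro co_add_cong A_carrier)
  qed
  show "cls a \<oplus>\<^bsub>F\<^esub> cls b = cls (a \<oplus>\<^bsub>M\<^esub> b)"
  proof
    show "cls a \<oplus>\<^bsub>F\<^esub> cls b \<subseteq> cls (a \<oplus>\<^bsub>M\<^esub> b)"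
    proof
      fix x assume "x \<in> cls a \<oplus>\<^bsub>F\<^esub> cls b"
      then obtain p q where pq: "p \<in> cls a" "q \<in> cls b" "x = p \<oplus>\<^bsub>M\<^esub> q" unfolding add_F_def by blast
      have p: "p \<in> A" "agree p a" and q: "q \<in> A" "agree q b" using pq(1,2) unfolding cls_def by blast+
      have "agree x (a \<oplus>\<^bsub>M\<^esub> b)" unfolding pq(3) by (rule agree_add[OF p(1) q(1) assms p(2) q(2)])
      moreover have "x \<in> A" unfolding pq(3) by (rule S.a_closed[OF p(1) q(1)])
      ultimately show "x \<in> cls (a \<oplus>\<^bsub>M\<^esub> b)" unfolding cls_def by blast
    qed
    show "cls (a \<oplus>\<^bsub>M\<^esub> b) \<subseteq> cls a \<oplus>\<^bsub>F\<^esub> cls b"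
    proof
      fix x assume x: "x \<in> cls (a \<oplus>\<^bsub>M\<^esub> b)"
      define y where "y = x \<ominus>\<^bsub>M\<^esub> a"
      have xA: "x \<in> A" using x by (simp add: cls_def)
      have yA: "y \<in> A" unfolding y_def M.minus_eq using xA assms by (intro S.a_closed S.a_inv_closed)
      have c: "x \<in> carrier M" "a \<in> carrier M" "b \<in> carrier M" using xA assms A_carrier by auto
      have xy: "x = a \<oplus>\<^bsub>M\<^esub> y" unfolding y_def M.minus_eq using c
        by (simp only: M.a_lcomm[OF c(2) c(1) M.a_inv_closed[OF c(2)]] M.r_neg[OF c(2)] M.r_zero[OF c(1)])
      have "x \<ominus>\<^bsub>M\<^esub> (a \<oplus>\<^bsub>M\<^esub> b) = y \<ominus>\<^bsub>M\<^esub> b"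
        unfolding y_def using c by (simp add: M.minus_eq M.minus_add M.a_assoc)
      then have "agree y b" using x agree_iff[OF xA ab] agree_iff[OF yA assms(2)] by (simp add: cls_def)
      then have "y \<in> cls b" using yA by (simp add: cls_def)
      then show "x \<in> cls a \<oplus>\<^bsub>F\<^esub> cls b" unfolding add_F_def using xy cls_self[OF assms(1)] by auto
    qed
  qed
qed

lemma zero_F: "\<zero>\<^bsub>F\<^esub> = cls \<zero>\<^bsub>M\<^esub>" "\<zero>\<^bsub>M\<^esub> \<in> A"
proof -
  interpret M: abelian_group M by (rule group)
  interpret S: additive_subgroup A M by (rule subgroups)
  show z: "\<zero>\<^bsub>M\<^esub> \<in> A" by (rule S.zero_closed)
  have "(\<Union>b\<in>A'. {b \<oplus>\<^bsub>M\<^esub> \<zero>\<^bsub>M\<^esub>}) = A'" using A'_subset A_carrier by force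
  then show "\<zero>\<^bsub>F\<^esub> = cls \<zero>\<^bsub>M\<^esub>" using coset_eq_cls[OF z] by (simp add: F_space_def quot_module_def)
qed

lemma F_group: "abelian_group F"
proof -
  interpret M: abelian_group M by (rule group)
  interpret S: additive_subgroup A M by (rule subgroups)
  show ?thesis
  proof (rule abelian_groupI)
    fix x y z assume "x \<in> carrier F" "y \<in> carrier F" "z \<in> carrier F"
    then obtain a b c where abc: "a \<in> A" "x = cls a" "b \<in> A" "y = cls b" "c \<in> A" "z = cls c"
      by (auto simp: carrier_F)
    then show "x \<oplus>\<^bsub>F\<^esub> y \<oplus>\<^bsub>F\<^esub> z = x \<oplus>\<^bsub>F\<^esub> (y \<oplus>\<^bsub>F\<^esub> z)" using A_carrier by (simp add: add_F M.a_assoc)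
  next
    fix x y assume "x \<in> carrier F" "y \<in> carrier F"
    then obtain a b where ab: "a \<in> A" "x = cls a" "b \<in> A" "y = cls b" by (auto simp: carrier_F)
    then show "x \<oplus>\<^bsub>F\<^esub> y = y \<oplus>\<^bsub>F\<^esub> x" "x \<oplus>\<^bsub>F\<^esub> y \<in> carrier F"
      using A_carrier by (auto simp: add_F M.a_comm carrier_F)
  next
    fix x assume "x \<in> carrier F"
    then obtain a where a: "a \<in> A" "x = cls a" by (auto simp: carrier_F)
    then show "\<zero>\<^bsub>F\<^esub> \<oplus>\<^bsub>F\<^esub> x = x" using A_carrier by (simp add: zero_F add_F)
    show "\<exists>y\<in>carrier F. y \<oplus>\<^bsub>F\<^esub> x = \<zero>\<^bsub>F\<^esub>"
      using a A_carrier S.a_inv_closed[OF a(1)]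
      by (intro bexI[of _ "cls (\<ominus>\<^bsub>M\<^esub> a)"]) (auto simp: zero_F add_F carrier_F M.l_neg)
  qed (auto simp: zero_F carrier_F)
qed

lemma head_in_verts: "word_head Q B \<in> verts Q"
proof -
  have "0 \<in> index_set (word_shape B)" using B(2) by (cases "word_shape B") (auto simp: has_head_def)
  then show ?thesis unfolding word_head_def using word_vertex_in_verts[OF quiver B(1)] by blast
qed

abbreviation scal :: "'k \<Rightarrow> 'm \<Rightarrow> 'm" where "scal c a \<equiv> vertex_elem Q \<rho> c (word_head Q B) \<odot>\<^bsub>M\<^esub> a"

lemma scal_coordinates:
  assumes "a \<in> A" "s \<in> J" "split s i"
  shows "s = Inl l \<Longrightarrow> c1 (scal c a) l i = c * c1 a l i"
    "s = Inr u \<Longrightarrow> c2 (scal c a) u i = Poly_Mapping.single 0 c \<odot>\<^bsub>V u\<^esub> c2 a u i"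
proof -
  have i: "i \<in> I s" using assms(3) by (auto simp: split_cell_def splits_at_def)
  have v: "word_vertex Q (wd s) i = word_head Q B"
    using region(3)[OF assms(3,2)] region(4)[OF assms(2) i] head by simp
  show "s = Inl l \<Longrightarrow> c1 (scal c a) l i = c * c1 a l i"
    "s = Inr u \<Longrightarrow> c2 (scal c a) u i = Poly_Mapping.single 0 c \<odot>\<^bsub>V u\<^esub> c2 a u i"
    using v assms(2) A_carrier[OF assms(1)] head_in_verts by (auto simp: c1_vertex c2_vertex)
qed

lemma scal_A: "a \<in> A \<Longrightarrow> scal c a \<in> A"
proof -
  assume a: "a \<in> A"
  have ac: "a \<in> carrier M" by (rule A_carrier[OF a])
  have "region s i" if s: "s \<in> J" "i \<in> I s" "co (scal c a) s i \<noteq> co0 s" for s i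
  proof -
    have "co a s i \<noteq> co0 s"
    proof (cases s)
      case (Inl l)
      then show ?thesis using s ac head_in_verts by (auto simp: c1_vertex split: if_splits)
    next
      case (Inr u)
      then have u: "u \<in> P" using s by auto
      interpret V: laurent_module "V u" by (rule laurent_module[OF u])
      show ?thesis using Inr s u ac head_in_verts by (auto simp: c2_vertex split: if_splits)
    qed
    then show ?thesis using a s(1,2) unfolding region(1) by (auto dest: supportedD(1))
  qed
  then show ?thesis using vertex_elem_closed[OF head_in_verts ac] unfolding region(1) by (simp add: supported_def)
qed

lemma smult_F:
  assumes "a \<in> A"
  shows "c \<odot>\<^bsub>F\<^esub> cls a = cls (scal c a)"
proof -
  have eq: "cls (scal c m) = cls (scal c a)" if "m \<in> cls a" for m
  proof -
    have m: "m \<in> A" "agree m a" using that by (auto simp: cls_def)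
    have "agree (scal c m) (scal c a)"
      unfolding agree_def
    proof (intro ballI allI impI)
      fix s i assume s: "s \<in> J" "split s i"
      then have "co m s i = co a s i" using m(2) unfolding agree_def by blast
      then show "co (scal c m) s i = co (scal c a) s i"
        using scal_coordinates[OF m(1) s] scal_coordinates[OF assms s] by (cases s) auto
    qed
    then show ?thesis using cls_eq_iff scal_A m(1) assms by simp
  qed
  have "c \<odot>\<^bsub>F\<^esub> cls a = (\<Union>m\<in>cls a. \<Union>b\<in>A'. {b \<oplus>\<^bsub>M\<^esub> scal c m})"
    by (simp add: F_space_def quot_module_def a_r_coset_def')
  \<comment> \<open>Multiplication by a constant respects \<open>agree\<close>, so the union runs
    over one and the same coset.\<close>
  also have "\<dots> = (\<Union>m\<in>cls a. cls (scal c a))"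
    by (rule SUP_cong[OF refl]) (use eq coset_eq_cls scal_A in \<open>auto simp: cls_def\<close>)
  finally show ?thesis using cls_self[OF assms] by auto
qed

definition kc :: "'m set \<Rightarrow> 'l + 'u \<Rightarrow> int \<Rightarrow> 'k + 'w" where
  "kc X = co (SOME a. a \<in> X)"

lemma kc_cls: "a \<in> A \<Longrightarrow> s \<in> J \<Longrightarrow> split s i \<Longrightarrow> kc (cls a) s i = co a s i"
proof -
  assume a: "a \<in> A" and s: "s \<in> J" "split s i"
  have "(SOME x. x \<in> cls a) \<in> cls a" by (rule someI) (rule cls_self[OF a])
  then have "agree (SOME x. x \<in> cls a) a" unfolding cls_def by blast
  then show ?thesis using s unfolding kc_def agree_def by blast
qed

lemma W_word: "is_word Q \<rho> W"
  using composable by (simp add: composable_def)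

text \<open>A periodic summand with a split position would make \<open>W\<close> periodic, and a
  non-periodic word has at most one split position. So there is exactly one coordinate for each
  string summand equivalent to \<open>W\<close>.\<close>

lemma string_case:
  assumes np: "\<not> periodic W"
  shows "has_dim F {l \<in> S. word_equiv (Cs l) W}"
proof -
  let ?S = "{l \<in> S. word_equiv (Cs l) W}"
  have equiv: "word_equiv C W \<longleftrightarrow> (\<exists>i d. splits_at Q B D C i d)" if "is_word Q \<rho> C" for C
    by (rule word_equiv_iff_splits[OF B(1) D(1) B(2) D(2) head refl W_word that])
  have no_periodic: "\<not> split (Inr u) i" if "u \<in> P" for u i
  proof
    assume "split (Inr u) i"
    then obtain d where sp: "splits_at Q B D (Cp u) i d" by (auto simp: split_cell_def)
    have per: "is_word Q \<rho> (Cp u)" "periodic (Cp u)" using periodic_word[OF that] by auto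
    then have "word_equiv (Cp u) W" using equiv sp by blast
    then have "periodic W" using word_equiv_periodic[OF per(2)] by blast
    then show False using np by simp
  qed
  have unique: "i = j" if "l \<in> S" "split (Inl l) i" "split (Inl l) j" for l i j
  proof -
    from that(2,3) obtain d e where de: "splits_at Q B D (Cs l) i d" "splits_at Q B D (Cs l) j e"
      by (auto simp: split_cell_def)
    have w: "is_word Q \<rho> (Cs l)" "\<not> periodic (Cs l)" using string_word[OF that(1)] by auto
    have "\<forall>d'. ray (Cs l) i d' = ray (Cs l) j d'" using splits_at_unique[OF w(1) de] by blast
    moreover have "i \<in> index_set (word_shape (Cs l))" "j \<in> index_set (word_shape (Cs l))"
      using de unfolding splits_at_def by blast+
    ultimately have "i = j \<or> word_shape (Cs l) = AllInt \<and> (\<forall>p. letter_at (Cs l) (p + (j - i)) = letter_at (Cs l) p)"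
      by (intro same_rays_periodic) blast+
    then show ?thesis using periodic_letters[of "Cs l" "j - i"] w(2) by auto
  qed
  define pos where "pos l = (SOME i. split (Inl l) i)" for l
  have pos: "split (Inl l) (pos l)" if "l \<in> ?S" for l
  proof -
    have "\<exists>i d. splits_at Q B D (Cs l) i d" using that equiv[of "Cs l"] string_word[of l] by blast
    then have "\<exists>i. split (Inl l) i" by (simp add: split_cell_def)
    then show ?thesis unfolding pos_def by (rule someI_ex)
  qed
  have all: "l \<in> ?S" if "l \<in> S" "split (Inl l) i" for l i
  proof -
    have "\<exists>i d. splits_at Q B D (Cs l) i d" using that(2) unfolding split_cell_def by auto
    then show ?thesis using that(1) equiv[of "Cs l"] string_word[of l] by blast
  qed
  have pos_eq: "i = pos l" if "l \<in> S" "split (Inl l) i" for l i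
    using unique[OF that] pos[OF all[OF that]] by blast
  define K where "K X l = projl (kc X (Inl l) (pos l))" for X l
  have K: "K (cls a) l = c1 a l (pos l)" if "a \<in> A" "l \<in> ?S" for a l
    using kc_cls[OF that(1) _ pos[OF that(2)]] that(2) by (simp add: K_def)
  show ?thesis
  proof (rule has_dimI[OF F_group, where K = K])
    show "c \<odot>\<^bsub>F\<^esub> x \<in> carrier F" if "x \<in> carrier F" for c x
      using that smult_F scal_A by (auto simp: carrier_F)
    show "K (x \<oplus>\<^bsub>F\<^esub> y) l = K x l + K y l" if "x \<in> carrier F" "y \<in> carrier F" "l \<in> ?S" for x y l
      using that K add_F A_carrier by (auto simp: carrier_F c1_add)
    show "K (c \<odot>\<^bsub>F\<^esub> x) l = c * K x l" if "x \<in> carrier F" "l \<in> ?S" for c x l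
    proof -
      from that(1) obtain a where a: "a \<in> A" "x = cls a" by (auto simp: carrier_F)
      show ?thesis
        using K[OF a(1) that(2)] K[OF scal_A[OF a(1)] that(2)] smult_F[OF a(1)] a(2)
          scal_coordinates(1)[OF a(1) _ pos[OF that(2)], of l] that(2) by simp
    qed
    show "x = y" if xy: "x \<in> carrier F" "y \<in> carrier F" and eq: "\<And>l. l \<in> ?S \<Longrightarrow> K x l = K y l" for x y
    proof -
      obtain a b where ab: "a \<in> A" "x = cls a" "b \<in> A" "y = cls b" using xy by (auto simp: carrier_F)
      have "agree a b"
        unfolding agree_def
      proof (intro ballI allI impI)
        fix s i assume s: "s \<in> J" "split s i"
        then obtain l where l: "s = Inl l" "l \<in> S" using no_periodic by auto
        then have "l \<in> ?S" "i = pos l" using all pos_eq s by auto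
        then show "co a s i = co b s i" using eq[of l] K[of a l] K[of b l] ab l by simp
      qed
      then show ?thesis using cls_eq_iff ab by simp
    qed
    show "finite {l \<in> ?S. K x l \<noteq> 0}" if "x \<in> carrier F" for x
    proof -
      from that obtain a where a: "a \<in> A" "x = cls a" by (auto simp: carrier_F)
      have "{l \<in> ?S. K x l \<noteq> 0} \<subseteq> fst ` {(l, i). l \<in> S \<and> c1 a l i \<noteq> 0}"
        using K[OF a(1)] a(2) by force
      then show ?thesis by (rule finite_subset) (use c1_finite[OF A_carrier[OF a(1)]] in auto)
    qed
    show "\<exists>x\<in>carrier F. \<forall>b\<in>?S. K x b = (if b = l then 1 else 0)" if l: "l \<in> ?S" for l
    proof -
      \<comment> \<open>The dual vector is the class of the basis vector of the summand
        \<open>l\<close> at its split position.\<close>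
      let ?f = "\<lambda>l' i. if l' = l \<and> i = pos l then 1 else 0 :: 'k"
      have pI: "pos l \<in> I (Inl l)" using pos[OF l] by (auto simp: split_cell_def splits_at_def)
      have "\<exists>m\<in>carrier M. (\<forall>l\<in>S. \<forall>i. c1 m l i = ?f l i) \<and> (\<forall>u\<in>P. \<forall>i. c2 m u i = \<zero>\<^bsub>V u\<^esub>)"
      proof (rule coordinates_surj)
        have "{(l', i). l' \<in> S \<and> ?f l' i \<noteq> 0} \<subseteq> {(l, pos l)}" by (auto split: if_splits)
        then show "finite {(l', i). l' \<in> S \<and> ?f l' i \<noteq> 0}" by (rule finite_subset) simp
        show "i \<in> index_set (word_shape (Cs l'))" if "?f l' i \<noteq> 0" for l' i
          using that pI by (auto split: if_splits)
        show "\<zero>\<^bsub>V u\<^esub> \<in> carrier (V u)" "\<zero>\<^bsub>V u\<^esub> = Poly_Mapping.single 1 1 \<odot>\<^bsub>V u\<^esub> \<zero>\<^bsub>V u\<^esub>" if "u \<in> P" for u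
        proof -
          interpret V: laurent_module "V u" by (rule laurent_module[OF that])
          show "\<zero>\<^bsub>V u\<^esub> \<in> carrier (V u)" "\<zero>\<^bsub>V u\<^esub> = Poly_Mapping.single 1 1 \<odot>\<^bsub>V u\<^esub> \<zero>\<^bsub>V u\<^esub>" by simp_all
        qed
      qed auto
      then obtain m where m: "m \<in> carrier M" "\<forall>l\<in>S. \<forall>i. c1 m l i = ?f l i" "\<forall>u\<in>P. \<forall>i. c2 m u i = \<zero>\<^bsub>V u\<^esub>" by blast
      have "m \<in> A"
        unfolding region(1) supported_def
      proof (intro CollectI conjI ballI impI m(1))
        fix s i assume s: "s \<in> J" "i \<in> I s" "co m s i \<noteq> co0 s"
        have "s = Inl l \<and> i = pos l"
        proof (cases s)
          case (Inl l')
          then have "l' \<in> S" "c1 m l' i \<noteq> 0" using s by auto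
          then have "?f l' i \<noteq> 0" using m(2) by metis
          then show ?thesis using Inl by (auto split: if_splits)
        next
          case (Inr u)
          then show ?thesis using s m(3) by auto
        qed
        then show "region s i" using region(3)[of s i] pos[OF l] s(1) by auto
      qed
      then show ?thesis using K m(2) l by (intro bexI[of _ "cls m"]) (auto simp: carrier_F)
    qed
  qed
qed

end

section \<open>Periodic words\<close>

context word_coordinates
begin

lemma chain_relation_cong: "(\<And>k. k < n \<Longrightarrow> c k = c' k) \<Longrightarrow> chain_relation c n = chain_relation c' n"
proof (induction n arbitrary: c c')
  case (Suc n)
  have "chain_relation (\<lambda>k. c (Suc k)) n = chain_relation (\<lambda>k. c' (Suc k)) n"
    by (rule Suc.IH) (simp add: Suc.prems)
  then show ?case using Suc.prems[of 0] by simp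
qed simp

lemma chain_relation_carrier:
  "(m', m) \<in> chain_relation c n \<Longrightarrow> m' \<in> carrier M \<Longrightarrow> (\<And>k. k < n \<Longrightarrow> letter_arrow (c k) \<in> arcs Q) \<Longrightarrow> m \<in> carrier M"
proof (cases n)
  case (Suc k)
  assume a: "(m', m) \<in> chain_relation c n" "\<And>k. k < n \<Longrightarrow> letter_arrow (c k) \<in> arcs Q"
  then obtain m1 where "(m1, m) \<in> letter_relation Q \<rho> M (c 0)" using Suc by auto
  then show "m \<in> carrier M" using letter_relation_coord(2)[OF a(2)[of 0]] Suc supportedD(2) by blast
qed simp

end

lemma concatenation_AllInt:
  assumes "has_head B" "has_head D" "word_shape (concatenation (word_inv B) D) = AllInt"
  shows "word_shape B = Nat" "word_shape D = Nat"
    "letter_at (concatenation (word_inv B) D) (int k + 1) = word_letters D k"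
    "word_shape (concatenation (word_inv D) B) = AllInt"
proof -
  have "word_shape B = Nat \<and> word_shape D = Nat \<and> (\<exists>b d. B = Letters Nat b \<and> D = Letters Nat d)"
  proof (cases B)
    case (Trivial v e)
    then show ?thesis using assms by (simp add: has_head_def)
  next
    case (Letters sb b)
    show ?thesis
    proof (cases D)
      case D: (Trivial v e)
      then show ?thesis using assms Letters by (cases sb) (auto simp: has_head_def)
    next
      case D: (Letters sd d)
      then show ?thesis using assms Letters by (cases sb; cases sd) (auto simp: has_head_def)
    qed
  qed
  then obtain b d where BD: "B = Letters Nat b" "D = Letters Nat d" by blast
  then show "word_shape B = Nat" "word_shape D = Nat"
    "letter_at (concatenation (word_inv B) D) (int k + 1) = word_letters D k"
    "word_shape (concatenation (word_inv D) B) = AllInt" by (simp_all add: word_letters_def)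
qed

lemma laurent_sum_smult:
  assumes "laurent_module V" "w \<in> carrier V" "finite K"
  shows "finsum V (\<lambda>j. f j \<odot>\<^bsub>V\<^esub> w) K = (\<Sum>j\<in>K. f j) \<odot>\<^bsub>V\<^esub> w"
proof -
  interpret laurent_module V by (rule assms(1))
  show ?thesis using assms(3)
  proof (induction K)
    case (insert x K)
    have "(\<lambda>j. f j \<odot>\<^bsub>V\<^esub> w) \<in> K \<rightarrow> carrier V" using assms(2) by auto
    then show ?case using insert assms(2) by (simp add: smult_add_left)
  qed (simp add: assms(2))
qed

lemma swap_T_sum: "(\<Sum>j\<in>Poly_Mapping.keys p. Poly_Mapping.single (- j) (Poly_Mapping.lookup p j)) = swap_T p"
proof (rule poly_mapping_eqI)
  fix q :: int
  have inj: "inj (uminus :: int \<Rightarrow> int)" by (simp add: inj_def)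
  have "Poly_Mapping.lookup (\<Sum>j\<in>Poly_Mapping.keys p. Poly_Mapping.single (- j) (Poly_Mapping.lookup p j)) q =
    (\<Sum>j\<in>Poly_Mapping.keys p. if j = - q then Poly_Mapping.lookup p j else 0)"
    unfolding lookup_sum by (rule sum.cong) (auto simp: lookup_single when_def)
  also have "\<dots> = Poly_Mapping.lookup p (- q)" by (simp add: in_keys_iff)
  finally show "Poly_Mapping.lookup (\<Sum>j\<in>Poly_Mapping.keys p. Poly_Mapping.single (- j) (Poly_Mapping.lookup p j)) q =
    Poly_Mapping.lookup (swap_T p) q"
    by (simp add: swap_T_def map_key.rep_eq[OF inj])
qed

locale string_sum_periodic = string_sum_functor Q \<rho> \<sigma> M S Cs P Cp V \<phi> B D
  for Q :: "('v, 'a) pre_digraph" and \<rho> \<sigma>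
    and M :: "((('v, 'a) qpath \<Rightarrow>\<^sub>0 'k::field) set, 'm) module"
    and S :: "'l set" and Cs and P :: "'u set" and Cp
    and V :: "'u \<Rightarrow> ('k laurent, 'w) module" and \<phi> and B D :: "('v, 'a) qword" +
  assumes W_periodic: "periodic W"
begin

abbreviation n where "n \<equiv> period W"
abbreviation T :: "int \<Rightarrow> 'k laurent" where "T j \<equiv> Poly_Mapping.single j 1"

lemma shapes: "word_shape W = AllInt" "word_shape B = Nat" "word_shape D = Nat"
    "word_shape (concatenation (word_inv D) B) = AllInt"
  and W_letter: "letter_at W (int k + 1) = word_letters D k"
  using period_props(3)[OF W_periodic] concatenation_AllInt[OF B(2) D(2)] by auto

lemma n_pos: "n > 0"
  by (rule period_props(1)[OF W_periodic])

text \<open>\<open>C\<close> arises from \<open>W\<close> by a translation or a reflection of the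
  indices, and both preserve the set of translations under which the letters are invariant.\<close>

lemma splits_periodic:
  assumes C: "is_word Q \<rho> C" and sp: "splits_at Q B D C i d"
  shows "periodic C \<and> period C = n"
proof -
  obtain j where j: "\<And>d. ray W j d = ray (if d then D else B) 0 True"
    using concatenation_rays[OF B(1) D(1) B(2) D(2) head refl] by blast
  have i: "i \<in> I'" if "I' = index_set (word_shape C)" for I' using sp that by (simp add: splits_at_def)
  \<comment> \<open>All invariant translations are compared at once, not just the least; the
    equality of the periods then follows from divisibility in both directions.\<close>
  have "word_shape C = AllInt \<and> (\<forall>t. (\<forall>p. letter_at C (p + t) = letter_at C p) \<longleftrightarrow> (\<forall>p. letter_at W (p + t) = letter_at W p))"
  proof (cases d)
    case True
    have rays: "ray C i e = ray W j e" for e using sp j True unfolding splits_at_def by (cases e) auto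
    have A: "word_shape C = AllInt" using same_rays_shape[OF i[OF refl] _ rays] shapes(1) by simp
    have eq: "letter_at C p = letter_at W (p + (j - i))" for p by (rule same_rays_letters[OF rays A shapes(1)])
    have "(\<forall>p. letter_at C (p + t) = letter_at C p) \<longleftrightarrow> (\<forall>p. letter_at W (p + t) = letter_at W p)" for t
    proof
      assume L: "\<forall>p. letter_at C (p + t) = letter_at C p"
      show "\<forall>p. letter_at W (p + t) = letter_at W p"
      proof
        fix p show "letter_at W (p + t) = letter_at W p"
          using spec[OF L, of "p - (j - i)"] unfolding eq by (simp add: algebra_simps)
      qed
    next
      assume R: "\<forall>p. letter_at W (p + t) = letter_at W p"
      show "\<forall>p. letter_at C (p + t) = letter_at C p"
      proof
        fix p show "letter_at C (p + t) = letter_at C p"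
          using spec[OF R, of "p + (j - i)"] unfolding eq by (simp add: algebra_simps)
      qed
    qed
    then show ?thesis using A by blast
  next
    case False
    have rays: "\<forall>e. ray C i e = ray W j (\<not> e)" using sp j False unfolding splits_at_def by (auto simp: all_bool_eq)
    then have opt: "letter_opt C (i + p) = map_option letter_inv (letter_opt W (j + 1 - p))" for p
      unfolding rays_opposite_iff by blast
    have pos: "i + p \<in> positions (word_shape C)" for p
      using opt[of p] shapes(1) by (auto simp: letter_opt_def positions_simps split: if_splits)
    have A: "word_shape C = AllInt"
    proof (cases "word_shape C")
      case (Fin k)
      then show ?thesis using pos[of "- i"] by (simp add: positions_simps)
    next
      case Nat
      then show ?thesis using pos[of "- i"] by (simp add: positions_simps)
    next
      case NegNat
      then show ?thesis using pos[of "1 - i"] by (simp add: positions_simps)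
    qed
    have eq: "letter_at C q = letter_inv (letter_at W (i + j + 1 - q))" for q
    proof -
      have eqs: "j + 1 - (q - i) = i + j + 1 - q" "i + (q - i) = q" by simp_all
      show ?thesis using opt[of "q - i"] A shapes(1) unfolding eqs by (simp add: letter_opt_def positions_simps)
    qed
    have "(\<forall>p. letter_at C (p + t) = letter_at C p) \<longleftrightarrow> (\<forall>p. letter_at W (p + t) = letter_at W p)" for t
    proof
      assume L: "\<forall>p. letter_at C (p + t) = letter_at C p"
      show "\<forall>p. letter_at W (p + t) = letter_at W p"
      proof
        fix p show "letter_at W (p + t) = letter_at W p"
          using spec[OF L, of "i + j + 1 - p - t"] unfolding eq by (simp add: algebra_simps)
      qed
    next
      assume R: "\<forall>p. letter_at W (p + t) = letter_at W p"
      show "\<forall>p. letter_at C (p + t) = letter_at C p"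
      proof
        fix p show "letter_at C (p + t) = letter_at C p"
          using spec[OF R, of "i + j + 1 - p - t"] unfolding eq by (simp add: algebra_simps)
      qed
    qed
    then show ?thesis using A by blast
  qed
  then have A: "word_shape C = AllInt"
    and t: "\<And>t. (\<forall>p. letter_at C (p + t) = letter_at C p) \<longleftrightarrow> int n dvd t"
    using letter_at_shift_iff[OF W_periodic] by auto
  have per: "periodic C" using periodic_letters[OF A, of "int n"] t[of "int n"] n_pos by auto
  have "int (period C) dvd t \<longleftrightarrow> int n dvd t" for t using letter_at_shift_iff[OF per, of t] t[of t] by simp
  from this[of "int n"] this[of "int (period C)"] have "period C = n"
    by (simp add: dvd_antisym)
  then show ?thesis using per by simp
qed

section \<open>Split positions and orientation of the periodic summands\<close>

lemma no_string: "l \<in> S \<Longrightarrow> \<not> split (Inl l) i"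
  using splits_periodic string_word unfolding split_cell_def by fastforce

lemma period_Cp: "u \<in> P \<Longrightarrow> split (Inr u) i \<Longrightarrow> period (Cp u) = n"
  using splits_periodic periodic_word unfolding split_cell_def by fastforce

text \<open>True if the word is a shift of \<open>W\<close>; for a summand with a split position,
  false means a shift of \<open>concatenation (word_inv D) B\<close>. A periodic word never splits
  in both directions.\<close>

definition orient :: "'u \<Rightarrow> bool" where
  "orient u \<longleftrightarrow> (\<exists>i. splits_at Q B D (Cp u) i True)"

definition pos :: "'u \<Rightarrow> int" where
  "pos u = (SOME i. split (Inr u) i)"

definition PP where "PP = {u \<in> P. \<exists>i. split (Inr u) i}"

lemma split_orient:
  assumes "u \<in> P" "split (Inr u) i"
  shows "splits_at Q B D (Cp u) i (orient u)"
proof -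
  have w: "is_word Q \<rho> (Cp u)" "periodic (Cp u)" using periodic_word[OF assms(1)] by auto
  from assms(2) obtain d where d: "splits_at Q B D (Cp u) i d" by (auto simp: split_cell_def)
  have "d = orient u"
  proof (cases d)
    case True
    then show ?thesis using d by (auto simp: orient_def)
  next
    case False
    then show ?thesis using d splits_at_unique[OF w(1) d] w(2) unfolding orient_def by blast
  qed
  then show ?thesis using d by simp
qed

lemma pos_split: "u \<in> PP \<Longrightarrow> split (Inr u) (pos u)"
  unfolding pos_def PP_def by (auto intro: someI_ex)

lemma PP_P: "u \<in> PP \<Longrightarrow> u \<in> P" "u \<in> P \<Longrightarrow> split (Inr u) i \<Longrightarrow> u \<in> PP"
  by (auto simp: PP_def)

lemma PP_orient:
  "{u \<in> P. is_shift_of (Cp u) W} = {u \<in> PP. orient u}"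
  "{u \<in> P. is_shift_of (Cp u) (concatenation (word_inv D) B)} = {u \<in> PP. \<not> orient u}"
proof -
  have 1: "is_shift_of (Cp u) W \<longleftrightarrow> (\<exists>i. splits_at Q B D (Cp u) i True)" if "u \<in> P" for u
    using is_shift_of_iff_splits[OF B(1) D(1) B(2) D(2) head shapes(1)] periodic_word[OF that] by blast
  have 2: "is_shift_of (Cp u) (concatenation (word_inv D) B) \<longleftrightarrow> (\<exists>i. splits_at Q B D (Cp u) i False)" if "u \<in> P" for u
    using is_shift_of_iff_splits[OF D(1) B(1) D(2) B(2) head[symmetric] shapes(4)] periodic_word[OF that]
      splits_at_swap[OF head] by simp
  have sp: "split (Inr u) i \<longleftrightarrow> (\<exists>d. splits_at Q B D (Cp u) i d)" for u i by (simp add: split_cell_def)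
  show "{u \<in> P. is_shift_of (Cp u) W} = {u \<in> PP. orient u}"
    using 1 unfolding PP_def orient_def sp by blast
  have "(\<exists>i. splits_at Q B D (Cp u) i False) \<longleftrightarrow> u \<in> PP \<and> \<not> orient u" if u: "u \<in> P" for u
  proof
    assume "\<exists>i. splits_at Q B D (Cp u) i False"
    then obtain i where i: "splits_at Q B D (Cp u) i False" by blast
    then have s: "split (Inr u) i" unfolding sp by blast
    have "splits_at Q B D (Cp u) i (orient u)" by (rule split_orient[OF u s])
    then have "orient u = False" using splits_at_unique[OF _ i] periodic_word[OF u] by blast
    then show "u \<in> PP \<and> \<not> orient u" using PP_P(2)[OF u s] by simp
  next
    assume a: "u \<in> PP \<and> \<not> orient u"
    then have "splits_at Q B D (Cp u) (pos u) (orient u)" using split_orient[OF u pos_split] by blast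
    then show "\<exists>i. splits_at Q B D (Cp u) i False" using a by auto
  qed
  then show "{u \<in> P. is_shift_of (Cp u) (concatenation (word_inv D) B)} = {u \<in> PP. \<not> orient u}"
    using 2 PP_P(1) by blast
qed

lemma split_shift:
  assumes "u \<in> P" "split (Inr u) i"
  shows "split (Inr u) (i + int n * q)"
proof -
  have w: "is_word Q \<rho> (Cp u)" "periodic (Cp u)" using periodic_word[OF assms(1)] by auto
  have A: "word_shape (Cp u) = AllInt" by (rule period_props(3)[OF w(2)])
  have rays: "ray (Cp u) i d = ray (Cp u) (i + int n * q) d" for d
    using same_rays_dvd[OF w(2), of i "i + int n * q"] period_Cp[OF assms] by simp
  moreover have "word_vertex Q (Cp u) i = word_vertex Q (Cp u) (i + int n * q)"
    by (rule same_rays_translate(2)[OF w(1) _ _ rays]) (simp_all add: A)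
  ultimately show ?thesis using split_orient[OF assms] A unfolding split_cell_def splits_at_def by auto
qed

lemma c2_shift_mult:
  assumes "m \<in> carrier M" "u \<in> P" "split (Inr u) i"
  shows "c2 m u (j + int n * q) = T q \<odot>\<^bsub>V u\<^esub> c2 m u j"
proof -
  interpret pt: periodic_tensor "V u" Q \<rho> "Cp u" by (rule tensor[OF assms(2)])
  show ?thesis
    using pt.shift_mult[where u = "c2 m u", OF c2_shift[OF assms(1,2)] c2_closed[OF assms(1,2)]]
    by (simp add: period_Cp[OF assms(2,3)])
qed

text \<open>All splittings of a periodic word have the same direction, so the positions have equal
  rays and form a single residue class.\<close>

lemma pos_dvd:
  assumes "u \<in> P" "split (Inr u) i"
  obtains q where "i = pos u + int n * q"
proof -
  have w: "is_word Q \<rho> (Cp u)" "periodic (Cp u)" using periodic_word[OF assms(1)] by auto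
  have "splits_at Q B D (Cp u) (pos u) (orient u)" "splits_at Q B D (Cp u) i (orient u)"
    using split_orient[OF assms(1) pos_split[OF PP_P(2)[OF assms]]] split_orient[OF assms] by auto
  then have "int (period (Cp u)) dvd i - pos u"
    using splits_at_unique[OF w(1)] same_rays_dvd[OF w(2), of "pos u" i] by blast
  then obtain q where "i - pos u = int n * q" using period_Cp[OF assms] by (auto elim: dvdE)
  then show ?thesis using that[of q] by simp
qed

text \<open>By compatibility with \<open>T\<close> the coordinate at \<open>pos u\<close> determines
  those at all split positions of the summand.\<close>

lemma agreeI:
  assumes "a \<in> A" "b \<in> A" "\<And>u. u \<in> PP \<Longrightarrow> c2 a u (pos u) = c2 b u (pos u)"
  shows "agree a b"
  unfolding agree_def
proof (intro ballI allI impI)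
  fix s i assume s: "s \<in> J" "split s i"
  then obtain u where u: "s = Inr u" "u \<in> P" using no_string by auto
  have sp: "split (Inr u) i" using s u by simp
  obtain q where q: "i = pos u + int n * q" using pos_dvd[OF u(2) sp] by blast
  show "co a s i = co b s i"
    using c2_shift_mult[OF A_carrier[OF assms(1)] u(2) sp, of "pos u" q]
      c2_shift_mult[OF A_carrier[OF assms(2)] u(2) sp, of "pos u" q] assms(3)[OF PP_P(2)[OF u(2) sp]]
    unfolding u q by simp
qed

lemma agreeD: "agree a b \<Longrightarrow> u \<in> PP \<Longrightarrow> c2 a u (pos u) = c2 b u (pos u)"
  using pos_split PP_P(1) unfolding agree_def by fastforce

lemma supported_split_A: "a \<in> supported split \<Longrightarrow> a \<in> A"
  using region(3) unfolding region(1) supported_def by blast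

lemma coordinates_at_pos:
  assumes y: "\<And>u. u \<in> PP \<Longrightarrow> y u \<in> carrier (V u)" "finite {u \<in> PP. y u \<noteq> \<zero>\<^bsub>V u\<^esub>}"
  shows "\<exists>a\<in>supported split. \<forall>u\<in>PP. c2 a u (pos u) = y u"
proof -
  \<comment> \<open>The value \<open>y u\<close> is spread over the residue class of
    \<open>pos u\<close> by the rule that one period to the right means one application of
    \<open>T\<close>.\<close>
  define g where "g u i = (if u \<in> PP \<and> int n dvd i - pos u then T ((i - pos u) div int n) \<odot>\<^bsub>V u\<^esub> y u else \<zero>\<^bsub>V u\<^esub>)" for u i
  have "\<exists>m\<in>carrier M. (\<forall>l\<in>S. \<forall>i. c1 m l i = 0) \<and> (\<forall>u\<in>P. \<forall>i. c2 m u i = g u i)"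
  proof (rule coordinates_surj)
    fix u i assume u: "u \<in> P"
    interpret V: laurent_module "V u" by (rule laurent_module[OF u])
    show "g u i \<in> carrier (V u)" using y(1) by (simp add: g_def)
    show "g u (i + int (period (Cp u))) = Poly_Mapping.single 1 1 \<odot>\<^bsub>V u\<^esub> g u i"
    proof (cases "u \<in> PP")
      case True
      have p: "period (Cp u) = n" by (rule period_Cp[OF u pos_split[OF True]])
      have eq: "i + int n - pos u = (i - pos u) + int n" by simp
      have div: "((i - pos u) + int n) div int n = 1 + (i - pos u) div int n" using n_pos by simp
      show ?thesis
      proof (cases "int n dvd i - pos u")
        case True
        then have "int n dvd i - pos u + int n" by simp
        then show ?thesis using True \<open>u \<in> PP\<close> y(1)[OF \<open>u \<in> PP\<close>]
          unfolding g_def p eq div by (simp add: V.smult_mult[symmetric] mult_single)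
      next
        case False
        then have "\<not> int n dvd i - pos u + int n" by simp
        then show ?thesis using False unfolding g_def p eq by simp
      qed
    qed (simp add: g_def)
  next
    have "{u \<in> P. \<exists>i. g u i \<noteq> \<zero>\<^bsub>V u\<^esub>} \<subseteq> {u \<in> PP. y u \<noteq> \<zero>\<^bsub>V u\<^esub>}"
    proof
      fix u assume u: "u \<in> {u \<in> P. \<exists>i. g u i \<noteq> \<zero>\<^bsub>V u\<^esub>}"
      interpret V: laurent_module "V u" by (rule laurent_module) (use u in simp)
      show "u \<in> {u \<in> PP. y u \<noteq> \<zero>\<^bsub>V u\<^esub>}" using u by (auto simp: g_def split: if_splits)
    qed
    then show "finite {u \<in> P. \<exists>i. g u i \<noteq> \<zero>\<^bsub>V u\<^esub>}" by (rule finite_subset) (rule y(2))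
  qed auto
  then obtain m where m: "m \<in> carrier M" "\<forall>l\<in>S. \<forall>i. c1 m l i = 0" "\<forall>u\<in>P. \<forall>i. c2 m u i = g u i" by blast
  have "m \<in> supported split"
    unfolding supported_def
  proof (intro CollectI conjI ballI impI m(1))
    fix s i assume s: "s \<in> J" "i \<in> I s" "co m s i \<noteq> co0 s"
    then obtain u where u: "s = Inr u" "u \<in> P" using m(2) by auto
    then have "g u i \<noteq> \<zero>\<^bsub>V u\<^esub>" using s m(3) by auto
    then have "u \<in> PP" "int n dvd i - pos u" by (auto simp: g_def split: if_splits)
    then obtain q where "i - pos u = int n * q" by (auto elim: dvdE)
    then have "i = pos u + int n * q" by simp
    then show "split s i" using split_shift[OF u(2) pos_split[OF \<open>u \<in> PP\<close>]] u(1) by simp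
  qed
  moreover have "c2 m u (pos u) = y u" if u: "u \<in> PP" for u
  proof -
    interpret V: laurent_module "V u" by (rule laurent_module[OF PP_P(1)[OF u]])
    show ?thesis using m(3) PP_P(1)[OF u] u y(1)[OF u] by (simp add: g_def)
  qed
  ultimately show ?thesis by blast
qed

section \<open>The automorphism induced by the relation of one period\<close>

abbreviation E where "E \<equiv> word_relation Q \<rho> M (period_word W)"

text \<open>The factors of \<open>W\<close> meet at position 0, so its letters 1 to \<open>n\<close>
  are the first \<open>n\<close> letters of \<open>D\<close>.\<close>

lemma E_chain: "E = chain_relation (word_letters D) n"
proof -
  have "E = chain_relation (\<lambda>k. (\<lambda>i\<in>positions (Fin n). letter_at W i) (int k + 1)) n"
    unfolding period_word_def by (rule word_relation_Letters)
  also have "\<dots> = chain_relation (word_letters D) n"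
    by (rule chain_relation_cong) (simp add: positions_simps W_letter)
  finally show ?thesis .
qed

lemma D_arcs: "letter_arrow (word_letters D k) \<in> arcs Q"
  by (rule Nat_word_letters(1)[OF D(1) shapes(3)])

lemma split_follows:
  assumes "u \<in> P" "split (Inr u) i"
  shows "follows (Cp u) (word_letters D) n i (i + dir (orient u) * int n)"
proof -
  have w: "is_word Q \<rho> (Cp u)" using periodic_word[OF assms(1)] by auto
  have red: "letter_inv (word_letters D k) \<noteq> word_letters D (Suc k)" for k
    using word_letters_reduced(1)[OF D(1), of k] shapes(3) by (simp add: positions_simps)
  have "ray (Cp u) i (orient u) k = Some (word_letters D k)" for k
    using split_orient[OF assms] ray_word[of D k] shapes(3) by (simp add: splits_at_def positions_simps)
  then show ?thesis using follows_iff_ray[OF w, of n "word_letters D" i] red by blast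
qed

lemma E_coordinates:
  assumes "(m', m) \<in> E" "m' \<in> carrier M" "u \<in> PP"
  shows "c2 m u (pos u) = T (dir (orient u)) \<odot>\<^bsub>V u\<^esub> c2 m' u (pos u)"
proof -
  have u: "u \<in> P" "split (Inr u) (pos u)" using assms(3) PP_P(1) pos_split by auto
  have "co m (Inr u) (pos u) = co m' (Inr u) (pos u + dir (orient u) * int n)"
    by (rule chain_relation_coord[OF assms(1)[unfolded E_chain]]) (use D_arcs u split_follows in auto)
  then show ?thesis using c2_shift_mult[OF assms(2) u, of "pos u" "dir (orient u)"] by (simp add: mult.commute)
qed

abbreviation F_shift where "F_shift \<equiv> F_T Q \<rho> \<sigma> M B D"

text \<open>Off the split positions the relation need not be defined on \<open>a\<close>, so
  \<open>a\<close> is replaced by a representative \<open>a0\<close> living on them only. There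
  reading one period is a bijection of positions, which provides \<open>b\<close>. For any other
  member of the class \<open>E_coordinates\<close> gives the same coordinates, so the result is the
  class of \<open>b\<close>.\<close>

lemma F_shift_cls:
  assumes a: "a \<in> A"
  obtains b where "b \<in> A" "F_shift (cls a) = cls b"
    "\<And>u. u \<in> PP \<Longrightarrow> c2 b u (pos u) = T (dir (orient u)) \<odot>\<^bsub>V u\<^esub> c2 a u (pos u)"
proof -
  interpret M: abelian_group M by (rule group)
  interpret SA: additive_subgroup A M by (rule subgroups)
  let ?T = "\<lambda>u. T (dir (orient u))"
  have fin: "finite {u \<in> PP. c2 a u (pos u) \<noteq> \<zero>\<^bsub>V u\<^esub>}"
    by (rule finite_subset[OF _ c2_finite[OF A_carrier[OF a]]]) (use PP_P(1) in auto)
  have cl: "c2 a u (pos u) \<in> carrier (V u)" if "u \<in> PP" for u using c2_closed[OF A_carrier[OF a] PP_P(1)[OF that]] .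
  have "\<exists>a0\<in>supported split. \<forall>u\<in>PP. c2 a0 u (pos u) = c2 a u (pos u)"
    by (rule coordinates_at_pos[OF _ fin]) (rule cl)
  then obtain a0 where a0: "a0 \<in> supported split" "\<And>u. u \<in> PP \<Longrightarrow> c2 a0 u (pos u) = c2 a u (pos u)"
    by blast
  have a0A: "a0 \<in> A" by (rule supported_split_A[OF a0(1)])
  have "a0 \<in> supported (\<lambda>s j. \<exists>i. follows (wd s) (word_letters D) n i j)"
    unfolding supported_def
  proof (intro CollectI conjI ballI impI)
    show "a0 \<in> carrier M" by (rule A_carrier[OF a0A])
    fix s j assume s: "s \<in> J" "j \<in> I s" "co a0 s j \<noteq> co0 s"
    have sp: "split s j" by (rule supportedD(1)[OF a0(1) s])
    then obtain u where u: "s = Inr u" "u \<in> P" using s(1) no_string by auto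
    have sp': "split (Inr u) j" using sp u by simp
    \<comment> \<open>Reading one period from this position ends at \<open>j\<close>, by
      \<open>split_follows\<close>.\<close>
    let ?i = "j + int n * (- dir (orient u))"
    have "split (Inr u) ?i" by (rule split_shift[OF u(2) sp'])
    from split_follows[OF u(2) this] have "follows (Cp u) (word_letters D) n ?i j" by (simp add: algebra_simps)
    then show "\<exists>i. follows (wd s) (word_letters D) n i j" using u(1) by auto
  qed
  from chain_relation_backward[OF D_arcs this]
  obtain b where b: "b \<in> carrier M" "(a0, b) \<in> chain_relation (word_letters D) n"
    "\<forall>s\<in>J. \<forall>i\<in>I s. co b s i \<noteq> co0 s \<longrightarrow> (\<exists>j. follows (wd s) (word_letters D) n i j \<and> co a0 s j \<noteq> co0 s)"
    by (elim bexE conjE)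
  have "b \<in> supported split"
    unfolding supported_def
  proof (intro CollectI conjI ballI impI b(1))
    fix s i assume s: "s \<in> J" "i \<in> I s" "co b s i \<noteq> co0 s"
    obtain j where j: "follows (wd s) (word_letters D) n i j" "co a0 s j \<noteq> co0 s"
      using mp[OF bspec[OF bspec[OF b(3) s(1)] s(2)] s(3)] by (elim exE conjE)
    have "j \<in> I s" by (rule follows_end(1)[OF cell_word[OF s(1)] j(1) s(2)])
    then have sp: "split s j" using supportedD(1)[OF a0(1) s(1) _ j(2)] by blast
    then obtain u where u: "s = Inr u" "u \<in> P" using s(1) no_string by auto
    have sp': "split (Inr u) j" using sp u by simp
    let ?i = "j + int n * (- dir (orient u))"
    have i': "split (Inr u) ?i" by (rule split_shift[OF u(2) sp'])
    from split_follows[OF u(2) this] have "follows (Cp u) (word_letters D) n ?i j" by (simp add: algebra_simps)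
    moreover have "follows (Cp u) (word_letters D) n i j" using j(1) u(1) by simp
    ultimately have "?i = i" using follows_back_unique[of Q \<rho> "Cp u"] periodic_word[OF u(2)] by blast
    then show "split s i" using i' u(1) by simp
  qed
  then have bA: "b \<in> A" by (rule supported_split_A)
  have bE: "(a0, b) \<in> E" using b(2) unfolding E_chain .
  have bc: "c2 b u (pos u) = ?T u \<odot>\<^bsub>V u\<^esub> c2 a u (pos u)" if "u \<in> PP" for u
    using E_coordinates[OF bE A_carrier[OF a0A] that] a0(2)[OF that] by simp
  have FT: "F_shift X = (\<Union>m\<in>X. A \<inter> (A' <+>\<^bsub>M\<^esub> (E `` {m})))" for X by (simp add: F_T_def Let_def)
  have "F_shift (cls a) = cls b"
  proof
    show "F_shift (cls a) \<subseteq> cls b"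
    proof
      fix x assume "x \<in> F_shift (cls a)"
      then obtain m p m1 where x: "x \<in> A" "m \<in> cls a" "p \<in> A'" "(m, m1) \<in> E" "x = p \<oplus>\<^bsub>M\<^esub> m1"
        unfolding FT set_add_def' by blast
      have mA: "m \<in> A" "agree m a" using x(2) unfolding cls_def by blast+
      have m1: "m1 \<in> carrier M"
        using chain_relation_carrier[OF x(4)[unfolded E_chain] A_carrier[OF mA(1)]] D_arcs by blast
      have pc: "p \<in> carrier M" using x(3) A'_subset A_carrier by blast
      have "agree x b"
      proof (rule agreeI[OF x(1) bA])
        fix u assume u: "u \<in> PP"
        interpret V: laurent_module "V u" by (rule laurent_module[OF PP_P(1)[OF u]])
        have sp: "split (Inr u) (pos u)" "Inr u \<in> J" using pos_split[OF u] PP_P(1)[OF u] by auto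
        then have "pos u \<in> I (Inr u)" by (auto simp: split_cell_def splits_at_def)
        then have "co p (Inr u) (pos u) = co0 (Inr u)"
          using supportedD(1)[OF x(3)[unfolded region(2)] sp(2)] sp(1) by blast
        then have "c2 p u (pos u) = \<zero>\<^bsub>V u\<^esub>" by simp
        then have "c2 x u (pos u) = c2 m1 u (pos u)"
          unfolding x(5) using c2_add[OF pc m1 PP_P(1)[OF u]] m1 PP_P(1)[OF u] by simp
        also have "\<dots> = ?T u \<odot>\<^bsub>V u\<^esub> c2 m u (pos u)" by (rule E_coordinates[OF x(4) A_carrier[OF mA(1)] u])
        finally show "c2 x u (pos u) = c2 b u (pos u)" using bc[OF u] agreeD[OF mA(2) u] by simp
      qed
      then show "x \<in> cls b" using x(1) unfolding cls_def by blast
    qed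
    show "cls b \<subseteq> F_shift (cls a)"
    proof
      fix x assume "x \<in> cls b"
      then have x: "x \<in> A" "agree x b" unfolding cls_def by blast+
      have d: "x \<ominus>\<^bsub>M\<^esub> b \<in> A'" using agree_iff[OF x(1) bA] x(2) by blast
      have xc: "x \<in> carrier M" by (rule A_carrier[OF x(1)])
      have xb: "x = (x \<ominus>\<^bsub>M\<^esub> b) \<oplus>\<^bsub>M\<^esub> b" using xc b(1) by (simp add: M.minus_eq M.a_assoc M.l_neg)
      have "agree a0 a" by (rule agreeI[OF a0A a]) (rule a0(2))
      then have "a0 \<in> cls a" using a0A unfolding cls_def by blast
      moreover have "x \<in> A' <+>\<^bsub>M\<^esub> (E `` {a0})" unfolding set_add_def' using d xb bE by blast
      ultimately show "x \<in> F_shift (cls a)" unfolding FT using x(1) by blast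
    qed
  qed
  then show ?thesis using that bA bc by blast
qed

end

section \<open>The Laurent module in coordinates\<close>

context string_sum_periodic
begin

definition kap :: "'m set \<Rightarrow> 'u \<Rightarrow> 'w" where
  "kap X u = projr (kc X (Inr u) (pos u))"

lemma kap_cls: "a \<in> A \<Longrightarrow> u \<in> PP \<Longrightarrow> kap (cls a) u = c2 a u (pos u)"
  using kc_cls[of a "Inr u" "pos u"] pos_split PP_P(1) by (simp add: kap_def)

lemma kap_closed: "X \<in> carrier F \<Longrightarrow> u \<in> PP \<Longrightarrow> kap X u \<in> carrier (V u)"
  using PP_P(1) A_carrier by (auto simp: carrier_F kap_cls)

lemma kap_inj:
  assumes "X \<in> carrier F" "Y \<in> carrier F" "\<And>u. u \<in> PP \<Longrightarrow> kap X u = kap Y u"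
  shows "X = Y"
proof -
  obtain a b where ab: "a \<in> A" "X = cls a" "b \<in> A" "Y = cls b" using assms(1,2) by (auto simp: carrier_F)
  have "agree a b" by (rule agreeI[OF ab(1,3)]) (use assms(3) ab kap_cls in force)
  then show ?thesis using cls_eq_iff ab by simp
qed

lemma kap_surj:
  assumes "\<And>u. u \<in> PP \<Longrightarrow> y u \<in> carrier (V u)" "finite {u \<in> PP. y u \<noteq> \<zero>\<^bsub>V u\<^esub>}"
  shows "\<exists>X\<in>carrier F. \<forall>u\<in>PP. kap X u = y u"
proof -
  have "\<exists>a\<in>supported split. \<forall>u\<in>PP. c2 a u (pos u) = y u"
    by (rule coordinates_at_pos[OF _ assms(2)]) (rule assms(1))
  then obtain a where a: "a \<in> supported split" "\<And>u. u \<in> PP \<Longrightarrow> c2 a u (pos u) = y u" by blast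
  have "a \<in> A" by (rule supported_split_A[OF a(1)])
  then show ?thesis using a(2) kap_cls by (intro bexI[of _ "cls a"]) (auto simp: carrier_F)
qed

lemma kap_finite: "X \<in> carrier F \<Longrightarrow> finite {u \<in> PP. kap X u \<noteq> \<zero>\<^bsub>V u\<^esub>}"
proof -
  assume "X \<in> carrier F"
  then obtain a where a: "a \<in> A" "X = cls a" by (auto simp: carrier_F)
  show ?thesis
    by (rule finite_subset[OF _ c2_finite[OF A_carrier[OF a(1)]]]) (use PP_P(1) a kap_cls in force)
qed

lemma kap_add: "X \<in> carrier F \<Longrightarrow> Y \<in> carrier F \<Longrightarrow> u \<in> PP \<Longrightarrow> kap (X \<oplus>\<^bsub>F\<^esub> Y) u = kap X u \<oplus>\<^bsub>V u\<^esub> kap Y u"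
  using PP_P(1) A_carrier by (auto simp: carrier_F kap_cls add_F c2_add)

lemma smult_closed_F: "X \<in> carrier F \<Longrightarrow> c \<odot>\<^bsub>F\<^esub> X \<in> carrier F"
  using smult_F scal_A by (auto simp: carrier_F)

lemma kap_smult: "X \<in> carrier F \<Longrightarrow> u \<in> PP \<Longrightarrow> kap (c \<odot>\<^bsub>F\<^esub> X) u = Poly_Mapping.single 0 c \<odot>\<^bsub>V u\<^esub> kap X u"
proof -
  assume "X \<in> carrier F" and u: "u \<in> PP"
  then obtain a where a: "a \<in> A" "X = cls a" by (auto simp: carrier_F)
  then show ?thesis
    using scal_coordinates(2)[OF a(1) _ pos_split[OF u] refl] PP_P(1)[OF u] u scal_A[OF a(1)]
    by (simp add: smult_F kap_cls)
qed

lemma F_shift_kap: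
  assumes "X \<in> carrier F"
  shows "F_shift X \<in> carrier F"
    "u \<in> PP \<Longrightarrow> kap (F_shift X) u = T (dir (orient u)) \<odot>\<^bsub>V u\<^esub> kap X u"
proof -
  obtain a where a: "a \<in> A" "X = cls a" using assms by (auto simp: carrier_F)
  obtain b where b: "b \<in> A" "F_shift (cls a) = cls b"
    "\<And>u. u \<in> PP \<Longrightarrow> c2 b u (pos u) = T (dir (orient u)) \<odot>\<^bsub>V u\<^esub> c2 a u (pos u)"
    by (rule F_shift_cls[OF a(1)]) (rule that)
  show "F_shift X \<in> carrier F" using a b by (auto simp: carrier_F)
  show "u \<in> PP \<Longrightarrow> kap (F_shift X) u = T (dir (orient u)) \<odot>\<^bsub>V u\<^esub> kap X u"
    using a b by (simp add: kap_cls)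
qed

lemma T_inverse:
  assumes "u \<in> PP" "w \<in> carrier (V u)"
  shows "T i \<odot>\<^bsub>V u\<^esub> (T j \<odot>\<^bsub>V u\<^esub> w) = T (i + j) \<odot>\<^bsub>V u\<^esub> w" "T 0 \<odot>\<^bsub>V u\<^esub> w = w"
proof -
  interpret V: laurent_module "V u" by (rule laurent_module[OF PP_P(1)[OF assms(1)]])
  show "T i \<odot>\<^bsub>V u\<^esub> (T j \<odot>\<^bsub>V u\<^esub> w) = T (i + j) \<odot>\<^bsub>V u\<^esub> w" "T 0 \<odot>\<^bsub>V u\<^esub> w = w"
    using assms(2) by (simp_all add: V.smult_mult[symmetric] mult_single)
qed

lemma smult_T_closed: "u \<in> PP \<Longrightarrow> w \<in> carrier (V u) \<Longrightarrow> p \<odot>\<^bsub>V u\<^esub> w \<in> carrier (V u)"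
  using laurent_module.smult_closed[OF laurent_module[OF PP_P(1)]] by blast

text \<open>Negative powers in \<open>int_iterate\<close> are taken with \<open>inv_into\<close>,
  which is an inverse only for a bijection. In coordinates the map is multiplication by
  \<open>T\<close> or by its inverse, hence invertible.\<close>

lemma F_shift_bij: "bij_betw F_shift (carrier F) (carrier F)"
proof (rule bij_betw_imageI)
  show "inj_on F_shift (carrier F)"
  proof (rule inj_onI)
    fix X Y assume XY: "X \<in> carrier F" "Y \<in> carrier F" "F_shift X = F_shift Y"
    show "X = Y"
    proof (rule kap_inj[OF XY(1,2)])
      fix u assume u: "u \<in> PP"
      let ?d = "dir (orient u)"
      have "T ?d \<odot>\<^bsub>V u\<^esub> kap X u = T ?d \<odot>\<^bsub>V u\<^esub> kap Y u" using F_shift_kap(2) XY u by metis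
      then have "T (- ?d) \<odot>\<^bsub>V u\<^esub> (T ?d \<odot>\<^bsub>V u\<^esub> kap X u) = T (- ?d) \<odot>\<^bsub>V u\<^esub> (T ?d \<odot>\<^bsub>V u\<^esub> kap Y u)" by simp
      then show "kap X u = kap Y u"
        unfolding T_inverse(1)[OF u kap_closed[OF XY(1) u]] T_inverse(1)[OF u kap_closed[OF XY(2) u]]
        using T_inverse(2)[OF u] kap_closed XY u by simp
    qed
  qed
  show "F_shift ` carrier F = carrier F"
  proof
    show "F_shift ` carrier F \<subseteq> carrier F" using F_shift_kap(1) by blast
    show "carrier F \<subseteq> F_shift ` carrier F"
    proof
      fix X assume X: "X \<in> carrier F"
      let ?y = "\<lambda>u. T (- dir (orient u)) \<odot>\<^bsub>V u\<^esub> kap X u"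
      have "finite {u \<in> PP. ?y u \<noteq> \<zero>\<^bsub>V u\<^esub>}"
      proof (rule finite_subset[OF _ kap_finite[OF X]], rule)
        fix u assume u: "u \<in> {u \<in> PP. ?y u \<noteq> \<zero>\<^bsub>V u\<^esub>}"
        interpret V: laurent_module "V u" by (rule laurent_module) (use u PP_P(1) in simp)
        show "u \<in> {u \<in> PP. kap X u \<noteq> \<zero>\<^bsub>V u\<^esub>}" using u by auto
      qed
      then obtain Y where Y: "Y \<in> carrier F" "\<forall>u\<in>PP. kap Y u = ?y u"
        using kap_surj[of ?y] smult_T_closed kap_closed[OF X] by blast
      have "X = F_shift Y"
      proof (rule kap_inj[OF X F_shift_kap(1)[OF Y(1)]])
        fix u assume u: "u \<in> PP"
        show "kap X u = kap (F_shift Y) u"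
          unfolding F_shift_kap(2)[OF Y(1) u] using Y(2) u T_inverse[OF u kap_closed[OF X u]] by simp
      qed
      then show "X \<in> F_shift ` carrier F" using Y(1) by blast
    qed
  qed
qed

lemma int_iterate_kap:
  assumes X: "X \<in> carrier F"
  shows "int_iterate (carrier F) F_shift j X \<in> carrier F \<and>
    (\<forall>u\<in>PP. kap (int_iterate (carrier F) F_shift j X) u = T (dir (orient u) * j) \<odot>\<^bsub>V u\<^esub> kap X u)"
proof -
  \<comment> \<open>With \<open>s = 1\<close> this describes the iterates of \<open>F_shift\<close>,
    with \<open>s = - 1\<close> those of its inverse.\<close>
  have iter: "(f ^^ m) X \<in> carrier F \<and>
      (\<forall>u\<in>PP. kap ((f ^^ m) X) u = T (dir (orient u) * (s * int m)) \<odot>\<^bsub>V u\<^esub> kap X u)"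
    if f: "\<And>Y. Y \<in> carrier F \<Longrightarrow> f Y \<in> carrier F"
      "\<And>Y u. Y \<in> carrier F \<Longrightarrow> u \<in> PP \<Longrightarrow> kap (f Y) u = T (dir (orient u) * s) \<odot>\<^bsub>V u\<^esub> kap Y u" for f s m
  proof (induction m)
    case 0
    then show ?case using X T_inverse(2) kap_closed by simp
  next
    case (Suc m)
    have "kap (f ((f ^^ m) X)) u = T (dir (orient u) * (s * int (Suc m))) \<odot>\<^bsub>V u\<^esub> kap X u" if "u \<in> PP" for u
      using f(2)[OF _ that, of "(f ^^ m) X"] Suc that T_inverse(1)[OF that kap_closed[OF X that]]
      by (simp add: algebra_simps)
    then show ?case using Suc f(1) by simp
  qed
  show ?thesis
  proof (cases "j \<ge> 0")
    case True
    have "kap (F_shift Y) u = T (dir (orient u) * 1) \<odot>\<^bsub>V u\<^esub> kap Y u" if "Y \<in> carrier F" "u \<in> PP" for Y u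
      using F_shift_kap(2)[OF that] by simp
    from iter[OF F_shift_kap(1) this, of "nat j"] show ?thesis
      using True unfolding int_iterate_def by simp
  next
    case False
    let ?g = "inv_into (carrier F) F_shift"
    have img: "F_shift ` carrier F = carrier F" using F_shift_bij by (simp add: bij_betw_def)
    have g: "?g Y \<in> carrier F" "F_shift (?g Y) = Y" if "Y \<in> carrier F" for Y
      using inv_into_into[of Y F_shift "carrier F"] f_inv_into_f[of Y F_shift "carrier F"] that unfolding img by auto
    have gk: "kap (?g Y) u = T (dir (orient u) * (- 1)) \<odot>\<^bsub>V u\<^esub> kap Y u" if Y: "Y \<in> carrier F" and u: "u \<in> PP" for Y u
    proof -
      have "kap Y u = T (dir (orient u)) \<odot>\<^bsub>V u\<^esub> kap (?g Y) u"
        using F_shift_kap(2)[OF g(1)[OF Y] u] g(2)[OF Y] by simp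
      then show ?thesis using T_inverse[OF u kap_closed[OF g(1)[OF Y] u]] by simp
    qed
    from iter[OF g(1) gk, of "nat (- j)"] show ?thesis
      using False unfolding int_iterate_def by simp
  qed
qed

abbreviation L where "L \<equiv> F_laurent_module Q \<rho> \<sigma> M B D"

lemma L_simps: "carrier L = carrier F" "X \<oplus>\<^bsub>L\<^esub> Y = X \<oplus>\<^bsub>F\<^esub> Y"
  "p \<odot>\<^bsub>L\<^esub> X = finsum F (\<lambda>j. Poly_Mapping.lookup p j \<odot>\<^bsub>F\<^esub> int_iterate (carrier F) F_shift j X) (Poly_Mapping.keys p)"
  by (simp_all add: F_laurent_module_def Let_def)

lemma kap_finsum:
  assumes "finite K" "\<And>j. j \<in> K \<Longrightarrow> g j \<in> carrier F" "u \<in> PP"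
  shows "finsum F g K \<in> carrier F" "kap (finsum F g K) u = finsum (V u) (\<lambda>j. kap (g j) u) K"
proof -
  interpret F: abelian_group F by (rule F_group)
  interpret V: laurent_module "V u" by (rule laurent_module[OF PP_P(1)[OF assms(3)]])
  show "finsum F g K \<in> carrier F" using assms(2) by (intro F.finsum_closed) auto
  have z: "kap \<zero>\<^bsub>F\<^esub> u = \<zero>\<^bsub>V u\<^esub>"
    using zero_F c_zero(2)[OF PP_P(1)[OF assms(3)]] assms(3) by (simp add: kap_cls)
  show "kap (finsum F g K) u = finsum (V u) (\<lambda>j. kap (g j) u) K"
    using assms(1,2)
  proof (induction K)
    case (insert x K)
    then have "g \<in> K \<rightarrow> carrier F" "g x \<in> carrier F" by auto
    then show ?case using insert kap_add assms(3) kap_closed by simp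
  qed (simp add: z)
qed

text \<open>The power \<open>j\<close> of the automorphism multiplies a coordinate by
  \<open>T j\<close> or by \<open>T (- j)\<close> according to the orientation. Summed with the
  coefficients of \<open>p\<close> this is \<open>p\<close> itself, or \<open>p\<close> with
  \<open>T\<close> and its inverse exchanged.\<close>

lemma kap_laurent:
  assumes X: "X \<in> carrier F" and u: "u \<in> PP"
  shows "p \<odot>\<^bsub>L\<^esub> X \<in> carrier F" "kap (p \<odot>\<^bsub>L\<^esub> X) u = (if orient u then p else swap_T p) \<odot>\<^bsub>V u\<^esub> kap X u"
proof -
  interpret V: laurent_module "V u" by (rule laurent_module[OF PP_P(1)[OF u]])
  let ?g = "\<lambda>j. Poly_Mapping.lookup p j \<odot>\<^bsub>F\<^esub> int_iterate (carrier F) F_shift j X"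
  have g: "?g j \<in> carrier F" for j using smult_closed_F int_iterate_kap[OF X] by blast
  have kg: "kap (?g j) u = Poly_Mapping.single (dir (orient u) * j) (Poly_Mapping.lookup p j) \<odot>\<^bsub>V u\<^esub> kap X u" for j
    using kap_smult[OF conjunct1[OF int_iterate_kap[OF X]] u] int_iterate_kap[OF X, of j] u kap_closed[OF X u]
    by (simp add: V.smult_mult[symmetric] mult_single)
  show "p \<odot>\<^bsub>L\<^esub> X \<in> carrier F" unfolding L_simps by (rule kap_finsum(1)[OF _ g u]) simp
  have "kap (p \<odot>\<^bsub>L\<^esub> X) u = finsum (V u) (\<lambda>j. kap (?g j) u) (Poly_Mapping.keys p)"
    unfolding L_simps by (rule kap_finsum(2)[OF _ g u]) simp
  also have "\<dots> = (\<Sum>j\<in>Poly_Mapping.keys p. Poly_Mapping.single (dir (orient u) * j) (Poly_Mapping.lookup p j)) \<odot>\<^bsub>V u\<^esub> kap X u"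
    unfolding kg by (rule laurent_sum_smult[OF laurent_module[OF PP_P(1)[OF u]] kap_closed[OF X u]]) simp
  also have "(\<Sum>j\<in>Poly_Mapping.keys p. Poly_Mapping.single (dir (orient u) * j) (Poly_Mapping.lookup p j)) =
      (if orient u then p else swap_T p)"
    by (cases "orient u") (simp_all add: poly_mapping_sum_singles swap_T_sum)
  finally show "kap (p \<odot>\<^bsub>L\<^esub> X) u = (if orient u then p else swap_T p) \<odot>\<^bsub>V u\<^esub> kap X u" .
qed

text \<open>The coordinates \<open>kap\<close> themselves form the isomorphism. Sorting them by
  orientation gives the two direct sums, with \<open>swap_T\<close> turning into the action of
  \<open>res_swap\<close>.\<close>

lemma periodic_case:
  "module_isomorphic laurent_ring L
     (direct_sum2
        (direct_sum {u \<in> P. is_shift_of (Cp u) W} V)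
        (direct_sum {u \<in> P. is_shift_of (Cp u) (concatenation (word_inv D) B)} (\<lambda>u. res_swap (V u))))"
proof -
  let ?P1 = "{u \<in> PP. orient u}" and ?P2 = "{u \<in> PP. \<not> orient u}"
  let ?R = "direct_sum2 (direct_sum ?P1 V) (direct_sum ?P2 (\<lambda>u. res_swap (V u)))"
  define \<psi> where "\<psi> X = (\<lambda>u\<in>?P1. kap X u, \<lambda>u\<in>?P2. kap X u)" for X
  have res: "carrier (res_swap Y) = carrier Y" "\<zero>\<^bsub>res_swap Y\<^esub> = \<zero>\<^bsub>Y\<^esub>" "x \<oplus>\<^bsub>res_swap Y\<^esub> y = x \<oplus>\<^bsub>Y\<^esub> y"
    "p \<odot>\<^bsub>res_swap Y\<^esub> x = swap_T p \<odot>\<^bsub>Y\<^esub> x" for Y :: "('k laurent, 'w) module" and x y p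
    by (simp_all add: res_swap_def)
  have closed: "\<psi> X \<in> carrier ?R" if X: "X \<in> carrier F" for X
  proof -
    have "finite {u \<in> ?P1. kap X u \<noteq> \<zero>\<^bsub>V u\<^esub>}" "finite {u \<in> ?P2. kap X u \<noteq> \<zero>\<^bsub>V u\<^esub>}"
      by (rule finite_subset[OF _ kap_finite[OF X]], auto)+
    moreover have "{u \<in> ?P1. (\<lambda>u\<in>?P1. kap X u) u \<noteq> \<zero>\<^bsub>V u\<^esub>} = {u \<in> ?P1. kap X u \<noteq> \<zero>\<^bsub>V u\<^esub>}"
      "{u \<in> ?P2. (\<lambda>u\<in>?P2. kap X u) u \<noteq> \<zero>\<^bsub>V u\<^esub>} = {u \<in> ?P2. kap X u \<noteq> \<zero>\<^bsub>V u\<^esub>}" by auto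
    ultimately show ?thesis
      using kap_closed[OF X] unfolding \<psi>_def direct_sum2_def direct_sum_def by (simp add: res PiE_def Pi_def)
  qed
  have add: "\<psi> (X \<oplus>\<^bsub>F\<^esub> Y) = \<psi> X \<oplus>\<^bsub>?R\<^esub> \<psi> Y" if "X \<in> carrier F" "Y \<in> carrier F" for X Y
    using kap_add[OF that] unfolding \<psi>_def direct_sum2_def direct_sum_def by (auto simp: res restrict_def fun_eq_iff)
  have inj: "inj_on \<psi> (carrier F)"
  proof (rule inj_onI)
    fix X Y assume XY: "X \<in> carrier F" "Y \<in> carrier F" "\<psi> X = \<psi> Y"
    show "X = Y"
    proof (rule kap_inj[OF XY(1,2)])
      fix u assume u: "u \<in> PP"
      have eq: "(\<lambda>u\<in>?P1. kap X u) = (\<lambda>u\<in>?P1. kap Y u)" "(\<lambda>u\<in>?P2. kap X u) = (\<lambda>u\<in>?P2. kap Y u)"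
        using conjunct1[OF XY(3)[unfolded \<psi>_def prod.inject]] conjunct2[OF XY(3)[unfolded \<psi>_def prod.inject]] .
      show "kap X u = kap Y u"
        using fun_cong[OF eq(1), of u] fun_cong[OF eq(2), of u] u by (cases "orient u") simp_all
    qed
  qed
  have surj: "\<exists>X\<in>carrier F. \<psi> X = y" if y: "y \<in> carrier ?R" for y
  proof -
    obtain f g where fg: "y = (f, g)" by (cases y)
    have f: "f \<in> extensional ?P1" "\<And>u. u \<in> ?P1 \<Longrightarrow> f u \<in> carrier (V u)" "finite {u \<in> ?P1. f u \<noteq> \<zero>\<^bsub>V u\<^esub>}"
      and g: "g \<in> extensional ?P2" "\<And>u. u \<in> ?P2 \<Longrightarrow> g u \<in> carrier (V u)" "finite {u \<in> ?P2. g u \<noteq> \<zero>\<^bsub>V u\<^esub>}"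
      using y unfolding fg direct_sum2_def direct_sum_def by (auto simp: res PiE_def Pi_def)
    let ?y = "\<lambda>u. if orient u then f u else g u"
    have "finite {u \<in> PP. ?y u \<noteq> \<zero>\<^bsub>V u\<^esub>}"
      by (rule finite_subset[OF _ finite_UnI[OF f(3) g(3)]]) auto
    moreover have "?y u \<in> carrier (V u)" if "u \<in> PP" for u using f(2)[of u] g(2)[of u] that by simp
    ultimately obtain X where X: "X \<in> carrier F" "\<forall>u\<in>PP. kap X u = ?y u"
      using kap_surj[of ?y] by blast
    have "(\<lambda>u\<in>?P1. kap X u) = f" by (rule extensionalityI[OF _ f(1)]) (use X(2) in auto)
    moreover have "(\<lambda>u\<in>?P2. kap X u) = g" by (rule extensionalityI[OF _ g(1)]) (use X(2) in auto)
    ultimately show ?thesis using X(1) fg unfolding \<psi>_def by blast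
  qed
  have bij: "bij_betw \<psi> (carrier F) (carrier ?R)"
  proof (rule bij_betw_imageI[OF inj])
    show "\<psi> ` carrier F = carrier ?R" using closed surj by blast
  qed
  have iso: "\<psi> \<in> iso (add_monoid L) (add_monoid ?R)"
    using bij closed add by (auto simp: iso_def hom_def L_simps)
  have smult: "\<psi> (p \<odot>\<^bsub>L\<^esub> X) = p \<odot>\<^bsub>?R\<^esub> \<psi> X" if "X \<in> carrier F" for p X
    using kap_laurent(2)[OF that] unfolding \<psi>_def direct_sum2_def direct_sum_def
    by (auto simp: res restrict_def fun_eq_iff)
  show ?thesis
    unfolding PP_orient module_isomorphic_def
    by (rule bexI[OF _ iso]) (simp add: smult L_simps(1))
qed

end

theorem theorem9p1:
  fixes Q :: "('v, 'a) pre_digraph"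
    and \<rho> :: "'a list set"
    and \<sigma> :: "'a letter \<Rightarrow> int"
    and M :: "((('v, 'a) qpath \<Rightarrow>\<^sub>0 'k::field) set, 'm) module"
    and S :: "'l set" and Cs :: "'l \<Rightarrow> ('v, 'a) qword"
    and P :: "'u set" and Cp :: "'u \<Rightarrow> ('v, 'a) qword"
    and V :: "'u \<Rightarrow> ('k laurent, 'w) module"
    and B D :: "('v, 'a) qword"
  assumes "string_algebra Q \<rho>"
    and "sign_choice Q \<rho> \<sigma>"
    and "\<And>l. l \<in> S \<Longrightarrow> is_word Q \<rho> (Cs l) \<and> \<not> periodic (Cs l)"
    and "\<And>u. u \<in> P \<Longrightarrow> is_word Q \<rho> (Cp u) \<and> periodic (Cp u)"
    and "\<And>u. u \<in> P \<Longrightarrow> Module.module laurent_ring (V u)"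
    and "full_module (quotient_algebra Q \<rho>) M"
    and "module_isomorphic (quotient_algebra Q \<rho>) M
           (direct_sum2
              (direct_sum S (\<lambda>l. string_module Q (Cs l)))
              (direct_sum P (\<lambda>u. periodic_module Q (Cp u) (V u))))"
    and "is_word Q \<rho> B" and "is_word Q \<rho> D"
    and "has_head B" and "has_head D"
    and "word_head Q B = word_head Q D"
    and "word_sign \<sigma> B = - word_sign \<sigma> D"
  shows "(composable Q \<rho> \<sigma> (word_inv B) D \<and> \<not> periodic (concatenation (word_inv B) D) \<longrightarrow>
            has_dim (F_space Q \<rho> \<sigma> M B D)
              {l \<in> S. word_equiv (Cs l) (concatenation (word_inv B) D)}) \<and>
         (composable Q \<rho> \<sigma> (word_inv B) D \<and> periodic (concatenation (word_inv B) D) \<longrightarrow>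
            module_isomorphic laurent_ring (F_laurent_module Q \<rho> \<sigma> M B D)
              (direct_sum2
                 (direct_sum {u \<in> P. is_shift_of (Cp u) (concatenation (word_inv B) D)} V)
                 (direct_sum {u \<in> P. is_shift_of (Cp u) (concatenation (word_inv D) B)}
                    (\<lambda>u. res_swap (V u)))))"
proof -
  obtain \<phi> where \<phi>: "\<phi> \<in> iso (add_monoid M) (add_monoid (direct_sum2
              (direct_sum S (\<lambda>l. string_module Q (Cs l)))
              (direct_sum P (\<lambda>u. periodic_module Q (Cp u) (V u)))))"
    "\<forall>r\<in>carrier (quotient_algebra Q \<rho>). \<forall>m\<in>carrier M. \<phi> (r \<odot>\<^bsub>M\<^esub> m) = r \<odot>\<^bsub>direct_sum2
              (direct_sum S (\<lambda>l. string_module Q (Cs l)))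
              (direct_sum P (\<lambda>u. periodic_module Q (Cp u) (V u)))\<^esub> \<phi> m"
    using assms(7) unfolding module_isomorphic_def by blast
  have sum: "string_sum Q \<rho> \<sigma> M S Cs P Cp V \<phi>"
    by (rule string_sum.intro) (use assms(1-6) \<phi> in blast)+
  have func: "string_sum_functor Q \<rho> \<sigma> M S Cs P Cp V \<phi> B D" if "composable Q \<rho> \<sigma> (word_inv B) D"
    by (rule string_sum_functor.intro[OF sum], rule string_sum_functor_axioms.intro) (use assms(8-13) that in blast)+
  show ?thesis
  proof (intro conjI impI; elim conjE)
    assume "composable Q \<rho> \<sigma> (word_inv B) D" "\<not> periodic (concatenation (word_inv B) D)"
    then show "has_dim (F_space Q \<rho> \<sigma> M B D) {l \<in> S. word_equiv (Cs l) (concatenation (word_inv B) D)}"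
      using string_sum_functor.string_case[OF func] by blast
  next
    assume c: "composable Q \<rho> \<sigma> (word_inv B) D" and p: "periodic (concatenation (word_inv B) D)"
    have "string_sum_periodic Q \<rho> \<sigma> M S Cs P Cp V \<phi> B D"
      by (rule string_sum_periodic.intro[OF func[OF c]], rule string_sum_periodic_axioms.intro) (rule p)
    then show "module_isomorphic laurent_ring (F_laurent_module Q \<rho> \<sigma> M B D)
              (direct_sum2
                 (direct_sum {u \<in> P. is_shift_of (Cp u) (concatenation (word_inv B) D)} V)
                 (direct_sum {u \<in> P. is_shift_of (Cp u) (concatenation (word_inv D) B)}
                    (\<lambda>u. res_swap (V u))))"
      by (rule string_sum_periodic.periodic_case)
  qed
qed

end
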